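(* Let $k$ be a field, $n$ a positive integer, and $R=k\langle x_0,\ldots,x_n\rangle$ the free algebra graded by $\deg x_i=1$. Let $L$ be the Leavitt algebra, i.e., the $k$-algebra generated by $x_0,\ldots,x_n,x_0^*,\ldots,x_n^*$ subject to the relations $$x_0^*x_0+\cdots+x_n^*x_n=1,\qquad x_ix_j^*=\delta_{ij}\ \ (0\le i,j\le n),$$ with $\mathbb{Z}$-grading given by $\deg x_i=1$ and $\deg x_i^*=-1$. Let $S=\varinjlim_i M_{n+1}(k)^{\otimes i}$ with transition maps $a_1\otimes\cdots\otimes a_i\mapsto 1\otimes a_1\otimes\cdots\otimes a_i$. Then $L$ is strongly graded, $L_0\cong S$, and there is an equivalence of categories $$\mathsf{QGr}\,R\equiv\mathsf{Gr}\,L\equiv\mathsf{Mod}\,L_0.$$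
   Context: For a $\mathbb{Z}$-graded algebra $A$, $\mathsf{Gr}\,A$ is the category of $\mathbb{Z}$-graded left $A$-modules with degree-preserving homomorphisms. $\mathsf{Fdim}\,R$ is the full subcategory of $\mathsf{Gr}\,R$ of direct limits (unions) of finite-dimensional graded modules, and $\mathsf{QGr}\,R:=\mathsf{Gr}\,R/\mathsf{Fdim}\,R$ is the quotient category. $\mathsf{Mod}\,L_0$ is the category of left modules over the degree-zero component $L_0$ of $L$. $L$ is strongly graded means $L_jL_{-j}=L_0$ for all integers $j$. *)

theory Defs
  imports
    "HOL-Algebra.QuotRing"
    "HOL-Algebra.Ideal_Product"
    "HOL-Library.Poly_Mapping"
    "Jordan_Normal_Form.VS_Connect"
begin

section \<open>Categories\<close>

text \<open>Hom-sets need not be disjoint, so composition takes its three objects as arguments: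
  \<open>cmp C a b c g f\<close> is \<open>g \<circ> f : a \<rightarrow> b \<rightarrow> c\<close>.\<close>

record ('o, 'm) cat =
  obj :: "'o set"
  homs :: "'o \<Rightarrow> 'o \<Rightarrow> 'm set"
  idm :: "'o \<Rightarrow> 'm"
  cmp :: "'o \<Rightarrow> 'o \<Rightarrow> 'o \<Rightarrow> 'm \<Rightarrow> 'm \<Rightarrow> 'm"

locale category =
  fixes C :: "('o, 'm) cat"
  assumes idm_closed: "a \<in> obj C \<Longrightarrow> idm C a \<in> homs C a a"
    and cmp_closed: "\<lbrakk>a \<in> obj C; b \<in> obj C; c \<in> obj C; f \<in> homs C a b; g \<in> homs C b c\<rbrakk>
      \<Longrightarrow> cmp C a b c g f \<in> homs C a c"
    and cmp_idm_right: "\<lbrakk>a \<in> obj C; b \<in> obj C; f \<in> homs C a b\<rbrakk> \<Longrightarrow> cmp C a a b f (idm C a) = f"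
    and cmp_idm_left: "\<lbrakk>a \<in> obj C; b \<in> obj C; f \<in> homs C a b\<rbrakk> \<Longrightarrow> cmp C a b b (idm C b) f = f"
    and cmp_assoc: "\<lbrakk>a \<in> obj C; b \<in> obj C; c \<in> obj C; d \<in> obj C;
        f \<in> homs C a b; g \<in> homs C b c; h \<in> homs C c d\<rbrakk>
      \<Longrightarrow> cmp C a b d (cmp C b c d h g) f = cmp C a c d h (cmp C a b c g f)"

locale cat_functor = C: category C + D: category D
  for C :: "('o1, 'm1) cat" and D :: "('o2, 'm2) cat" +
  fixes Fo :: "'o1 \<Rightarrow> 'o2" and Fm :: "'o1 \<Rightarrow> 'o1 \<Rightarrow> 'm1 \<Rightarrow> 'm2"
  assumes Fo_closed: "a \<in> obj C \<Longrightarrow> Fo a \<in> obj D"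
    and Fm_closed: "\<lbrakk>a \<in> obj C; b \<in> obj C; f \<in> homs C a b\<rbrakk> \<Longrightarrow> Fm a b f \<in> homs D (Fo a) (Fo b)"
    and Fm_idm: "a \<in> obj C \<Longrightarrow> Fm a a (idm C a) = idm D (Fo a)"
    and Fm_cmp: "\<lbrakk>a \<in> obj C; b \<in> obj C; c \<in> obj C; f \<in> homs C a b; g \<in> homs C b c\<rbrakk>
      \<Longrightarrow> Fm a c (cmp C a b c g f) = cmp D (Fo a) (Fo b) (Fo c) (Fm b c g) (Fm a b f)"

definition cat_iso :: "('o, 'm) cat \<Rightarrow> 'o \<Rightarrow> 'o \<Rightarrow> 'm set" where
  "cat_iso C a b = {f \<in> homs C a b. \<exists>g \<in> homs C b a.
     cmp C a b a g f = idm C a \<and> cmp C b a b f g = idm C b}"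

definition natural_iso ::
  "('o1, 'm1) cat \<Rightarrow> ('o2, 'm2) cat \<Rightarrow> ('o1 \<Rightarrow> 'o2) \<Rightarrow> ('o1 \<Rightarrow> 'o1 \<Rightarrow> 'm1 \<Rightarrow> 'm2)
     \<Rightarrow> ('o1 \<Rightarrow> 'o2) \<Rightarrow> ('o1 \<Rightarrow> 'o1 \<Rightarrow> 'm1 \<Rightarrow> 'm2) \<Rightarrow> ('o1 \<Rightarrow> 'm2) \<Rightarrow> bool" where
  "natural_iso C D Fo Fm Go Gm \<eta> \<longleftrightarrow>
     (\<forall>a \<in> obj C. \<eta> a \<in> cat_iso D (Fo a) (Go a)) \<and>
     (\<forall>a \<in> obj C. \<forall>b \<in> obj C. \<forall>f \<in> homs C a b.
        cmp D (Fo a) (Fo b) (Go b) (\<eta> b) (Fm a b f) = cmp D (Fo a) (Go a) (Go b) (Gm a b f) (\<eta> a))"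

definition equivalent_categories :: "('o1, 'm1) cat \<Rightarrow> ('o2, 'm2) cat \<Rightarrow> bool" where
  "equivalent_categories C D \<longleftrightarrow>
     (\<exists>Fo Fm Go Gm \<eta> \<epsilon>. cat_functor C D Fo Fm \<and> cat_functor D C Go Gm \<and>
        natural_iso C C (\<lambda>a. a) (\<lambda>a b f. f)
          (\<lambda>a. Go (Fo a)) (\<lambda>a b f. Gm (Fo a) (Fo b) (Fm a b f)) \<eta> \<and>
        natural_iso D D (\<lambda>a. Fo (Go a)) (\<lambda>a b f. Fm (Go a) (Go b) (Gm a b f))
          (\<lambda>a. a) (\<lambda>a b f. f) \<epsilon>)"


section \<open>Algebras, left modules and gradings\<close>

text \<open>The library locale \<^locale>\<open>Module.module\<close> is restricted to commutative base rings. As there, the ring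
  multiplication and unit of the record \<open>M\<close> play no role.\<close>

locale left_module = A?: ring A + M?: abelian_group M
  for A :: "('a, 'y) ring_scheme" (structure) and M :: "('a, 'u, 'z) module_scheme" (structure) +
  assumes smult_closed: "\<lbrakk>a \<in> carrier A; x \<in> carrier M\<rbrakk> \<Longrightarrow> a \<odot>\<^bsub>M\<^esub> x \<in> carrier M"
    and smult_l_distr: "\<lbrakk>a \<in> carrier A; b \<in> carrier A; x \<in> carrier M\<rbrakk>
      \<Longrightarrow> (a \<oplus>\<^bsub>A\<^esub> b) \<odot>\<^bsub>M\<^esub> x = a \<odot>\<^bsub>M\<^esub> x \<oplus>\<^bsub>M\<^esub> b \<odot>\<^bsub>M\<^esub> x"
    and smult_r_distr: "\<lbrakk>a \<in> carrier A; x \<in> carrier M; y \<in> carrier M\<rbrakk>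
      \<Longrightarrow> a \<odot>\<^bsub>M\<^esub> (x \<oplus>\<^bsub>M\<^esub> y) = a \<odot>\<^bsub>M\<^esub> x \<oplus>\<^bsub>M\<^esub> a \<odot>\<^bsub>M\<^esub> y"
    and smult_assoc1: "\<lbrakk>a \<in> carrier A; b \<in> carrier A; x \<in> carrier M\<rbrakk>
      \<Longrightarrow> (a \<otimes>\<^bsub>A\<^esub> b) \<odot>\<^bsub>M\<^esub> x = a \<odot>\<^bsub>M\<^esub> (b \<odot>\<^bsub>M\<^esub> x)"
    and smult_one: "x \<in> carrier M \<Longrightarrow> \<one>\<^bsub>A\<^esub> \<odot>\<^bsub>M\<^esub> x = x"

text \<open>A \<open>k\<close>-algebra is a \<^typ>\<open>('k, 'a) module\<close> record whose multiplication and unit are used; the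
  field \<open>k\<close> is the universe of the type \<open>'k\<close>. The record \<open>graded\<close> serves both for graded
  \<open>k\<close>-algebras (scalars \<open>'k\<close>) and for graded modules over an algebra (scalars \<open>'a\<close>).\<close>

record ('r, 'm) graded = "('r, 'm) module" +
  component :: "int \<Rightarrow> 'm set"

definition k_algebra :: "('k::field, 'a, 'z) module_scheme \<Rightarrow> bool" where
  "k_algebra A \<longleftrightarrow> ring A \<and> Module.module class_ring A \<and>
     (\<forall>c. \<forall>a \<in> carrier A. \<forall>b \<in> carrier A.
        c \<odot>\<^bsub>A\<^esub> (a \<otimes>\<^bsub>A\<^esub> b) = (c \<odot>\<^bsub>A\<^esub> a) \<otimes>\<^bsub>A\<^esub> b \<and>
        c \<odot>\<^bsub>A\<^esub> (a \<otimes>\<^bsub>A\<^esub> b) = a \<otimes>\<^bsub>A\<^esub> (c \<odot>\<^bsub>A\<^esub> b))"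

definition isomorphic_algebras ::
  "('k, 'a, 'z1) module_scheme \<Rightarrow> ('k, 'b, 'z2) module_scheme \<Rightarrow> bool" where
  "isomorphic_algebras A B \<longleftrightarrow>
     (\<exists>h \<in> ring_iso A B. \<forall>c. \<forall>a \<in> carrier A. h (c \<odot>\<^bsub>A\<^esub> a) = c \<odot>\<^bsub>B\<^esub> h a)"

definition direct_sum_grading :: "('r, 'm) graded \<Rightarrow> bool" where
  "direct_sum_grading M \<longleftrightarrow>
     (\<forall>i. additive_subgroup (component M i) M) \<and>
     (\<forall>x \<in> carrier M. \<exists>!f. (\<forall>i. f i \<in> component M i) \<and> finite {i. f i \<noteq> \<zero>\<^bsub>M\<^esub>} \<and>
        x = finsum M f {i. f i \<noteq> \<zero>\<^bsub>M\<^esub>})"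

definition graded_algebra :: "('k::field, 'a) graded \<Rightarrow> bool" where
  "graded_algebra A \<longleftrightarrow> k_algebra A \<and> direct_sum_grading A \<and>
     (\<forall>i c. \<forall>a \<in> component A i. c \<odot>\<^bsub>A\<^esub> a \<in> component A i) \<and>
     \<one>\<^bsub>A\<^esub> \<in> component A 0 \<and>
     (\<forall>i j. \<forall>a \<in> component A i. \<forall>b \<in> component A j. a \<otimes>\<^bsub>A\<^esub> b \<in> component A (i + j))"

text \<open>The library's \<^const>\<open>ideal_prod\<close> is the set of finite sums of products; its arguments
  need not be ideals.\<close>

definition strongly_graded :: "('k::field, 'a) graded \<Rightarrow> bool" where
  "strongly_graded A \<longleftrightarrow> graded_algebra A \<and>
     (\<forall>j. component A j \<cdot>\<^bsub>A\<^esub> component A (- j) = component A 0)"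

definition degree_zero :: "('k, 'a) graded \<Rightarrow> ('k, 'a) graded" where
  "degree_zero A = A\<lparr>carrier := component A 0\<rparr>"

definition quot_module :: "('r, 'm, 'z) module_scheme \<Rightarrow> 'm set \<Rightarrow> ('r, 'm set) module" where
  "quot_module M N = ring.extend (M Quot N) (module.fields (\<lambda>r X. N <+>\<^bsub>M\<^esub> ((\<odot>\<^bsub>M\<^esub>) r ` X)))"

definition quot_graded :: "('r, 'm) graded \<Rightarrow> 'm set \<Rightarrow> ('r, 'm set) graded" where
  "quot_graded M N =
     module.extend (quot_module M N) (graded.fields (\<lambda>i. (\<lambda>x. N +>\<^bsub>M\<^esub> x) ` component M i))"


section \<open>The categories \<open>LMod A\<close> and \<open>Gr A\<close>\<close>

text \<open>The type \<open>'u\<close> of module elements is the universe: objects are modules whose carrier is a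
  subset of \<open>'u\<close>. Morphisms are made extensional so that equality of functions is equality of
  morphisms.\<close>

definition LMod :: "('a, 'z) ring_scheme \<Rightarrow> (('a, 'u) module, 'u \<Rightarrow> 'u) cat" where
  "LMod A = \<lparr>obj = {M. left_module A M},
     homs = (\<lambda>M N. LinearCombinations.module_hom A M N \<inter> extensional (carrier M)),
     idm = (\<lambda>M. \<lambda>x \<in> carrier M. x),
     cmp = (\<lambda>M N P g f. compose (carrier M) g f)\<rparr>"

definition graded_left_module :: "('k, 'a) graded \<Rightarrow> ('a, 'u) graded \<Rightarrow> bool" where
  "graded_left_module A M \<longleftrightarrow> left_module A M \<and> direct_sum_grading M \<and>
     (\<forall>i j. \<forall>a \<in> component A i. \<forall>x \<in> component M j. a \<odot>\<^bsub>M\<^esub> x \<in> component M (i + j))"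

definition graded_hom :: "('k, 'a) graded \<Rightarrow> ('a, 'u) graded \<Rightarrow> ('a, 'v) graded \<Rightarrow> ('u \<Rightarrow> 'v) set" where
  "graded_hom A M N = {f \<in> LinearCombinations.module_hom A M N \<inter> extensional (carrier M).
     \<forall>i. f ` component M i \<subseteq> component N i}"

definition Gr :: "('k, 'a) graded \<Rightarrow> (('a, 'u) graded, 'u \<Rightarrow> 'u) cat" where
  "Gr A = \<lparr>obj = {M. graded_left_module A M},
     homs = graded_hom A,
     idm = (\<lambda>M. \<lambda>x \<in> carrier M. x),
     cmp = (\<lambda>M N P g f. compose (carrier M) g f)\<rparr>"


section \<open>The quotient category \<open>QGr A = Gr A / Fdim A\<close>\<close>

definition sub_graded :: "('a, 'u) graded \<Rightarrow> 'u set \<Rightarrow> ('a, 'u) graded" where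
  "sub_graded M N = M\<lparr>carrier := N, component := (\<lambda>i. component M i \<inter> N)\<rparr>"

definition graded_submodule :: "('k, 'a) graded \<Rightarrow> 'u set \<Rightarrow> ('a, 'u) graded \<Rightarrow> bool" where
  "graded_submodule A N M \<longleftrightarrow> N \<subseteq> carrier M \<and> graded_left_module A (sub_graded M N)"

definition restrict_scalars :: "('k, 'a) graded \<Rightarrow> ('a, 'u) graded \<Rightarrow> ('k, 'u) module" where
  "restrict_scalars A M = \<lparr>carrier = carrier M, mult = mult M, one = \<one>\<^bsub>M\<^esub>, zero = \<zero>\<^bsub>M\<^esub>, add = add M,
     smult = (\<lambda>c x. (c \<odot>\<^bsub>A\<^esub> \<one>\<^bsub>A\<^esub>) \<odot>\<^bsub>M\<^esub> x)\<rparr>"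

definition finite_dimensional :: "('k::field, 'a) graded \<Rightarrow> ('a, 'u) graded \<Rightarrow> bool" where
  "finite_dimensional A M \<longleftrightarrow> vectorspace class_ring (restrict_scalars A M) \<and>
     vectorspace.fin_dim class_ring (restrict_scalars A M)"

text \<open>\<open>Fdim A\<close>: directed unions of finite-dimensional graded submodules.\<close>

definition Fdim :: "('k::field, 'a) graded \<Rightarrow> ('a, 'u) graded set" where
  "Fdim A = {M. graded_left_module A M \<and>
     (\<exists>\<F>. \<F> \<noteq> {} \<and>
        (\<forall>N \<in> \<F>. graded_submodule A N M \<and> finite_dimensional A (sub_graded M N)) \<and>
        (\<forall>N \<in> \<F>. \<forall>P \<in> \<F>. \<exists>Q \<in> \<F>. N \<union> P \<subseteq> Q) \<and>
        carrier M = \<Union>\<F>)}"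

text \<open>Morphisms \<open>M \<rightarrow> N\<close> in the quotient category are the elements of
  \<open>colim Hom (M', N / N')\<close> over graded submodules \<open>M' \<subseteq> M\<close>, \<open>N' \<subseteq> N\<close> with \<open>M / M'\<close> and \<open>N'\<close> in
  \<open>Fdim A\<close>. Elements of the colimit are represented by triples \<open>(M', N', f)\<close>; two triples are
  identified when they agree at some later stage \<open>(M0, N0)\<close>.\<close>

definition qgr_frac :: "('k::field, 'a) graded \<Rightarrow> ('a, 'u) graded \<Rightarrow> ('a, 'u) graded
    \<Rightarrow> ('u set \<times> 'u set \<times> ('u \<Rightarrow> 'u set)) set" where
  "qgr_frac A M N = {(M', N', f).
     graded_submodule A M' M \<and> quot_graded M M' \<in> Fdim A \<and>
     graded_submodule A N' N \<and> sub_graded N N' \<in> Fdim A \<and>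
     f \<in> graded_hom A (sub_graded M M') (quot_graded N N')}"

definition qgr_rel :: "('k::field, 'a) graded \<Rightarrow> ('a, 'u) graded \<Rightarrow> ('a, 'u) graded
    \<Rightarrow> ('u set \<times> 'u set \<times> ('u \<Rightarrow> 'u set)) rel" where
  "qgr_rel A M N = {((M1, N1, f1), (M2, N2, f2)).
     (M1, N1, f1) \<in> qgr_frac A M N \<and> (M2, N2, f2) \<in> qgr_frac A M N \<and>
     (\<exists>M0 N0. graded_submodule A M0 M \<and> quot_graded M M0 \<in> Fdim A \<and> M0 \<subseteq> M1 \<inter> M2 \<and>
        graded_submodule A N0 N \<and> sub_graded N N0 \<in> Fdim A \<and> N1 \<union> N2 \<subseteq> N0 \<and>
        (\<forall>x \<in> M0. N0 <+>\<^bsub>N\<^esub> f1 x = N0 <+>\<^bsub>N\<^esub> f2 x))}"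

text \<open>For \<open>f : M' \<rightarrow> N / N'\<close> and \<open>g : N'' \<rightarrow> P / P'\<close> the composite is defined on
  \<open>{x \<in> M'. f x \<in> (N'' + N') / N'}\<close> with values in \<open>P / P0\<close>, where \<open>P0 / P' = g (N'' \<inter> N')\<close>, and
  sends \<open>x\<close> to the coset \<open>g y + P0\<close> for any representative \<open>y \<in> N''\<close> of \<open>f x\<close>. That coset is the
  union of the \<open>g y\<close> over all such \<open>y\<close>.\<close>

fun qgr_frac_comp :: "('u set \<times> 'u set \<times> ('u \<Rightarrow> 'u set)) \<Rightarrow> ('u set \<times> 'u set \<times> ('u \<Rightarrow> 'u set))
    \<Rightarrow> 'u set \<times> 'u set \<times> ('u \<Rightarrow> 'u set)" where
  "qgr_frac_comp (N'', P', g) (M', N', f) =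
     (let M0 = {x \<in> M'. f x \<inter> N'' \<noteq> {}}
      in (M0, \<Union>(g ` (N'' \<inter> N')), \<lambda>x \<in> M0. \<Union>(g ` (f x \<inter> N''))))"

definition QGr :: "('k::field, 'a) graded
    \<Rightarrow> (('a, 'u) graded, ('u set \<times> 'u set \<times> ('u \<Rightarrow> 'u set)) set) cat" where
  "QGr A = \<lparr>obj = {M. graded_left_module A M},
     homs = (\<lambda>M N. qgr_frac A M N // qgr_rel A M N),
     idm = (\<lambda>M. qgr_rel A M M `` {(carrier M, {\<zero>\<^bsub>M\<^esub>}, \<lambda>x \<in> carrier M. {\<zero>\<^bsub>M\<^esub>} +>\<^bsub>M\<^esub> x)}),
     cmp = (\<lambda>M N P G F. \<Union>q \<in> G. \<Union>p \<in> F. qgr_rel A M P `` {qgr_frac_comp q p})\<rparr>"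


section \<open>Free algebras and the Leavitt algebra\<close>

definition monoid_algebra :: "'w monoid \<Rightarrow> ('k::field, 'w \<Rightarrow>\<^sub>0 'k) module" where
  "monoid_algebra W = \<lparr>carrier = {f. Poly_Mapping.keys f \<subseteq> carrier W},
     mult = (\<lambda>f g. \<Sum>u \<in> Poly_Mapping.keys f. \<Sum>v \<in> Poly_Mapping.keys g.
       Poly_Mapping.single (u \<otimes>\<^bsub>W\<^esub> v) (Poly_Mapping.lookup f u * Poly_Mapping.lookup g v)),
     one = Poly_Mapping.single \<one>\<^bsub>W\<^esub> 1, zero = 0, add = (+),
     smult = (\<lambda>c. Poly_Mapping.map ((*) c))\<rparr>"

definition word_monoid :: "'x set \<Rightarrow> 'x list monoid" where
  "word_monoid X = \<lparr>carrier = lists X, mult = (@), one = []\<rparr>"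

definition graded_free_algebra :: "'x set \<Rightarrow> ('x \<Rightarrow> int) \<Rightarrow> ('k::field, 'x list \<Rightarrow>\<^sub>0 'k) graded" where
  "graded_free_algebra X d = module.extend (monoid_algebra (word_monoid X))
     (graded.fields (\<lambda>i. {f. \<forall>w \<in> Poly_Mapping.keys f. w \<in> lists X \<and> (\<Sum>x\<leftarrow>w. d x) = i}))"

text \<open>\<open>k\<langle>x\<^sub>0, \<dots>, x\<^sub>n\<rangle>\<close>; the variable \<open>x\<^sub>i\<close> is the number \<open>i\<close>.\<close>

definition free_algebra :: "nat \<Rightarrow> ('k::field, nat list \<Rightarrow>\<^sub>0 'k) graded" where
  "free_algebra n = graded_free_algebra {0..n} (\<lambda>i. 1)"

datatype leavitt_gen = Gen nat | Gen_star nat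

primrec leavitt_deg :: "leavitt_gen \<Rightarrow> int" where
  "leavitt_deg (Gen i) = 1"
| "leavitt_deg (Gen_star i) = - 1"

definition leavitt_free :: "nat \<Rightarrow> ('k::field, leavitt_gen list \<Rightarrow>\<^sub>0 'k) graded" where
  "leavitt_free n = graded_free_algebra (Gen ` {0..n} \<union> Gen_star ` {0..n}) leavitt_deg"

definition leavitt_relations :: "nat \<Rightarrow> (leavitt_gen list \<Rightarrow>\<^sub>0 'k::field) set" where
  "leavitt_relations n =
     {(\<Sum>i \<in> {0..n}. Poly_Mapping.single [Gen_star i, Gen i] 1) - Poly_Mapping.single [] 1} \<union>
     {Poly_Mapping.single [Gen i, Gen_star j] 1 - Poly_Mapping.single [] (if i = j then 1 else 0)
       | i j. i \<in> {0..n} \<and> j \<in> {0..n}}"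

definition leavitt :: "nat \<Rightarrow> ('k::field, (leavitt_gen list \<Rightarrow>\<^sub>0 'k) set) graded" where
  "leavitt n = quot_graded (leavitt_free n) (Idl\<^bsub>leavitt_free n\<^esub> (leavitt_relations n))"


section \<open>Tensor powers of algebras and sequential direct limits\<close>

definition tuple_monoid :: "('k, 'a, 'z) module_scheme \<Rightarrow> nat \<Rightarrow> 'a list monoid" where
  "tuple_monoid A i = \<lparr>carrier = {as. length as = i \<and> set as \<subseteq> carrier A},
     mult = map2 (mult A), one = replicate i \<one>\<^bsub>A\<^esub>\<rparr>"

definition multilinear_relations ::
  "('k::field, 'a, 'z) module_scheme \<Rightarrow> nat \<Rightarrow> ('a list \<Rightarrow>\<^sub>0 'k) set" where
  "multilinear_relations A i =
     {Poly_Mapping.single (as[p := a \<oplus>\<^bsub>A\<^esub> b]) 1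
        - Poly_Mapping.single (as[p := a]) 1 - Poly_Mapping.single (as[p := b]) 1
       | as p a b. as \<in> carrier (tuple_monoid A i) \<and> p < i \<and> a \<in> carrier A \<and> b \<in> carrier A} \<union>
     {Poly_Mapping.single (as[p := c \<odot>\<^bsub>A\<^esub> a]) 1 - Poly_Mapping.single (as[p := a]) c
       | as p c a. as \<in> carrier (tuple_monoid A i) \<and> p < i \<and> a \<in> carrier A}"

text \<open>The \<open>i\<close>-fold tensor power of \<open>A\<close> over \<open>k\<close>: the free vector space on \<open>A\<^sup>i\<close> modulo the
  multilinearity relations. Multiplication by a tuple maps multilinearity relations to
  multilinearity relations, so the ideal generated by them in the monoid algebra of \<open>A\<^sup>i\<close> is just
  their linear span.\<close>

definition tensor_ideal :: "('k::field, 'a, 'z) module_scheme \<Rightarrow> nat \<Rightarrow> ('a list \<Rightarrow>\<^sub>0 'k) set" where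
  "tensor_ideal A i = Idl\<^bsub>monoid_algebra (tuple_monoid A i)\<^esub> (multilinear_relations A i)"

definition tensor_power ::
  "('k::field, 'a, 'z) module_scheme \<Rightarrow> nat \<Rightarrow> ('k, ('a list \<Rightarrow>\<^sub>0 'k) set) module" where
  "tensor_power A i = quot_module (monoid_algebra (tuple_monoid A i)) (tensor_ideal A i)"

text \<open>The map \<open>a\<^sub>1 \<otimes> \<dots> \<otimes> a\<^sub>i \<mapsto> 1 \<otimes> a\<^sub>1 \<otimes> \<dots> \<otimes> a\<^sub>i\<close>, as the map induced on cosets by
  the linear extension of \<open>as \<mapsto> 1 # as\<close>.\<close>

definition tensor_one_left :: "('k::field, 'a, 'z) module_scheme \<Rightarrow> nat
    \<Rightarrow> ('a list \<Rightarrow>\<^sub>0 'k) set \<Rightarrow> ('a list \<Rightarrow>\<^sub>0 'k) set" where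
  "tensor_one_left A i T = tensor_ideal A (Suc i) <+>\<^bsub>monoid_algebra (tuple_monoid A (Suc i))\<^esub>
     (\<lambda>f. \<Sum>as \<in> Poly_Mapping.keys f.
        Poly_Mapping.single (\<one>\<^bsub>A\<^esub> # as) (Poly_Mapping.lookup f as)) ` T"

text \<open>In the direct limit of \<open>A 0 \<rightarrow> A 1 \<rightarrow> A 2 \<rightarrow> \<dots>\<close> with transition maps \<open>\<phi> i : A i \<rightarrow> A (i + 1)\<close>,
  the composite \<open>A i \<rightarrow> A m\<close> is \<open>fold \<phi> [i..<m]\<close>.\<close>

definition dirlim_rel :: "(nat \<Rightarrow> ('k, 'a) module) \<Rightarrow> (nat \<Rightarrow> 'a \<Rightarrow> 'a) \<Rightarrow> (nat \<times> 'a) rel" where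
  "dirlim_rel A \<phi> = {((i, a), (j, b)). a \<in> carrier (A i) \<and> b \<in> carrier (A j) \<and>
     (\<exists>m. i \<le> m \<and> j \<le> m \<and> fold \<phi> [i..<m] a = fold \<phi> [j..<m] b)}"

definition dirlim_op :: "(nat \<Rightarrow> ('k, 'a) module) \<Rightarrow> (nat \<Rightarrow> 'a \<Rightarrow> 'a) \<Rightarrow> (nat \<Rightarrow> 'a \<Rightarrow> 'a \<Rightarrow> 'a)
    \<Rightarrow> (nat \<times> 'a) set \<Rightarrow> (nat \<times> 'a) set \<Rightarrow> (nat \<times> 'a) set" where
  "dirlim_op A \<phi> oper S T = (\<Union>(i, a) \<in> S. \<Union>(j, b) \<in> T. dirlim_rel A \<phi> ``
     {(max i j, oper (max i j) (fold \<phi> [i..<max i j] a) (fold \<phi> [j..<max i j] b))})"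

definition dirlim :: "(nat \<Rightarrow> ('k, 'a) module) \<Rightarrow> (nat \<Rightarrow> 'a \<Rightarrow> 'a) \<Rightarrow> ('k, (nat \<times> 'a) set) module" where
  "dirlim A \<phi> = \<lparr>carrier = (SIGMA i:UNIV. carrier (A i)) // dirlim_rel A \<phi>,
     mult = dirlim_op A \<phi> (\<lambda>m. mult (A m)),
     one = dirlim_rel A \<phi> `` {(0, \<one>\<^bsub>A 0\<^esub>)},
     zero = dirlim_rel A \<phi> `` {(0, \<zero>\<^bsub>A 0\<^esub>)},
     add = dirlim_op A \<phi> (\<lambda>m. add (A m)),
     smult = (\<lambda>c S. \<Union>(i, a) \<in> S. dirlim_rel A \<phi> `` {(i, c \<odot>\<^bsub>A i\<^esub> a)})\<rparr>"

definition matrix_tensor_limit ::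
  "nat \<Rightarrow> ('k::field, (nat \<times> ('k mat list \<Rightarrow>\<^sub>0 'k) set) set) module" where
  "matrix_tensor_limit n = dirlim (tensor_power (module_mat TYPE('k) (n + 1) (n + 1)))
     (tensor_one_left (module_mat TYPE('k) (n + 1) (n + 1)))"

end

theory Submission
 imports Defs "HOL-Algebra.Free_Abelian_Groups"
begin

text \<open>Multiplication by \<open>x\<^sub>i\<close> and \<open>x\<^sub>i\<^sup>*\<close> makes every element of \<open>L\<close> a combination of \<open>v\<^sup>* w\<close> with all
 words \<open>v\<close> of one length \<open>r\<close>. Since \<open>\<Sum> v\<^sup>* v = 1\<close> over the words of length \<open>r\<close>, this gives strong
 grading, and the elements \<open>v\<^sup>* w\<close> with \<open>v, w\<close> of length \<open>r\<close> are matrix units, which identifies \<open>L\<^sub>0\<close>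
 with the limit of matrix algebras. Over a strongly graded algebra a graded module is recovered from
 its degree zero part by coinduction. A module is in \<open>Fdim R\<close> iff each of its elements is killed by
 all sufficiently long words. The quotient functor sends a graded \<open>R\<close>-module \<open>M\<close> to the \<open>L\<close>-module of
 germs at infinity of functions \<open>u\<close> from words to \<open>M\<close> with \<open>u (v w) = v u w\<close> for long \<open>w\<close>, on which
 \<open>x\<^sub>i\<close> acts by \<open>(x\<^sub>i u) w = u (w x\<^sub>i)\<close> and \<open>x\<^sub>i\<^sup>*\<close> by \<open>(x\<^sub>i\<^sup>* u) (w x\<^sub>j) = \<delta>\<^sub>i\<^sub>j u w\<close>; a fraction acts on
 germs through its graph.\<close>

hide_const (open) Wellorder_Constructions.zero

text \<open>All modules live over one universe \<open>'u\<close>, so the equivalences need more than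
  algebra: coinduced modules and modules of germs consist of functions and must be injected back
  into \<open>'u\<close>. Each of their elements is determined by a natural number and finitely many
  values, so an infinite carrier absorbs them. Finite carriers are harmless for two different
  reasons. A finite graded \<open>R\<close>-module has bounded degrees and hence only the zero germ.
  For n \<ge> 1 a nonzero module over the degree zero part of \<open>L\<close> is infinite, because
  matrix units of unbounded size act on it. Neither the category axioms of QGr nor the equivalence
  property of \<open>qgr_rel\<close> is checked directly. Both are pulled back along the functor to
  graded \<open>L\<close>-modules; this is why fractions are first turned into linear relations,
  whose composites and induced maps are easy to handle. The defining relations could a priori force
  \<open>L\<close> to be zero. That they do not is needed to embed the tensor powers of matrices,
  and is read off from the germs of the free module of rank one.\<close>

abbreviation (input) "single \<equiv> Poly_Mapping.single"
abbreviation (input) "keys \<equiv> Poly_Mapping.keys"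
abbreviation (input) "lookup \<equiv> Poly_Mapping.lookup"

section \<open>Categories\<close>

text \<open>For \<open>C\<close> only the closure of identities and composites is assumed. The unit
  and associativity laws follow from those of \<open>D\<close> because \<open>Fm\<close> is
  injective on hom-sets, so they need not be verified for classes of fractions.\<close>

locale weak_equivalence = D: category D
 for C :: "('o1, 'm1) cat" and D :: "('o2, 'm2) cat" +
 fixes Fo :: "'o1 => 'o2" and Fm :: "'o1 => 'o1 => 'm1 => 'm2"
 assumes C_idm: "a \<in> obj C ==> idm C a \<in> homs C a a"
  and C_cmp: "[|a \<in> obj C; b \<in> obj C; c \<in> obj C; f \<in> homs C a b; g \<in> homs C b c|]
   ==> cmp C a b c g f \<in> homs C a c"
  and Fo_obj: "a \<in> obj C ==> Fo a \<in> obj D"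
  and Fm_bij: "[|a \<in> obj C; b \<in> obj C|] ==> bij_betw (Fm a b) (homs C a b) (homs D (Fo a) (Fo b))"
  and Fm_id: "a \<in> obj C ==> Fm a a (idm C a) = idm D (Fo a)"
  and Fm_comp: "[|a \<in> obj C; b \<in> obj C; c \<in> obj C; f \<in> homs C a b; g \<in> homs C b c|]
   ==> Fm a c (cmp C a b c g f) = cmp D (Fo a) (Fo b) (Fo c) (Fm b c g) (Fm a b f)"
  and ess_surj: "d \<in> obj D ==> \<exists>a \<in> obj C. cat_iso D (Fo a) d ~= {}"
begin

lemma Fm_hom: "[|a \<in> obj C; b \<in> obj C; f \<in> homs C a b|] ==> Fm a b f \<in> homs D (Fo a) (Fo b)"
 using Fm_bij bij_betwE by blast

lemma Fm_eqI:
 assumes "a \<in> obj C" "b \<in> obj C" "f \<in> homs C a b" "g \<in> homs C a b" "Fm a b f = Fm a b g"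
 shows "f = g"
 using Fm_bij[OF assms(1,2)] assms by (auto simp: bij_betw_def inj_on_def)

lemma category_source: "category C"
proof
 fix a b f assume *: "a \<in> obj C" "b \<in> obj C" "f \<in> homs C a b"
 then show "cmp C a a b f (idm C a) = f" "cmp C a b b (idm C b) f = f"
  by (auto intro!: Fm_eqI[OF *(1,2)]
    simp: C_cmp C_idm Fm_comp Fm_id D.cmp_idm_right D.cmp_idm_left Fm_hom Fo_obj)
next
 fix a b c d f g h
 assume *: "a \<in> obj C" "b \<in> obj C" "c \<in> obj C" "d \<in> obj C"
  "f \<in> homs C a b" "g \<in> homs C b c" "h \<in> homs C c d"
 then show "cmp C a b d (cmp C b c d h g) f = cmp C a c d h (cmp C a b c g f)"
  by (intro Fm_eqI[OF *(1,4)])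
   (auto simp: C_cmp Fm_comp Fm_hom Fo_obj intro!: D.cmp_assoc)
qed (auto simp: C_idm C_cmp)

sublocale C: category C by (rule category_source)

definition inv_hom :: "'o1 => 'o1 => 'm2 => 'm1" where
 "inv_hom a b = inv_into (homs C a b) (Fm a b)"

lemma inv_hom:
 assumes "a \<in> obj C" "b \<in> obj C" "g \<in> homs D (Fo a) (Fo b)"
 shows "inv_hom a b g \<in> homs C a b" "Fm a b (inv_hom a b g) = g"
 using Fm_bij[OF assms(1,2)] assms(3) unfolding inv_hom_def
 by (auto simp: bij_betw_def intro!: inv_into_into f_inv_into_f)

text \<open>The inverse functor chooses a preimage \<open>Go d\<close> and an isomorphism
  \<open>e d\<close> for each object, and sends a morphism to the preimage of its conjugate. That
  conjugate is the only morphism making the square with \<open>e\<close> commute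
  (\<open>lift_unique\<close>), so the functor laws reduce to pasting squares.\<close>

lemma equivalent: "equivalent_categories C D"
proof -
 define Go where "Go d = (SOME a. a \<in> obj C \<and> cat_iso D (Fo a) d ~= {})" for d
 have Go: "Go d \<in> obj C" "cat_iso D (Fo (Go d)) d ~= {}" if "d \<in> obj D" for d
 proof -
  have "\<exists>a. a \<in> obj C \<and> cat_iso D (Fo a) d ~= {}" using ess_surj[OF that] by blast
  from someI_ex[OF this] show "Go d \<in> obj C" "cat_iso D (Fo (Go d)) d ~= {}"
   unfolding Go_def by auto
 qed
 have "\<forall>d. \<exists>e e'. d \<in> obj D --> e \<in> homs D (Fo (Go d)) d \<and> e' \<in> homs D d (Fo (Go d)) \<and>
   cmp D (Fo (Go d)) d (Fo (Go d)) e' e = idm D (Fo (Go d)) \<and> cmp D d (Fo (Go d)) d e e' = idm D d"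
 proof
  fix d show "\<exists>e e'. d \<in> obj D --> e \<in> homs D (Fo (Go d)) d \<and> e' \<in> homs D d (Fo (Go d)) \<and>
   cmp D (Fo (Go d)) d (Fo (Go d)) e' e = idm D (Fo (Go d)) \<and> cmp D d (Fo (Go d)) d e e' = idm D d"
   using Go(2)[of d] unfolding cat_iso_def by blast
 qed
 then obtain e e' where e: "!!d. d \<in> obj D ==> e d \<in> homs D (Fo (Go d)) d"
  "!!d. d \<in> obj D ==> e' d \<in> homs D d (Fo (Go d))"
  "!!d. d \<in> obj D ==> cmp D (Fo (Go d)) d (Fo (Go d)) (e' d) (e d) = idm D (Fo (Go d))"
  "!!d. d \<in> obj D ==> cmp D d (Fo (Go d)) d (e d) (e' d) = idm D d"
  by metis
 define lift where "lift d d' g = cmp D (Fo (Go d)) d' (Fo (Go d')) (e' d') (cmp D (Fo (Go d)) d d' g (e d))"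
  for d d' g
 have lift: "lift d d' g \<in> homs D (Fo (Go d)) (Fo (Go d'))"
  if "d \<in> obj D" "d' \<in> obj D" "g \<in> homs D d d'" for d d' g
  using that unfolding lift_def by (auto intro!: D.cmp_closed simp: e Go Fo_obj)
 define Gm where "Gm d d' g = inv_hom (Go d) (Go d') (lift d d' g)" for d d' g
 have Gm: "Gm d d' g \<in> homs C (Go d) (Go d')" "Fm (Go d) (Go d') (Gm d d' g) = lift d d' g"
  if "d \<in> obj D" "d' \<in> obj D" "g \<in> homs D d d'" for d d' g
  using that unfolding Gm_def by (auto simp: inv_hom lift Go)
 have e_lift: "cmp D (Fo (Go d)) (Fo (Go d')) d' (e d') (lift d d' g) = cmp D (Fo (Go d)) d d' g (e d)"
  if "d \<in> obj D" "d' \<in> obj D" "g \<in> homs D d d'" for d d' g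
 proof -
  have "cmp D (Fo (Go d)) (Fo (Go d')) d' (e d') (lift d d' g)
   = cmp D (Fo (Go d)) d' d' (cmp D d' (Fo (Go d')) d' (e d') (e' d')) (cmp D (Fo (Go d)) d d' g (e d))"
   unfolding lift_def using that by (intro D.cmp_assoc[symmetric]) (auto simp: e Go Fo_obj D.cmp_closed)
  then show ?thesis using that by (simp add: e D.cmp_idm_left D.cmp_closed Go Fo_obj)
 qed
 have lift_unique: "h = lift d d' g"
  if "d \<in> obj D" "d' \<in> obj D" "g \<in> homs D d d'" "h \<in> homs D (Fo (Go d)) (Fo (Go d'))"
   "cmp D (Fo (Go d)) (Fo (Go d')) d' (e d') h = cmp D (Fo (Go d)) d d' g (e d)" for d d' g h
 proof -
  have "h = cmp D (Fo (Go d)) (Fo (Go d')) (Fo (Go d'))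
    (cmp D (Fo (Go d')) d' (Fo (Go d')) (e' d') (e d')) h"
   using that by (simp add: e D.cmp_idm_left Go Fo_obj)
  also have "\<dots> = cmp D (Fo (Go d)) d' (Fo (Go d')) (e' d')
    (cmp D (Fo (Go d)) (Fo (Go d')) d' (e d') h)"
   using that by (intro D.cmp_assoc) (auto simp: e Go Fo_obj)
  finally show ?thesis using that by (simp add: lift_def)
 qed
 have F: "cat_functor C D Fo Fm"
  by unfold_locales (auto simp: Fo_obj Fm_hom Fm_id Fm_comp)
 have G: "cat_functor D C Go Gm"
 proof unfold_locales
  fix a assume a: "a \<in> obj D"
  have "idm D (Fo (Go a)) = lift a a (idm D a)"
   using a by (intro lift_unique)
    (auto simp: D.idm_closed e D.cmp_idm_left D.cmp_idm_right Go Fo_obj)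
  then show "Gm a a (idm D a) = idm C (Go a)"
   using a by (intro Fm_eqI[of "Go a" "Go a"]) (auto simp: Gm Go D.idm_closed C.idm_closed Fm_id)
 next
  fix a b c f g assume *: "a \<in> obj D" "b \<in> obj D" "c \<in> obj D" "f \<in> homs D a b" "g \<in> homs D b c"
  have "cmp D (Fo (Go a)) (Fo (Go b)) (Fo (Go c)) (lift b c g) (lift a b f)
    = lift a c (cmp D a b c g f)"
  proof (rule lift_unique)
   have "cmp D (Fo (Go a)) (Fo (Go c)) c (e c)
     (cmp D (Fo (Go a)) (Fo (Go b)) (Fo (Go c)) (lift b c g) (lift a b f))
    = cmp D (Fo (Go a)) (Fo (Go b)) c (cmp D (Fo (Go b)) b c g (e b)) (lift a b f)"
    using * by (subst D.cmp_assoc[symmetric]) (auto simp: lift e Go Fo_obj e_lift)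
   also have "\<dots> = cmp D (Fo (Go a)) b c g (cmp D (Fo (Go a)) a b f (e a))"
    using * by (subst D.cmp_assoc) (auto simp: lift e Go Fo_obj e_lift)
   also have "\<dots> = cmp D (Fo (Go a)) a c (cmp D a b c g f) (e a)"
    using * by (intro D.cmp_assoc[symmetric]) (auto simp: e Go Fo_obj)
   finally show "cmp D (Fo (Go a)) (Fo (Go c)) c (e c)
     (cmp D (Fo (Go a)) (Fo (Go b)) (Fo (Go c)) (lift b c g) (lift a b f))
    = cmp D (Fo (Go a)) a c (cmp D a b c g f) (e a)" .
  qed (use * in \<open>auto intro!: D.cmp_closed lift simp: Go Fo_obj\<close>)
  then show "Gm a c (cmp D a b c g f) = cmp C (Go a) (Go b) (Go c) (Gm b c g) (Gm a b f)"
   using * by (intro Fm_eqI[of "Go a" "Go c"])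
    (auto simp: Gm Go D.cmp_closed C.cmp_closed Fm_comp)
 qed (auto simp: Go Gm)
 \<comment> \<open>The unit is the preimage of the inverse of \<open>e\<close>, so every identity
   about it can be tested after applying the faithful \<open>Fm\<close>.\<close>
 define \<eta> where "\<eta> a = inv_hom a (Go (Fo a)) (e' (Fo a))" for a
 have \<eta>: "\<eta> a \<in> homs C a (Go (Fo a))" "Fm a (Go (Fo a)) (\<eta> a) = e' (Fo a)" if "a \<in> obj C" for a
  using that unfolding \<eta>_def by (auto simp: inv_hom Go Fo_obj e)
 have "natural_iso C C (\<lambda>a. a) (\<lambda>a b f. f)
   (\<lambda>a. Go (Fo a)) (\<lambda>a b f. Gm (Fo a) (Fo b) (Fm a b f)) \<eta>"
  unfolding natural_iso_def
 proof (intro conjI ballI)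
  fix a assume a: "a \<in> obj C"
  define \<theta> where "\<theta> = inv_hom (Go (Fo a)) a (e (Fo a))"
  have \<theta>: "\<theta> \<in> homs C (Go (Fo a)) a" "Fm (Go (Fo a)) a \<theta> = e (Fo a)"
   using a unfolding \<theta>_def by (auto simp: inv_hom Go Fo_obj e)
  have "cmp C a (Go (Fo a)) a \<theta> (\<eta> a) = idm C a"
   using a by (intro Fm_eqI[of a a]) (auto simp: \<theta> \<eta> Go Fo_obj C.cmp_closed C.idm_closed Fm_comp e Fm_id)
  moreover have "cmp C (Go (Fo a)) a (Go (Fo a)) (\<eta> a) \<theta> = idm C (Go (Fo a))"
   using a by (intro Fm_eqI[of "Go (Fo a)" "Go (Fo a)"])
    (auto simp: \<theta> \<eta> Go Fo_obj C.cmp_closed C.idm_closed Fm_comp e Fm_id)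
  ultimately show "\<eta> a \<in> cat_iso C a (Go (Fo a))"
   using \<theta> \<eta> a by (auto simp: cat_iso_def)
 next
  fix a b f assume *: "a \<in> obj C" "b \<in> obj C" "f \<in> homs C a b"
  have "cmp D (Fo a) (Fo (Go (Fo a))) (Fo (Go (Fo b))) (lift (Fo a) (Fo b) (Fm a b f)) (e' (Fo a))
    = cmp D (Fo a) (Fo b) (Fo (Go (Fo b))) (e' (Fo b)) (Fm a b f)"
  proof -
   have "cmp D (Fo a) (Fo (Go (Fo a))) (Fo (Go (Fo b))) (lift (Fo a) (Fo b) (Fm a b f)) (e' (Fo a))
    = cmp D (Fo a) (Fo b) (Fo (Go (Fo b))) (e' (Fo b))
      (cmp D (Fo a) (Fo (Go (Fo a))) (Fo b)
       (cmp D (Fo (Go (Fo a))) (Fo a) (Fo b) (Fm a b f) (e (Fo a))) (e' (Fo a)))"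
    unfolding lift_def using * by (intro D.cmp_assoc) (auto simp: e Go Fo_obj Fm_hom D.cmp_closed)
   also have "cmp D (Fo a) (Fo (Go (Fo a))) (Fo b)
       (cmp D (Fo (Go (Fo a))) (Fo a) (Fo b) (Fm a b f) (e (Fo a))) (e' (Fo a)) = Fm a b f"
    using * by (subst D.cmp_assoc) (auto simp: e Go Fo_obj Fm_hom D.cmp_idm_right)
   finally show ?thesis .
  qed
  then show "cmp C a b (Go (Fo b)) (\<eta> b) f
    = cmp C a (Go (Fo a)) (Go (Fo b)) (Gm (Fo a) (Fo b) (Fm a b f)) (\<eta> a)"
   using * by (intro Fm_eqI[of a "Go (Fo b)"])
    (auto simp: \<eta> Go Fo_obj C.cmp_closed Fm_comp Gm Fm_hom)
 qed
 moreover have "natural_iso D D (\<lambda>a. Fo (Go a)) (\<lambda>a b f. Fm (Go a) (Go b) (Gm a b f))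
   (\<lambda>a. a) (\<lambda>a b f. f) e"
  unfolding natural_iso_def
 proof (intro conjI ballI)
  fix d assume d: "d \<in> obj D"
  show "e d \<in> cat_iso D (Fo (Go d)) d"
   unfolding cat_iso_def by (simp add: e(1)[OF d]) (intro bexI[of _ "e' d"] conjI e d)
 qed (simp add: Gm e_lift)
 ultimately show ?thesis unfolding equivalent_categories_def using F G by blast
qed

end


section \<open>Additive maps and gradings\<close>

lemma abelian_group_cong:
 assumes "abelian_group M" "carrier N = carrier M" "add N = add M" "zero N = zero M"
 shows "abelian_group N"
proof -
 interpret M: abelian_group M by fact
 show ?thesis
  by (rule abelian_groupI) (auto simp: assms M.a_ac intro!: bexI[of _ "\<ominus>\<^bsub>M\<^esub> _"] M.l_neg)
qed

lemma ring_cong: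
 assumes "ring A" "carrier B = carrier A" "add B = add A" "zero B = zero A" "mult B = mult A"
  "one B = one A"
 shows "ring B"
proof -
 interpret A: ring A by fact
 show ?thesis
  by (rule ringI)
   (auto simp: assms A.m_assoc A.l_distr A.r_distr intro: abelian_group_cong[OF A.is_abelian_group]
    intro!: monoidI)
qed

text \<open>A single notion for algebras, modules and graded records: actions, products and
  projections become instances of \<open>additive_map\<close> and inherit the rules for zero,
  negatives and finite sums.\<close>

definition add_map :: "('a, 'x) ring_scheme => ('b, 'y) ring_scheme => ('a => 'b) => bool" where
 "add_map M N f \<longleftrightarrow> f \<in> carrier M \<rightarrow> carrier N \<and>
   (\<forall>x \<in> carrier M. \<forall>y \<in> carrier M. f (x \<oplus>\<^bsub>M\<^esub> y) = f x \<oplus>\<^bsub>N\<^esub> f y)"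

lemma add_mapI:
 assumes "!!x. x \<in> carrier M ==> f x \<in> carrier N"
  "!!x y. [|x \<in> carrier M; y \<in> carrier M|] ==> f (x \<oplus>\<^bsub>M\<^esub> y) = f x \<oplus>\<^bsub>N\<^esub> f y"
 shows "add_map M N f"
 using assms by (auto simp: add_map_def)

locale additive_map = M: abelian_group M + N: abelian_group N
 for M :: "('a, 'x) ring_scheme" and N :: "('b, 'y) ring_scheme" and f +
 assumes add_map: "add_map M N f"
begin

lemma closed: "x \<in> carrier M ==> f x \<in> carrier N"
 and add: "[|x \<in> carrier M; y \<in> carrier M|] ==> f (x \<oplus>\<^bsub>M\<^esub> y) = f x \<oplus>\<^bsub>N\<^esub> f y"
 using add_map by (auto simp: add_map_def)

lemma zero: "f \<zero>\<^bsub>M\<^esub> = \<zero>\<^bsub>N\<^esub>"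
proof -
 have "f \<zero>\<^bsub>M\<^esub> \<oplus>\<^bsub>N\<^esub> f \<zero>\<^bsub>M\<^esub> = f \<zero>\<^bsub>M\<^esub>" using add[of "\<zero>\<^bsub>M\<^esub>" "\<zero>\<^bsub>M\<^esub>"] by simp
 then show ?thesis by (simp add: closed)
qed

lemma minus: "x \<in> carrier M ==> f (\<ominus>\<^bsub>M\<^esub> x) = \<ominus>\<^bsub>N\<^esub> f x"
 by (rule N.minus_equality[symmetric]) (auto simp: closed add[symmetric] M.l_neg zero)

lemma diff: "[|x \<in> carrier M; y \<in> carrier M|] ==> f (x \<ominus>\<^bsub>M\<^esub> y) = f x \<ominus>\<^bsub>N\<^esub> f y"
 by (simp add: a_minus_def add minus)

lemma finsum: "g \<in> I \<rightarrow> carrier M ==> f (finsum M g I) = finsum N (\<lambda>i. f (g i)) I"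
 by (induction I rule: infinite_finite_induct) (auto simp: zero add closed Pi_iff)

end

lemma (in abelian_group) diff_zero_iff:
 "[|x \<in> carrier G; y \<in> carrier G|] ==> x \<ominus> y = \<zero> \<longleftrightarrow> x = y"
 by (metis a_minus_def minus_equality minus_minus r_neg a_inv_closed)

lemma (in abelian_group) diff_zero: "x \<in> carrier G ==> x \<ominus> \<zero> = x"
 using minus_equality[of \<zero> \<zero>] by (simp add: a_minus_def)

lemma (in abelian_group) finsum_eq_superset:
 assumes "finite J" "I \<subseteq> J" "f \<in> I \<rightarrow> carrier G" "!!i. i \<in> J - I ==> f i = \<zero>"
 shows "finsum G f J = finsum G f I"
 using assms by (intro add.finprod_mono_neutral_cong_left[symmetric]) auto

lemma finsum_restrict_carrier:
 assumes "abelian_group M" "abelian_group N" "carrier N \<subseteq> carrier M" "add N = add M" "zero N = zero M"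
  "f \<in> I \<rightarrow> carrier N"
 shows "finsum N f I = finsum M f I"
proof -
 interpret additive_map N M "\<lambda>x. x"
  using assms(1-4) by (auto simp: additive_map_def additive_map_axioms_def add_map_def)
 show ?thesis using finsum[OF assms(6)] .
qed

lemma (in abelian_group) additive_subgroup_iff:
 "additive_subgroup H G \<longleftrightarrow> H \<subseteq> carrier G \<and> \<zero> \<in> H \<and>
   (\<forall>x \<in> H. \<forall>y \<in> H. x \<oplus> y \<in> H) \<and> (\<forall>x \<in> H. \<ominus> x \<in> H)"
 by (auto simp: additive_subgroup_def subgroup_def a_inv_def)

section \<open>Homogeneous parts with respect to a direct sum grading\<close>

definition hpart :: "('r, 'm) graded => 'm => int => 'm" where
 "hpart M x = (THE f. (\<forall>i. f i \<in> component M i) \<and> finite {i. f i ~= \<zero>\<^bsub>M\<^esub>} \<and>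
   x = finsum M f {i. f i ~= \<zero>\<^bsub>M\<^esub>})"

locale graded_group = M?: abelian_group M for M :: "('r, 'm) graded" (structure) +
 assumes direct_sum: "direct_sum_grading M"
begin

lemma comp_subgroup: "additive_subgroup (component M i) M"
 using direct_sum by (auto simp: direct_sum_grading_def)

lemma comp_carrier: "x \<in> component M i ==> x \<in> carrier M"
 using comp_subgroup[of i] by (auto simp: additive_subgroup_iff)

lemma comp_zero: "\<zero> \<in> component M i"
 and comp_add: "[|x \<in> component M i; y \<in> component M i|] ==> x \<oplus> y \<in> component M i"
 and comp_minus: "x \<in> component M i ==> \<ominus> x \<in> component M i"
 using comp_subgroup[of i] by (auto simp: additive_subgroup_iff)

lemma comp_diff: "[|x \<in> component M i; y \<in> component M i|] ==> x \<ominus> y \<in> component M i"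
 by (simp add: a_minus_def comp_add comp_minus)

lemma comp_finsum: "f \<in> I \<rightarrow> component M i ==> finsum M f I \<in> component M i"
proof (induction I rule: infinite_finite_induct)
 case (insert j F)
 then have "f \<in> F \<rightarrow> carrier M" "f j \<in> carrier M" using comp_carrier by (auto simp: Pi_iff)
 then show ?case using insert by (auto simp: comp_add)
qed (auto simp: comp_zero)

lemma hpart:
 assumes "x \<in> carrier M"
 shows "hpart M x i \<in> component M i" "finite {i. hpart M x i ~= \<zero>}"
  "x = finsum M (hpart M x) {i. hpart M x i ~= \<zero>}"
proof -
 have "\<exists>!f. (\<forall>i. f i \<in> component M i) \<and> finite {i. f i ~= \<zero>} \<and> x = finsum M f {i. f i ~= \<zero>}"
  using direct_sum assms by (auto simp: direct_sum_grading_def)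
 from theI'[OF this] show "hpart M x i \<in> component M i" "finite {i. hpart M x i ~= \<zero>}"
  "x = finsum M (hpart M x) {i. hpart M x i ~= \<zero>}"
  unfolding hpart_def by auto
qed

lemma hpart_closed: "x \<in> carrier M ==> hpart M x i \<in> carrier M"
 using hpart(1) comp_carrier by blast

lemma hpart_unique:
 assumes "finite J" "!!i. i \<in> J ==> f i \<in> component M i" "x = finsum M f J"
 shows "hpart M x i = (if i \<in> J then f i else \<zero>)"
proof -
 define g where "g i = (if i \<in> J then f i else \<zero>)" for i
 have x: "x \<in> carrier M" unfolding assms(3) using comp_carrier[OF assms(2)] by (intro finsum_closed) auto
 have g: "g i \<in> component M i" for i using assms(2) comp_zero by (auto simp: g_def)
 have sub: "{i. g i ~= \<zero>} \<subseteq> J" by (auto simp: g_def)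
 have fin: "finite {i. g i ~= \<zero>}" using sub assms(1) finite_subset by blast
 have "x = finsum M g J"
  unfolding assms(3) using comp_carrier[OF assms(2)] by (intro finsum_cong') (auto simp: g_def)
 also have "\<dots> = finsum M g {i. g i ~= \<zero>}"
  using sub assms(1) g comp_carrier by (intro finsum_eq_superset) auto
 finally have "x = finsum M g {i. g i ~= \<zero>}" .
 moreover have "\<exists>!f. (\<forall>i. f i \<in> component M i) \<and> finite {i. f i ~= \<zero>} \<and> x = finsum M f {i. f i ~= \<zero>}"
  using direct_sum x by (auto simp: direct_sum_grading_def)
 ultimately have "hpart M x = g"
  unfolding hpart_def using g fin by (intro the1_equality) auto
 then show ?thesis by (simp add: g_def)
qed

lemma hpart_sum:
 assumes "x \<in> carrier M" "finite J" "!!i. i \<notin> J ==> hpart M x i = \<zero>"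
 shows "finsum M (hpart M x) J = x"
proof -
 have "finsum M (hpart M x) J = finsum M (hpart M x) {i. hpart M x i ~= \<zero>}"
  using assms by (intro finsum_eq_superset) (auto simp: hpart_closed)
 then show ?thesis using hpart(3)[OF assms(1)] by simp
qed

lemma sum_hpart: "x \<in> carrier M ==> finsum M (hpart M x) {i. hpart M x i ~= \<zero>} = x"
 using hpart(3) by metis

lemma hpart_comp: "x \<in> component M j ==> hpart M x i = (if i = j then x else \<zero>)"
 using hpart_unique[of "{j}" "\<lambda>_. x" x i] by (auto simp: comp_carrier)

lemma hpart_zero: "hpart M \<zero> i = \<zero>"
 using hpart_comp[OF comp_zero, of i i] by simp

lemma hpart_add:
 assumes "x \<in> carrier M" "y \<in> carrier M"
 shows "hpart M (x \<oplus> y) i = hpart M x i \<oplus> hpart M y i"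
proof -
 define J where "J = {i. hpart M x i ~= \<zero>} \<union> {i. hpart M y i ~= \<zero>}"
 have J: "finite J" using hpart(2) assms by (auto simp: J_def)
 have "x \<oplus> y = finsum M (hpart M x) J \<oplus> finsum M (hpart M y) J"
  using J by (subst (1 2) hpart_sum) (auto simp: J_def assms)
 also have "\<dots> = finsum M (\<lambda>i. hpart M x i \<oplus> hpart M y i) J"
  using assms by (subst finsum_addf) (auto simp: hpart_closed)
 finally have "hpart M (x \<oplus> y) i = (if i \<in> J then hpart M x i \<oplus> hpart M y i else \<zero>)"
  using J assms by (intro hpart_unique) (auto intro!: comp_add hpart)
 also have "\<dots> = hpart M x i \<oplus> hpart M y i" by (auto simp: J_def)
 finally show ?thesis .
qed

lemma additive_hpart: "additive_map M M (\<lambda>x. hpart M x i)"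
 by unfold_locales (auto intro!: add_mapI simp: hpart_closed hpart_add)

lemmas hpart_minus = additive_map.minus[OF additive_hpart]
 and hpart_diff = additive_map.diff[OF additive_hpart]
 and hpart_finsum = additive_map.finsum[OF additive_hpart]

lemma hpart_eqI:
 assumes "x \<in> carrier M" "y \<in> carrier M" "!!i. hpart M x i = hpart M y i"
 shows "x = y"
proof -
 have "hpart M x = hpart M y" using assms(3) by auto
 then show ?thesis using hpart(3)[OF assms(1)] hpart(3)[OF assms(2)] by simp
qed

lemma in_compI:
 assumes "x \<in> carrier M" "!!i. i ~= j ==> hpart M x i = \<zero>"
 shows "x \<in> component M j"
proof -
 have "x = hpart M x j"
  using assms by (subst hpart_sum[of x "{j}", symmetric]) (auto simp: hpart_closed)
 then show ?thesis using hpart(1)[OF assms(1), of j] by simp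
qed

lemma subgroup_mem:
 assumes "x \<in> carrier M" "\<zero> \<in> H" "!!y z. [|y \<in> H; z \<in> H|] ==> y \<oplus> z \<in> H" "H \<subseteq> carrier M"
  "!!i. hpart M x i \<in> H"
 shows "x \<in> H"
proof -
 have "finsum M (hpart M x) I \<in> H" for I
  using assms by (induction I rule: infinite_finite_induct) (auto simp: hpart_closed)
 then show ?thesis using hpart(3)[OF assms(1)] by metis
qed

lemma homogeneous_induct [consumes 1, case_names zero homogeneous add]:
 assumes "x \<in> carrier M" "P \<zero>" "!!i x. x \<in> component M i ==> P x"
  "!!x y. [|x \<in> carrier M; y \<in> carrier M; P x; P y|] ==> P (x \<oplus> y)"
 shows "P x"
proof -
 have "P (hpart M x i)" for i by (rule assms(3)[OF hpart(1)[OF assms(1)]])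
 with assms(1,2) have "x \<in> {x \<in> carrier M. P x}"
  by - (rule subgroup_mem, simp_all add: hpart_closed, blast intro: assms(4))
 then show ?thesis by simp
qed

end

text \<open>A family of additive projections is enough. Uniqueness of the decomposition comes from
  applying \<open>p i\<close> to it: \<open>p i\<close> kills the components of other degrees and
  fixes its own, the latter because an element is the sum of its projections.\<close>

lemma direct_sum_gradingI:
 fixes M :: "('r, 'm) graded" (structure)
 assumes M: "abelian_group M"
  and sub: "!!i. additive_subgroup (component M i) M"
  and comp: "!!i x. x \<in> carrier M ==> p i x \<in> component M i"
  and add: "!!i x y. [|x \<in> carrier M; y \<in> carrier M|] ==> p i (x \<oplus> y) = p i x \<oplus> p i y"
  and fin: "!!x. x \<in> carrier M ==> \<exists>J. finite J \<and> (\<forall>i. i \<notin> J --> p i x = \<zero>) \<and> finsum M (\<lambda>i. p i x) J = x"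
  and orth: "!!i j x. [|x \<in> component M j; i ~= j|] ==> p i x = \<zero>"
 shows "direct_sum_grading M"
proof -
 interpret M: abelian_group M by fact
 have cc: "component M i \<subseteq> carrier M" for i using sub[of i] by (simp add: M.additive_subgroup_iff)
 have p: "p i x \<in> carrier M" if "x \<in> carrier M" for i x using comp[OF that] cc by blast
 interpret P: additive_map M M "p i" for i
  by unfold_locales (auto intro!: add_mapI simp: p add)
 have p_id: "p i x = x" if "x \<in> component M i" for i x
 proof -
  have x: "x \<in> carrier M" using that cc by auto
  obtain J where J: "finite J" "!!i. i \<notin> J ==> p i x = \<zero>" "finsum M (\<lambda>i. p i x) J = x"
   using fin[OF x] by blast
  have "finsum M (\<lambda>i. p i x) (insert i J) = finsum M (\<lambda>i. p i x) J"
   using J by (intro M.finsum_eq_superset) (auto simp: p x)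
  moreover have "finsum M (\<lambda>i. p i x) (insert i J) = finsum M (\<lambda>i. p i x) {i}"
   using J(1) orth[OF that] by (intro M.finsum_eq_superset) (auto simp: p x)
  ultimately show ?thesis using J(3) p x by simp
 qed
 show ?thesis unfolding direct_sum_grading_def
 proof (intro conjI ballI allI)
  show "additive_subgroup (component M i) M" for i by (rule sub)
  fix x assume x: "x \<in> carrier M"
  obtain J where J: "finite J" "!!i. i \<notin> J ==> p i x = \<zero>" "finsum M (\<lambda>i. p i x) J = x"
   using fin[OF x] by blast
  have sub: "{i. p i x ~= \<zero>} \<subseteq> J" using J by auto
  show "\<exists>!f. (\<forall>i. f i \<in> component M i) \<and> finite {i. f i ~= \<zero>} \<and> x = finsum M f {i. f i ~= \<zero>}"
  proof (rule ex1I[of _ "\<lambda>i. p i x"], intro conjI allI)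
   show "p i x \<in> component M i" for i using comp[OF x] .
   show "finite {i. p i x ~= \<zero>}" using sub J(1) finite_subset by blast
   have "finsum M (\<lambda>i. p i x) J = finsum M (\<lambda>i. p i x) {i. p i x ~= \<zero>}"
    using J(1) sub x by (intro M.finsum_eq_superset) (auto simp: p)
   then show "x = finsum M (\<lambda>i. p i x) {i. p i x ~= \<zero>}" using J(3) by simp
  next
   fix f assume f: "(\<forall>i. f i \<in> component M i) \<and> finite {i. f i ~= \<zero>} \<and> x = finsum M f {i. f i ~= \<zero>}"
   show "f = (\<lambda>i. p i x)"
   proof
    fix i
    have fc: "f j \<in> carrier M" for j using f cc by blast
    have "p i x = finsum M (\<lambda>j. p i (f j)) {j. f j ~= \<zero>}"
     using f P.finsum[of f "{j. f j ~= \<zero>}" i] fc by auto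
    also have "\<dots> = finsum M (\<lambda>j. p i (f j)) (insert i {j. f j ~= \<zero>})"
     using f fc by (intro M.finsum_eq_superset[symmetric]) (auto simp: P.zero P.closed)
    also have "\<dots> = finsum M (\<lambda>j. p i (f j)) {i}"
     using f fc by (intro M.finsum_eq_superset) (auto simp: P.closed intro: orth)
    also have "\<dots> = f i" using f fc p_id by simp
    finally show "f i = p i x" by simp
   qed
  qed
 qed
qed

lemma direct_sum_grading_cong:
 fixes M :: "('r, 'm) graded" and N :: "('s, 'm) graded"
 assumes M: "abelian_group M" "direct_sum_grading M"
  and eq: "carrier N = carrier M" "add N = add M" "zero N = zero M" "component N = component M"
 shows "direct_sum_grading N"
proof -
 interpret M: graded_group M using M by (simp add: graded_group_def graded_group_axioms_def)
 interpret N: abelian_group N by (rule abelian_group_cong[OF M(1) eq(1-3)])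
 have minus: "\<ominus>\<^bsub>N\<^esub> x = \<ominus>\<^bsub>M\<^esub> x" if "x \<in> carrier M" for x
  using that by (intro N.minus_equality) (simp_all add: eq M.l_neg)
 show ?thesis
 proof (rule direct_sum_gradingI[OF N.abelian_group_axioms, where p = "\<lambda>i x. hpart M x i"])
  show "additive_subgroup (component N i) N" for i
   unfolding N.additive_subgroup_iff
   by (auto simp: eq minus M.comp_carrier intro: M.comp_zero M.comp_add M.comp_minus)
  fix x assume "x \<in> carrier N"
  then have x: "x \<in> carrier M" by (simp add: eq)
  have "finsum N (hpart M x) {i. hpart M x i ~= \<zero>\<^bsub>M\<^esub>} = x"
   using x M.sum_hpart[OF x] finsum_restrict_carrier[OF M(1) N.abelian_group_axioms, of "hpart M x"]
   by (simp add: eq M.hpart_closed)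
  then show "\<exists>J. finite J \<and> (\<forall>i. i \<notin> J --> hpart M x i = \<zero>\<^bsub>N\<^esub>) \<and> finsum N (hpart M x) J = x"
   using M.hpart(2)[OF x] by (intro exI[of _ "{i. hpart M x i ~= \<zero>\<^bsub>M\<^esub>}"]) (simp add: eq)
 qed (auto simp: eq M.hpart_add M.hpart_comp intro: M.hpart(1))
qed

text \<open>Serves actions of homogeneous elements, products in an algebra and graded homomorphisms
  alike; the shift \<open>d\<close> accounts for operators of nonzero degree. Additivity reduces the
  claim to homogeneous elements.\<close>

lemma hpart_add_map:
 assumes M: "graded_group M" and N: "graded_group N" and f: "add_map M N f"
  and deg: "!!i x. x \<in> component M i ==> f x \<in> component N (i + d)" and x: "x \<in> carrier M"
 shows "hpart N (f x) (i + d) = f (hpart M x i)"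
proof -
 interpret M: graded_group M by fact
 interpret N: graded_group N by fact
 interpret f: additive_map M N f by unfold_locales (rule f)
 show ?thesis using x
 proof (induction x rule: M.homogeneous_induct)
  case zero
  then show ?case by (simp add: f.zero N.hpart_zero M.hpart_zero)
 next
  case (homogeneous j y)
  then show ?case by (auto simp: M.hpart_comp N.hpart_comp[OF deg] f.zero)
 next
  case (add y z)
  then show ?case by (simp add: f.add M.hpart_add N.hpart_add f.closed M.hpart_closed)
 qed
qed

section \<open>Graded modules\<close>

context left_module
begin

lemma additive_smult: "a \<in> carrier A ==> additive_map M M (\<lambda>x. a \<odot>\<^bsub>M\<^esub> x)"
 by unfold_locales (auto intro!: add_mapI simp: smult_closed smult_r_distr)

lemma additive_smult_left: "x \<in> carrier M ==> additive_map A M (\<lambda>a. a \<odot>\<^bsub>M\<^esub> x)"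
 by unfold_locales (auto intro!: add_mapI simp: smult_closed smult_l_distr)

lemmas smult_zero = additive_map.zero[OF additive_smult]
 and smult_minus = additive_map.minus[OF additive_smult]
 and smult_diff = additive_map.diff[OF additive_smult]
 and smult_finsum = additive_map.finsum[OF additive_smult]
 and zero_smult = additive_map.zero[OF additive_smult_left]
 and minus_smult = additive_map.minus[OF additive_smult_left]
 and diff_smult = additive_map.diff[OF additive_smult_left]
 and finsum_smult = additive_map.finsum[OF additive_smult_left]

end

lemma left_moduleI:
 assumes "ring A" "abelian_group M"
  "!!a x. [|a \<in> carrier A; x \<in> carrier M|] ==> a \<odot>\<^bsub>M\<^esub> x \<in> carrier M"
  "!!a b x. [|a \<in> carrier A; b \<in> carrier A; x \<in> carrier M|]
   ==> (a \<oplus>\<^bsub>A\<^esub> b) \<odot>\<^bsub>M\<^esub> x = a \<odot>\<^bsub>M\<^esub> x \<oplus>\<^bsub>M\<^esub> b \<odot>\<^bsub>M\<^esub> x"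
  "!!a x y. [|a \<in> carrier A; x \<in> carrier M; y \<in> carrier M|]
   ==> a \<odot>\<^bsub>M\<^esub> (x \<oplus>\<^bsub>M\<^esub> y) = a \<odot>\<^bsub>M\<^esub> x \<oplus>\<^bsub>M\<^esub> a \<odot>\<^bsub>M\<^esub> y"
  "!!a b x. [|a \<in> carrier A; b \<in> carrier A; x \<in> carrier M|]
   ==> (a \<otimes>\<^bsub>A\<^esub> b) \<odot>\<^bsub>M\<^esub> x = a \<odot>\<^bsub>M\<^esub> (b \<odot>\<^bsub>M\<^esub> x)"
  "!!x. x \<in> carrier M ==> \<one>\<^bsub>A\<^esub> \<odot>\<^bsub>M\<^esub> x = x"
 shows "left_module A M"
 using assms by (simp add: left_module_def left_module_axioms_def)

lemma graded_algebra_group: "graded_algebra A ==> graded_group A"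
 by (simp add: graded_algebra_def k_algebra_def ring_def graded_group_def graded_group_axioms_def)

locale graded_mod =
 fixes A :: "('k::field, 'a) graded" and M :: "('a, 'u) graded" (structure)
 assumes algebra: "graded_algebra A" and graded_module: "graded_left_module A M"

sublocale graded_mod \<subseteq> left_module A M
 using graded_module by (simp add: graded_left_module_def)

sublocale graded_mod \<subseteq> A: graded_group A
 using algebra by (rule graded_algebra_group)

sublocale graded_mod \<subseteq> M: graded_group M
 using graded_module
 by (simp add: graded_left_module_def graded_group_def graded_group_axioms_def M.abelian_group_axioms)

lemma graded_modI:
 assumes "graded_algebra A" "left_module A M" "direct_sum_grading M"
  "!!i j a x. [|a \<in> component A i; x \<in> component M j|] ==> a \<odot>\<^bsub>M\<^esub> x \<in> component M (i + j)"
 shows "graded_mod A M"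
 using assms by (simp add: graded_mod_def graded_left_module_def)

section \<open>Graded submodules and graded quotient modules\<close>

lemma sub_graded_simps [simp]:
 "carrier (sub_graded M N) = N" "add (sub_graded M N) = add M" "zero (sub_graded M N) = zero M"
 "smult (sub_graded M N) = smult M" "component (sub_graded M N) i = component M i \<inter> N"
 by (simp_all add: sub_graded_def)

lemma quot_graded_simps:
 "carrier (quot_graded M N) = (\<lambda>x. N +>\<^bsub>M\<^esub> x) ` carrier M"
 "add (quot_graded M N) = set_add M" "zero (quot_graded M N) = N"
 "mult (quot_graded M N) = rcoset_mult M N" "one (quot_graded M N) = N +>\<^bsub>M\<^esub> \<one>\<^bsub>M\<^esub>"
 "a \<odot>\<^bsub>quot_graded M N\<^esub> X = N <+>\<^bsub>M\<^esub> ((\<odot>\<^bsub>M\<^esub>) a ` X)"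
 "component (quot_graded M N) i = (\<lambda>x. N +>\<^bsub>M\<^esub> x) ` component M i"
 by (auto simp: quot_graded_def quot_module_def FactRing_def ring.defs module.defs graded.defs
   A_RCOSETS_def')

context abelian_subgroup
begin

lemma coset_mem: "x \<in> carrier G ==> y \<in> H +> x \<longleftrightarrow> y \<in> carrier G \<and> y \<ominus> x \<in> H"
 using a_elemrcos_carrier[of x y] a_rcos_module[of x y] by (auto simp: a_minus_def)

lemma coset_eq_iff:
 assumes "x \<in> carrier G" "y \<in> carrier G"
 shows "H +> x = H +> y \<longleftrightarrow> x \<ominus> y \<in> H"
 using assms coset_mem[OF assms(2), of x] a_rcos_self[of x] a_repr_independence'[of x y] by auto

lemma zero_coset: "H +> \<zero> = H"
 using a_subset by simp

lemma coset_eq_self_iff: "x \<in> carrier G ==> H +> x = H \<longleftrightarrow> x \<in> H"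
 using coset_eq_iff[of x \<zero>] by (simp add: zero_coset diff_zero)

end

context graded_mod
begin

lemma comp_smult: "[|a \<in> component A i; x \<in> component M j|] ==> a \<odot> x \<in> component M (i + j)"
 using graded_module by (simp add: graded_left_module_def)

lemma hpart_smult:
 assumes "a \<in> component A i" "x \<in> carrier M"
 shows "hpart M (a \<odot> x) (i + j) = a \<odot> hpart M x j"
proof -
 interpret additive_map M M "\<lambda>x. a \<odot> x"
  using additive_smult A.comp_carrier[OF assms(1)] .
 have "hpart M (a \<odot> x) (j + i) = a \<odot> hpart M x j"
  using assms by (intro hpart_add_map[OF M.graded_group_axioms M.graded_group_axioms add_map])
   (auto dest: comp_smult simp: add.commute)
 then show ?thesis by (simp add: add.commute)
qed

text \<open>Negatives are multiples by minus one, and the grading is inherited because the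
  homogeneous parts taken in \<open>M\<close> stay inside \<open>N\<close>.\<close>

lemma graded_submoduleI:
 assumes N: "N \<subseteq> carrier M" "\<zero> \<in> N" "!!x y. [|x \<in> N; y \<in> N|] ==> x \<oplus> y \<in> N"
  "!!a x. [|a \<in> carrier A; x \<in> N|] ==> a \<odot> x \<in> N"
  "!!x i. x \<in> N ==> hpart M x i \<in> N"
 shows "graded_submodule A N M"
proof -
 have minus: "\<ominus> x \<in> N" if "x \<in> N" for x
 proof -
  have "(\<ominus>\<^bsub>A\<^esub> \<one>\<^bsub>A\<^esub>) \<odot> x = \<ominus> x"
   using that N(1) by (subst minus_smult) (auto simp: smult_one)
  then show ?thesis using N(4)[of "\<ominus>\<^bsub>A\<^esub> \<one>\<^bsub>A\<^esub>" x] that by auto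
 qed
 have ab: "abelian_group (sub_graded M N)"
 proof (rule abelian_groupI, goal_cases)
  case (6 x)
  then show ?case using minus[of x] N(1) by (intro bexI[of _ "\<ominus> x"]) (auto simp: M.l_neg)
 qed (use N in \<open>auto simp: subset_iff M.a_ac\<close>)
 have lm: "left_module A (sub_graded M N)"
  using N by (intro left_moduleI ab A.ring_axioms)
   (auto simp: subset_iff smult_l_distr smult_r_distr smult_assoc1 smult_one)
 have "direct_sum_grading (sub_graded M N)"
 proof (rule direct_sum_gradingI[OF ab, where p = "\<lambda>i x. hpart M x i"])
  fix i
  have inv: "\<ominus>\<^bsub>sub_graded M N\<^esub> x = \<ominus> x" if "x \<in> N" for x
   using that N(1) minus[of x]
   by (intro abelian_group.minus_equality[OF ab]) (auto simp: M.l_neg)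
  show "additive_subgroup (component (sub_graded M N) i) (sub_graded M N)"
   using N minus M.comp_zero M.comp_add M.comp_minus
   by (auto simp: abelian_group.additive_subgroup_iff[OF ab] inv)
 next
  fix x assume "x \<in> carrier (sub_graded M N)"
  then have x: "x \<in> N" "x \<in> carrier M" using N(1) by auto
  have "finsum (sub_graded M N) (hpart M x) {i. hpart M x i ~= \<zero>}
   = finsum M (hpart M x) {i. hpart M x i ~= \<zero>}"
   using N x by (intro finsum_restrict_carrier ab M.abelian_group_axioms) auto
  then show "\<exists>J. finite J \<and> (\<forall>i. i \<notin> J --> hpart M x i = \<zero>\<^bsub>sub_graded M N\<^esub>) \<and>
    finsum (sub_graded M N) (hpart M x) J = x"
   using M.hpart(2)[OF x(2)] M.sum_hpart[OF x(2)]
   by (intro exI[of _ "{i. hpart M x i ~= \<zero>}"]) auto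
 qed (use N in \<open>auto simp: subset_iff M.hpart_add M.hpart_comp M.hpart\<close>)
 then show ?thesis using lm N(1,4) comp_smult A.comp_carrier
  by (auto simp: graded_submodule_def graded_left_module_def)
qed

context
 fixes N assumes N: "graded_submodule A N M"
begin

lemma sub_graded_mod: "graded_mod A (sub_graded M N)"
 using N by (simp add: graded_submodule_def graded_mod_def algebra)

interpretation N: graded_mod A "sub_graded M N" by (rule sub_graded_mod)

lemma submodule_carrier: "x \<in> N ==> x \<in> carrier M"
 using N by (auto simp: graded_submodule_def)

lemma submodule_zero: "\<zero> \<in> N"
 and submodule_add: "[|x \<in> N; y \<in> N|] ==> x \<oplus> y \<in> N"
 and submodule_smult: "[|a \<in> carrier A; x \<in> N|] ==> a \<odot> x \<in> N"
 using N.M.zero_closed N.M.a_closed[of x y] N.smult_closed[of a x] by auto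

lemma submodule_minus: "x \<in> N ==> \<ominus> x \<in> N"
proof -
 assume x: "x \<in> N"
 have "\<ominus> x = \<ominus>\<^bsub>sub_graded M N\<^esub> x"
  using x N.M.a_inv_closed[of x] N.M.l_neg[of x] by (intro M.minus_equality) (auto simp: submodule_carrier)
 then show ?thesis using N.M.a_inv_closed[of x] x by simp
qed

lemma hpart_sub_graded:
 assumes "x \<in> N"
 shows "hpart (sub_graded M N) x i = hpart M x i"
proof -
 have "x = finsum (sub_graded M N) (hpart (sub_graded M N) x) {i. hpart (sub_graded M N) x i ~= \<zero>}"
  using N.M.hpart(3)[of x] assms by simp
 also have "\<dots> = finsum M (hpart (sub_graded M N) x) {i. hpart (sub_graded M N) x i ~= \<zero>}"
  using N.M.hpart_closed[of x] assms submodule_carrier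
  by (intro finsum_restrict_carrier N.M.abelian_group_axioms M.abelian_group_axioms) auto
 finally have "hpart M x i = (if i \<in> {i. hpart (sub_graded M N) x i ~= \<zero>}
   then hpart (sub_graded M N) x i else \<zero>)"
  using N.M.hpart[of x] assms by (intro M.hpart_unique) auto
 then show ?thesis by auto
qed

lemma submodule_hpart: "x \<in> N ==> hpart M x i \<in> N"
 using hpart_sub_graded[of x i] N.M.hpart_closed[of x i] by simp

lemma abelian_subgroup: "abelian_subgroup N M"
 using submodule_carrier submodule_zero submodule_add submodule_minus
 by (intro abelian_subgroupI3 M.abelian_group_axioms) (auto simp: M.additive_subgroup_iff)

interpretation N: abelian_subgroup N M by (rule abelian_subgroup)

lemma quot_add: "[|x \<in> carrier M; y \<in> carrier M|]
  ==> (N +> x) \<oplus>\<^bsub>quot_graded M N\<^esub> (N +> y) = N +> (x \<oplus> y)"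
 by (simp add: quot_graded_simps N.a_rcos_sum)

lemma quot_zero: "\<zero>\<^bsub>quot_graded M N\<^esub> = N +> \<zero>"
 by (simp add: quot_graded_simps N.zero_coset)

lemma quot_smult:
 assumes "a \<in> carrier A" "x \<in> carrier M"
 shows "a \<odot>\<^bsub>quot_graded M N\<^esub> (N +> x) = N +> (a \<odot> x)"
proof (intro equalityI subsetI)
  fix z assume "z \<in> a \<odot>\<^bsub>quot_graded M N\<^esub> (N +> x)"
  then obtain u v where uv: "u \<in> N" "v \<in> N" "z = u \<oplus> a \<odot> (v \<oplus> x)"
   by (auto simp: quot_graded_simps set_add_def' a_r_coset_def')
  then have "z = (u \<oplus> a \<odot> v) \<oplus> a \<odot> x"
   using assms by (simp add: smult_r_distr submodule_carrier M.a_assoc smult_closed)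
  then show "z \<in> N +> (a \<odot> x)"
   using uv assms
   by (simp only:, intro M.a_rcosI submodule_add submodule_smult smult_closed)
    (auto simp: submodule_carrier)
 next
  fix z assume "z \<in> N +> (a \<odot> x)"
  then obtain u where u: "u \<in> N" "z = u \<oplus> a \<odot> x" by (auto simp: a_r_coset_def')
  moreover have "x \<in> N +> x" using assms by (intro N.a_rcos_self)
  ultimately show "z \<in> a \<odot>\<^bsub>quot_graded M N\<^esub> (N +> x)"
   by (auto simp: quot_graded_simps set_add_def')
qed

lemma quot_carrier_iff: "X \<in> carrier (quot_graded M N) \<longleftrightarrow> (\<exists>x \<in> carrier M. X = N +> x)"
 by (auto simp: quot_graded_simps)

lemma coset_closed: "x \<in> carrier M ==> N +> x \<in> carrier (quot_graded M N)"
 by (auto simp: quot_graded_simps)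

lemma coset_comp: "x \<in> component M i ==> N +> x \<in> component (quot_graded M N) i"
 by (auto simp: quot_graded_simps)

lemma quot_abelian_group: "abelian_group (quot_graded M N)"
proof (rule abelian_groupI, goal_cases)
 case (6 X)
 then obtain x where "x \<in> carrier M" "X = N +> x" by (auto simp: quot_carrier_iff)
 then show ?case
  by (intro bexI[of _ "N +> (\<ominus> x)"]) (simp_all add: quot_add coset_closed M.l_neg quot_zero)
qed (auto simp: quot_carrier_iff quot_add coset_closed M.a_ac quot_zero intro!: bexI[of _ "_ \<oplus> _"])

lemma additive_coset: "additive_map M (quot_graded M N) (\<lambda>x. N +> x)"
 by (intro additive_map.intro additive_map_axioms.intro add_mapI quot_abelian_group
     M.abelian_group_axioms) (auto simp: quot_add coset_closed)

lemma quot_graded_mod: "graded_mod A (quot_graded M N)"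
proof (rule graded_modI[OF algebra])
 show "left_module A (quot_graded M N)"
  by (rule left_moduleI[OF A.ring_axioms quot_abelian_group])
   (auto simp: quot_carrier_iff quot_add quot_smult smult_closed smult_l_distr smult_r_distr
    smult_assoc1 smult_one)
 have hp: "hpart M x i \<ominus> hpart M y i \<in> N" if "x \<in> carrier M" "y \<in> carrier M" "x \<ominus> y \<in> N" for x y i
  using submodule_hpart[OF that(3)] that by (simp add: M.hpart_diff)
 \<comment> \<open>A coset is projected through a chosen representative. The choice is immaterial by
   \<open>hp\<close>: two representatives differ by an element of \<open>N\<close>, and
   \<open>N\<close> contains the homogeneous parts of its elements.\<close>
 define p where "p i X = N +> hpart M (SOME x. x \<in> carrier M \<and> X = N +> x) i" for i X
 have p: "p i (N +> x) = N +> hpart M x i" if "x \<in> carrier M" for i x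
 proof -
  define y where "y = (SOME y. y \<in> carrier M \<and> N +> x = N +> y)"
  have "\<exists>y. y \<in> carrier M \<and> N +> x = N +> y" using that by auto
  from someI_ex[OF this] have y: "y \<in> carrier M" "N +> x = N +> y" by (auto simp: y_def)
  then have "N +> hpart M x i = N +> hpart M y i"
   using hp[of x y i] that by (simp add: N.coset_eq_iff M.hpart_closed)
  then show ?thesis by (simp add: p_def y_def)
 qed
 show "direct_sum_grading (quot_graded M N)"
 proof (rule direct_sum_gradingI[OF quot_abelian_group, where p = p])
  fix i
  have inv: "\<ominus>\<^bsub>quot_graded M N\<^esub> (N +> x) = N +> (\<ominus> x)" if "x \<in> carrier M" for x
   using that by (intro abelian_group.minus_equality[OF quot_abelian_group])
    (auto simp: quot_add coset_closed M.l_neg quot_zero)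
  show "additive_subgroup (component (quot_graded M N) i) (quot_graded M N)"
   unfolding abelian_group.additive_subgroup_iff[OF quot_abelian_group] quot_graded_simps(7)
  proof (intro conjI ballI; (elim imageE)?)
   show "(\<lambda>x. N +> x) ` component M i \<subseteq> carrier (quot_graded M N)"
    using M.comp_carrier by (auto simp: coset_closed)
   show "\<zero>\<^bsub>quot_graded M N\<^esub> \<in> (\<lambda>x. N +> x) ` component M i"
    using M.comp_zero by (auto simp: quot_zero)
  qed (auto simp: quot_add M.comp_carrier inv intro: M.comp_add M.comp_minus)
 next
  fix X assume "X \<in> carrier (quot_graded M N)"
  then obtain x where x: "x \<in> carrier M" "X = N +> x" by (auto simp: quot_carrier_iff)
  define J where "J = {i. hpart M x i ~= \<zero>}"
  interpret q: additive_map M "quot_graded M N" "\<lambda>x. N +> x" by (rule additive_coset)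
  have pX: "p i X = N +> hpart M x i" for i unfolding x(2) by (rule p[OF x(1)])
  have "finsum (quot_graded M N) (\<lambda>i. p i X) J = X"
   unfolding pX using M.hpart_closed[OF x(1)]
   by (subst q.finsum[symmetric]) (simp_all add: J_def M.sum_hpart x)
  moreover have "finite J" "\<forall>i. i \<notin> J --> p i X = \<zero>\<^bsub>quot_graded M N\<^esub>"
   unfolding pX using M.hpart(2)[OF x(1)] by (auto simp: J_def quot_zero)
  ultimately show "\<exists>J. finite J \<and> (\<forall>i. i \<notin> J --> p i X = \<zero>\<^bsub>quot_graded M N\<^esub>) \<and>
    finsum (quot_graded M N) (\<lambda>i. p i X) J = X" by (metis (no_types, lifting))
 next
  show "p i X \<in> component (quot_graded M N) i" if "X \<in> carrier (quot_graded M N)" for i X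
   using that by (auto simp: quot_carrier_iff p intro!: coset_comp M.hpart(1))
  show "p i (X \<oplus>\<^bsub>quot_graded M N\<^esub> Y) = p i X \<oplus>\<^bsub>quot_graded M N\<^esub> p i Y"
   if "X \<in> carrier (quot_graded M N)" "Y \<in> carrier (quot_graded M N)" for i X Y
   using that by (auto simp: quot_carrier_iff p quot_add M.hpart_add M.hpart_closed)
  show "p i X = \<zero>\<^bsub>quot_graded M N\<^esub>" if "X \<in> component (quot_graded M N) j" "i ~= j" for i j X
   using that by (auto simp: quot_graded_simps(7) p M.comp_carrier M.hpart_comp quot_zero)
 qed
 show "a \<odot>\<^bsub>quot_graded M N\<^esub> X \<in> component (quot_graded M N) (i + j)"
  if "a \<in> component A i" "X \<in> component (quot_graded M N) j" for i j a X
  using that by (auto simp: quot_graded_simps(7) quot_smult A.comp_carrier M.comp_carrier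
    intro: comp_smult)
qed

lemma hpart_coset:
 assumes "x \<in> carrier M"
 shows "hpart (quot_graded M N) (N +> x) i = N +> hpart M x i"
proof -
 interpret Q: graded_mod A "quot_graded M N" by (rule quot_graded_mod)
 show ?thesis
  using hpart_add_map[OF M.graded_group_axioms Q.M.graded_group_axioms
    additive_map.add_map[OF additive_coset], of 0 x i] assms by (simp add: coset_comp)
qed

end

lemma graded_submodule_Int:
 "[|graded_submodule A N M; graded_submodule A P M|] ==> graded_submodule A (N \<inter> P) M"
 by (rule graded_submoduleI)
  (auto intro: submodule_carrier submodule_zero submodule_add submodule_smult submodule_hpart)

end


subsection \<open>The categories of modules and of graded modules\<close>

lemma category_LMod: "category (LMod A :: (('a, 'u) module, 'u => 'u) cat)"
proof
 fix M :: "('a, 'u) module" assume "M \<in> obj (LMod A)"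
 then interpret left_module A M by (simp add: LMod_def)
 show "idm (LMod A) M \<in> homs (LMod A) M M"
  by (auto simp: LMod_def LinearCombinations.module_hom_def smult_closed)
next
 fix M N P :: "('a, 'u) module" and f g
 assume "M \<in> obj (LMod A)" and fg: "f \<in> homs (LMod A) M N" "g \<in> homs (LMod A) N P"
 then interpret left_module A M by (simp add: LMod_def)
 show "cmp (LMod A) M N P g f \<in> homs (LMod A) M P"
  using fg by (auto simp: LMod_def LinearCombinations.module_hom_def compose_def Pi_iff smult_closed)
qed (auto simp: LMod_def LinearCombinations.module_hom_def Id_compose compose_Id compose_assoc)

lemma graded_homI:
 assumes "!!x. x \<in> carrier M ==> f x \<in> carrier N"
  "!!x y. [|x \<in> carrier M; y \<in> carrier M|] ==> f (x \<oplus>\<^bsub>M\<^esub> y) = f x \<oplus>\<^bsub>N\<^esub> f y"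
  "!!a x. [|a \<in> carrier A; x \<in> carrier M|] ==> f (a \<odot>\<^bsub>M\<^esub> x) = a \<odot>\<^bsub>N\<^esub> f x"
  "!!i x. x \<in> component M i ==> f x \<in> component N i"
  "f \<in> extensional (carrier M)"
 shows "f \<in> graded_hom A M N"
 using assms by (auto simp: graded_hom_def LinearCombinations.module_hom_def)

lemma graded_homD:
 assumes "f \<in> graded_hom A M N"
 shows "x \<in> carrier M ==> f x \<in> carrier N"
  "[|x \<in> carrier M; y \<in> carrier M|] ==> f (x \<oplus>\<^bsub>M\<^esub> y) = f x \<oplus>\<^bsub>N\<^esub> f y"
  "[|a \<in> carrier A; x \<in> carrier M|] ==> f (a \<odot>\<^bsub>M\<^esub> x) = a \<odot>\<^bsub>N\<^esub> f x"
  "x \<in> component M i ==> f x \<in> component N i"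
  "f \<in> extensional (carrier M)" "add_map M N f"
 using assms by (auto simp: graded_hom_def LinearCombinations.module_hom_def add_map_def image_subset_iff)

lemma category_Gr:
 assumes "graded_algebra A"
 shows "category (Gr A :: (('a, 'u) graded, 'u => 'u) cat)"
proof
 fix M :: "('a, 'u) graded" assume "M \<in> obj (Gr A)"
 then interpret graded_mod A M using assms by (simp add: graded_mod_def Gr_def)
 show "idm (Gr A) M \<in> homs (Gr A) M M"
  by (auto simp: Gr_def smult_closed M.comp_carrier intro!: graded_homI)
next
 fix M N P :: "('a, 'u) graded" and f g
 assume "M \<in> obj (Gr A)" and fg: "f \<in> homs (Gr A) M N" "g \<in> homs (Gr A) N P"
 then interpret graded_mod A M using assms by (simp add: graded_mod_def Gr_def)
 show "cmp (Gr A) M N P g f \<in> homs (Gr A) M P"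
  using fg by (auto simp: Gr_def compose_def smult_closed M.comp_carrier graded_homD intro!: graded_homI)
qed (auto simp: Gr_def graded_hom_def LinearCombinations.module_hom_def Id_compose compose_Id compose_assoc)

lemma graded_iso:
 assumes M: "graded_mod A M" and N: "graded_mod A N"
  and f: "f \<in> graded_hom A M N" and bij: "bij_betw f (carrier M) (carrier N)"
 shows "f \<in> cat_iso (Gr A) M N"
proof -
 interpret M: graded_mod A M by fact
 interpret N: graded_mod A N by fact
 interpret f: additive_map M N f by unfold_locales (rule graded_homD(6)[OF f])
 define g where "g = (\<lambda>y \<in> carrier N. inv_into (carrier M) f y)"
 have g: "g y \<in> carrier M" "f (g y) = y" if "y \<in> carrier N" for y
  using bij that by (auto simp: g_def bij_betw_def intro: inv_into_into f_inv_into_f)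
 have gI: "g y = x" if "x \<in> carrier M" "f x = y" for x y
  using bij that f.closed by (auto simp: g_def bij_betw_def)
 have "g \<in> graded_hom A N M"
 proof (rule graded_homI)
  fix i y assume y: "y \<in> component N i"
  then have yc: "y \<in> carrier N" by (rule N.M.comp_carrier)
  show "g y \<in> component M i"
  proof (rule M.M.in_compI)
   \<comment> \<open>The inverse preserves degrees because \<open>f\<close> commutes with
     homogeneous parts: a part of \<open>g y\<close> in a wrong degree is mapped to zero, hence is
     zero by injectivity.\<close>
   fix j assume "j ~= i"
   have "f (hpart M (g y) j) = hpart N (f (g y)) (j + 0)"
    using graded_homD(4)[OF f] g(1)[OF yc]
    by (intro hpart_add_map[OF M.M.graded_group_axioms N.M.graded_group_axioms f.add_map, symmetric]) auto
   also have "\<dots> = \<zero>\<^bsub>N\<^esub>" using \<open>j ~= i\<close> y yc by (simp add: g N.M.hpart_comp)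
   finally have "f (hpart M (g y) j) = f \<zero>\<^bsub>M\<^esub>" by (simp add: f.zero)
   then show "hpart M (g y) j = \<zero>\<^bsub>M\<^esub>"
    using bij g(1)[OF yc] by (auto simp: bij_betw_def inj_on_def M.M.hpart_closed)
  qed (use g yc in auto)
 qed (auto simp: g graded_homD[OF f] M.smult_closed intro!: gI, auto simp: g_def)
 moreover have "compose (carrier M) g f = (\<lambda>x \<in> carrier M. x)"
  "compose (carrier N) f g = (\<lambda>x \<in> carrier N. x)"
  by (auto simp: fun_eq_iff compose_def g gI)
 ultimately show ?thesis using f by (auto simp: cat_iso_def Gr_def)
qed

text \<open>Transport of structure along an injection of the carrier. Objects of \<open>Gr\<close>
  have elements of a prescribed type, so a module built from functions has to be relabelled in this
  way before it can be an object.\<close>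

definition transport :: "('u => 'v) => ('a, 'u) graded => ('a, 'v) graded" where
 "transport h M = \<lparr>carrier = h ` carrier M,
   mult = (\<lambda>x y. h (inv_into (carrier M) h x \<otimes>\<^bsub>M\<^esub> inv_into (carrier M) h y)), one = h \<one>\<^bsub>M\<^esub>, zero = h \<zero>\<^bsub>M\<^esub>,
   add = (\<lambda>x y. h (inv_into (carrier M) h x \<oplus>\<^bsub>M\<^esub> inv_into (carrier M) h y)),
   smult = (\<lambda>a x. h (a \<odot>\<^bsub>M\<^esub> inv_into (carrier M) h x)), component = (\<lambda>i. h ` component M i)\<rparr>"

locale transported = graded_mod A M for A :: "('k::field, 'a) graded" and M :: "('a, 'u) graded" +
 fixes h :: "'u => 'v"
 assumes inj: "inj_on h (carrier M)"
begin

lemma transport_simps: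
 "carrier (transport h M) = h ` carrier M" "\<zero>\<^bsub>transport h M\<^esub> = h \<zero>\<^bsub>M\<^esub>"
 "component (transport h M) i = h ` component M i"
 "[|x \<in> carrier M; y \<in> carrier M|] ==> h x \<oplus>\<^bsub>transport h M\<^esub> h y = h (x \<oplus>\<^bsub>M\<^esub> y)"
 "x \<in> carrier M ==> a \<odot>\<^bsub>transport h M\<^esub> h x = h (a \<odot>\<^bsub>M\<^esub> x)"
 by (simp_all add: transport_def inj)

lemma transport_abelian_group: "abelian_group (transport h M)"
proof (rule abelian_groupI, goal_cases)
 case (6 x)
 then obtain y where "y \<in> carrier M" "x = h y" by (auto simp: transport_simps)
 then show ?case by (intro bexI[of _ "h (\<ominus>\<^bsub>M\<^esub> y)"]) (auto simp: transport_simps M.l_neg)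
qed (auto simp: transport_simps M.a_ac)

sublocale h: additive_map M "transport h M" h
 by (intro additive_map.intro additive_map_axioms.intro add_mapI transport_abelian_group
   M.abelian_group_axioms) (auto simp: transport_simps)

lemma transport_graded_mod: "graded_mod A (transport h M)"
proof (rule graded_modI[OF algebra])
 show "left_module A (transport h M)"
  by (rule left_moduleI[OF A.ring_axioms transport_abelian_group])
   (auto simp: transport_simps smult_closed smult_l_distr smult_r_distr smult_assoc1 smult_one)
 show "direct_sum_grading (transport h M)"
 proof (rule direct_sum_gradingI[OF transport_abelian_group,
    where p = "\<lambda>i x. h (hpart M (inv_into (carrier M) h x) i)"])
  show "additive_subgroup (component (transport h M) i) (transport h M)" for i
   unfolding abelian_group.additive_subgroup_iff[OF transport_abelian_group]
   using M.comp_zero M.comp_add M.comp_minus M.comp_carrier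
   by (auto simp: transport_simps h.minus[symmetric])
 next
  fix x assume "x \<in> carrier (transport h M)"
  then obtain y where y: "y \<in> carrier M" "x = h y" by (auto simp: transport_simps)
  have px: "h (hpart M (inv_into (carrier M) h x) i) = h (hpart M y i)" for i
   using y inj by simp
  have "finsum (transport h M) (\<lambda>i. h (hpart M y i)) {i. hpart M y i ~= \<zero>\<^bsub>M\<^esub>} = x"
   using M.sum_hpart[OF y(1)] y M.hpart_closed h.finsum[of "hpart M y" "{i. hpart M y i ~= \<zero>\<^bsub>M\<^esub>}"]
   by auto
  then show "\<exists>J. finite J \<and> (\<forall>i. i \<notin> J --> h (hpart M (inv_into (carrier M) h x) i) = \<zero>\<^bsub>transport h M\<^esub>) \<and>
    finsum (transport h M) (\<lambda>i. h (hpart M (inv_into (carrier M) h x) i)) J = x"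
   unfolding px using M.hpart(2)[OF y(1)]
   by (intro exI[of _ "{i. hpart M y i ~= \<zero>\<^bsub>M\<^esub>}"]) (auto simp: transport_simps)
 qed (auto simp: transport_simps inj M.hpart M.hpart_add M.hpart_closed M.hpart_comp M.comp_carrier)
qed (auto simp: transport_simps M.comp_carrier comp_smult)

end

section \<open>Monoid algebras and their modules\<close>

subsection \<open>Linear extension\<close>

text \<open>Vector spaces over the field with universe \<open>'k\<close>, with scalars combined by
  the type class operations instead of those of \<open>class_ring\<close>;
  \<open>kspace_iff_module\<close> translates between the two.\<close>

locale kspace = M?: abelian_group P for P :: "('k::field, 'p, 'z) module_scheme" (structure) +
 assumes scalar_closed: "x \<in> carrier P ==> c \<odot> x \<in> carrier P"
  and scalar_add: "x \<in> carrier P ==> (c + d) \<odot> x = c \<odot> x \<oplus> d \<odot> x"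
  and scalar_distrib: "[|x \<in> carrier P; y \<in> carrier P|] ==> c \<odot> (x \<oplus> y) = c \<odot> x \<oplus> c \<odot> y"
  and scalar_mult: "x \<in> carrier P ==> (c * d) \<odot> x = c \<odot> (d \<odot> x)"
  and scalar_one: "x \<in> carrier P ==> 1 \<odot> x = x"
begin

lemma additive_scalar: "additive_map P P (\<lambda>x. c \<odot> x)"
 by unfold_locales (auto intro!: add_mapI simp: scalar_closed scalar_distrib)

lemmas scalar_zero = additive_map.zero[OF additive_scalar]
 and scalar_minus = additive_map.minus[OF additive_scalar]
 and scalar_finsum = additive_map.finsum[OF additive_scalar]

lemma zero_scalar: "x \<in> carrier P ==> 0 \<odot> x = \<zero>"
 using scalar_add[of x 0 0] by (simp add: scalar_closed)

end

lemma kspace_iff_module: "kspace P \<longleftrightarrow> Module.module class_ring P"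
proof
 assume "kspace P"
 then interpret kspace P .
 show "Module.module class_ring P"
  by (intro moduleI class_cring.is_cring M.abelian_group_axioms)
   (auto simp: scalar_closed scalar_add scalar_distrib scalar_mult scalar_one)
next
 assume "Module.module class_ring P"
 then interpret Module.module class_ring P .
 show "kspace P"
  using smult_closed smult_l_distr smult_r_distr smult_assoc1 smult_one
  by unfold_locales auto
qed

lemma kspaceI:
 assumes "abelian_group P"
  "!!c x. x \<in> carrier P ==> c \<odot>\<^bsub>P\<^esub> x \<in> carrier P"
  "!!c d x. x \<in> carrier P ==> (c + d) \<odot>\<^bsub>P\<^esub> x = c \<odot>\<^bsub>P\<^esub> x \<oplus>\<^bsub>P\<^esub> d \<odot>\<^bsub>P\<^esub> x"
  "!!c x y. [|x \<in> carrier P; y \<in> carrier P|] ==> c \<odot>\<^bsub>P\<^esub> (x \<oplus>\<^bsub>P\<^esub> y) = c \<odot>\<^bsub>P\<^esub> x \<oplus>\<^bsub>P\<^esub> c \<odot>\<^bsub>P\<^esub> y"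
  "!!c d x. x \<in> carrier P ==> (c * d) \<odot>\<^bsub>P\<^esub> x = c \<odot>\<^bsub>P\<^esub> (d \<odot>\<^bsub>P\<^esub> x)"
  "!!x. x \<in> carrier P ==> 1 \<odot>\<^bsub>P\<^esub> x = x"
 shows "kspace (P :: ('k::field, 'p, 'z) module_scheme)"
 using assms by (simp add: kspace_def kspace_axioms_def)

lemma poly_mapping_sum_single:
 assumes "finite U" "keys f \<subseteq> U"
 shows "(\<Sum>w \<in> U. single w (lookup f w)) = f"
proof (rule poly_mapping_eqI)
 fix v
 have "lookup f v = 0" if "v \<notin> U" using that assms by (auto simp: in_keys_iff)
 then show "lookup (\<Sum>w \<in> U. single w (lookup f w)) v
   = lookup f v"
  using assms(1) by (auto simp: lookup_sum lookup_single when_def)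
qed

lemma poly_mapping_induct [consumes 1, case_names zero single add]:
 assumes "keys f \<subseteq> X" "P 0" "!!w c. w \<in> X ==> P (single w c)"
  "!!f g. [|keys f \<subseteq> X; keys g \<subseteq> X; P f; P g|] ==> P (f + g)"
 shows "P (f :: 'w \<Rightarrow>\<^sub>0 'k::comm_monoid_add)"
proof -
 have "keys (\<Sum>w \<in> U. single w (lookup f w)) \<subseteq> X \<and>
   P (\<Sum>w \<in> U. single w (lookup f w))" if "finite U" "U \<subseteq> X" for U
  using that
 proof (induction U rule: finite_induct)
  case (insert w U)
  then have "keys (single w (lookup f w)) \<subseteq> X"
   by (auto split: if_splits)
  with insert show ?case
   using keys_add[of "single w (lookup f w)"
     "\<Sum>w \<in> U. single w (lookup f w)"]
   by (auto intro!: assms(3,4) simp del: keys_single)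
 qed (use assms(2) in auto)
 from this[OF finite_keys assms(1)] show ?thesis
  by (simp add: poly_mapping_sum_single)
qed

lemma keys_add_subset:
 "[|keys f \<subseteq> X; keys g \<subseteq> X|] ==> keys (f + g) \<subseteq> X"
 using keys_add[of f g] by blast

lemma lookup_scale: "lookup (Poly_Mapping.map ((*) c) f) w = c * lookup f w"
 for c :: "'k::field"
 by (simp add: map.rep_eq when_def)

lemma keys_scale: "keys (Poly_Mapping.map ((*) c) f) \<subseteq> keys f"
 for c :: "'k::field"
 by (auto simp: in_keys_iff lookup_scale)

definition lin_ext :: "('k::field, 'p, 'z) module_scheme => ('w => 'p) => ('w \<Rightarrow>\<^sub>0 'k) => 'p" where
 "lin_ext P ph f = finsum P (\<lambda>w. lookup f w \<odot>\<^bsub>P\<^esub> ph w) (keys f)"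

context kspace
begin

lemma lin_ext_superset:
 assumes "finite U" "keys f \<subseteq> U" "ph \<in> U \<rightarrow> carrier P"
 shows "lin_ext P ph f = finsum P (\<lambda>w. lookup f w \<odot>\<^bsub>P\<^esub> ph w) U"
 unfolding lin_ext_def using assms
 by (intro M.finsum_eq_superset[symmetric]) (auto simp: in_keys_iff zero_scalar scalar_closed Pi_iff subset_iff)

lemma lin_ext_closed:
 "[|keys f \<subseteq> X; ph \<in> X \<rightarrow> carrier P|] ==> lin_ext P ph f \<in> carrier P"
 unfolding lin_ext_def by (intro M.finsum_closed) (auto simp: scalar_closed Pi_iff subset_iff)

lemma lin_ext_zero: "lin_ext P ph 0 = \<zero>\<^bsub>P\<^esub>"
 by (simp add: lin_ext_def)

lemma lin_ext_single: "ph w \<in> carrier P ==> lin_ext P ph (single w c) = c \<odot>\<^bsub>P\<^esub> ph w"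
 by (subst lin_ext_superset[of "{w}"]) (auto simp: scalar_closed)

lemma lin_ext_add:
 assumes "keys f \<subseteq> X" "keys g \<subseteq> X" "ph \<in> X \<rightarrow> carrier P"
 shows "lin_ext P ph (f + g) = lin_ext P ph f \<oplus>\<^bsub>P\<^esub> lin_ext P ph g"
proof -
 let ?U = "keys f \<union> keys g"
 have U: "ph \<in> ?U \<rightarrow> carrier P" using assms by auto
 have "lin_ext P ph (f + g) = finsum P (\<lambda>w. lookup f w \<odot>\<^bsub>P\<^esub> ph w \<oplus>\<^bsub>P\<^esub>
   lookup g w \<odot>\<^bsub>P\<^esub> ph w) ?U"
  using U keys_add[of f g]
  by (subst lin_ext_superset[of ?U], simp, simp, simp, intro M.finsum_cong')
   (auto simp: lookup_add scalar_add scalar_closed Pi_iff)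
 also have "\<dots> = lin_ext P ph f \<oplus>\<^bsub>P\<^esub> lin_ext P ph g"
  using U by (subst M.finsum_addf) (auto simp: lin_ext_superset[of ?U] scalar_closed Pi_iff)
 finally show ?thesis .
qed

lemma lin_ext_fun_add:
 assumes "ph \<in> X \<rightarrow> carrier P" "ps \<in> X \<rightarrow> carrier P" "keys f \<subseteq> X"
 shows "lin_ext P (\<lambda>w. ph w \<oplus>\<^bsub>P\<^esub> ps w) f = lin_ext P ph f \<oplus>\<^bsub>P\<^esub> lin_ext P ps f"
 unfolding lin_ext_def using assms
 by (subst M.finsum_addf[symmetric], (auto simp: scalar_closed Pi_iff subset_iff)[2],
   intro M.finsum_cong') (auto simp: scalar_closed scalar_distrib Pi_iff subset_iff)

lemma lin_ext_cong:
 assumes "!!w. w \<in> keys f ==> ph w = ps w" "ps \<in> keys f \<rightarrow> carrier P"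
 shows "lin_ext P ph f = lin_ext P ps f"
 unfolding lin_ext_def using assms by (intro M.finsum_cong') (auto simp: scalar_closed Pi_iff)

lemma lin_ext_scale:
 assumes "keys f \<subseteq> X" "ph \<in> X \<rightarrow> carrier P"
 shows "lin_ext P ph (Poly_Mapping.map ((*) c) f) = c \<odot>\<^bsub>P\<^esub> lin_ext P ph f"
proof -
 have "ph \<in> keys f \<rightarrow> carrier P" using assms by auto
 then show ?thesis
  using scalar_finsum[of "\<lambda>w. lookup f w \<odot>\<^bsub>P\<^esub> ph w" "keys f" c]
   keys_scale[of c f]
  by (subst lin_ext_superset[of "keys f"])
   (auto simp: lookup_scale scalar_mult scalar_closed Pi_iff lin_ext_def[of P ph f]
    intro!: M.finsum_cong')
qed

end

lemma lin_ext_linear: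
 assumes P: "kspace P" and Q: "kspace Q" and T: "add_map P Q T"
  "!!c x. x \<in> carrier P ==> T (c \<odot>\<^bsub>P\<^esub> x) = c \<odot>\<^bsub>Q\<^esub> T x"
  and ph: "ph \<in> X \<rightarrow> carrier P" "keys f \<subseteq> X"
 shows "T (lin_ext P ph f) = lin_ext Q (\<lambda>w. T (ph w)) f"
proof -
 interpret P: kspace P by fact
 interpret Q: kspace Q by fact
 interpret T: additive_map P Q T by unfold_locales fact
 have "T (lin_ext P ph f)
   = finsum Q (\<lambda>w. T (lookup f w \<odot>\<^bsub>P\<^esub> ph w)) (keys f)"
  unfolding lin_ext_def using ph by (intro T.finsum) (auto simp: P.scalar_closed Pi_iff subset_iff)
 also have "\<dots> = lin_ext Q (\<lambda>w. T (ph w)) f"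
  unfolding lin_ext_def using ph
  by (intro Q.M.finsum_cong') (auto simp: T(2) Q.scalar_closed T.closed Pi_iff subset_iff)
 finally show ?thesis .
qed


subsection \<open>Monoid algebras\<close>

lemma monoid_algebra_simps:
 "carrier (monoid_algebra W) = {f. keys f \<subseteq> carrier W}"
 "\<one>\<^bsub>monoid_algebra W\<^esub> = single \<one>\<^bsub>W\<^esub> 1" "\<zero>\<^bsub>monoid_algebra W\<^esub> = 0"
 "f \<oplus>\<^bsub>monoid_algebra W\<^esub> g = f + g"
 "c \<odot>\<^bsub>monoid_algebra W\<^esub> f = Poly_Mapping.map ((*) c) f"
 by (simp_all add: monoid_algebra_def)

text \<open>The supports in the definition may be replaced by larger finite sets. Summing two
  factors over the union of their supports then makes distributivity a rearrangement of one double
  sum.\<close>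

lemma monoid_algebra_mult:
 assumes "finite U" "keys f \<subseteq> U" "finite V" "keys g \<subseteq> V"
 shows "f \<otimes>\<^bsub>monoid_algebra W\<^esub> g = (\<Sum>u \<in> U. \<Sum>v \<in> V.
  single (u \<otimes>\<^bsub>W\<^esub> v) (lookup f u * lookup g v))"
proof -
 have "(\<Sum>u \<in> U. \<Sum>v \<in> V.
   single (u \<otimes>\<^bsub>W\<^esub> v) (lookup f u * lookup g v))
  = (\<Sum>u \<in> keys f. \<Sum>v \<in> V.
   single (u \<otimes>\<^bsub>W\<^esub> v) (lookup f u * lookup g v))"
  using assms by (intro sum.mono_neutral_right) (auto simp: in_keys_iff)
 also have "\<dots> = f \<otimes>\<^bsub>monoid_algebra W\<^esub> g"
  unfolding monoid_algebra_def using assms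
  by (simp, intro sum.cong refl sum.mono_neutral_right) (auto simp: in_keys_iff)
 finally show ?thesis by simp
qed

lemma monoid_algebra_mult_add_left:
 "(f + g) \<otimes>\<^bsub>monoid_algebra W\<^esub> h = f \<otimes>\<^bsub>monoid_algebra W\<^esub> h + g \<otimes>\<^bsub>monoid_algebra W\<^esub> h"
proof -
 let ?U = "keys f \<union> keys g"
 show ?thesis using keys_add[of f g]
  by (simp add: monoid_algebra_mult[of ?U _ "keys h"] lookup_add distrib_right
    single_add sum.distrib)
qed

lemma monoid_algebra_mult_add_right:
 "h \<otimes>\<^bsub>monoid_algebra W\<^esub> (f + g) = h \<otimes>\<^bsub>monoid_algebra W\<^esub> f + h \<otimes>\<^bsub>monoid_algebra W\<^esub> g"
proof -
 let ?U = "keys f \<union> keys g"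
 show ?thesis using keys_add[of f g]
  by (simp add: monoid_algebra_mult[of "keys h" _ ?U] lookup_add distrib_left
    single_add sum.distrib)
qed

lemma monoid_algebra_mult_zero:
 "0 \<otimes>\<^bsub>monoid_algebra W\<^esub> f = 0" "f \<otimes>\<^bsub>monoid_algebra W\<^esub> 0 = 0"
 by (simp_all add: monoid_algebra_def)

lemma monoid_algebra_mult_single:
 "single u a \<otimes>\<^bsub>monoid_algebra W\<^esub> single v b
  = single (u \<otimes>\<^bsub>W\<^esub> v) (a * b)"
 by (subst monoid_algebra_mult[of "{u}" _ "{v}"]) auto

lemma map_scale_single: "Poly_Mapping.map ((*) c) (single w a) = single w (c * a)"
 for c :: "'k::field"
 by (rule poly_mapping_eqI) (simp add: lookup_scale lookup_single when_def)

text \<open>Phrased for any record with these operations, so that monoid algebras and graded free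
  algebras, which have different record types, can share it.\<close>

lemma kspace_poly_mapping:
 assumes "carrier A = {f. keys f \<subseteq> X}" "zero A = 0" "add A = (+)"
  "smult A = (\<lambda>c. Poly_Mapping.map ((*) c))"
 shows "kspace (A :: ('k::field, 'w \<Rightarrow>\<^sub>0 'k, 'z) module_scheme)"
proof (rule kspaceI)
 show "abelian_group A"
 proof (rule abelian_groupI, goal_cases)
  case (6 f)
  then show ?case by (intro bexI[of _ "- f"]) (auto simp: assms in_keys_iff)
 qed (simp_all add: assms keys_add_subset add.assoc add.commute)
next
 fix f :: "'w \<Rightarrow>\<^sub>0 'k" and c assume "f \<in> carrier A"
 then show "c \<odot>\<^bsub>A\<^esub> f \<in> carrier A" using keys_scale[of c f] by (auto simp: assms)
qed (auto simp: assms lookup_scale lookup_add algebra_simps intro!: poly_mapping_eqI)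

lemma ring_monoid_algebra:
 assumes "monoid W"
 shows "ring (monoid_algebra W :: ('k::field, 'w \<Rightarrow>\<^sub>0 'k) module)"
proof -
 interpret W: monoid W by fact
 let ?A = "monoid_algebra W :: ('k, 'w \<Rightarrow>\<^sub>0 'k) module"
 interpret kspace ?A by (rule kspace_poly_mapping) (simp_all add: monoid_algebra_def fun_eq_iff)
 show ?thesis
 proof (rule ringI)
  show "abelian_group ?A" by (rule M.abelian_group_axioms)
  show "monoid ?A"
  proof
   fix f g :: "'w \<Rightarrow>\<^sub>0 'k" assume f: "f \<in> carrier ?A" and g: "g \<in> carrier ?A"
   have f': "keys f \<subseteq> carrier W" and g': "keys g \<subseteq> carrier W"
    using f g by (auto simp: monoid_algebra_simps)
   have "keys (f \<otimes>\<^bsub>?A\<^esub> g) \<subseteq> carrier W" using f'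
   proof (induction f rule: poly_mapping_induct)
    case (single w c)
    show ?case using g'
     by (induction g rule: poly_mapping_induct)
      (simp_all add: single monoid_algebra_mult_zero monoid_algebra_mult_single
       monoid_algebra_mult_add_right keys_add_subset)
   qed (simp_all add: monoid_algebra_mult_zero monoid_algebra_mult_add_left keys_add_subset)
   then show "f \<otimes>\<^bsub>?A\<^esub> g \<in> carrier ?A" by (simp add: monoid_algebra_simps)
   fix h assume "h \<in> carrier ?A"
   then have h': "keys h \<subseteq> carrier W" by (auto simp: monoid_algebra_simps)
   show "f \<otimes>\<^bsub>?A\<^esub> g \<otimes>\<^bsub>?A\<^esub> h = f \<otimes>\<^bsub>?A\<^esub> (g \<otimes>\<^bsub>?A\<^esub> h)" using f'
   proof (induction f rule: poly_mapping_induct)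
    case (single u a)
    show ?case using g'
    proof (induction g rule: poly_mapping_induct)
     case (single v b)
     show ?case using h'
      by (induction h rule: poly_mapping_induct)
       (use single \<open>u \<in> carrier W\<close> in \<open>simp_all add: monoid_algebra_mult_zero
        monoid_algebra_mult_add_right monoid_algebra_mult_single W.m_assoc mult.assoc\<close>)
    qed (simp_all add: monoid_algebra_mult_zero monoid_algebra_mult_add_left monoid_algebra_mult_add_right)
   qed (simp_all add: monoid_algebra_mult_zero monoid_algebra_mult_add_left)
  next
   show "\<one>\<^bsub>?A\<^esub> \<in> carrier ?A" by (simp add: monoid_algebra_simps)
   fix f assume "f \<in> carrier ?A"
   then have f': "keys f \<subseteq> carrier W" by (auto simp: monoid_algebra_simps)
   show "\<one>\<^bsub>?A\<^esub> \<otimes>\<^bsub>?A\<^esub> f = f" unfolding monoid_algebra_simps using f'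
    by (induction f rule: poly_mapping_induct) (simp_all add: monoid_algebra_mult_zero
      monoid_algebra_mult_add_right monoid_algebra_mult_single)
   show "f \<otimes>\<^bsub>?A\<^esub> \<one>\<^bsub>?A\<^esub> = f" unfolding monoid_algebra_simps using f'
    by (induction f rule: poly_mapping_induct) (simp_all add: monoid_algebra_mult_zero
      monoid_algebra_mult_add_left monoid_algebra_mult_single)
  qed
 qed (simp_all add: monoid_algebra_simps(4) monoid_algebra_mult_add_left monoid_algebra_mult_add_right)
qed

lemma monoid_algebra_scale_mult:
 fixes c :: "'k::field"
 shows "Poly_Mapping.map ((*) c) (f \<otimes>\<^bsub>monoid_algebra W\<^esub> g) = Poly_Mapping.map ((*) c) f \<otimes>\<^bsub>monoid_algebra W\<^esub> g"
  "Poly_Mapping.map ((*) c) (f \<otimes>\<^bsub>monoid_algebra W\<^esub> g) = f \<otimes>\<^bsub>monoid_algebra W\<^esub> Poly_Mapping.map ((*) c) g"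
proof -
 have sum: "Poly_Mapping.map ((*) c) (sum F I) = (\<Sum>i \<in> I. Poly_Mapping.map ((*) c) (F i))"
  for F :: "'i => _" and I
  by (rule poly_mapping_eqI) (simp add: lookup_scale lookup_sum sum_distrib_left)
 show "Poly_Mapping.map ((*) c) (f \<otimes>\<^bsub>monoid_algebra W\<^esub> g) = Poly_Mapping.map ((*) c) f \<otimes>\<^bsub>monoid_algebra W\<^esub> g"
  by (simp add: monoid_algebra_mult[of "keys f" _ "keys g"] keys_scale
    lookup_scale sum map_scale_single mult.assoc)
 show "Poly_Mapping.map ((*) c) (f \<otimes>\<^bsub>monoid_algebra W\<^esub> g) = f \<otimes>\<^bsub>monoid_algebra W\<^esub> Poly_Mapping.map ((*) c) g"
  by (simp add: monoid_algebra_mult[of "keys f" _ "keys g"] keys_scale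
    lookup_scale sum map_scale_single mult.left_commute)
qed

lemma k_algebra_monoid_algebra:
 assumes "monoid W" "carrier A = carrier (monoid_algebra W)" "mult A = mult (monoid_algebra W)"
  "\<one>\<^bsub>A\<^esub> = \<one>\<^bsub>monoid_algebra W\<^esub>" "\<zero>\<^bsub>A\<^esub> = 0" "add A = (+)" "smult A = (\<lambda>c. Poly_Mapping.map ((*) c))"
 shows "k_algebra (A :: ('k::field, 'w \<Rightarrow>\<^sub>0 'k, 'z) module_scheme)"
proof -
 have "ring A"
  using assms by (intro ring_cong[OF ring_monoid_algebra[OF assms(1)]]) (simp_all add: monoid_algebra_def fun_eq_iff)
 moreover have "kspace A"
  using assms by (intro kspace_poly_mapping) (auto simp: monoid_algebra_simps)
 ultimately show ?thesis
  unfolding k_algebra_def kspace_iff_module[symmetric]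
  unfolding assms(3,7) by (auto simp flip: monoid_algebra_scale_mult)
qed


subsection \<open>Actions of a monoid\<close>

text \<open>A linear action of a monoid amounts to a module over its monoid algebra
  (\<open>act_ext_mult\<close>). This is used twice: for words acting through operators, and for
  tuples of matrices acting on \<open>L\<close> by left multiplication.\<close>

locale monoid_action = kspace P + W: monoid W
 for P :: "('k::field, 'p, 'z) module_scheme" and W :: "'w monoid" +
 fixes act :: "'w => 'p => 'p"
 assumes act_closed: "[|w \<in> carrier W; x \<in> carrier P|] ==> act w x \<in> carrier P"
  and act_add: "[|w \<in> carrier W; x \<in> carrier P; y \<in> carrier P|]
   ==> act w (x \<oplus>\<^bsub>P\<^esub> y) = act w x \<oplus>\<^bsub>P\<^esub> act w y"
  and act_scalar: "[|w \<in> carrier W; x \<in> carrier P|] ==> act w (c \<odot>\<^bsub>P\<^esub> x) = c \<odot>\<^bsub>P\<^esub> act w x"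
  and act_mult: "[|v \<in> carrier W; w \<in> carrier W; x \<in> carrier P|]
   ==> act (v \<otimes>\<^bsub>W\<^esub> w) x = act v (act w x)"
  and act_one: "x \<in> carrier P ==> act \<one>\<^bsub>W\<^esub> x = x"
begin

definition act_ext :: "('w \<Rightarrow>\<^sub>0 'k) => 'p => 'p" where
 "act_ext f x = lin_ext P (\<lambda>w. act w x) f"

context
 fixes f :: "'w \<Rightarrow>\<^sub>0 'k" assumes f: "keys f \<subseteq> carrier W"
begin

lemma act_ext_closed: "x \<in> carrier P ==> act_ext f x \<in> carrier P"
 unfolding act_ext_def using f by (intro lin_ext_closed) (auto simp: act_closed)

lemma act_ext_add_left:
 "[|keys g \<subseteq> carrier W; x \<in> carrier P|] ==> act_ext (f + g) x = act_ext f x \<oplus>\<^bsub>P\<^esub> act_ext g x"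
 unfolding act_ext_def using f by (intro lin_ext_add) (auto simp: act_closed)

lemma act_ext_add_right:
 assumes "x \<in> carrier P" "y \<in> carrier P"
 shows "act_ext f (x \<oplus>\<^bsub>P\<^esub> y) = act_ext f x \<oplus>\<^bsub>P\<^esub> act_ext f y"
proof -
 have "act_ext f (x \<oplus>\<^bsub>P\<^esub> y) = lin_ext P (\<lambda>w. act w x \<oplus>\<^bsub>P\<^esub> act w y) f"
  unfolding act_ext_def using f assms by (intro lin_ext_cong) (auto simp: act_add act_closed)
 also have "\<dots> = act_ext f x \<oplus>\<^bsub>P\<^esub> act_ext f y"
  unfolding act_ext_def using f assms by (intro lin_ext_fun_add) (auto simp: act_closed)
 finally show ?thesis .
qed

end

lemma act_ext_zero: "act_ext 0 x = \<zero>\<^bsub>P\<^esub>"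
 by (simp add: act_ext_def lin_ext_zero)

lemma act_ext_single:
 "[|w \<in> carrier W; x \<in> carrier P|] ==> act_ext (single w c) x = c \<odot>\<^bsub>P\<^esub> act w x"
 by (simp add: act_ext_def lin_ext_single act_closed)

lemma act_zero: "w \<in> carrier W ==> act w \<zero>\<^bsub>P\<^esub> = \<zero>\<^bsub>P\<^esub>"
 using act_scalar[of w "\<zero>\<^bsub>P\<^esub>" 0] by (simp add: zero_scalar act_closed)

lemma act_ext_one: "x \<in> carrier P ==> act_ext \<one>\<^bsub>monoid_algebra W\<^esub> x = x"
 by (simp add: monoid_algebra_simps act_ext_single act_one scalar_one)

lemma act_ext_mult:
 assumes f: "keys f \<subseteq> carrier W" and g: "keys g \<subseteq> carrier W"
  and x: "x \<in> carrier P"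
 shows "act_ext (f \<otimes>\<^bsub>monoid_algebra W\<^esub> g) x = act_ext f (act_ext g x)"
proof -
 interpret MA: ring "monoid_algebra W :: ('k, 'w \<Rightarrow>\<^sub>0 'k) module"
  by (rule ring_monoid_algebra) (rule W.monoid_axioms)
 have closed: "keys (f \<otimes>\<^bsub>monoid_algebra W\<^esub> g) \<subseteq> carrier W"
  if "keys f \<subseteq> carrier W" "keys g \<subseteq> carrier W" for f g :: "'w \<Rightarrow>\<^sub>0 'k"
  using MA.m_closed[of f g] that by (simp add: monoid_algebra_simps)
 show ?thesis using f
 proof (induction f rule: poly_mapping_induct)
  case (single u a)
  then have u: "keys (single u a) \<subseteq> carrier W" by simp
  show ?case using g
  proof (induction g rule: poly_mapping_induct)
   case zero
   show ?case using single
    by (simp add: monoid_algebra_mult_zero act_ext_zero act_ext_single act_zero scalar_zero)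
  next
   case (single v b)
   then show ?case using x \<open>u \<in> carrier W\<close>
    by (simp add: monoid_algebra_mult_single act_ext_single act_closed scalar_closed act_mult
      act_scalar scalar_mult)
  next
   case (add g h)
   then show ?case using x
    by (simp add: monoid_algebra_mult_add_right act_ext_add_left[OF closed[OF u]] closed[OF u]
      act_ext_add_left act_ext_add_right[OF u] act_ext_closed)
  qed
 next
  case (add f h)
  then show ?case using x g
   by (simp add: monoid_algebra_mult_add_left act_ext_add_left[OF closed] closed
      act_ext_add_left act_ext_closed)
 qed (simp add: monoid_algebra_mult_zero act_ext_zero)
qed

end

subsection \<open>The ground field as a graded algebra\<close>

text \<open>With the field regarded as an algebra concentrated in degree zero, graded vector spaces
  are graded modules and a homogeneous ideal of a graded algebra is a graded submodule. The quotient
  lemmas for modules then supply the additive and graded part of quotient algebras.\<close>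

definition base_field :: "('k::field, 'k) graded" where
 "base_field = \<lparr>carrier = UNIV, mult = (*), one = 1, zero = 0, add = (+), smult = (*),
   component = (\<lambda>i. if i = 0 then UNIV else {0})\<rparr>"

lemma base_field_simps [simp]:
 "carrier base_field = UNIV" "a \<otimes>\<^bsub>base_field\<^esub> b = a * b" "\<one>\<^bsub>base_field\<^esub> = 1" "\<zero>\<^bsub>base_field\<^esub> = 0"
 "a \<oplus>\<^bsub>base_field\<^esub> b = a + b" "a \<odot>\<^bsub>base_field\<^esub> b = a * b"
 "component base_field i = (if i = 0 then UNIV else {0})"
 by (simp_all add: base_field_def)

lemma left_module_base_field:
 "left_module base_field P \<longleftrightarrow> kspace (P :: ('k::field, 'p, 'z) module_scheme)"
proof
 assume "left_module base_field P"
 then interpret left_module base_field P .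
 show "kspace P"
  using smult_closed smult_l_distr smult_r_distr smult_assoc1 smult_one
  by unfold_locales auto
next
 assume "kspace P"
 then interpret kspace P .
 have "ring (base_field :: ('k, 'k) graded)"
  by (rule ring_cong[OF class_ring.ring_axioms]) (auto simp: base_field_def)
 then show "left_module base_field P"
  by (rule left_moduleI[OF _ M.abelian_group_axioms])
   (auto simp: scalar_closed scalar_add scalar_distrib scalar_mult scalar_one)
qed

lemma graded_algebra_base_field: "graded_algebra (base_field :: ('k::field, 'k) graded)"
proof -
 let ?A = "base_field :: ('k, 'k) graded"
 have ring: "ring ?A"
  by (rule ring_cong[OF class_ring.ring_axioms]) (auto simp: base_field_def)
 interpret A: ring ?A by (rule ring)
 have "kspace ?A"
  by (intro kspaceI A.abelian_group_axioms) (auto simp: algebra_simps)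
 then have "k_algebra ?A"
  using ring by (auto simp: k_algebra_def kspace_iff_module[symmetric])
 moreover have "\<ominus>\<^bsub>?A\<^esub> x = - x" for x
  by (rule A.minus_equality) auto
 then have "direct_sum_grading ?A"
  by (intro direct_sum_gradingI[OF A.abelian_group_axioms, where p = "\<lambda>i x. if i = 0 then x else 0"])
   (auto simp: A.additive_subgroup_iff intro!: exI[of _ "{0}"] A.finsum_singleton)
 ultimately show ?thesis by (auto simp: graded_algebra_def)
qed

locale graded_kspace = graded_mod base_field P for P :: "('k::field, 'p) graded"

sublocale graded_kspace \<subseteq> kspace P
 using left_module_axioms by (simp add: left_module_base_field)

lemma graded_kspaceI:
 assumes "kspace P" "direct_sum_grading P" "!!c i x. x \<in> component P i ==> c \<odot>\<^bsub>P\<^esub> x \<in> component P i"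
 shows "graded_kspace (P :: ('k::field, 'p) graded)"
proof -
 interpret P: kspace P by fact
 interpret P: graded_group P
  using assms(2) P.M.abelian_group_axioms by (simp add: graded_group_def graded_group_axioms_def)
 show ?thesis unfolding graded_kspace_def
  using assms by (intro graded_modI graded_algebra_base_field)
   (auto simp: left_module_base_field P.zero_scalar P.comp_carrier P.comp_zero split: if_splits)
qed

locale graded_alg =
 fixes A :: "('k::field, 'a) graded" assumes graded_algebra: "graded_algebra A"

sublocale graded_alg \<subseteq> ring A
 using graded_algebra by (simp add: graded_algebra_def k_algebra_def)

sublocale graded_alg \<subseteq> A: graded_group A
 using graded_algebra by (rule graded_algebra_group)

sublocale graded_alg \<subseteq> S: kspace A
 using graded_algebra by (simp add: graded_algebra_def k_algebra_def kspace_iff_module)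

lemma (in graded_alg) graded_mod_base_field: "graded_mod base_field A"
 using graded_algebra A.direct_sum S.kspace_axioms graded_kspaceI[of A]
 by (simp add: graded_algebra_def graded_kspace_def)

context graded_alg
begin

lemma scalar_mult_assoc: "[|a \<in> carrier A; b \<in> carrier A|] ==> c \<odot>\<^bsub>A\<^esub> (a \<otimes>\<^bsub>A\<^esub> b) = (c \<odot>\<^bsub>A\<^esub> a) \<otimes>\<^bsub>A\<^esub> b"
 and scalar_mult_right: "[|a \<in> carrier A; b \<in> carrier A|] ==> c \<odot>\<^bsub>A\<^esub> (a \<otimes>\<^bsub>A\<^esub> b) = a \<otimes>\<^bsub>A\<^esub> (c \<odot>\<^bsub>A\<^esub> b)"
 using graded_algebra unfolding graded_algebra_def k_algebra_def by blast+

lemma scalar_eq_mult: "a \<in> carrier A ==> c \<odot>\<^bsub>A\<^esub> a = (c \<odot>\<^bsub>A\<^esub> \<one>\<^bsub>A\<^esub>) \<otimes>\<^bsub>A\<^esub> a"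
 using scalar_mult_assoc[of "\<one>\<^bsub>A\<^esub>" a c] by simp

lemma comp_one: "\<one>\<^bsub>A\<^esub> \<in> component A 0"
 and comp_mult: "[|a \<in> component A i; b \<in> component A j|] ==> a \<otimes>\<^bsub>A\<^esub> b \<in> component A (i + j)"
 and comp_scalar: "a \<in> component A i ==> c \<odot>\<^bsub>A\<^esub> a \<in> component A i"
 using graded_algebra by (auto simp: graded_algebra_def)

lemma additive_mult_left: "a \<in> carrier A ==> additive_map A A (\<lambda>x. a \<otimes>\<^bsub>A\<^esub> x)"
 and additive_mult_right: "a \<in> carrier A ==> additive_map A A (\<lambda>x. x \<otimes>\<^bsub>A\<^esub> a)"
 by (unfold_locales, auto intro!: add_mapI simp: r_distr l_distr)

lemma hpart_mult_left:
 assumes "a \<in> component A i" "x \<in> carrier A"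
 shows "hpart A (a \<otimes>\<^bsub>A\<^esub> x) j = a \<otimes>\<^bsub>A\<^esub> hpart A x (j - i)"
 using hpart_add_map[OF A.graded_group_axioms A.graded_group_axioms
   additive_map.add_map[OF additive_mult_left], of a i x "j - i"] comp_mult[OF assms(1)] assms
 by (auto simp: A.comp_carrier add.commute)

lemma hpart_mult_right:
 assumes "a \<in> component A i" "x \<in> carrier A"
 shows "hpart A (x \<otimes>\<^bsub>A\<^esub> a) j = hpart A x (j - i) \<otimes>\<^bsub>A\<^esub> a"
 using hpart_add_map[OF A.graded_group_axioms A.graded_group_axioms
   additive_map.add_map[OF additive_mult_right], of a i x "j - i"] comp_mult[OF _ assms(1)] assms
 by (auto simp: A.comp_carrier)

end


subsection \<open>Generators of an algebra\<close>

inductive_set alg_closure :: "('k, 'a) graded => 'a set => 'a set"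
 for A :: "('k, 'a) graded" and G :: "'a set" where
 scalar: "c \<odot>\<^bsub>A\<^esub> \<one>\<^bsub>A\<^esub> \<in> alg_closure A G"
| gen: "g \<in> G ==> g \<in> alg_closure A G"
| add: "[|a \<in> alg_closure A G; b \<in> alg_closure A G|] ==> a \<oplus>\<^bsub>A\<^esub> b \<in> alg_closure A G"
| mult: "[|a \<in> alg_closure A G; b \<in> alg_closure A G|] ==> a \<otimes>\<^bsub>A\<^esub> b \<in> alg_closure A G"

definition alg_generated :: "('k, 'a) graded => 'a set => bool" where
 "alg_generated A G \<longleftrightarrow> G \<subseteq> carrier A \<and> carrier A = alg_closure A G"

context graded_alg
begin

lemma alg_closure_closed: "G \<subseteq> carrier A ==> a \<in> alg_closure A G ==> a \<in> carrier A"
 by (rotate_tac, induction rule: alg_closure.induct) (auto simp: S.scalar_closed)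

lemma generated_induct [consumes 2, case_names scalar gen add mult]:
 assumes "alg_generated A G" "a \<in> carrier A"
  "!!c. Q (c \<odot>\<^bsub>A\<^esub> \<one>\<^bsub>A\<^esub>)" "!!g. g \<in> G ==> Q g"
  "!!a b. [|a \<in> carrier A; b \<in> carrier A; Q a; Q b|] ==> Q (a \<oplus>\<^bsub>A\<^esub> b)"
  "!!a b. [|a \<in> carrier A; b \<in> carrier A; Q a; Q b|] ==> Q (a \<otimes>\<^bsub>A\<^esub> b)"
 shows "Q a"
proof -
 have "a \<in> alg_closure A G" using assms(1,2) by (simp add: alg_generated_def)
 then show ?thesis
  by (induction rule: alg_closure.induct)
   (use assms(1) alg_closure_closed[of G] in \<open>auto simp: alg_generated_def intro: assms(3-)\<close>)
qed

end

context graded_mod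
begin

sublocale alg: graded_alg A
 by unfold_locales (rule algebra)

lemma submodule_generated:
 assumes "alg_generated A G" "N \<subseteq> carrier M" "!!x y. [|x \<in> N; y \<in> N|] ==> x \<oplus>\<^bsub>M\<^esub> y \<in> N"
  "!!c x. x \<in> N ==> (c \<odot>\<^bsub>A\<^esub> \<one>\<^bsub>A\<^esub>) \<odot>\<^bsub>M\<^esub> x \<in> N" "!!g x. [|g \<in> G; x \<in> N|] ==> g \<odot>\<^bsub>M\<^esub> x \<in> N"
  and "a \<in> carrier A" "x \<in> N"
 shows "a \<odot>\<^bsub>M\<^esub> x \<in> N"
 using assms(1,6,7)
proof (induction a arbitrary: x rule: alg.generated_induct)
 case (add a b)
 then show ?case using assms(2) by (simp add: smult_l_distr subset_iff assms(3))
next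
 case (mult a b)
 then show ?case using assms(2) by (simp add: smult_assoc1 subset_iff)
qed (use assms in auto)

lemma restrict_scalars_kspace: "kspace (restrict_scalars A M)"
proof (rule kspaceI)
 show "abelian_group (restrict_scalars A M)"
  by (rule abelian_group_cong[OF M.abelian_group_axioms]) (auto simp: restrict_scalars_def)
next
 fix c d and x assume "x \<in> carrier (restrict_scalars A M)"
 then have x: "x \<in> carrier M" by (simp add: restrict_scalars_def)
 have "((c * d) \<odot>\<^bsub>A\<^esub> \<one>\<^bsub>A\<^esub>) = (c \<odot>\<^bsub>A\<^esub> \<one>\<^bsub>A\<^esub>) \<otimes>\<^bsub>A\<^esub> (d \<odot>\<^bsub>A\<^esub> \<one>\<^bsub>A\<^esub>)"
  by (subst alg.scalar_eq_mult[symmetric]) (auto simp: alg.S.scalar_mult alg.S.scalar_closed)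
 then show "(c * d) \<odot>\<^bsub>restrict_scalars A M\<^esub> x
   = c \<odot>\<^bsub>restrict_scalars A M\<^esub> (d \<odot>\<^bsub>restrict_scalars A M\<^esub> x)"
  using x by (simp add: restrict_scalars_def smult_assoc1 alg.S.scalar_closed)
qed (auto simp: restrict_scalars_def smult_closed alg.S.scalar_closed alg.S.scalar_add smult_l_distr
  smult_r_distr alg.S.scalar_one smult_one)

sublocale K: kspace "restrict_scalars A M"
 rewrites "carrier (restrict_scalars A M) = carrier M" and "add (restrict_scalars A M) = add M"
  and "zero (restrict_scalars A M) = zero M"
  and "smult (restrict_scalars A M) = (\<lambda>c x. (c \<odot>\<^bsub>A\<^esub> \<one>\<^bsub>A\<^esub>) \<odot>\<^bsub>M\<^esub> x)"
 by (rule restrict_scalars_kspace) (simp_all add: restrict_scalars_def)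

end

lemma hom_generated:
 assumes M: "graded_mod A M" and N: "graded_mod A N" and gen: "alg_generated A G"
  and f: "add_map M N f"
  and sc: "!!c x. x \<in> carrier M ==> f ((c \<odot>\<^bsub>A\<^esub> \<one>\<^bsub>A\<^esub>) \<odot>\<^bsub>M\<^esub> x) = (c \<odot>\<^bsub>A\<^esub> \<one>\<^bsub>A\<^esub>) \<odot>\<^bsub>N\<^esub> f x"
  and g: "!!g x. [|g \<in> G; x \<in> carrier M|] ==> f (g \<odot>\<^bsub>M\<^esub> x) = g \<odot>\<^bsub>N\<^esub> f x"
  and "a \<in> carrier A" "x \<in> carrier M"
 shows "f (a \<odot>\<^bsub>M\<^esub> x) = a \<odot>\<^bsub>N\<^esub> f x"
proof -
 interpret M: graded_mod A M by fact
 interpret N: graded_mod A N by fact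
 have fc: "f x \<in> carrier N" if "x \<in> carrier M" for x using f that by (auto simp: add_map_def)
 have fa: "f (x \<oplus>\<^bsub>M\<^esub> y) = f x \<oplus>\<^bsub>N\<^esub> f y" if "x \<in> carrier M" "y \<in> carrier M" for x y
  using f that by (auto simp: add_map_def)
 show ?thesis using gen assms(7,8)
 proof (induction a arbitrary: x rule: M.alg.generated_induct)
  case (add a b)
  then show ?case by (simp add: M.smult_l_distr N.smult_l_distr fa fc M.smult_closed)
 next
  case (mult a b)
  then show ?case by (simp add: M.smult_assoc1 N.smult_assoc1 fc M.smult_closed)
 qed (auto simp: sc g)
qed


subsection \<open>Graded free algebras\<close>

lemma graded_free_algebra_simps:
 "carrier (graded_free_algebra X d) = {f. keys f \<subseteq> lists X}"
 "mult (graded_free_algebra X d) = mult (monoid_algebra (word_monoid X))"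
 "\<one>\<^bsub>graded_free_algebra X d\<^esub> = single [] 1" "\<zero>\<^bsub>graded_free_algebra X d\<^esub> = 0"
 "add (graded_free_algebra X d) = (+)"
 "smult (graded_free_algebra X d) = (\<lambda>c. Poly_Mapping.map ((*) c))"
 "component (graded_free_algebra X d) i
  = {f. \<forall>w \<in> keys f. w \<in> lists X \<and> (\<Sum>x\<leftarrow>w. d x) = i}"
 by (simp_all add: graded_free_algebra_def monoid_algebra_def word_monoid_def module.defs graded.defs)

lemma monoid_word_monoid: "monoid (word_monoid X)"
 by unfold_locales (auto simp: word_monoid_def)

lemma word_monoid_simps [simp]:
 "carrier (word_monoid X) = lists X" "v \<otimes>\<^bsub>word_monoid X\<^esub> w = v @ w" "\<one>\<^bsub>word_monoid X\<^esub> = []"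
 by (simp_all add: word_monoid_def)

lemma keys_monoid_algebra_mult:
 assumes "w \<in> keys (f \<otimes>\<^bsub>monoid_algebra W\<^esub> g)"
 obtains u v where "u \<in> keys f" "v \<in> keys g" "w = u \<otimes>\<^bsub>W\<^esub> v"
proof -
 have "(\<Sum>u \<in> keys f. \<Sum>v \<in> keys g. lookup
   (single (u \<otimes>\<^bsub>W\<^esub> v) (lookup f u * lookup g v)) w) ~= 0"
  using assms by (simp add: monoid_algebra_def in_keys_iff lookup_sum)
 then obtain u where u: "u \<in> keys f" "(\<Sum>v \<in> keys g. lookup
   (single (u \<otimes>\<^bsub>W\<^esub> v) (lookup f u * lookup g v)) w) ~= 0"
  by (rule sum.not_neutral_contains_not_neutral)
 from u(2) obtain v where "v \<in> keys g" "lookup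
   (single (u \<otimes>\<^bsub>W\<^esub> v) (lookup f u * lookup g v)) w ~= 0"
  by (rule sum.not_neutral_contains_not_neutral)
 with u(1) that show ?thesis by (auto simp: lookup_single when_def split: if_splits)
qed

lemma graded_algebra_free: "graded_algebra (graded_free_algebra X d :: ('k::field, 'x list \<Rightarrow>\<^sub>0 'k) graded)"
proof -
 let ?F = "graded_free_algebra X d :: ('k, 'x list \<Rightarrow>\<^sub>0 'k) graded"
 let ?deg = "\<lambda>w. \<Sum>x\<leftarrow>w. d x"
 have k: "k_algebra ?F"
  by (rule k_algebra_monoid_algebra[OF monoid_word_monoid])
   (simp_all add: graded_free_algebra_simps monoid_algebra_simps)
 then interpret ring ?F by (simp add: k_algebra_def)
 have minus: "\<ominus>\<^bsub>?F\<^esub> f = - f" if "keys f \<subseteq> lists X" for f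
  using that by (intro minus_equality) (auto simp: graded_free_algebra_simps in_keys_iff)
 define p where "p i f = (\<Sum>w \<in> {w \<in> keys f. ?deg w = i}.
   single w (lookup f w))" for i and f :: "'x list \<Rightarrow>\<^sub>0 'k"
 have p: "lookup (p i f) w = (if ?deg w = i then lookup f w else 0)" for i f w
  by (simp add: p_def lookup_sum lookup_single when_def in_keys_iff)
 have finsum: "finsum ?F g J = sum g J" if "g \<in> J \<rightarrow> carrier ?F" "finite J" for g and J :: "int set"
  using that(2,1) by (induction J rule: finite_induct) (auto simp: graded_free_algebra_simps)
 have "direct_sum_grading ?F"
 proof (rule direct_sum_gradingI[OF abelian_group_axioms, where p = p])
  fix i
  have comp: "component ?F i = {f. keys f \<subseteq> {w \<in> lists X. ?deg w = i}}"
   by (auto simp: graded_free_algebra_simps)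
  have minus_comp: "\<ominus>\<^bsub>?F\<^esub> f \<in> component ?F i" if "f \<in> component ?F i" for f
  proof -
   have "keys f \<subseteq> lists X" using that by (auto simp: comp)
   then show ?thesis using that by (subst minus) (auto simp: comp in_keys_iff)
  qed
  show "additive_subgroup (component ?F i) ?F"
   unfolding additive_subgroup_iff
  proof (intro conjI ballI minus_comp)
   fix f g assume "f \<in> component ?F i" "g \<in> component ?F i"
   then show "f \<oplus>\<^bsub>?F\<^esub> g \<in> component ?F i"
    using keys_add_subset[of f _ g] by (simp add: comp graded_free_algebra_simps(5))
  qed (auto simp: comp graded_free_algebra_simps(1,4))
 next
  fix f assume f: "f \<in> carrier ?F"
  let ?J = "?deg ` keys f"
  have "finsum ?F (\<lambda>i. p i f) ?J = sum (\<lambda>i. p i f) ?J"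
   using f by (intro finsum) (auto simp: graded_free_algebra_simps in_keys_iff p split: if_splits)
  also have "\<dots> = f"
   by (rule poly_mapping_eqI) (auto simp: lookup_sum p in_keys_iff)
  finally have "finsum ?F (\<lambda>i. p i f) ?J = f" .
  moreover have "p i f = \<zero>\<^bsub>?F\<^esub>" if "i \<notin> ?J" for i
  proof -
   have "lookup (p i f) w = 0" for w
    using that in_keys_iff[of w f] by (auto simp: p)
   then show ?thesis by (simp add: graded_free_algebra_simps poly_mapping_eqI)
  qed
  ultimately show "\<exists>J. finite J \<and> (\<forall>i. i \<notin> J --> p i f = \<zero>\<^bsub>?F\<^esub>) \<and> finsum ?F (\<lambda>i. p i f) J = f"
   by (intro exI[of _ ?J]) simp
 next
  show "p i (f \<oplus>\<^bsub>?F\<^esub> g) = p i f \<oplus>\<^bsub>?F\<^esub> p i g" for i f g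
   by (auto simp: graded_free_algebra_simps p lookup_add intro!: poly_mapping_eqI)
  show "p i f \<in> component ?F i" if "f \<in> carrier ?F" for i f
   using that by (auto simp: graded_free_algebra_simps in_keys_iff p split: if_splits)
  show "p i f = \<zero>\<^bsub>?F\<^esub>" if "f \<in> component ?F j" "i ~= j" for i j f
   using that by (auto simp: graded_free_algebra_simps p in_keys_iff intro!: poly_mapping_eqI)
 qed
 moreover have "f \<otimes>\<^bsub>?F\<^esub> g \<in> component ?F (i + j)" if "f \<in> component ?F i" "g \<in> component ?F j" for i j f g
  using that unfolding graded_free_algebra_simps
  by (auto simp: in_lists_conv_set elim!: keys_monoid_algebra_mult)
 moreover have "c \<odot>\<^bsub>?F\<^esub> f \<in> component ?F i" if "f \<in> component ?F i" for i c f
  using that keys_scale[of c f] by (auto simp: graded_free_algebra_simps(6,7) simp del: in_lists_conv_set)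
 moreover have "\<one>\<^bsub>?F\<^esub> \<in> component ?F 0" by (simp add: graded_free_algebra_simps(3,7))
 ultimately show ?thesis
  unfolding graded_algebra_def using k by blast
qed

lemma free_algebra_mult_single:
 "single v a \<otimes>\<^bsub>graded_free_algebra X d\<^esub> single w b
  = single (v @ w) (a * b)"
 by (simp add: graded_free_algebra_simps monoid_algebra_mult_single)

lemma alg_generated_free:
 "alg_generated (graded_free_algebra X d :: ('k::field, 'x list \<Rightarrow>\<^sub>0 'k) graded)
   ((\<lambda>x. single [x] 1) ` X)"
proof -
 let ?F = "graded_free_algebra X d :: ('k, 'x list \<Rightarrow>\<^sub>0 'k) graded"
 let ?G = "(\<lambda>x. single [x] (1::'k)) ` X"
 interpret graded_alg ?F by unfold_locales (rule graded_algebra_free)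
 have sc: "single [] c \<in> alg_closure ?F ?G" for c
  using alg_closure.scalar[where c = c and A = ?F and G = ?G] by (simp add: graded_free_algebra_simps map_scale_single)
 have word: "single w 1 \<in> alg_closure ?F ?G" if "w \<in> lists X" for w
  using that
 proof (induction w)
  case (Cons x w)
  then have "single [x] 1 \<otimes>\<^bsub>?F\<^esub> single w 1 \<in> alg_closure ?F ?G"
   by (intro alg_closure.mult[OF alg_closure.gen]) auto
  then show ?case by (simp add: free_algebra_mult_single)
 qed (rule sc)
 have "f \<in> alg_closure ?F ?G" if "keys f \<subseteq> lists X" for f using that
 proof (induction f rule: poly_mapping_induct)
  case zero
  then show ?case using sc[of 0] by simp
 next
  case (single w c)
  then show ?case
   using alg_closure.mult[OF sc[of c] word] by (simp add: free_algebra_mult_single)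
 next
  case (add f g)
  then show ?case using alg_closure.add[of f ?F ?G g] by (simp add: graded_free_algebra_simps)
 qed
 moreover have "?G \<subseteq> carrier ?F" by (auto simp: graded_free_algebra_simps)
 ultimately show ?thesis using alg_closure_closed[of ?G]
  unfolding alg_generated_def graded_free_algebra_simps(1) by blast
qed

text \<open>The module over the free algebra on \<open>X\<close> in which the letter \<open>x\<close> acts as the operator \<open>T x\<close>.\<close>

definition operator_module ::
 "('k::field, 'p) graded => ('x => 'p => 'p) => ('x list \<Rightarrow>\<^sub>0 'k, 'p) graded" where
 "operator_module P T = \<lparr>carrier = carrier P, mult = mult P, one = \<one>\<^bsub>P\<^esub>, zero = \<zero>\<^bsub>P\<^esub>, add = add P,
   smult = (\<lambda>f x. lin_ext P (\<lambda>w. foldr T w x) f), component = component P\<rparr>"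

locale graded_operators = graded_kspace P for P :: "('k::field, 'p) graded" +
 fixes X :: "'x set" and d :: "'x => int" and T :: "'x => 'p => 'p"
 assumes T_closed: "[|x \<in> X; p \<in> carrier P|] ==> T x p \<in> carrier P"
  and T_add: "[|x \<in> X; p \<in> carrier P; q \<in> carrier P|] ==> T x (p \<oplus>\<^bsub>P\<^esub> q) = T x p \<oplus>\<^bsub>P\<^esub> T x q"
  and T_scalar: "[|x \<in> X; p \<in> carrier P|] ==> T x (c \<odot>\<^bsub>P\<^esub> p) = c \<odot>\<^bsub>P\<^esub> T x p"
  and T_comp: "[|x \<in> X; p \<in> component P i|] ==> T x p \<in> component P (d x + i)"
begin

sublocale monoid_action P "word_monoid X" "foldr T"
proof (intro monoid_action.intro kspace_axioms monoid_word_monoid monoid_action_axioms.intro)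
 have closed: "foldr T w x \<in> carrier P" if "w \<in> lists X" "x \<in> carrier P" for w x
  using that by (induction w) (auto simp: T_closed)
 fix w assume w: "w \<in> carrier (word_monoid X)"
 then have w': "w \<in> lists X" by simp
 fix x assume x: "x \<in> carrier P"
 show "foldr T w x \<in> carrier P" using w' x by (rule closed)
 show "foldr T w (x \<oplus>\<^bsub>P\<^esub> y) = foldr T w x \<oplus>\<^bsub>P\<^esub> foldr T w y" if "y \<in> carrier P" for y
  using w' that x by (induction w) (auto simp: T_add closed)
 show "foldr T w (c \<odot>\<^bsub>P\<^esub> x) = c \<odot>\<^bsub>P\<^esub> foldr T w x" for c
  using w' x by (induction w) (auto simp: T_scalar closed)
qed auto

lemma operator_module_simps:
 "carrier (operator_module P T) = carrier P" "add (operator_module P T) = add P"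
 "zero (operator_module P T) = zero P" "component (operator_module P T) = component P"
 "smult (operator_module P T) = act_ext"
 by (simp_all add: operator_module_def act_ext_def fun_eq_iff)

lemma operator_module_scalar:
 "p \<in> carrier P ==> single [] c \<odot>\<^bsub>operator_module P T\<^esub> p = c \<odot>\<^bsub>P\<^esub> p"
 by (simp add: operator_module_simps act_ext_single)

lemma operator_module_graded: "graded_mod (graded_free_algebra X d) (operator_module P T)"
proof (rule graded_modI[OF graded_algebra_free])
 have ag: "abelian_group (operator_module P T)"
  by (rule abelian_group_cong[OF M.abelian_group_axioms]) (simp_all add: operator_module_simps)
 show "left_module (graded_free_algebra X d) (operator_module P T)"
 proof (rule left_moduleI[OF _ ag])
  show "ring (graded_free_algebra X d :: ('k, _) graded)"
   using graded_algebra_free unfolding graded_algebra_def k_algebra_def by blast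
 qed (auto simp: operator_module_simps graded_free_algebra_simps act_ext_closed act_ext_add_left
   act_ext_add_right act_ext_mult act_ext_one[simplified monoid_algebra_simps, simplified])
 show "direct_sum_grading (operator_module P T)"
  by (rule direct_sum_grading_cong[OF M.abelian_group_axioms M.direct_sum])
   (simp_all add: operator_module_simps)
 fix i j p and f :: "'x list \<Rightarrow>\<^sub>0 'k"
 assume f: "f \<in> component (graded_free_algebra X d) i" and p: "p \<in> component (operator_module P T) j"
 have p': "p \<in> component P j" using p by (simp add: operator_module_simps)
 have "foldr T w p \<in> component P ((\<Sum>x\<leftarrow>w. d x) + j)" if "w \<in> lists X" for w
  using that p' by (induction w) (auto intro: T_comp simp: add.assoc)
 then have "foldr T w p \<in> component P (i + j)" if "w \<in> keys f" for w
  using f that by (fastforce simp: graded_free_algebra_simps)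
 moreover have "c \<odot>\<^bsub>P\<^esub> x \<in> component P k" if "x \<in> component P k" for c x k
  using comp_smult[of c 0 x k] that by simp
 ultimately show "f \<odot>\<^bsub>operator_module P T\<^esub> p \<in> component (operator_module P T) (i + j)"
  by (auto simp: operator_module_simps act_ext_def lin_ext_def intro!: M.comp_finsum)
qed

end


subsection \<open>Quotient algebras\<close>

locale graded_ideal = graded_alg A + ideal I A for A :: "('k::field, 'a) graded" and I +
 assumes homogeneous: "x \<in> I ==> hpart A x i \<in> I"
begin

lemma graded_submodule_ideal: "graded_submodule base_field I A"
proof (rule graded_mod.graded_submoduleI[OF graded_mod_base_field])
 fix c x assume "x \<in> I"
 then show "c \<odot>\<^bsub>A\<^esub> x \<in> I"
  by (subst scalar_eq_mult) (auto simp: a_subset[THEN subsetD] I_l_closed S.scalar_closed)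
qed (auto simp: homogeneous a_subset[THEN subsetD])

lemmas quot_zero = graded_mod.quot_zero[OF graded_mod_base_field graded_submodule_ideal]
 and quot_add = graded_mod.quot_add[OF graded_mod_base_field graded_submodule_ideal]
 and quot_scalar = graded_mod.quot_smult[OF graded_mod_base_field graded_submodule_ideal, simplified]
 and quot_carrier_iff = graded_mod.quot_carrier_iff[OF graded_mod_base_field graded_submodule_ideal]
 and coset_closed = graded_mod.coset_closed[OF graded_mod_base_field graded_submodule_ideal]
 and coset_comp = graded_mod.coset_comp[OF graded_mod_base_field graded_submodule_ideal]
 and hpart_coset = graded_mod.hpart_coset[OF graded_mod_base_field graded_submodule_ideal]
 and additive_coset = graded_mod.additive_coset[OF graded_mod_base_field graded_submodule_ideal]

lemma quot_mult: "[|a \<in> carrier A; b \<in> carrier A|]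
  ==> (I +>\<^bsub>A\<^esub> a) \<otimes>\<^bsub>quot_graded A I\<^esub> (I +>\<^bsub>A\<^esub> b) = I +>\<^bsub>A\<^esub> (a \<otimes>\<^bsub>A\<^esub> b)"
 by (simp add: quot_graded_simps rcoset_mult_add)

lemma quot_one: "\<one>\<^bsub>quot_graded A I\<^esub> = I +>\<^bsub>A\<^esub> \<one>\<^bsub>A\<^esub>"
 by (simp add: quot_graded_simps)

lemma quot_graded_algebra: "graded_algebra (quot_graded A I)"
proof -
 interpret Q: graded_mod base_field "quot_graded A I"
  by (rule graded_mod.quot_graded_mod[OF graded_mod_base_field graded_submodule_ideal])
 have "ring (quot_graded A I)"
  by (rule ring_cong[OF quotient_is_ring])
   (auto simp: quot_graded_simps FactRing_def A_RCOSETS_def')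
 moreover have "kspace (quot_graded A I)"
  using Q.left_module_axioms by (simp add: left_module_base_field)
 ultimately have "k_algebra (quot_graded A I)"
  by (auto simp: k_algebra_def kspace_iff_module[symmetric] quot_carrier_iff quot_mult quot_scalar
    S.scalar_closed scalar_mult_assoc scalar_mult_right simp flip: scalar_mult_right)
 then show ?thesis
  unfolding graded_algebra_def using Q.M.direct_sum
  by (auto simp: quot_graded_simps(7) quot_mult quot_scalar A.comp_carrier quot_one
    intro: comp_one comp_mult comp_scalar)
qed

lemma quot_generated:
 assumes "alg_generated A G"
 shows "alg_generated (quot_graded A I) ((\<lambda>a. I +>\<^bsub>A\<^esub> a) ` G)"
proof -
 interpret Q: graded_alg "quot_graded A I" by unfold_locales (rule quot_graded_algebra)
 let ?H = "(\<lambda>a. I +>\<^bsub>A\<^esub> a) ` G"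
 have H: "?H \<subseteq> carrier (quot_graded A I)"
  using assms coset_closed by (auto simp: alg_generated_def)
 have "I +>\<^bsub>A\<^esub> a \<in> alg_closure (quot_graded A I) ?H" if "a \<in> carrier A" for a
  using assms that
 proof (induction a rule: generated_induct)
  case (scalar c)
  then show ?case using alg_closure.scalar[where c = c and A = "quot_graded A I" and G = ?H] by (simp add: quot_one quot_scalar)
 next
  case (add a b)
  then show ?case using alg_closure.add[of "I +>\<^bsub>A\<^esub> a" "quot_graded A I" ?H "I +>\<^bsub>A\<^esub> b"]
   by (simp add: quot_add)
 next
  case (mult a b)
  then show ?case using alg_closure.mult[of "I +>\<^bsub>A\<^esub> a" "quot_graded A I" ?H "I +>\<^bsub>A\<^esub> b"]
   by (simp add: quot_mult)
 qed (auto intro: alg_closure.gen)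
 then show ?thesis
  using H Q.alg_closure_closed[OF H] by (auto simp: alg_generated_def quot_carrier_iff)
qed

end

text \<open>The members of the generated ideal whose homogeneous parts also belong to it form an
  ideal containing the generators; closure under multiplication is reduced to homogeneous
  multipliers. By minimality this is the whole ideal.\<close>

lemma (in graded_alg) graded_ideal_genideal:
 assumes S: "S \<subseteq> (\<Union>i. component A i)"
 shows "graded_ideal A (Idl\<^bsub>A\<^esub> S)"
proof -
 have Sc: "S \<subseteq> carrier A" using S A.comp_carrier by auto
 interpret I: ideal "Idl\<^bsub>A\<^esub> S" A by (rule genideal_ideal[OF Sc])
 let ?J = "{x \<in> Idl\<^bsub>A\<^esub> S. \<forall>i. hpart A x i \<in> Idl\<^bsub>A\<^esub> S}"
 have "ideal ?J A"
 proof (rule idealI[OF ring_axioms])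
  show "subgroup ?J (add_monoid A)"
   using I.a_subset I.a_inv_closed
   by (auto simp: subgroup_def A.hpart_add A.hpart_zero A.hpart_minus subset_iff
     simp flip: a_inv_def)
  fix a x assume a: "a \<in> ?J" and x: "x \<in> carrier A"
  then have ac: "a \<in> carrier A" "!!i. hpart A a i \<in> carrier A" using I.a_subset by (auto simp: A.hpart_closed)
  have "hpart A (x \<otimes>\<^bsub>A\<^esub> a) i \<in> Idl\<^bsub>A\<^esub> S" for i using x
  proof (induction x rule: A.homogeneous_induct)
   case (homogeneous j y)
   then show ?case using a ac by (simp add: hpart_mult_left I.I_l_closed A.comp_carrier)
  qed (use a ac in \<open>simp_all add: l_distr A.hpart_add A.hpart_zero\<close>)
  then show "x \<otimes>\<^bsub>A\<^esub> a \<in> ?J" using a x by (auto simp: I.I_l_closed)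
  have "hpart A (a \<otimes>\<^bsub>A\<^esub> x) i \<in> Idl\<^bsub>A\<^esub> S" for i using x
  proof (induction x rule: A.homogeneous_induct)
   case (homogeneous j y)
   then show ?case using a ac by (simp add: hpart_mult_right I.I_r_closed A.comp_carrier)
  qed (use a ac in \<open>simp_all add: r_distr A.hpart_add A.hpart_zero\<close>)
  then show "a \<otimes>\<^bsub>A\<^esub> x \<in> ?J" using a x by (auto simp: I.I_r_closed)
 qed
 moreover have "S \<subseteq> ?J"
 proof
  fix s assume s: "s \<in> S"
  then obtain j where "s \<in> component A j" using S by auto
  then show "s \<in> ?J" using s genideal_self[OF Sc] by (auto simp: A.hpart_comp)
 qed
 ultimately have "Idl\<^bsub>A\<^esub> S \<subseteq> ?J" by (rule genideal_minimal)
 then show ?thesis by unfold_locales auto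
qed

text \<open>A coset acts through an arbitrary representative; this is sound as soon as the ideal
  annihilates the module (\<open>descend_smult\<close>).\<close>

definition descend_module :: "('a, 'u) graded => ('a set, 'u) graded" where
 "descend_module P = \<lparr>carrier = carrier P, mult = mult P, one = \<one>\<^bsub>P\<^esub>, zero = \<zero>\<^bsub>P\<^esub>, add = add P,
   smult = (\<lambda>X x. (SOME a. a \<in> X) \<odot>\<^bsub>P\<^esub> x), component = component P\<rparr>"

lemma descend_module_simps [simp]:
 "carrier (descend_module P) = carrier P" "add (descend_module P) = add P"
 "zero (descend_module P) = zero P" "component (descend_module P) = component P"
 by (simp_all add: descend_module_def)

context graded_ideal
begin

context
 fixes P :: "('a, 'u) graded"
 assumes P: "graded_mod A P" and annihilates: "!!a x. [|a \<in> I; x \<in> carrier P|] ==> a \<odot>\<^bsub>P\<^esub> x = \<zero>\<^bsub>P\<^esub>"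
begin

interpretation P: graded_mod A P by (rule P)

lemma descend_smult:
 assumes "a \<in> carrier A" "x \<in> carrier P"
 shows "(I +>\<^bsub>A\<^esub> a) \<odot>\<^bsub>descend_module P\<^esub> x = a \<odot>\<^bsub>P\<^esub> x"
proof -
 interpret abelian_subgroup I A by (rule graded_mod.abelian_subgroup[OF graded_mod_base_field graded_submodule_ideal])
 define b where "b = (SOME b. b \<in> I +>\<^bsub>A\<^esub> a)"
 have "b \<in> I +>\<^bsub>A\<^esub> a" unfolding b_def using a_rcos_self[OF assms(1)] by (rule someI)
 then have b: "b \<in> carrier A" "b \<ominus>\<^bsub>A\<^esub> a \<in> I" using assms by (auto simp: coset_mem)
 have "b \<odot>\<^bsub>P\<^esub> x \<ominus>\<^bsub>P\<^esub> a \<odot>\<^bsub>P\<^esub> x = \<zero>\<^bsub>P\<^esub>"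
  using annihilates[OF b(2) assms(2)] b(1) assms by (simp add: P.diff_smult)
 then show ?thesis
  using b assms by (simp add: P.M.diff_zero_iff P.smult_closed descend_module_def b_def[symmetric])
qed

lemma descend_graded_mod: "graded_mod (quot_graded A I) (descend_module P)"
proof (rule graded_modI[OF quot_graded_algebra])
 have ag: "abelian_group (descend_module P)"
  by (rule abelian_group_cong[OF P.M.abelian_group_axioms]) simp_all
 show "left_module (quot_graded A I) (descend_module P)"
 proof (rule left_moduleI[OF _ ag])
  show "ring (quot_graded A I)"
   using quot_graded_algebra by (simp add: graded_algebra_def k_algebra_def)
 qed (auto simp: quot_carrier_iff quot_add quot_mult quot_one descend_smult P.smult_closed
   P.smult_l_distr P.smult_r_distr P.smult_assoc1 P.smult_one)
 show "direct_sum_grading (descend_module P)"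
  by (rule direct_sum_grading_cong[OF P.M.abelian_group_axioms P.M.direct_sum]) simp_all
qed (auto simp: quot_graded_simps(7) descend_smult A.comp_carrier P.M.comp_carrier P.comp_smult)

end

end

lemma (in graded_mod) ideal_annihilator: "ideal {a \<in> carrier A. \<forall>x \<in> carrier M. a \<odot>\<^bsub>M\<^esub> x = \<zero>\<^bsub>M\<^esub>} A"
proof (rule idealI[OF A.ring_axioms])
 show "subgroup {a \<in> carrier A. \<forall>x \<in> carrier M. a \<odot>\<^bsub>M\<^esub> x = \<zero>\<^bsub>M\<^esub>} (add_monoid A)"
  by (auto simp: subgroup_def smult_l_distr zero_smult minus_smult simp flip: a_inv_def)
qed (auto simp: smult_assoc1 smult_closed smult_zero)

section \<open>Leavitt algebras\<close>

definition words :: "nat => nat => nat list set" where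
 "words n r = {w \<in> lists {0..n}. length w = r}"

lemma words_0: "words n 0 = {[]}"
 by (auto simp: words_def)

lemma words_Suc: "w \<in> words n (Suc r) \<longleftrightarrow> (\<exists>i v. w = i # v \<and> i \<le> n \<and> v \<in> words n r)"
 by (cases w) (auto simp: words_def)

lemma Cons_words: "i # v \<in> words n (Suc r) \<longleftrightarrow> i \<le> n \<and> v \<in> words n r"
 by (auto simp: words_def)

lemma words_lists: "w \<in> words n r ==> w \<in> lists {0..n}"
 by (auto simp: words_def)

lemma finite_words: "finite (words n r)"
 using finite_lists_length_eq[of "{0..n}" r] by (auto simp: words_def lists_eq_set intro: rev_finite_subset)

text \<open>Summation over \<open>words n r\<close> with the first letter innermost. For the
  products of \<open>Y (i # w)\<close> with \<open>X (i # w)\<close> the letters \<open>i\<close>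
  meet in the middle, so the inner sum is exactly where the relation \<open>sum_y_x\<close>
  applies.\<close>

primrec word_sum :: "('m, 'z) ring_scheme => nat => nat => (nat list => 'm) => 'm" where
 "word_sum M n 0 g = g []"
| "word_sum M n (Suc r) g = word_sum M n r (\<lambda>w. \<Oplus>\<^bsub>M\<^esub>i \<in> {0..n}. g (i # w))"

context abelian_group
begin

lemma word_sum_cong:
 "(!!w. w \<in> words n r ==> g w = h w \<and> h w \<in> carrier G) ==> word_sum G n r g = word_sum G n r h"
proof (induction r arbitrary: g h)
 case (Suc r)
 have "(\<Oplus>i \<in> {0..n}. g (i # w)) = (\<Oplus>i \<in> {0..n}. h (i # w)) \<and> (\<Oplus>i \<in> {0..n}. h (i # w)) \<in> carrier G"
  if "w \<in> words n r" for w
  using Suc.prems that by (intro conjI finsum_cong' finsum_closed) (auto simp: Cons_words)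
 then show ?case by (simp add: Suc.IH[of "\<lambda>w. \<Oplus>i \<in> {0..n}. g (i # w)"])
qed (simp add: words_0)

lemma word_sum_closed: "(!!w. w \<in> words n r ==> g w \<in> carrier G) ==> word_sum G n r g \<in> carrier G"
 by (induction r arbitrary: g) (auto simp: words_0 Cons_words intro!: finsum_closed)

lemma word_sum_mem:
 assumes "H \<subseteq> carrier G" "\<zero> \<in> H" "!!x y. [|x \<in> H; y \<in> H|] ==> x \<oplus> y \<in> H"
 shows "(!!w. w \<in> words n r ==> g w \<in> H) ==> word_sum G n r g \<in> H"
proof (induction r arbitrary: g)
 case (Suc r)
 have "(\<Oplus>i \<in> J. f i) \<in> H" if "f \<in> J \<rightarrow> H" for f and J :: "nat set"
  using that
 proof (induction J rule: infinite_finite_induct)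
  case (insert j J)
  then have "f j \<in> H" "f \<in> J \<rightarrow> H" "f j \<in> carrier G" "f \<in> J \<rightarrow> carrier G" using assms(1) by auto
  then show ?case using insert assms(3) by simp
 qed (use assms(2) in auto)
 then show ?case using Suc by (simp add: Cons_words)
qed (simp add: words_0)

lemma word_sum_delta:
 assumes "v \<in> words n r" "a \<in> carrier G"
 shows "word_sum G n r (\<lambda>w. if w = v then a else \<zero>) = a"
 using assms(1)
proof (induction r arbitrary: v)
 case (Suc r)
 then obtain i u where v: "v = i # u" "i \<le> n" "u \<in> words n r" by (auto simp: words_Suc)
 have "(\<Oplus>j \<in> {0..n}. if j # w = v then a else \<zero>) = (if w = u then a else \<zero>)" for w
 proof (cases "w = u")
  case True
  have "(\<Oplus>j \<in> {0..n}. if j # w = v then a else \<zero>) = (\<Oplus>j \<in> {i}. if j # w = v then a else \<zero>)"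
   using assms(2) v True by (intro finsum_eq_superset) auto
  then show ?thesis using True v assms(2) by simp
 next
  case False
  then have "(\<Oplus>j \<in> {0..n}. if j # w = v then a else \<zero>) = (\<Oplus>j \<in> {0..n}. \<zero>)"
   using v by (intro finsum_cong') auto
  then show ?thesis using False by simp
 qed
 then show ?case using Suc.IH[OF v(3)] by simp
qed (simp add: words_0)

end

lemma (in additive_map) word_sum:
 "(!!w. w \<in> words n r ==> g w \<in> carrier M)
  ==> f (word_sum M n r g) = word_sum N n r (\<lambda>w. f (g w))"
proof (induction r arbitrary: g)
 case (Suc r)
 have "f (word_sum M n (Suc r) g) = word_sum N n r (\<lambda>w. f (\<Oplus>\<^bsub>M\<^esub>i \<in> {0..n}. g (i # w)))"
  unfolding word_sum.simps using Suc.prems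
  by (intro Suc.IH M.finsum_closed) (auto simp: Cons_words)
 also have "\<dots> = word_sum N n r (\<lambda>w. \<Oplus>\<^bsub>N\<^esub>i \<in> {0..n}. f (g (i # w)))"
  using Suc.prems by (intro N.word_sum_cong conjI finsum N.finsum_closed) (auto simp: Cons_words closed)
 finally show ?case by simp
qed simp


subsection \<open>Normal forms and strong grading\<close>

text \<open>Only the degrees, the relations and generation are recorded, so the results hold for any
  algebra with such generators. The zero algebra is excluded later, by
  \<open>leavitt_nontrivial\<close>.\<close>

locale leavitt_alg = graded_alg L for L :: "('k::field, 'a) graded" (structure) +
 fixes n :: nat and x y :: "nat => 'a"
 assumes x_comp: "i \<le> n ==> x i \<in> component L 1"
  and y_comp: "i \<le> n ==> y i \<in> component L (- 1)"
  and x_y: "[|i \<le> n; j \<le> n|] ==> x i \<otimes> y j = (if i = j then \<one> else \<zero>)"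
  and sum_y_x: "(\<Oplus>i \<in> {0..n}. y i \<otimes> x i) = \<one>"
  and generated: "alg_generated L (x ` {0..n} \<union> y ` {0..n})"
begin

lemma x_closed: "i \<le> n ==> x i \<in> carrier L" and y_closed: "i \<le> n ==> y i \<in> carrier L"
 using x_comp y_comp A.comp_carrier by auto

definition X :: "nat list => 'a" where
 "X w = foldr (\<lambda>i z. x i \<otimes> z) w \<one>"

text \<open>\<open>Y\<close> reverses its argument, so that \<open>Y w\<close> is the adjoint of \<open>X w\<close>.\<close>

definition Y :: "nat list => 'a" where
 "Y w = fold (\<lambda>i z. y i \<otimes> z) w \<one>"

lemma X_simps [simp]: "X [] = \<one>" "X (i # w) = x i \<otimes> X w"
 by (simp_all add: X_def)

lemma X_comp: "w \<in> lists {0..n} ==> X w \<in> component L (int (length w))"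
proof (induction w)
 case (Cons i w)
 then show ?case using comp_mult[OF x_comp, of i "X w" "int (length w)"] by (simp add: algebra_simps)
qed (simp add: comp_one)

lemma X_closed: "w \<in> lists {0..n} ==> X w \<in> carrier L"
 using X_comp A.comp_carrier by blast

lemma X_append: "[|v \<in> lists {0..n}; w \<in> lists {0..n}|] ==> X (v @ w) = X v \<otimes> X w"
 by (induction v) (auto simp: X_closed x_closed m_assoc)

lemma Y_snoc: "Y (w @ [i]) = y i \<otimes> Y w" and Y_Nil [simp]: "Y [] = \<one>"
 by (simp_all add: Y_def)

lemma Y_comp: "w \<in> lists {0..n} ==> Y w \<in> component L (- int (length w))"
proof (induction w rule: rev_induct)
 case (snoc i w)
 then show ?case using comp_mult[OF y_comp, of i "Y w" "- int (length w)"]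
  by (simp add: algebra_simps Y_snoc)
qed (simp add: comp_one)

lemma Y_closed: "w \<in> lists {0..n} ==> Y w \<in> carrier L"
 using Y_comp A.comp_carrier by blast

lemma Y_append: "[|v \<in> lists {0..n}; w \<in> lists {0..n}|] ==> Y (v @ w) = Y w \<otimes> Y v"
 by (induction w rule: rev_induct)
  (auto simp: Y_closed y_closed m_assoc Y_snoc simp flip: append_assoc)

lemma Y_Cons: "[|i \<le> n; w \<in> lists {0..n}|] ==> Y (i # w) = Y w \<otimes> y i"
 using Y_append[of "[i]" w] Y_snoc[of "[]" i] by (simp add: y_closed)

lemma X_words: "w \<in> words n r ==> X w \<in> component L (int r)"
 and Y_words: "w \<in> words n r ==> Y w \<in> component L (- int r)"
 using X_comp[of w] Y_comp[of w] by (auto simp: words_def)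

lemma X_words_closed: "w \<in> words n r ==> X w \<in> carrier L"
 and Y_words_closed: "w \<in> words n r ==> Y w \<in> carrier L"
 using X_words Y_words A.comp_carrier by blast+

text \<open>The letters at the ends of the two words meet first, so the induction cancels the tails
  and compares the head letters last.\<close>

lemma X_Y: "[|v \<in> words n r; w \<in> words n r|] ==> X v \<otimes> Y w = (if v = w then \<one> else \<zero>)"
proof (induction r arbitrary: v w)
 case (Suc r)
 then obtain i v' j w' where vw: "v = i # v'" "i \<le> n" "v' \<in> words n r" "w = j # w'" "j \<le> n" "w' \<in> words n r"
  by (auto simp: words_Suc)
 note l = words_lists[OF vw(3)] words_lists[OF vw(6)]
 have "X v \<otimes> Y w = x i \<otimes> (X v' \<otimes> Y w') \<otimes> y j"
  using vw l by (simp add: Y_Cons X_closed Y_closed x_closed y_closed m_assoc del: in_lists_conv_set)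
 also have "\<dots> = (if v' = w' then x i \<otimes> y j else \<zero>)"
  using vw Suc.IH[of v' w'] by (simp add: x_closed y_closed)
 finally show ?case using vw by (auto simp: x_y)
qed (simp add: words_0)

lemma sum_Y_X: "word_sum L n r (\<lambda>w. Y w \<otimes> X w) = \<one>"
proof (induction r)
 case (Suc r)
 have "(\<Oplus>i \<in> {0..n}. Y (i # w) \<otimes> X (i # w)) = Y w \<otimes> X w" if w: "w \<in> words n r" for w
 proof -
  note l = words_lists[OF w]
  interpret Yw: additive_map L L "\<lambda>z. Y w \<otimes> z" by (rule additive_mult_left[OF Y_closed[OF l]])
  interpret Xw: additive_map L L "\<lambda>z. z \<otimes> X w" by (rule additive_mult_right[OF X_closed[OF l]])
  have "(\<Oplus>i \<in> {0..n}. Y (i # w) \<otimes> X (i # w)) = (\<Oplus>i \<in> {0..n}. Y w \<otimes> (y i \<otimes> x i \<otimes> X w))"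
   using l by (intro finsum_cong')
    (auto simp: Y_Cons X_closed Y_closed x_closed y_closed m_assoc simp del: in_lists_conv_set)
  also have "\<dots> = Y w \<otimes> (\<Oplus>i \<in> {0..n}. y i \<otimes> x i \<otimes> X w)"
   using l by (intro Yw.finsum[symmetric]) (auto simp: X_closed x_closed y_closed simp del: in_lists_conv_set)
  also have "(\<Oplus>i \<in> {0..n}. y i \<otimes> x i \<otimes> X w) = (\<Oplus>i \<in> {0..n}. y i \<otimes> x i) \<otimes> X w"
   by (intro Xw.finsum[symmetric]) (auto simp: x_closed y_closed)
  finally show ?thesis using l by (simp add: sum_y_x X_closed del: in_lists_conv_set)
 qed
 then have "word_sum L n (Suc r) (\<lambda>w. Y w \<otimes> X w) = word_sum L n r (\<lambda>w. Y w \<otimes> X w)"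
  unfolding word_sum.simps
  by (intro word_sum_cong) (auto intro!: m_closed X_closed Y_closed dest: words_lists simp del: in_lists_conv_set)
 with Suc show ?case by simp
qed simp

text \<open>The left word always has length \<open>r\<close>, while \<open>Q\<close> restricts the
  length of the right word: no restriction in general, equality with \<open>r\<close> in degree
  zero. Adding one monomial at a time gives an induction principle without indexed families of
  coefficients.\<close>

inductive_set normal_forms :: "nat => (nat => bool) => 'a set" for r Q where
 zero: "\<zero> \<in> normal_forms r Q"
| add: "[|v \<in> words n r; w \<in> words n s; Q s; z \<in> normal_forms r Q|]
  ==> c \<odot>\<^bsub>L\<^esub> (Y v \<otimes> X w) \<oplus> z \<in> normal_forms r Q"

lemma monomial_closed: "[|v \<in> words n r; w \<in> words n s|] ==> c \<odot>\<^bsub>L\<^esub> (Y v \<otimes> X w) \<in> carrier L"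
 by (intro S.scalar_closed m_closed X_closed Y_closed words_lists)

lemma normal_forms_closed: "z \<in> normal_forms r Q ==> z \<in> carrier L"
 by (induction rule: normal_forms.induct) (auto simp: monomial_closed)

lemma normal_forms_monomial:
 "[|v \<in> words n r; w \<in> words n s; Q s|] ==> c \<odot>\<^bsub>L\<^esub> (Y v \<otimes> X w) \<in> normal_forms r Q"
 using normal_forms.add[OF _ _ _ normal_forms.zero, of v r w s Q c] by (simp add: monomial_closed)

lemma normal_forms_add: "[|z \<in> normal_forms r Q; z' \<in> normal_forms r Q|] ==> z \<oplus> z' \<in> normal_forms r Q"
proof (induction rule: normal_forms.induct)
 case (add v w s z c)
 then have "c \<odot>\<^bsub>L\<^esub> (Y v \<otimes> X w) \<oplus> (z \<oplus> z') \<in> normal_forms r Q" by (intro normal_forms.add)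
 then show ?case using add normal_forms_closed by (simp add: a_assoc monomial_closed)
qed (use normal_forms_closed in auto)

lemma normal_forms_map:
 assumes f: "add_map L L f" and mon: "!!c v w s. [|v \<in> words n r; w \<in> words n s; Q s|]
   ==> f (c \<odot>\<^bsub>L\<^esub> (Y v \<otimes> X w)) \<in> normal_forms r' Q'"
  and z: "z \<in> normal_forms r Q"
 shows "f z \<in> normal_forms r' Q'"
proof -
 interpret f: additive_map L L f by unfold_locales (rule f)
 show ?thesis using z
 proof (induction rule: normal_forms.induct)
  case (add v w s z c)
  then show ?case using normal_forms_closed[OF add(4)]
   by (simp add: f.add monomial_closed normal_forms_add mon)
 qed (simp add: f.zero normal_forms.zero)
qed

lemma normal_forms_one: "\<one> \<in> normal_forms r (\<lambda>_. True)"
proof -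
 have "word_sum L n r (\<lambda>w. Y w \<otimes> X w) \<in> normal_forms r (\<lambda>_. True)"
 proof (rule word_sum_mem)
  fix w assume w: "w \<in> words n r"
  then have "1 \<odot>\<^bsub>L\<^esub> (Y w \<otimes> X w) \<in> normal_forms r (\<lambda>_. True)" by (intro normal_forms_monomial) auto
  then show "Y w \<otimes> X w \<in> normal_forms r (\<lambda>_. True)"
   using words_lists[OF w] by (simp add: S.scalar_one X_closed Y_closed del: in_lists_conv_set)
 qed (auto simp: normal_forms_closed normal_forms.zero normal_forms_add)
 then show ?thesis by (simp add: sum_Y_X)
qed

text \<open>Since \<open>Y\<close> reverses words, the last letter of the left word is the leftmost
  factor; \<open>x i\<close> either cancels it or kills the monomial, so the length of the left word
  drops by one.\<close>

lemma normal_forms_x: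
 assumes i: "i \<le> n" and z: "z \<in> normal_forms (Suc r) (\<lambda>_. True)"
 shows "x i \<otimes> z \<in> normal_forms r (\<lambda>_. True)"
proof (rule normal_forms_map[OF additive_map.add_map[OF additive_mult_left[OF x_closed[OF i]]] _ z])
 fix c v w s assume v: "v \<in> words n (Suc r)" and w: "w \<in> words n s"
 obtain v' j where v': "v = v' @ [j]" using v by (cases v rule: rev_cases) (auto simp: words_def)
 then have j: "j \<le> n" "v' \<in> words n r" using v by (auto simp: words_def)
 note l = words_lists[OF w] words_lists[OF j(2)]
 have "x i \<otimes> (c \<odot>\<^bsub>L\<^esub> (Y v \<otimes> X w)) = c \<odot>\<^bsub>L\<^esub> (x i \<otimes> y j \<otimes> (Y v' \<otimes> X w))"
  using i j l by (simp add: v' Y_snoc scalar_mult_right[symmetric] X_closed Y_closed x_closed y_closed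
    m_assoc del: in_lists_conv_set)
 also have "\<dots> = (if i = j then c \<odot>\<^bsub>L\<^esub> (Y v' \<otimes> X w) else \<zero>)"
  using i j l by (simp add: x_y X_closed Y_closed S.scalar_zero del: in_lists_conv_set)
 finally show "x i \<otimes> (c \<odot>\<^bsub>L\<^esub> (Y v \<otimes> X w)) \<in> normal_forms r (\<lambda>_. True)"
  using normal_forms_monomial[OF j(2) w] normal_forms.zero by (simp split: if_splits)
qed

lemma normal_forms_y:
 assumes i: "i \<le> n" and z: "z \<in> normal_forms r (\<lambda>_. True)"
 shows "y i \<otimes> z \<in> normal_forms (Suc r) (\<lambda>_. True)"
proof (rule normal_forms_map[OF additive_map.add_map[OF additive_mult_left[OF y_closed[OF i]]] _ z])
 fix c v w s assume v: "v \<in> words n r" and w: "w \<in> words n s"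
 note l = words_lists[OF w] words_lists[OF v]
 have "y i \<otimes> (c \<odot>\<^bsub>L\<^esub> (Y v \<otimes> X w)) = c \<odot>\<^bsub>L\<^esub> (Y (v @ [i]) \<otimes> X w)"
  using i l by (simp add: Y_snoc scalar_mult_right[symmetric] X_closed Y_closed y_closed
    m_assoc del: in_lists_conv_set)
 moreover have "v @ [i] \<in> words n (Suc r)" using v i by (auto simp: words_def)
 ultimately show "y i \<otimes> (c \<odot>\<^bsub>L\<^esub> (Y v \<otimes> X w)) \<in> normal_forms (Suc r) (\<lambda>_. True)"
  using normal_forms_monomial[OF _ w] by simp
qed

text \<open>Only left multiplication by generators is controlled, so the induction shows that
  \<open>a\<close> times any element with normal forms has normal forms, and is finally applied to
  the unit. Asking for every length from a threshold on lets the summands of a sum be brought to a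
  common length.\<close>

lemma normal_form:
 assumes "a \<in> carrier L"
 shows "\<exists>r\<^sub>0. \<forall>r \<ge> r\<^sub>0. a \<in> normal_forms r (\<lambda>_. True)"
proof -
 let ?N = "\<lambda>r\<^sub>0 z. \<forall>r \<ge> r\<^sub>0. z \<in> normal_forms r (\<lambda>_. True)"
 have "\<exists>s. ?N s (a \<otimes> z)" if "?N r z" "z \<in> carrier L" for r z
  using generated assms that
 proof (induction a arbitrary: r z rule: generated_induct)
  case (scalar c)
  have "c \<odot>\<^bsub>L\<^esub> \<one> \<otimes> z \<in> normal_forms s (\<lambda>_. True)" if "s \<ge> r" for s
   unfolding scalar_eq_mult[OF scalar(2), symmetric]
  proof (rule normal_forms_map[where f = "\<lambda>z. c \<odot>\<^bsub>L\<^esub> z" and z = z])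
   show "add_map L L (\<lambda>z. c \<odot>\<^bsub>L\<^esub> z)"
    by (rule additive_map.add_map[OF S.additive_scalar])
   show "z \<in> normal_forms s (\<lambda>_. True)" using scalar that by simp
  next
   fix d v w t assume vw: "v \<in> words n s" "w \<in> words n t"
   then show "c \<odot>\<^bsub>L\<^esub> (d \<odot>\<^bsub>L\<^esub> (Y v \<otimes> X w)) \<in> normal_forms s (\<lambda>_. True)"
    using normal_forms_monomial[OF vw, of "\<lambda>_. True" "c * d"] words_lists[OF vw(1)] words_lists[OF vw(2)]
    by (subst S.scalar_mult[symmetric]) (simp_all add: X_closed Y_closed del: in_lists_conv_set)
  qed
  then show ?case by (intro exI[of _ r]) simp
 next
  case (gen g)
  then consider i where "i \<le> n" "g = x i" | i where "i \<le> n" "g = y i" by auto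
  then show ?case
  proof cases
   case 1
   then show ?thesis using gen by (auto intro!: exI[of _ r] normal_forms_x)
  next
   case 2
   have "y i \<otimes> z \<in> normal_forms s (\<lambda>_. True)" if "s \<ge> Suc r" for s
    using normal_forms_y[OF 2(1), of z "s - 1"] gen(2) that by (cases s) auto
   then show ?thesis unfolding 2(2) by (intro exI[of _ "Suc r"]) simp
  qed
 next
  case (add a b)
  obtain s where "?N s (a \<otimes> z)" using add.IH(1)[OF add.prems] ..
  moreover obtain t where "?N t (b \<otimes> z)" using add.IH(2)[OF add.prems] ..
  ultimately have "?N (max s t) ((a \<oplus> b) \<otimes> z)"
   using add by (simp add: l_distr normal_forms_add)
  then show ?case ..
 next
  case (mult a b)
  obtain s where s: "?N s (b \<otimes> z)" using mult.IH(2)[OF mult.prems] ..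
  have "b \<otimes> z \<in> carrier L" using mult by simp
  then obtain t where "?N t (a \<otimes> (b \<otimes> z))" using mult.IH(1)[OF s] by auto
  then show ?case using mult by (intro exI[of _ t]) (simp add: m_assoc)
 qed
 from this[of 0 \<one>] show ?thesis using assms normal_forms_one by auto
qed

text \<open>Projecting a normal form to degree zero keeps just the monomials whose right word is as
  long as the left one.\<close>

lemma normal_form_zero:
 assumes a: "a \<in> component L 0"
 shows "\<exists>r\<^sub>0. \<forall>r \<ge> r\<^sub>0. a \<in> normal_forms r (\<lambda>s. s = r)"
proof -
 have ac: "a \<in> carrier L" using a by (rule A.comp_carrier)
 obtain r\<^sub>0 where r: "!!r. r \<ge> r\<^sub>0 ==> a \<in> normal_forms r (\<lambda>_. True)"
  using normal_form[OF ac] by blast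
 have "a \<in> normal_forms r (\<lambda>s. s = r)" if "r \<ge> r\<^sub>0" for r
 proof -
  have "hpart L a 0 \<in> normal_forms r (\<lambda>s. s = r)"
  proof (rule normal_forms_map[OF additive_map.add_map[OF A.additive_hpart] _ r[OF that]])
   fix c v w s assume vw: "v \<in> words n r" "w \<in> words n s"
   then have "c \<odot>\<^bsub>L\<^esub> (Y v \<otimes> X w) \<in> component L (- int r + int s)"
    by (intro comp_scalar comp_mult X_words Y_words)
   then have "hpart L (c \<odot>\<^bsub>L\<^esub> (Y v \<otimes> X w)) 0 = (if s = r then c \<odot>\<^bsub>L\<^esub> (Y v \<otimes> X w) else \<zero>)"
    by (simp add: A.hpart_comp)
   then show "hpart L (c \<odot>\<^bsub>L\<^esub> (Y v \<otimes> X w)) 0 \<in> normal_forms r (\<lambda>s. s = r)"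
    using normal_forms_monomial[OF vw, of "\<lambda>s. s = r" c] normal_forms.zero by simp
  qed
  then show ?thesis using a by (simp add: A.hpart_comp)
 qed
 then show ?thesis by blast
qed

text \<open>For j \<ge> 0 one word already gives the unit as \<open>X w \<otimes> Y w\<close>; for
  negative j the sum of all \<open>Y w \<otimes> X w\<close> of length -j is used.\<close>

lemma one_mem_ideal_prod: "\<one> \<in> component L j \<cdot>\<^bsub>L\<^esub> component L (- j)"
proof (cases "j \<ge> 0")
 case True
 define w where "w = replicate (nat j) (0::nat)"
 have w: "w \<in> words n (nat j)" by (auto simp: w_def words_def)
 then have "X w \<otimes> Y w \<in> component L j \<cdot>\<^bsub>L\<^esub> component L (- j)"
  using True X_comp[of w] Y_comp[of w] by (intro ideal_prod.prod) (auto simp: words_def)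
 then show ?thesis using X_Y[OF w w] by simp
next
 case False
 let ?H = "component L j \<cdot>\<^bsub>L\<^esub> component L (- j)"
 have "word_sum L n (nat (- j)) (\<lambda>w. Y w \<otimes> X w) \<in> ?H"
 proof (rule word_sum_mem)
  show "?H \<subseteq> carrier L"
  proof
   fix z assume "z \<in> ?H"
   then show "z \<in> carrier L" by induction (auto simp: A.comp_carrier)
  qed
  show "\<zero> \<in> ?H"
   using ideal_prod.prod[OF A.comp_zero[of j] A.comp_zero[of "- j"], of L] by simp
  show "Y w \<otimes> X w \<in> ?H" if "w \<in> words n (nat (- j))" for w
   using that False X_comp[of w] Y_comp[of w] by (intro ideal_prod.prod) (auto simp: words_def)
 qed (rule ideal_prod.sum)
 then show ?thesis by (simp add: sum_Y_X)
qed

lemma strongly_graded: "strongly_graded L"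
proof -
 have "component L j \<cdot>\<^bsub>L\<^esub> component L (- j) = component L 0" for j
 proof (intro equalityI subsetI)
  fix z assume "z \<in> component L j \<cdot>\<^bsub>L\<^esub> component L (- j)"
  then show "z \<in> component L 0"
   by induction (use comp_mult[of _ j _ "- j"] in \<open>auto intro: A.comp_add\<close>)
 next
  fix z assume z: "z \<in> component L 0"
  \<comment> \<open>Left multiplication by degree zero elements preserves the product, so it
    suffices that the product contains the unit.\<close>
  have "z \<otimes> a \<in> component L j \<cdot>\<^bsub>L\<^esub> component L (- j) \<and> a \<in> carrier L"
   if "a \<in> component L j \<cdot>\<^bsub>L\<^esub> component L (- j)" for a
   using that
  proof induction
   case (prod a b)
   then have "z \<otimes> a \<otimes> b \<in> component L j \<cdot>\<^bsub>L\<^esub> component L (- j)"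
    using comp_mult[OF z, of a j] by (intro ideal_prod.prod) auto
   then show ?case using z prod by (simp add: m_assoc A.comp_carrier)
  next
   case (sum a b)
   then show ?case using z by (auto simp: r_distr A.comp_carrier intro: ideal_prod.sum)
  qed
  from this[OF one_mem_ideal_prod] show "z \<in> component L j \<cdot>\<^bsub>L\<^esub> component L (- j)"
   using z by (simp add: A.comp_carrier)
 qed
 then show ?thesis by (simp add: strongly_graded_def graded_algebra)
qed

lemma sum_Y_X_smult:
 assumes M: "graded_mod L M" and p: "p \<in> carrier M"
 shows "word_sum M n r (\<lambda>w. Y w \<odot>\<^bsub>M\<^esub> (X w \<odot>\<^bsub>M\<^esub> p)) = p"
proof -
 interpret M: graded_mod L M by fact
 interpret ap: additive_map L M "\<lambda>a. a \<odot>\<^bsub>M\<^esub> p" by (rule M.additive_smult_left[OF p])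
 have "word_sum M n r (\<lambda>w. Y w \<odot>\<^bsub>M\<^esub> (X w \<odot>\<^bsub>M\<^esub> p)) = word_sum M n r (\<lambda>w. (Y w \<otimes> X w) \<odot>\<^bsub>M\<^esub> p)"
  using p by (intro M.M.word_sum_cong)
   (auto simp: M.smult_assoc1 M.smult_closed X_words_closed Y_words_closed)
 also have "\<dots> = word_sum L n r (\<lambda>w. Y w \<otimes> X w) \<odot>\<^bsub>M\<^esub> p"
  by (rule ap.word_sum[symmetric]) (auto simp: X_words_closed Y_words_closed)
 finally show ?thesis using p by (simp add: sum_Y_X M.smult_one)
qed

end


subsection \<open>The Leavitt algebra and its modules\<close>

definition leavitt_coset :: "nat => (leavitt_gen list \<Rightarrow>\<^sub>0 'k::field) => (leavitt_gen list \<Rightarrow>\<^sub>0 'k) set" where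
 "leavitt_coset n f = Idl\<^bsub>leavitt_free n\<^esub> (leavitt_relations n) +>\<^bsub>leavitt_free n\<^esub> f"

definition leavitt_x :: "nat => nat => (leavitt_gen list \<Rightarrow>\<^sub>0 'k::field) set" where
 "leavitt_x n i = leavitt_coset n (single [Gen i] 1)"

definition leavitt_y :: "nat => nat => (leavitt_gen list \<Rightarrow>\<^sub>0 'k::field) set" where
 "leavitt_y n i = leavitt_coset n (single [Gen_star i] 1)"

context
 fixes n :: nat
begin

abbreviation (input) "LF \<equiv> leavitt_free n :: ('k::field, leavitt_gen list \<Rightarrow>\<^sub>0 'k) graded"

interpretation F: graded_alg LF
 by unfold_locales (simp add: leavitt_free_def graded_algebra_free)

lemmas leavitt_free_simps = graded_free_algebra_simps[of "Gen ` {0..n} \<union> Gen_star ` {0..n}" leavitt_deg,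
  folded leavitt_free_def]

lemma leavitt_free_sum:
 "finite J ==> g \<in> J \<rightarrow> carrier LF ==> finsum LF g J = sum g J"
 by (induction J rule: finite_induct) (auto simp: leavitt_free_simps)

lemma leavitt_free_minus: "f \<in> carrier LF ==> \<ominus>\<^bsub>LF\<^esub> f = - f"
 by (intro F.minus_equality) (auto simp: leavitt_free_simps in_keys_iff)

lemma leavitt_relations_comp: "leavitt_relations n \<subseteq> component LF 0"
proof -
 let ?K = "{w. w \<in> lists (Gen ` {0..n} \<union> Gen_star ` {0..n}) \<and> (\<Sum>x\<leftarrow>w. leavitt_deg x) = 0}"
 have comp: "component LF 0 = {f. keys f \<subseteq> ?K}"
  unfolding leavitt_free_simps by blast
 have sub: "f - g \<in> component LF 0" if "f \<in> component LF 0" "g \<in> component LF 0" for f g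
  using F.A.comp_diff[OF that] that F.A.comp_carrier[of g 0]
  by (simp add: a_minus_def leavitt_free_minus leavitt_free_simps(5))
 have mono: "single w c \<in> component LF 0" if "w \<in> ?K" for w c
  using that by (auto simp: comp simp del: in_lists_conv_set)
 have "(\<Sum>i \<in> {0..n}. single [Gen_star i, Gen i] 1) \<in> component LF 0"
 proof -
  have "(\<Oplus>\<^bsub>LF\<^esub>i \<in> {0..n}. single [Gen_star i, Gen i] 1) \<in> component LF 0"
   by (intro F.A.comp_finsum) (auto intro!: mono)
  then show ?thesis
   by (subst (asm) leavitt_free_sum) (auto simp: leavitt_free_simps)
 qed
 then show ?thesis unfolding leavitt_relations_def by (auto intro!: sub mono)
qed

lemma graded_ideal_leavitt: "graded_ideal LF (Idl\<^bsub>LF\<^esub> (leavitt_relations n))"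
 using leavitt_relations_comp by (intro F.graded_ideal_genideal) auto

interpretation I: graded_ideal LF "Idl\<^bsub>LF\<^esub> (leavitt_relations n)"
 by (rule graded_ideal_leavitt)

lemma leavitt_relation_coset:
 assumes "f - g \<in> leavitt_relations n" "f \<in> carrier LF" "g \<in> carrier LF"
 shows "leavitt_coset n f = leavitt_coset n (g :: leavitt_gen list \<Rightarrow>\<^sub>0 'k::field)"
proof -
 have "leavitt_relations n \<subseteq> carrier LF" using leavitt_relations_comp F.A.comp_carrier by blast
 then have "f - g \<in> Idl\<^bsub>LF\<^esub> (leavitt_relations n)" using F.genideal_self assms(1) by blast
 then show ?thesis using assms(2,3)
  by (simp add: leavitt_coset_def I.coset_eq_iff a_minus_def leavitt_free_minus leavitt_free_simps(5))
qed

lemma single_leavitt_carrier: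
 "w \<in> lists (Gen ` {0..n} \<union> Gen_star ` {0..n}) ==> single w c \<in> carrier LF"
 by (auto simp: leavitt_free_simps simp del: in_lists_conv_set)

lemma leavitt_alg_leavitt:
 "leavitt_alg (leavitt n :: ('k::field, (leavitt_gen list \<Rightarrow>\<^sub>0 'k) set) graded) n (leavitt_x n) (leavitt_y n)"
proof -
 let ?L = "leavitt n :: ('k, (leavitt_gen list \<Rightarrow>\<^sub>0 'k) set) graded"
 let ?X = "Gen ` {0..n} \<union> Gen_star ` {0..n}"
 interpret L: graded_alg ?L
  unfolding leavitt_def by unfold_locales (rule I.quot_graded_algebra)
 have gens: "single [Gen i] (1::'k) \<in> carrier LF" "single [Gen_star i] (1::'k) \<in> carrier LF"
  if "i \<le> n" for i
  using that by (auto intro!: single_leavitt_carrier)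
 have mult: "leavitt_coset n f \<otimes>\<^bsub>?L\<^esub> leavitt_coset n g = leavitt_coset n (f \<otimes>\<^bsub>LF\<^esub> g)"
  if "f \<in> carrier LF" "g \<in> carrier LF" for f g
  using that by (simp add: leavitt_def leavitt_coset_def I.quot_mult)
 have mult1: "single v (1::'k) \<otimes>\<^bsub>LF\<^esub> single w 1 = single (v @ w) 1" for v w
  by (simp add: leavitt_free_def free_algebra_mult_single)
 have one: "\<one>\<^bsub>?L\<^esub> = leavitt_coset n (single [] (1::'k))"
  by (simp add: leavitt_def leavitt_coset_def I.quot_one leavitt_free_simps)
 have zero: "\<zero>\<^bsub>?L\<^esub> = leavitt_coset n (0 :: leavitt_gen list \<Rightarrow>\<^sub>0 'k)"
  by (simp add: leavitt_def leavitt_coset_def I.quot_zero leavitt_free_simps)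
 show ?thesis
 proof unfold_locales
  fix i assume i: "i \<le> n"
  then show "leavitt_x n i \<in> component ?L 1" "leavitt_y n i \<in> component ?L (- 1)"
   unfolding leavitt_x_def leavitt_y_def leavitt_def leavitt_coset_def
   by (auto intro!: I.coset_comp simp: leavitt_free_simps)
  fix j assume j: "j \<le> n"
  have "single [Gen i, Gen_star j] 1 - single [] (if i = j then 1 else (0::'k))
    \<in> leavitt_relations n"
   using i j by (auto simp: leavitt_relations_def)
  then have "leavitt_coset n (single [Gen i, Gen_star j] 1)
    = leavitt_coset n (single [] (if i = j then 1 else (0::'k)))"
   using i j by (intro leavitt_relation_coset single_leavitt_carrier) auto
  then show "leavitt_x n i \<otimes>\<^bsub>?L\<^esub> leavitt_y n j = (if i = j then \<one>\<^bsub>?L\<^esub> else \<zero>\<^bsub>?L\<^esub>)"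
   using i j by (auto simp: leavitt_x_def leavitt_y_def mult mult1 gens one zero split: if_splits)
 next
  interpret q: additive_map LF ?L "leavitt_coset n"
   using I.additive_coset by (simp add: leavitt_def leavitt_coset_def[abs_def])
  have c: "single [Gen_star i, Gen i] (1::'k) \<in> carrier LF" if "i \<le> n" for i
   using that by (intro single_leavitt_carrier) auto
  have "(\<Oplus>\<^bsub>?L\<^esub>i \<in> {0..n}. leavitt_y n i \<otimes>\<^bsub>?L\<^esub> leavitt_x n i)
    = (\<Oplus>\<^bsub>?L\<^esub>i \<in> {0..n}. leavitt_coset n (single [Gen_star i, Gen i] 1))"
   by (intro L.finsum_cong') (auto simp: leavitt_x_def leavitt_y_def mult mult1 gens q.closed c)
  also have "\<dots> = leavitt_coset n (\<Oplus>\<^bsub>LF\<^esub>i \<in> {0..n}. single [Gen_star i, Gen i] 1)"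
   by (intro q.finsum[symmetric]) (auto simp: c)
  also have "(\<Oplus>\<^bsub>LF\<^esub>i \<in> {0..n}. single [Gen_star i, Gen i] (1::'k))
    = (\<Sum>i \<in> {0..n}. single [Gen_star i, Gen i] 1)"
   by (intro leavitt_free_sum) (auto simp: c)
  also have "leavitt_coset n \<dots> = leavitt_coset n (single [] (1::'k))"
  proof (rule leavitt_relation_coset)
   have "(\<Oplus>\<^bsub>LF\<^esub>i \<in> {0..n}. single [Gen_star i, Gen i] (1::'k)) \<in> carrier LF"
    by (intro F.finsum_closed) (auto simp: c)
   then show "(\<Sum>i \<in> {0..n}. single [Gen_star i, Gen i] (1::'k)) \<in> carrier LF"
    by (subst (asm) leavitt_free_sum) (auto simp: c)
  qed (auto simp: leavitt_relations_def leavitt_free_simps)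
  finally show "(\<Oplus>\<^bsub>?L\<^esub>i \<in> {0..n}. leavitt_y n i \<otimes>\<^bsub>?L\<^esub> leavitt_x n i) = \<one>\<^bsub>?L\<^esub>"
   by (simp add: one)
 next
  have "alg_generated LF ((\<lambda>x. single [x] (1::'k)) ` ?X)"
   unfolding leavitt_free_def by (rule alg_generated_free)
  from I.quot_generated[OF this]
  show "alg_generated ?L (leavitt_x n ` {0..n} \<union> leavitt_y n ` {0..n})"
   by (simp add: leavitt_def image_Un image_image leavitt_x_def leavitt_y_def leavitt_coset_def)
 qed
qed

text \<open>The universal property of the presentation, in terms of modules: operators satisfying
  the Leavitt relations make \<open>P\<close> a module over the free algebra whose annihilator is an
  ideal containing the relations, so the action descends to \<open>leavitt n\<close>.\<close>

lemma leavitt_module: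
 fixes P :: "('k::field, 'p) graded"
 assumes T: "graded_operators P (Gen ` {0..n} \<union> Gen_star ` {0..n}) leavitt_deg T"
  and xy: "!!i j p. [|i \<le> n; j \<le> n; p \<in> carrier P|]
   ==> T (Gen i) (T (Gen_star j) p) = (if i = j then p else \<zero>\<^bsub>P\<^esub>)"
  and yx: "!!p. p \<in> carrier P ==> (\<Oplus>\<^bsub>P\<^esub>i \<in> {0..n}. T (Gen_star i) (T (Gen i) p)) = p"
 defines "M \<equiv> descend_module (operator_module P T)"
 shows "graded_mod (leavitt n) M" "carrier M = carrier P" "add M = add P" "zero M = zero P"
  "component M = component P"
  "!!i p. [|i \<le> n; p \<in> carrier P|] ==> leavitt_x n i \<odot>\<^bsub>M\<^esub> p = T (Gen i) p"
  "!!i p. [|i \<le> n; p \<in> carrier P|] ==> leavitt_y n i \<odot>\<^bsub>M\<^esub> p = T (Gen_star i) p"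
  "!!c p. p \<in> carrier P ==> (c \<odot>\<^bsub>leavitt n\<^esub> \<one>\<^bsub>leavitt n\<^esub>) \<odot>\<^bsub>M\<^esub> p = c \<odot>\<^bsub>P\<^esub> p"
proof -
 interpret T: graded_operators P "Gen ` {0..n} \<union> Gen_star ` {0..n}" leavitt_deg T by (rule T)
 let ?P = "operator_module P T"
 interpret P: graded_mod LF ?P
  unfolding leavitt_free_def by (rule T.operator_module_graded)
 note [simp] = T.operator_module_simps
 let ?Ann = "{f \<in> carrier LF. \<forall>p \<in> carrier ?P. f \<odot>\<^bsub>?P\<^esub> p = \<zero>\<^bsub>?P\<^esub>}"
 have word: "single w c \<odot>\<^bsub>?P\<^esub> p = c \<odot>\<^bsub>P\<^esub> foldr T w p"
  if "w \<in> lists (Gen ` {0..n} \<union> Gen_star ` {0..n})" "p \<in> carrier P" for w c p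
  using that by (simp add: T.act_ext_single)
 have diff: "(f - g) \<odot>\<^bsub>?P\<^esub> p = f \<odot>\<^bsub>?P\<^esub> p \<ominus>\<^bsub>?P\<^esub> g \<odot>\<^bsub>?P\<^esub> p"
  if "f \<in> carrier LF" "g \<in> carrier LF" "p \<in> carrier P" for f g p
  using P.diff_smult[of p f g] that
  by (simp add: a_minus_def leavitt_free_minus leavitt_free_simps(5))
 have sub: "f - g \<in> carrier LF" if "f \<in> carrier LF" "g \<in> carrier LF" for f g :: "leavitt_gen list \<Rightarrow>\<^sub>0 'k"
  using F.minus_closed[OF that] that by (simp add: a_minus_def leavitt_free_minus leavitt_free_simps(5))
 have "leavitt_relations n \<subseteq> ?Ann"
 proof
  fix f :: "leavitt_gen list \<Rightarrow>\<^sub>0 'k" assume "f \<in> leavitt_relations n"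
  then consider "f = (\<Sum>i \<in> {0..n}. single [Gen_star i, Gen i] 1) - single [] 1"
   | i j where "i \<le> n" "j \<le> n" "f = single [Gen i, Gen_star j] 1
     - single [] (if i = j then 1 else 0)"
   by (auto simp: leavitt_relations_def)
  then show "f \<in> ?Ann"
  proof cases
   case 1
   have c: "single [Gen_star i, Gen i] (1::'k) \<in> carrier LF" if "i \<le> n" for i
    using that by (intro single_leavitt_carrier) auto
   have e: "(\<Sum>i \<in> {0..n}. single [Gen_star i, Gen i] (1::'k))
     = (\<Oplus>\<^bsub>LF\<^esub>i \<in> {0..n}. single [Gen_star i, Gen i] 1)"
    by (intro leavitt_free_sum[symmetric]) (auto simp: c)
   have ec: "(\<Oplus>\<^bsub>LF\<^esub>i \<in> {0..n}. single [Gen_star i, Gen i] (1::'k)) \<in> carrier LF"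
    by (intro F.finsum_closed) (auto simp: c)
   have oc: "single [] (1::'k) \<in> carrier LF" by (intro single_leavitt_carrier) auto
   have "(\<Oplus>\<^bsub>LF\<^esub>i \<in> {0..n}. single [Gen_star i, Gen i] (1::'k)) \<odot>\<^bsub>?P\<^esub> p = p"
    if p: "p \<in> carrier P" for p
   proof -
    have "(\<Oplus>\<^bsub>LF\<^esub>i \<in> {0..n}. single [Gen_star i, Gen i] (1::'k)) \<odot>\<^bsub>?P\<^esub> p
     = (\<Oplus>\<^bsub>?P\<^esub>i \<in> {0..n}. single [Gen_star i, Gen i] 1 \<odot>\<^bsub>?P\<^esub> p)"
     using p by (intro P.finsum_smult) (auto simp: c)
    also have "\<dots> = (\<Oplus>\<^bsub>?P\<^esub>i \<in> {0..n}. T (Gen_star i) (T (Gen i) p))"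
     using p by (intro P.M.finsum_cong')
      (auto simp: T.act_ext_single T.scalar_one T.T_closed)
    also have "\<dots> = (\<Oplus>\<^bsub>P\<^esub>i \<in> {0..n}. T (Gen_star i) (T (Gen i) p))"
     using p by (intro finsum_restrict_carrier T.M.abelian_group_axioms P.M.abelian_group_axioms)
      (auto simp: T.T_closed)
    finally show ?thesis using yx[OF p] by simp
   qed
   then have "f \<odot>\<^bsub>?P\<^esub> p = \<zero>\<^bsub>?P\<^esub>" if "p \<in> carrier P" for p
    unfolding 1 e diff[OF ec oc that] using that ec oc P.smult_closed[OF ec, of p]
     P.M.diff_zero_iff[of p p]
    by (simp add: T.act_ext_single T.scalar_one)
   then show ?thesis using ec oc unfolding 1 e by (auto intro!: sub)
  next
   case 2
   have c: "single [Gen i, Gen_star j] (1::'k) \<in> carrier LF"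
    "single [] (if i = j then 1 else (0::'k)) \<in> carrier LF"
    using 2(1,2) by (intro single_leavitt_carrier; simp)+
   have "f \<odot>\<^bsub>?P\<^esub> p = \<zero>\<^bsub>?P\<^esub>" if p: "p \<in> carrier P" for p
    unfolding 2(3) diff[OF c p] using p 2(1,2) P.M.diff_zero_iff[of p p] P.M.diff_zero_iff[of "\<zero>\<^bsub>P\<^esub>" "\<zero>\<^bsub>P\<^esub>"]
    by (simp add: T.act_ext_single T.scalar_one T.zero_scalar xy T.T_closed)
   then show ?thesis using c unfolding 2(3) by (auto intro!: sub)
  qed
 qed
 then have "Idl\<^bsub>LF\<^esub> (leavitt_relations n) \<subseteq> ?Ann"
  by (rule F.genideal_minimal[OF P.ideal_annihilator])
 then have ann: "f \<odot>\<^bsub>?P\<^esub> p = \<zero>\<^bsub>?P\<^esub>" if "f \<in> Idl\<^bsub>LF\<^esub> (leavitt_relations n)" "p \<in> carrier ?P" for f p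
  using that by blast
 have smult: "leavitt_coset n f \<odot>\<^bsub>M\<^esub> p = f \<odot>\<^bsub>?P\<^esub> p" if "f \<in> carrier LF" "p \<in> carrier P" for f p
  unfolding M_def leavitt_coset_def using that
  by (intro I.descend_smult[OF P.graded_mod_axioms ann]) auto
 show "graded_mod (leavitt n) M"
  unfolding M_def leavitt_def by (rule I.descend_graded_mod[OF P.graded_mod_axioms ann])
 show "carrier M = carrier P" "add M = add P" "zero M = zero P" "component M = component P"
  by (simp_all add: M_def)
 show "leavitt_x n i \<odot>\<^bsub>M\<^esub> p = T (Gen i) p" "leavitt_y n i \<odot>\<^bsub>M\<^esub> p = T (Gen_star i) p"
  if "i \<le> n" "p \<in> carrier P" for i p
  using that
  by (simp_all add: leavitt_x_def leavitt_y_def smult single_leavitt_carrier word T.scalar_one T.T_closed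
    del: T.operator_module_simps)
 show "(c \<odot>\<^bsub>leavitt n\<^esub> \<one>\<^bsub>leavitt n\<^esub>) \<odot>\<^bsub>M\<^esub> p = c \<odot>\<^bsub>P\<^esub> p" if "p \<in> carrier P" for c p
 proof -
  have "c \<odot>\<^bsub>leavitt n\<^esub> \<one>\<^bsub>leavitt n\<^esub> = leavitt_coset n (single [] c)"
   unfolding leavitt_def leavitt_coset_def I.quot_one
   by (simp add: I.quot_scalar) (simp add: leavitt_free_simps map_scale_single)
  then show ?thesis
   using that by (simp add: smult single_leavitt_carrier word del: T.operator_module_simps)
 qed
qed

end

section \<open>The degree zero component\<close>

lemma quot_module_simps:
 "carrier (quot_module M N) = (\<lambda>x. N +>\<^bsub>M\<^esub> x) ` carrier M"
 "add (quot_module M N) = set_add M" "zero (quot_module M N) = N"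
 "mult (quot_module M N) = rcoset_mult M N" "one (quot_module M N) = N +>\<^bsub>M\<^esub> \<one>\<^bsub>M\<^esub>"
 "a \<odot>\<^bsub>quot_module M N\<^esub> X = N <+>\<^bsub>M\<^esub> ((\<odot>\<^bsub>M\<^esub>) a ` X)"
 by (auto simp: quot_module_def FactRing_def ring.defs module.defs A_RCOSETS_def')

section \<open>Matrix units\<close>

definition unit_mat :: "nat => nat => nat => 'k::field mat" where
 "unit_mat N i j = mat N N (\<lambda>(p, q). if p = i \<and> q = j then 1 else 0)"

lemma unit_mat_carrier: "unit_mat N i j \<in> carrier_mat N N"
 by (simp add: unit_mat_def)

lemma unit_mat_index: "[|p < N; q < N|] ==> unit_mat N i j $$ (p, q) = (if p = i \<and> q = j then 1 else 0)"
 by (simp add: unit_mat_def)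

lemma carrier_mat_induct [consumes 1, case_names unit add]:
 assumes a: "(a :: 'k::field mat) \<in> carrier_mat (Suc n) (Suc n)"
  and unit: "!!c i j. [|i \<le> n; j \<le> n|] ==> Q (c \<cdot>\<^sub>m unit_mat (Suc n) i j)"
  and add: "!!a b. [|a \<in> carrier_mat (Suc n) (Suc n); b \<in> carrier_mat (Suc n) (Suc n); Q a; Q b|] ==> Q (a + b)"
 shows "Q a"
proof -
 let ?r = "\<lambda>K. mat (Suc n) (Suc n) (\<lambda>ij. if ij \<in> K then a $$ ij else 0)"
 have "Q (?r K)" if "finite K" "K \<subseteq> {0..n} \<times> {0..n}" for K
  using that
 proof (induction K rule: finite_induct)
  case empty
  \<comment> \<open>The induction rule has no case for the zero matrix, so it is obtained as a zero
    multiple of a matrix unit.\<close>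
  have "?r {} = 0 \<cdot>\<^sub>m unit_mat (Suc n) 0 0" by (rule eq_matI) (auto simp: unit_mat_def)
  then show ?case using unit[of 0 0 0] by simp
 next
  case (insert ij K)
  obtain i j where ij: "ij = (i, j)" by (cases ij)
  have "?r (insert ij K) = a $$ ij \<cdot>\<^sub>m unit_mat (Suc n) i j + ?r K"
   using insert(2) by (intro eq_matI) (auto simp: ij unit_mat_def)
  then show ?case using insert ij by (auto intro!: add unit simp: unit_mat_carrier)
 qed
 moreover have "?r ({0..n} \<times> {0..n}) = a" using a by (intro eq_matI) auto
 ultimately show ?thesis by (metis finite_SigmaI finite_atLeastAtMost subset_refl)
qed

locale leavitt_nontrivial = leavitt_alg L n x y
 for L :: "('k::field, 'a) graded" (structure) and n x y +
 assumes one_not_zero: "\<one> ~= \<zero>"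
begin

abbreviation "Mat \<equiv> module_mat TYPE('k) (Suc n) (Suc n)"

text \<open>Inserting the sum of the \<open>y p \<otimes> x p\<close>, which is 1, on both sides
  recovers an element from the entries \<open>x p \<otimes> s \<otimes> y q\<close>. In other words,
  the map from L to M_{n+1}(L) given by these entries is injective.\<close>

lemma xy_eqI:
 assumes "s \<in> carrier L" "t \<in> carrier L"
  "!!p q. [|p \<le> n; q \<le> n|] ==> x p \<otimes> s \<otimes> y q = x p \<otimes> t \<otimes> y q"
 shows "s = t"
proof -
 have left: "a = b" if "a \<in> carrier L" "b \<in> carrier L" "!!p. p \<le> n ==> x p \<otimes> a = x p \<otimes> b" for a b
 proof -
  have expand: "z = (\<Oplus>p \<in> {0..n}. y p \<otimes> (x p \<otimes> z))" if "z \<in> carrier L" for z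
  proof -
   interpret additive_map L L "\<lambda>w. w \<otimes> z" by (rule additive_mult_right[OF that])
   have "z = (\<Oplus>p \<in> {0..n}. y p \<otimes> x p) \<otimes> z" using that by (simp add: sum_y_x)
   also have "\<dots> = (\<Oplus>p \<in> {0..n}. y p \<otimes> x p \<otimes> z)" by (rule finsum) (auto simp: x_closed y_closed)
   also have "\<dots> = (\<Oplus>p \<in> {0..n}. y p \<otimes> (x p \<otimes> z))"
    using that by (intro finsum_cong') (auto simp: x_closed y_closed m_assoc)
   finally show ?thesis .
  qed
  have "(\<Oplus>p \<in> {0..n}. y p \<otimes> (x p \<otimes> a)) = (\<Oplus>p \<in> {0..n}. y p \<otimes> (x p \<otimes> b))"
   using that by (intro finsum_cong') (auto simp: x_closed y_closed)
  then show ?thesis unfolding expand[OF that(1), symmetric] expand[OF that(2), symmetric] .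
 qed
 have right: "a = b" if "a \<in> carrier L" "b \<in> carrier L" "!!p. p \<le> n ==> a \<otimes> y p = b \<otimes> y p" for a b
 proof -
  have expand: "z = (\<Oplus>p \<in> {0..n}. z \<otimes> y p \<otimes> x p)" if "z \<in> carrier L" for z
  proof -
   interpret additive_map L L "\<lambda>w. z \<otimes> w" by (rule additive_mult_left[OF that])
   have "z = z \<otimes> (\<Oplus>p \<in> {0..n}. y p \<otimes> x p)" using that by (simp add: sum_y_x)
   also have "\<dots> = (\<Oplus>p \<in> {0..n}. z \<otimes> (y p \<otimes> x p))" by (rule finsum) (auto simp: x_closed y_closed)
   also have "\<dots> = (\<Oplus>p \<in> {0..n}. z \<otimes> y p \<otimes> x p)"
    using that by (intro finsum_cong') (auto simp: x_closed y_closed m_assoc)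
   finally show ?thesis .
  qed
  have "(\<Oplus>p \<in> {0..n}. a \<otimes> y p \<otimes> x p) = (\<Oplus>p \<in> {0..n}. b \<otimes> y p \<otimes> x p)"
   using that by (intro finsum_cong') (auto simp: x_closed y_closed)
  then show ?thesis unfolding expand[OF that(1), symmetric] expand[OF that(2), symmetric] .
 qed
 show ?thesis using assms by (rule_tac left, simp, simp, rule_tac right) (auto simp: x_closed y_closed)
qed

text \<open>The element of \<open>L\<close> whose entry at (p, q), in the sense of
  \<open>x p \<otimes> s \<otimes> y q\<close>, is the multiple of \<open>z\<close> by the entry of
  \<open>a\<close>. Iterating this construction embeds the tensor powers of the matrix algebra into
  degree zero.\<close>

definition sandwich :: "'k mat => 'a => 'a" where
 "sandwich a z = (\<Oplus>i \<in> {0..n}. \<Oplus>j \<in> {0..n}. a $$ (i, j) \<odot>\<^bsub>L\<^esub> (y i \<otimes> z \<otimes> x j))"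

lemma sandwich_closed: "z \<in> carrier L ==> sandwich a z \<in> carrier L"
 unfolding sandwich_def by (intro finsum_closed) (auto intro!: finsum_closed S.scalar_closed simp: x_closed y_closed)

lemma sandwich_comp: "z \<in> component L 0 ==> sandwich a z \<in> component L 0"
 unfolding sandwich_def
 using comp_mult[OF comp_mult[OF y_comp] x_comp, of _ z 0]
 by (intro A.comp_finsum) (auto intro!: A.comp_finsum comp_scalar)

lemma x_sandwich_y:
 assumes z: "z \<in> carrier L" and pq: "p \<le> n" "q \<le> n"
 shows "x p \<otimes> sandwich a z \<otimes> y q = a $$ (p, q) \<odot>\<^bsub>L\<^esub> z"
proof -
 interpret l: additive_map L L "\<lambda>w. x p \<otimes> w" by (rule additive_mult_left[OF x_closed[OF pq(1)]])
 interpret r: additive_map L L "\<lambda>w. w \<otimes> y q" by (rule additive_mult_right[OF y_closed[OF pq(2)]])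
 have summand: "x p \<otimes> (a $$ (i, j) \<odot>\<^bsub>L\<^esub> (y i \<otimes> z \<otimes> x j)) \<otimes> y q
   = (if i = p then if j = q then a $$ (p, q) \<odot>\<^bsub>L\<^esub> z else \<zero> else \<zero>)"
  if "i \<le> n" "j \<le> n" for i j
 proof -
  have "x p \<otimes> (a $$ (i, j) \<odot>\<^bsub>L\<^esub> (y i \<otimes> z \<otimes> x j)) \<otimes> y q
    = a $$ (i, j) \<odot>\<^bsub>L\<^esub> ((x p \<otimes> y i) \<otimes> z \<otimes> (x j \<otimes> y q))"
   using that pq z
   by (simp add: scalar_mult_right[symmetric] scalar_mult_assoc[symmetric] x_closed y_closed m_assoc)
  then show ?thesis using that pq z by (auto simp: x_y S.scalar_zero)
 qed
 have "x p \<otimes> sandwich a z \<otimes> y q = (\<Oplus>i \<in> {0..n}. \<Oplus>j \<in> {0..n}.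
   x p \<otimes> (a $$ (i, j) \<odot>\<^bsub>L\<^esub> (y i \<otimes> z \<otimes> x j)) \<otimes> y q)"
 proof -
  have c: "a $$ (i, j) \<odot>\<^bsub>L\<^esub> (y i \<otimes> z \<otimes> x j) \<in> carrier L" if "i \<le> n" "j \<le> n" for i j
   using that z by (intro S.scalar_closed) (auto simp: x_closed y_closed)
  have "x p \<otimes> sandwich a z \<otimes> y q = (\<Oplus>i \<in> {0..n}. x p \<otimes> (\<Oplus>j \<in> {0..n}. a $$ (i, j) \<odot>\<^bsub>L\<^esub> (y i \<otimes> z \<otimes> x j)) \<otimes> y q)"
   unfolding sandwich_def using c pq
   by (subst l.finsum, (auto intro!: finsum_closed)[1], intro r.finsum) (auto intro!: finsum_closed simp: x_closed)
  also have "\<dots> = (\<Oplus>i \<in> {0..n}. \<Oplus>j \<in> {0..n}.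
   x p \<otimes> (a $$ (i, j) \<odot>\<^bsub>L\<^esub> (y i \<otimes> z \<otimes> x j)) \<otimes> y q)"
  proof (rule finsum_cong'[OF refl])
   fix i assume i: "i \<in> {0..n}"
   show "x p \<otimes> (\<Oplus>j \<in> {0..n}. a $$ (i, j) \<odot>\<^bsub>L\<^esub> (y i \<otimes> z \<otimes> x j)) \<otimes> y q
     = (\<Oplus>j \<in> {0..n}. x p \<otimes> (a $$ (i, j) \<odot>\<^bsub>L\<^esub> (y i \<otimes> z \<otimes> x j)) \<otimes> y q)"
    using c i pq by (subst l.finsum, (auto)[1], intro r.finsum) (auto simp: x_closed)
  qed (use c pq in \<open>auto intro!: finsum_closed simp: x_closed y_closed\<close>)
  finally show ?thesis .
 qed
 also have "\<dots> = (\<Oplus>i \<in> {0..n}. \<Oplus>j \<in> {0..n}. if i = p then if j = q then a $$ (p, q) \<odot>\<^bsub>L\<^esub> z else \<zero> else \<zero>)"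
  using z by (intro finsum_cong' refl) (auto simp: summand S.scalar_closed intro!: finsum_closed)
 also have "\<dots> = (\<Oplus>i \<in> {p}. \<Oplus>j \<in> {0..n}. if i = p then if j = q then a $$ (p, q) \<odot>\<^bsub>L\<^esub> z else \<zero> else \<zero>)"
  using z pq by (intro finsum_eq_superset) (auto simp: S.scalar_closed intro!: finsum_closed)
 also have "\<dots> = (\<Oplus>j \<in> {0..n}. if j = q then a $$ (p, q) \<odot>\<^bsub>L\<^esub> z else \<zero>)"
  using z pq by (simp add: S.scalar_closed Pi_iff)
 also have "\<dots> = (\<Oplus>j \<in> {q}. if j = q then a $$ (p, q) \<odot>\<^bsub>L\<^esub> z else \<zero>)"
  using z pq by (intro finsum_eq_superset) (auto simp: S.scalar_closed)
 also have "\<dots> = a $$ (p, q) \<odot>\<^bsub>L\<^esub> z" using z by (simp add: S.scalar_closed)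
 finally show ?thesis .
qed

lemma sandwich_eqI:
 assumes "z \<in> carrier L" "t \<in> carrier L"
  "!!p q. [|p \<le> n; q \<le> n|] ==> x p \<otimes> t \<otimes> y q = a $$ (p, q) \<odot>\<^bsub>L\<^esub> z"
 shows "sandwich a z = t"
 using assms by (rule_tac xy_eqI) (auto simp: sandwich_closed x_sandwich_y)

lemma sandwich_add_right:
 assumes "z \<in> carrier L" "z' \<in> carrier L"
 shows "sandwich a (z \<oplus> z') = sandwich a z \<oplus> sandwich a z'"
 using assms by (intro sandwich_eqI)
  (auto simp: sandwich_closed x_sandwich_y S.scalar_distrib r_distr l_distr x_closed y_closed)

lemma sandwich_scalar_right:
 assumes "z \<in> carrier L"
 shows "sandwich a (c \<odot>\<^bsub>L\<^esub> z) = c \<odot>\<^bsub>L\<^esub> sandwich a z"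
proof (rule sandwich_eqI)
 fix p q assume "p \<le> n" "q \<le> n"
 then show "x p \<otimes> (c \<odot>\<^bsub>L\<^esub> sandwich a z) \<otimes> y q = a $$ (p, q) \<odot>\<^bsub>L\<^esub> (c \<odot>\<^bsub>L\<^esub> z)"
  using assms by (simp add: scalar_mult_right[symmetric] scalar_mult_assoc[symmetric] x_closed y_closed
    sandwich_closed x_sandwich_y S.scalar_mult[symmetric] mult.commute)
qed (use assms in \<open>auto simp: S.scalar_closed sandwich_closed\<close>)

lemma sandwich_add:
 assumes "a \<in> carrier Mat" "b \<in> carrier Mat" "z \<in> carrier L"
 shows "sandwich (a + b) z = sandwich a z \<oplus> sandwich b z"
 using assms by (intro sandwich_eqI)
  (auto simp: module_mat_simps sandwich_closed x_sandwich_y S.scalar_add r_distr l_distr x_closed y_closed)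

lemma sandwich_scalar:
 assumes "a \<in> carrier Mat" "z \<in> carrier L"
 shows "sandwich (c \<cdot>\<^sub>m a) z = c \<odot>\<^bsub>L\<^esub> sandwich a z"
 using assms by (intro sandwich_eqI)
  (auto simp: module_mat_simps sandwich_closed x_sandwich_y S.scalar_closed S.scalar_mult scalar_mult_right[symmetric]
   scalar_mult_assoc[symmetric] x_closed y_closed)

lemma sandwich_one: "sandwich (1\<^sub>m (Suc n)) \<one> = \<one>"
 by (rule sandwich_eqI) (auto simp: x_closed x_y S.scalar_one S.zero_scalar)

lemma sandwich_mult:
 assumes ab: "a \<in> carrier Mat" "b \<in> carrier Mat" and z: "z \<in> carrier L" "z' \<in> carrier L"
 shows "sandwich a z \<otimes> sandwich b z' = sandwich (a * b) (z \<otimes> z')"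
proof (rule sandwich_eqI[symmetric])
 fix p q assume pq: "p \<le> n" "q \<le> n"
 let ?u = "x p \<otimes> sandwich a z" and ?v = "sandwich b z' \<otimes> y q"
 have uv: "?u \<in> carrier L" "?v \<in> carrier L" using z pq by (auto simp: sandwich_closed x_closed y_closed)
 interpret l: additive_map L L "\<lambda>w. ?u \<otimes> w" by (rule additive_mult_left[OF uv(1)])
 interpret r: additive_map L L "\<lambda>w. w \<otimes> ?v" by (rule additive_mult_right[OF uv(2)])
 interpret s: additive_map "class_ring :: 'k ring" L "\<lambda>c. c \<odot>\<^bsub>L\<^esub> (z \<otimes> z')"
  using z by unfold_locales (auto intro!: add_mapI simp: S.scalar_closed S.scalar_add)
 \<comment> \<open>Inserting the sum of the \<open>y i \<otimes> x i\<close> between the two factors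
   turns the product into the row by column formula.\<close>
 have "x p \<otimes> (sandwich a z \<otimes> sandwich b z') \<otimes> y q = ?u \<otimes> (\<Oplus>i \<in> {0..n}. y i \<otimes> x i) \<otimes> ?v"
  using z pq by (simp add: sum_y_x sandwich_closed x_closed y_closed m_assoc)
 also have "\<dots> = (\<Oplus>i \<in> {0..n}. ?u \<otimes> (y i \<otimes> x i) \<otimes> ?v)"
  using uv by (subst l.finsum, (auto simp: x_closed y_closed)[1], intro r.finsum) (auto simp: x_closed y_closed)
 also have "\<dots> = (\<Oplus>i \<in> {0..n}. (a $$ (p, i) * b $$ (i, q)) \<odot>\<^bsub>L\<^esub> (z \<otimes> z'))"
 proof (rule finsum_cong'[OF refl])
  fix i assume "i \<in> {0..n}"
  then have i: "i \<le> n" by simp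
  have "?u \<otimes> (y i \<otimes> x i) \<otimes> ?v = (x p \<otimes> sandwich a z \<otimes> y i) \<otimes> (x i \<otimes> sandwich b z' \<otimes> y q)"
   using z pq i by (simp add: sandwich_closed x_closed y_closed m_assoc)
  also have "\<dots> = (a $$ (p, i) * b $$ (i, q)) \<odot>\<^bsub>L\<^esub> (z \<otimes> z')"
   using z pq i by (simp add: x_sandwich_y scalar_mult_right[symmetric] scalar_mult_assoc[symmetric]
     S.scalar_closed S.scalar_mult[symmetric] mult.commute)
  finally show "?u \<otimes> (y i \<otimes> x i) \<otimes> ?v = (a $$ (p, i) * b $$ (i, q)) \<odot>\<^bsub>L\<^esub> (z \<otimes> z')" .
 qed (use z in \<open>auto simp: S.scalar_closed\<close>)
 also have "\<dots> = (\<Sum>i \<in> {0..n}. a $$ (p, i) * b $$ (i, q)) \<odot>\<^bsub>L\<^esub> (z \<otimes> z')"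
  using s.finsum[of "\<lambda>i. a $$ (p, i) * b $$ (i, q)" "{0..n}"] by (simp add: class_ring_simps)
 also have "(\<Sum>i \<in> {0..n}. a $$ (p, i) * b $$ (i, q)) = (a * b) $$ (p, q)"
  using ab pq by (auto simp: module_mat_simps scalar_prod_def atLeastLessThanSuc_atLeastAtMost intro!: sum.cong)
 finally show "x p \<otimes> (sandwich a z \<otimes> sandwich b z') \<otimes> y q = (a * b) $$ (p, q) \<odot>\<^bsub>L\<^esub> (z \<otimes> z')" .
qed (use z in \<open>auto simp: sandwich_closed\<close>)

lemma sandwich_unit:
 assumes "i \<le> n" "j \<le> n" "z \<in> carrier L"
 shows "sandwich (unit_mat (Suc n) i j) z = y i \<otimes> z \<otimes> x j"
proof (rule sandwich_eqI)
 fix p q assume pq: "p \<le> n" "q \<le> n"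
 have "x p \<otimes> (y i \<otimes> z \<otimes> x j) \<otimes> y q = (x p \<otimes> y i) \<otimes> z \<otimes> (x j \<otimes> y q)"
  using assms pq by (simp add: x_closed y_closed m_assoc)
 then show "x p \<otimes> (y i \<otimes> z \<otimes> x j) \<otimes> y q = unit_mat (Suc n) i j $$ (p, q) \<odot>\<^bsub>L\<^esub> z"
  using assms pq by (auto simp: x_y unit_mat_index S.scalar_one S.zero_scalar)
qed (use assms in \<open>auto simp: x_closed y_closed\<close>)

lemma fold_sandwich_closed: "z \<in> carrier L ==> fold sandwich as z \<in> carrier L"
 by (induction as arbitrary: z) (auto simp: sandwich_closed)

lemma fold_sandwich_comp: "z \<in> component L 0 ==> fold sandwich as z \<in> component L 0"
 by (induction as arbitrary: z) (auto simp: sandwich_comp)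

lemma fold_sandwich_add: "[|z \<in> carrier L; z' \<in> carrier L|]
  ==> fold sandwich as (z \<oplus> z') = fold sandwich as z \<oplus> fold sandwich as z'"
 by (induction as arbitrary: z z') (auto simp: sandwich_closed sandwich_add_right)

lemma fold_sandwich_scalar: "z \<in> carrier L ==> fold sandwich as (c \<odot>\<^bsub>L\<^esub> z) = c \<odot>\<^bsub>L\<^esub> fold sandwich as z"
 by (induction as arbitrary: z) (auto simp: sandwich_closed sandwich_scalar_right)

lemma fold_sandwich_mult:
 "[|length as = length bs; set as \<subseteq> carrier Mat; set bs \<subseteq> carrier Mat; z \<in> carrier L; z' \<in> carrier L|]
  ==> fold sandwich as z \<otimes> fold sandwich bs z' = fold sandwich (map2 (*) as bs) (z \<otimes> z')"
 by (induction as bs arbitrary: z z' rule: list_induct2) (auto simp: sandwich_closed sandwich_mult)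

lemma fold_sandwich_update_add:
 "[|p < length as; a \<in> carrier Mat; b \<in> carrier Mat; z \<in> carrier L|]
  ==> fold sandwich (as[p := a + b]) z = fold sandwich (as[p := a]) z \<oplus> fold sandwich (as[p := b]) z"
 by (induction as arbitrary: p z) (auto simp: sandwich_closed sandwich_add fold_sandwich_add split: nat.split)

lemma fold_sandwich_update_scalar:
 "[|p < length as; a \<in> carrier Mat; z \<in> carrier L|]
  ==> fold sandwich (as[p := c \<cdot>\<^sub>m a]) z = c \<odot>\<^bsub>L\<^esub> fold sandwich (as[p := a]) z"
 by (induction as arbitrary: p z) (auto simp: sandwich_closed sandwich_scalar fold_sandwich_scalar split: nat.split)

lemma fold_sandwich_one: "fold sandwich (replicate i (1\<^sub>m (Suc n))) \<one> = \<one>"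
 by (induction i) (auto simp: sandwich_one)

text \<open>The tuple of matrix units whose row indices spell \<open>v\<close> and whose column
  indices spell \<open>w\<close>; it corresponds to the element
  \<open>Y v \<otimes> X w\<close>.\<close>

definition units :: "nat list => nat list => 'k mat list" where
 "units v w = map2 (unit_mat (Suc n)) v w"

text \<open>The first matrix of the tuple is applied innermost, which is the order in which
  \<open>Y\<close> multiplies the letters of its argument.\<close>

lemma fold_sandwich_units:
 "[|v \<in> words n r; w \<in> words n r; z \<in> carrier L|] ==> fold sandwich (units v w) z = Y v \<otimes> z \<otimes> X w"
proof (induction r arbitrary: v w z)
 case (Suc r)
 then obtain i v' j w' where vw: "v = i # v'" "i \<le> n" "v' \<in> words n r" "w = j # w'" "j \<le> n" "w' \<in> words n r"
  by (auto simp: words_Suc)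
 note c = X_words_closed[OF vw(6)] Y_words_closed[OF vw(3)] x_closed[OF vw(5)] y_closed[OF vw(2)]
 have "fold sandwich (units v w) z = fold sandwich (units v' w') (y i \<otimes> z \<otimes> x j)"
  using vw Suc.prems(3) by (simp add: units_def sandwich_unit[simplified])
 also have "\<dots> = Y v' \<otimes> (y i \<otimes> z \<otimes> x j) \<otimes> X w'"
  using vw Suc.prems(3) c by (intro Suc.IH) auto
 also have "\<dots> = Y v \<otimes> z \<otimes> X w"
  using vw words_lists[OF vw(3)] Suc.prems(3) c by (simp add: Y_Cons m_assoc del: in_lists_conv_set)
 finally show ?case .
qed (simp add: words_0 units_def)

lemma X_fold_sandwich_Y:
 assumes "v \<in> words n r" "w \<in> words n r" "v' \<in> words n r" "w' \<in> words n r" "z \<in> carrier L"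
 shows "X v \<otimes> fold sandwich (units v' w') z \<otimes> Y w = (if v = v' \<and> w = w' then z else \<zero>)"
proof -
 note c = X_words_closed[OF assms(1)] Y_words_closed[OF assms(2)] Y_words_closed[OF assms(3)]
  X_words_closed[OF assms(4)] assms(5)
 have "X v \<otimes> fold sandwich (units v' w') z \<otimes> Y w = (X v \<otimes> Y v') \<otimes> z \<otimes> (X w' \<otimes> Y w)"
  using c by (simp add: fold_sandwich_units[OF assms(3-5)] m_assoc)
 then show ?thesis using assms by (auto simp: X_Y)
qed


subsection \<open>Tensor powers of the matrix algebra\<close>

abbreviation "W i \<equiv> tuple_monoid Mat i"
abbreviation "MA i \<equiv> monoid_algebra (W i) :: ('k, 'k mat list \<Rightarrow>\<^sub>0 'k) module"

lemma tuple_monoid_simps: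
 "carrier (W i) = {as. length as = i \<and> set as \<subseteq> carrier_mat (Suc n) (Suc n)}"
 "as \<otimes>\<^bsub>W i\<^esub> bs = map2 (*) as bs" "\<one>\<^bsub>W i\<^esub> = replicate i (1\<^sub>m (Suc n))"
 by (simp_all add: tuple_monoid_def module_mat_simps)

lemma monoid_tuple_monoid: "monoid (W i)"
proof
 fix as bs cs assume a: "as \<in> carrier (W i)" and b: "bs \<in> carrier (W i)"
 have nth: "xs ! p \<in> carrier_mat (Suc n) (Suc n)" "length xs = i" if "xs \<in> carrier (W i)" "p < i" for xs p
  using that nth_mem[of p xs] by (auto simp: tuple_monoid_simps simp del: nth_mem)
 show "as \<otimes>\<^bsub>W i\<^esub> bs \<in> carrier (W i)"
  using a b by (auto simp: tuple_monoid_simps subset_iff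
    intro!: mult_carrier_mat[of _ "Suc n" "Suc n"] dest: set_zip_leftD set_zip_rightD)
 show "\<one>\<^bsub>W i\<^esub> \<otimes>\<^bsub>W i\<^esub> as = as" "as \<otimes>\<^bsub>W i\<^esub> \<one>\<^bsub>W i\<^esub> = as"
  using a nth(1)[OF a] by (auto simp: tuple_monoid_simps(1) intro!: nth_equalityI)
   (simp_all add: tuple_monoid_simps left_mult_one_mat[of _ "Suc n" "Suc n"] right_mult_one_mat[of _ "Suc n" "Suc n"])
 assume c: "cs \<in> carrier (W i)"
 show "as \<otimes>\<^bsub>W i\<^esub> bs \<otimes>\<^bsub>W i\<^esub> cs = as \<otimes>\<^bsub>W i\<^esub> (bs \<otimes>\<^bsub>W i\<^esub> cs)"
  unfolding tuple_monoid_simps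
 proof (rule nth_equalityI)
  fix p assume "p < length (map2 (*) (map2 (*) as bs) cs)"
  moreover have "length as = i" "length bs = i" "length cs = i"
   using a b c by (auto simp: tuple_monoid_simps)
  ultimately show "map2 (*) (map2 (*) as bs) cs ! p = map2 (*) as (map2 (*) bs cs) ! p"
   using nth(1)[OF a, of p] nth(1)[OF b, of p] nth(1)[OF c, of p] by (simp add: assoc_mult_mat)
 qed (use a b c in \<open>simp add: tuple_monoid_simps\<close>)
qed (auto simp: tuple_monoid_simps)

text \<open>The extension of this action to the monoid algebra is left multiplication by
  \<open>Theta f\<close> (\<open>Theta_act\<close>). Multiplicativity of \<open>Theta\<close> thus
  follows from the general lemma on actions, without expanding the convolution product
  again.\<close>

lemma monoid_action_tuples: "monoid_action L (W i) (\<lambda>as z. fold sandwich as \<one> \<otimes> z)"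
proof (intro monoid_action.intro S.kspace_axioms monoid_tuple_monoid monoid_action_axioms.intro)
 fix as bs z assume as: "as \<in> carrier (W i)" and bs: "bs \<in> carrier (W i)" and z: "z \<in> carrier L"
 then have "fold sandwich as \<one> \<otimes> fold sandwich bs \<one> = fold sandwich (as \<otimes>\<^bsub>W i\<^esub> bs) \<one>"
  using fold_sandwich_mult[of as bs \<one> \<one>] by (simp add: tuple_monoid_simps module_mat_simps)
 then show "fold sandwich (as \<otimes>\<^bsub>W i\<^esub> bs) \<one> \<otimes> z = fold sandwich as \<one> \<otimes> (fold sandwich bs \<one> \<otimes> z)"
  using z by (simp add: m_assoc[symmetric] fold_sandwich_closed)
qed (auto simp: fold_sandwich_closed r_distr scalar_mult_right tuple_monoid_simps fold_sandwich_one[simplified])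

text \<open>One map serves the tensor powers of all orders, the length of the tuples carrying the
  order. The first entry of a tuple is folded in innermost, so a leading identity matrix leaves the
  value unchanged; this makes the map compatible with the transition maps of the direct
  system.\<close>

definition Theta :: "('k mat list \<Rightarrow>\<^sub>0 'k) => 'a" where
 "Theta f = lin_ext L (\<lambda>as. fold sandwich as \<one>) f"

context
 fixes i :: nat
begin

interpretation MA: ring "MA i" by (rule ring_monoid_algebra[OF monoid_tuple_monoid])

interpretation act: monoid_action L "W i" "\<lambda>as z. fold sandwich as \<one> \<otimes> z"
 by (rule monoid_action_tuples)

lemma Theta_comp: "Theta f \<in> component L 0"
 unfolding Theta_def lin_ext_def
 by (intro A.comp_finsum) (auto intro!: comp_scalar fold_sandwich_comp comp_one)

lemma Theta_add: "Theta (f + g) = Theta f \<oplus> Theta g"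
 unfolding Theta_def by (rule S.lin_ext_add[where X = UNIV]) (auto simp: fold_sandwich_closed)

lemma Theta_zero: "Theta 0 = \<zero>"
 by (simp add: Theta_def S.lin_ext_zero)

lemma Theta_single: "Theta (single as c) = c \<odot>\<^bsub>L\<^esub> fold sandwich as \<one>"
 unfolding Theta_def by (simp add: S.lin_ext_single fold_sandwich_closed)

lemma Theta_scale: "Theta (Poly_Mapping.map ((*) c) f) = c \<odot>\<^bsub>L\<^esub> Theta f"
 unfolding Theta_def by (rule S.lin_ext_scale[where X = UNIV]) (auto simp: fold_sandwich_closed)

lemma Theta_carrier: "Theta f \<in> carrier L"
 using Theta_comp A.comp_carrier by blast

lemma Theta_minus: "Theta (- f) = \<ominus> Theta f"
 using Theta_add[of "- f" f] by (intro minus_equality[symmetric]) (auto simp: Theta_zero Theta_carrier)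

lemma Theta_diff: "Theta (f - g) = Theta f \<ominus> Theta g"
 using Theta_add[of f "- g"] by (simp add: Theta_minus a_minus_def)

lemma Theta_act:
 assumes "f \<in> carrier (MA i)" "z \<in> carrier L"
 shows "act.act_ext f z = Theta f \<otimes> z"
 unfolding Theta_def act.act_ext_def using assms
 by (intro lin_ext_linear[symmetric, OF S.kspace_axioms S.kspace_axioms
    additive_map.add_map[OF additive_mult_right], where X = "carrier (W i)"])
  (auto simp: scalar_mult_assoc fold_sandwich_closed monoid_algebra_simps)

lemma Theta_mult:
 assumes "f \<in> carrier (MA i)" "g \<in> carrier (MA i)"
 shows "Theta (f \<otimes>\<^bsub>MA i\<^esub> g) = Theta f \<otimes> Theta g"
proof -
 have "Theta (f \<otimes>\<^bsub>MA i\<^esub> g) = act.act_ext (f \<otimes>\<^bsub>MA i\<^esub> g) \<one>"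
  using assms by (subst Theta_act) (auto simp: Theta_carrier)
 also have "\<dots> = act.act_ext f (act.act_ext g \<one>)"
  using assms by (intro act.act_ext_mult) (auto simp: monoid_algebra_simps)
 also have "\<dots> = Theta f \<otimes> Theta g"
  using assms by (simp add: Theta_act Theta_carrier)
 finally show ?thesis .
qed

lemma MA_minus: "f \<in> carrier (MA i) ==> \<ominus>\<^bsub>MA i\<^esub> f = - f"
 by (intro MA.minus_equality) (auto simp: monoid_algebra_simps in_keys_iff)

lemma MA_diff: "[|f \<in> carrier (MA i); g \<in> carrier (MA i)|] ==> f \<ominus>\<^bsub>MA i\<^esub> g = f - g"
 by (simp add: a_minus_def MA_minus monoid_algebra_simps(4))

lemma MA_diff_closed: "[|f \<in> carrier (MA i); g \<in> carrier (MA i)|] ==> f - g \<in> carrier (MA i)"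
 using MA.minus_closed by (simp add: MA_diff)

lemma single_MA: "as \<in> carrier (W i) ==> single as c \<in> carrier (MA i)"
 by (simp add: monoid_algebra_simps)

lemma update_tuple: "[|as \<in> carrier (W i); a \<in> carrier Mat|] ==> as[p := a] \<in> carrier (W i)"
 by (auto simp: tuple_monoid_simps module_mat_simps dest: set_update_subset_insert[THEN subsetD])

lemma multilinear_relations_kernel:
 "multilinear_relations Mat i \<subseteq> {f \<in> carrier (MA i). Theta f = \<zero>}"
proof
 fix f assume "f \<in> multilinear_relations Mat i"
 then consider as p a b where "as \<in> carrier (W i)" "p < i" "a \<in> carrier Mat" "b \<in> carrier Mat"
   "f = single (as[p := a \<oplus>\<^bsub>Mat\<^esub> b]) 1 - single (as[p := a]) 1
    - single (as[p := b]) 1"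
  | as p c a where "as \<in> carrier (W i)" "p < i" "a \<in> carrier Mat"
   "f = single (as[p := c \<odot>\<^bsub>Mat\<^esub> a]) 1 - single (as[p := a]) c"
  unfolding multilinear_relations_def by blast
 then show "f \<in> {f \<in> carrier (MA i). Theta f = \<zero>}"
 proof cases
  case 1
  have len: "length as = i" using 1(1) by (simp add: tuple_monoid_simps)
  have "a \<oplus>\<^bsub>Mat\<^esub> b \<in> carrier Mat" using 1 by (auto simp: module_mat_simps)
  then have "f \<in> carrier (MA i)"
   unfolding 1(5) using 1 by (intro MA_diff_closed single_MA update_tuple)
  moreover have "Theta f = \<zero>"
  proof -
   have "fold sandwich (as[p := a \<oplus>\<^bsub>Mat\<^esub> b]) \<one> = fold sandwich (as[p := a]) \<one> \<oplus> fold sandwich (as[p := b]) \<one>"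
    using 1 len fold_sandwich_update_add[of p as a b \<one>] by (simp add: module_mat_simps)
   then show ?thesis unfolding 1(5) diff_diff_eq Theta_diff Theta_add Theta_single
    by (simp add: S.scalar_one fold_sandwich_closed diff_zero_iff)
  qed
  ultimately show ?thesis by simp
 next
  case 2
  have len: "length as = i" using 2(1) by (simp add: tuple_monoid_simps)
  have "c \<odot>\<^bsub>Mat\<^esub> a \<in> carrier Mat" using 2 by (auto simp: module_mat_simps)
  then have "f \<in> carrier (MA i)"
   unfolding 2(4) using 2 by (intro MA_diff_closed single_MA update_tuple)
  moreover have "Theta f = \<zero>"
   unfolding 2(4) Theta_diff Theta_single using 2 len fold_sandwich_update_scalar[of p as a \<one> c]
   by (simp add: module_mat_simps S.scalar_one fold_sandwich_closed S.scalar_closed r_neg a_minus_def)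
  ultimately show ?thesis by simp
 qed
qed

lemma kernel_ideal: "ideal {f \<in> carrier (MA i). Theta f = \<zero>} (MA i)"
proof (rule idealI[OF MA.ring_axioms])
 show "subgroup {f \<in> carrier (MA i). Theta f = \<zero>} (add_monoid (MA i))"
 proof (rule additive_subgroup.a_subgroup, unfold MA.additive_subgroup_iff, intro conjI ballI)
  show "\<zero>\<^bsub>MA i\<^esub> \<in> {f \<in> carrier (MA i). Theta f = \<zero>}"
   using MA.zero_closed Theta_zero by (simp add: monoid_algebra_simps(3))
  fix f assume f: "f \<in> {f \<in> carrier (MA i). Theta f = \<zero>}"
  then show "\<ominus>\<^bsub>MA i\<^esub> f \<in> {f \<in> carrier (MA i). Theta f = \<zero>}"
   using MA.a_inv_closed[of f] by (simp add: MA_minus Theta_minus)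
  fix g assume "g \<in> {f \<in> carrier (MA i). Theta f = \<zero>}"
  then show "f \<oplus>\<^bsub>MA i\<^esub> g \<in> {f \<in> carrier (MA i). Theta f = \<zero>}"
   using f MA.a_closed[of f g] by (simp add: monoid_algebra_simps(4) Theta_add)
 qed auto
qed (auto simp: Theta_mult Theta_carrier)

lemma multilinear_relations_carrier: "multilinear_relations Mat i \<subseteq> carrier (MA i)"
 using multilinear_relations_kernel by blast

interpretation I: ideal "tensor_ideal Mat i" "MA i"
 unfolding tensor_ideal_def by (rule MA.genideal_ideal[OF multilinear_relations_carrier])

lemma tensor_ideal_relation: "f \<in> multilinear_relations Mat i ==> f \<in> tensor_ideal Mat i"
 unfolding tensor_ideal_def using MA.genideal_self[OF multilinear_relations_carrier] by blast

lemma units_carrier: "[|v \<in> words n i; w \<in> words n i|] ==> units v w \<in> carrier (W i)"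
 by (auto simp: tuple_monoid_simps units_def words_def set_zip unit_mat_def)

text \<open>Modulo the multilinearity relations every element is a combination of tuples of matrix units.\<close>

definition reducible :: "('k mat list \<Rightarrow>\<^sub>0 'k) => bool" where
 "reducible f \<longleftrightarrow> (\<exists>g. keys g \<subseteq> {units v w | v w. v \<in> words n i \<and> w \<in> words n i} \<and>
   f - g \<in> tensor_ideal Mat i)"

lemma tensor_ideal_add: "[|f \<in> tensor_ideal Mat i; g \<in> tensor_ideal Mat i|] ==> f + g \<in> tensor_ideal Mat i"
 using I.a_closed[of f g] by (simp add: monoid_algebra_simps)

lemma reducible_add: "[|reducible f; reducible g|] ==> reducible (f + g)"
proof -
 assume "reducible f" "reducible g"
 then obtain f' g' where *: "keys f' \<subseteq> {units v w | v w. v \<in> words n i \<and> w \<in> words n i}"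
  "keys g' \<subseteq> {units v w | v w. v \<in> words n i \<and> w \<in> words n i}"
  "f - f' \<in> tensor_ideal Mat i" "g - g' \<in> tensor_ideal Mat i"
  unfolding reducible_def by blast
 have "(f + g) - (f' + g') \<in> tensor_ideal Mat i"
  using tensor_ideal_add[OF *(3,4)] by (simp add: algebra_simps)
 then show "reducible (f + g)"
  unfolding reducible_def using keys_add_subset[OF *(1,2)] by blast
qed

lemma reducible_mod: "[|reducible g; f - g \<in> tensor_ideal Mat i|] ==> reducible f"
proof -
 assume "reducible g" and d: "f - g \<in> tensor_ideal Mat i"
 then obtain g' where *: "keys g' \<subseteq> {units v w | v w. v \<in> words n i \<and> w \<in> words n i}"
  "g - g' \<in> tensor_ideal Mat i"
  unfolding reducible_def by blast
 have "f - g' \<in> tensor_ideal Mat i"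
  using tensor_ideal_add[OF d *(2)] by simp
 then show "reducible f" unfolding reducible_def using *(1) by blast
qed

lemma tensor_ideal_scale:
 assumes "f \<in> tensor_ideal Mat i" shows "Poly_Mapping.map ((*) c) f \<in> tensor_ideal Mat i"
proof -
 have f: "f \<in> carrier (MA i)" using I.a_subset assms by blast
 have "Poly_Mapping.map ((*) c) \<one>\<^bsub>MA i\<^esub> \<in> carrier (MA i)"
  using MA.one_closed keys_scale[of c "\<one>\<^bsub>MA i\<^esub>"] by (auto simp: monoid_algebra_simps)
 then have "Poly_Mapping.map ((*) c) \<one>\<^bsub>MA i\<^esub> \<otimes>\<^bsub>MA i\<^esub> f \<in> tensor_ideal Mat i"
  using assms I.I_l_closed by blast
 then show ?thesis using f by (simp flip: monoid_algebra_scale_mult(1))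
qed

lemma reducible_scale: "reducible f ==> reducible (Poly_Mapping.map ((*) c) f)"
proof -
 assume "reducible f"
 then obtain g where g: "keys g \<subseteq> {units v w | v w. v \<in> words n i \<and> w \<in> words n i}"
  "f - g \<in> tensor_ideal Mat i"
  unfolding reducible_def by blast
 have "Poly_Mapping.map ((*) c) f - Poly_Mapping.map ((*) c) g = Poly_Mapping.map ((*) c) (f - g)"
  by (rule poly_mapping_eqI) (simp add: lookup_scale lookup_minus algebra_simps)
 then show "reducible (Poly_Mapping.map ((*) c) f)"
  unfolding reducible_def using g tensor_ideal_scale[OF g(2), of c] keys_scale[of c g]
  by (intro exI[of _ "Poly_Mapping.map ((*) c) g"]) auto
qed

text \<open>Induction on the number \<open>p\<close> of leading entries that may be arbitrary. The
  step rewrites one further entry by matrix induction, whose sums and scalar multiples are exactly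
  those of the multilinearity relations.\<close>

lemma reducible_tuple:
 assumes "p \<le> i" "as \<in> carrier (W i)"
  "!!q. [|p \<le> q; q < i|] ==> \<exists>k l. k \<le> n \<and> l \<le> n \<and> as ! q = unit_mat (Suc n) k l"
 shows "reducible (single as 1)"
 using assms
proof (induction p arbitrary: as)
 case 0
 then obtain k l where kl: "!!q. q < i ==> k q \<le> n \<and> l q \<le> n \<and> as ! q = unit_mat (Suc n) (k q) (l q)"
  by (metis le0)
 have len: "length as = i" using 0 by (simp add: tuple_monoid_simps)
 have "as = units (map k [0..<i]) (map l [0..<i])"
  using kl len by (intro nth_equalityI) (auto simp: units_def)
 moreover have "map k [0..<i] \<in> words n i" "map l [0..<i] \<in> words n i"
  using kl by (auto simp: words_def)
 ultimately have "keys (single as (1::'k)) \<subseteq> {units v w | v w. v \<in> words n i \<and> w \<in> words n i}"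
  by auto
 moreover have "single as 1 - single as 1 \<in> tensor_ideal Mat i"
  using I.zero_closed by (simp add: monoid_algebra_simps)
 ultimately show ?case unfolding reducible_def by blast
next
 case (Suc p)
 have len: "length as = i" using Suc by (simp add: tuple_monoid_simps)
 have p: "p < i" using Suc by simp
 have "reducible (single (as[p := a]) 1)" if "a \<in> carrier_mat (Suc n) (Suc n)" for a
  using that
 proof (induction a rule: carrier_mat_induct)
  case (unit c k l)
  let ?u = "unit_mat (Suc n) k l :: 'k mat"
  have u: "?u \<in> carrier Mat" by (simp add: module_mat_simps unit_mat_carrier)
  have "reducible (single (as[p := ?u]) 1)"
  proof (rule Suc.IH)
   fix q assume "p \<le> q" "q < i"
   then show "\<exists>k l. k \<le> n \<and> l \<le> n \<and> as[p := ?u] ! q = unit_mat (Suc n) k l"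
    using Suc.prems(3)[of q] unit len p by (cases "q = p") auto
  qed (use p Suc.prems(2) u in \<open>auto intro: update_tuple\<close>)
  from reducible_scale[OF this, of c] have "reducible (single (as[p := ?u]) c)"
   by (simp add: map_scale_single)
  moreover have "single (as[p := c \<cdot>\<^sub>m ?u]) 1 - single (as[p := ?u]) c
    \<in> multilinear_relations Mat i"
   unfolding multilinear_relations_def using Suc.prems(2) p u by (fastforce simp: module_mat_simps(6))
  ultimately show ?case using reducible_mod tensor_ideal_relation by blast
 next
  case (add a b)
  then have ab: "a \<in> carrier Mat" "b \<in> carrier Mat" by (simp_all add: module_mat_simps)
  have "single (as[p := a \<oplus>\<^bsub>Mat\<^esub> b]) 1 - single (as[p := a]) 1
    - single (as[p := b]) 1 \<in> multilinear_relations Mat i"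
   unfolding multilinear_relations_def using Suc.prems(2) p ab by blast
  then have "single (as[p := a + b]) 1 - (single (as[p := a]) 1
    + single (as[p := b]) 1) \<in> tensor_ideal Mat i"
   using tensor_ideal_relation by (simp add: module_mat_simps diff_diff_eq)
  then show ?case using reducible_mod[OF reducible_add] add by blast
 qed
 moreover have "as ! p \<in> carrier_mat (Suc n) (Suc n)"
  using Suc.prems(2) p len nth_mem[of p as] by (auto simp: tuple_monoid_simps simp del: nth_mem)
 ultimately have "reducible (single (as[p := as ! p]) 1)" .
 then show ?case by simp
qed

lemma reducible: "f \<in> carrier (MA i) ==> reducible f"
proof -
 assume "f \<in> carrier (MA i)"
 then have "keys f \<subseteq> carrier (W i)" by (simp add: monoid_algebra_simps)
 then show "reducible f"
 proof (induction f rule: poly_mapping_induct)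
  case zero
  show ?case unfolding reducible_def
   using I.zero_closed by (intro exI[of _ 0]) (simp add: monoid_algebra_simps)
 next
  case (single as c)
  have "reducible (single as 1)" using single by (intro reducible_tuple[of i]) auto
  from reducible_scale[OF this, of c] show ?case by (simp add: map_scale_single)
 qed (rule reducible_add)
qed

text \<open>The scalars embed into \<open>L\<close>. This is where \<open>one_not_zero\<close>
  enters: in the zero algebra \<open>Theta\<close> would vanish and no tensor power could be
  recognised by its image.\<close>

lemma scalar_one_zero: "c \<odot>\<^bsub>L\<^esub> \<one> = \<zero> ==> c = 0"
proof (rule ccontr)
 assume "c \<odot>\<^bsub>L\<^esub> \<one> = \<zero>" "c ~= 0"
 then have "(inverse c * c) \<odot>\<^bsub>L\<^esub> \<one> = \<zero>" by (simp only: S.scalar_mult[OF one_closed] S.scalar_zero)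
 then show False using \<open>c ~= 0\<close> one_not_zero by (simp add: S.scalar_one)
qed

text \<open>Multiplying by \<open>X v\<close> on the left and \<open>Y w\<close> on the right
  extracts the coefficient of \<open>units v w\<close>, so the images of the tuples of matrix units
  are linearly independent.\<close>

lemma Theta_units_zero:
 assumes g: "keys g \<subseteq> {units v w | v w. v \<in> words n i \<and> w \<in> words n i}" and "Theta g = \<zero>"
 shows "g = 0"
proof (rule ccontr)
 assume "g ~= 0"
 then obtain u where u: "u \<in> keys g" by (metis keys_eq_empty ex_in_conv)
 then obtain v w where vw: "v \<in> words n i" "w \<in> words n i" "u = units v w" using g by blast
 note c = X_words_closed[OF vw(1)] Y_words_closed[OF vw(2)]
 have add: "add_map L L (\<lambda>z. X v \<otimes> z \<otimes> Y w)"
  using c by (intro add_mapI) (auto simp: r_distr l_distr)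
 have "X v \<otimes> Theta g \<otimes> Y w = lin_ext L (\<lambda>as. X v \<otimes> fold sandwich as \<one> \<otimes> Y w) g"
  unfolding Theta_def using c
  by (intro lin_ext_linear[OF S.kspace_axioms S.kspace_axioms add, where X = UNIV])
   (auto simp: fold_sandwich_closed scalar_mult_right[symmetric] scalar_mult_assoc[symmetric])
 also have "\<dots> = (\<Oplus>as \<in> keys g. lookup g as \<odot>\<^bsub>L\<^esub> (X v \<otimes> fold sandwich as \<one> \<otimes> Y w))"
  by (simp add: lin_ext_def)
 also have "\<dots> = (\<Oplus>as \<in> {u}. lookup g as \<odot>\<^bsub>L\<^esub> (X v \<otimes> fold sandwich as \<one> \<otimes> Y w))"
 proof (rule finsum_eq_superset)
  fix as assume as: "as \<in> keys g - {u}"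
  then obtain v' w' where vw': "v' \<in> words n i" "w' \<in> words n i" "as = units v' w'" using g by blast
  then show "lookup g as \<odot>\<^bsub>L\<^esub> (X v \<otimes> fold sandwich as \<one> \<otimes> Y w) = \<zero>"
   using as vw by (auto simp: X_fold_sandwich_Y[OF vw(1,2) vw'(1,2)] S.scalar_zero)
 qed (use u c in \<open>auto simp: S.scalar_closed fold_sandwich_closed\<close>)
 also have "\<dots> = lookup g u \<odot>\<^bsub>L\<^esub> \<one>"
  using vw c X_fold_sandwich_Y[OF vw(1,2) vw(1,2), of \<one>] by (simp add: S.scalar_closed fold_sandwich_closed)
 finally have "lookup g u \<odot>\<^bsub>L\<^esub> \<one> = \<zero>" using assms(2) c by simp
 then have "lookup g u = 0" by (rule scalar_one_zero)
 with u show False by (simp add: in_keys_iff)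
qed

text \<open>The ideal lies in the kernel by minimality. Conversely, an element of the kernel is
  congruent to a combination of tuples of matrix units, which \<open>Theta\<close> still kills and
  which therefore vanishes.\<close>

lemma tensor_ideal_eq: "tensor_ideal Mat i = {f \<in> carrier (MA i). Theta f = \<zero>}"
proof
 show "tensor_ideal Mat i \<subseteq> {f \<in> carrier (MA i). Theta f = \<zero>}"
  unfolding tensor_ideal_def
  by (rule MA.genideal_minimal[OF kernel_ideal multilinear_relations_kernel])
 then have sub: "Theta f = \<zero>" if "f \<in> tensor_ideal Mat i" for f using that by blast
 show "{f \<in> carrier (MA i). Theta f = \<zero>} \<subseteq> tensor_ideal Mat i"
 proof
  fix f assume "f \<in> {f \<in> carrier (MA i). Theta f = \<zero>}"
  then have f: "f \<in> carrier (MA i)" "Theta f = \<zero>" by auto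
  obtain g where g: "keys g \<subseteq> {units v w | v w. v \<in> words n i \<and> w \<in> words n i}"
   "f - g \<in> tensor_ideal Mat i"
   using reducible[OF f(1)] unfolding reducible_def by blast
  have "Theta f \<ominus> Theta g = \<zero>" using sub[OF g(2)] by (simp add: Theta_diff)
  then have "Theta g = \<zero>" using f(2) diff_zero_iff[of "Theta f" "Theta g"] by (simp add: Theta_carrier)
  then have "g = 0" using g(1) by (rule Theta_units_zero[rotated])
  then show "f \<in> tensor_ideal Mat i" using g(2) by simp
 qed
qed

text \<open>The cosets of the tensor ideal are the nonempty fibres of \<open>Theta\<close>, so the
  elements of the tensor power can be named by elements of \<open>L\<close> and coset arithmetic
  becomes arithmetic in \<open>L\<close>.\<close>

definition fib :: "'a => ('k mat list \<Rightarrow>\<^sub>0 'k) set" where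
 "fib z = {f \<in> carrier (MA i). Theta f = z}"

lemma coset_eq_fib: "f \<in> carrier (MA i) ==> tensor_ideal Mat i +>\<^bsub>MA i\<^esub> f = fib (Theta f)"
proof -
 assume f: "f \<in> carrier (MA i)"
 have "g \<in> tensor_ideal Mat i +>\<^bsub>MA i\<^esub> f \<longleftrightarrow> g \<in> fib (Theta f)" for g
 proof (cases "g \<in> carrier (MA i)")
  case True
  then have "g \<in> tensor_ideal Mat i +>\<^bsub>MA i\<^esub> f \<longleftrightarrow> g - f \<in> tensor_ideal Mat i"
   by (simp only: I.coset_mem[OF f] MA_diff[OF _ f] simp_thms)
  also have "\<dots> \<longleftrightarrow> Theta g \<ominus> Theta f = \<zero>"
   by (simp only: tensor_ideal_eq mem_Collect_eq MA_diff_closed[OF True f] Theta_diff simp_thms)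
  finally show ?thesis
   by (simp only: fib_def mem_Collect_eq True simp_thms diff_zero_iff[OF Theta_carrier Theta_carrier])
 next
  case False
  then show ?thesis unfolding I.coset_mem[OF f] by (simp only: fib_def mem_Collect_eq simp_thms)
 qed
 then show "tensor_ideal Mat i +>\<^bsub>MA i\<^esub> f = fib (Theta f)" by blast
qed

lemma fib_mem: "f \<in> carrier (MA i) ==> f \<in> fib (Theta f)"
 by (simp add: fib_def)

lemma fib_inj: "[|fib z = fib z'; z \<in> Theta ` carrier (MA i)|] ==> z = z'"
 by (auto simp: fib_def)

lemma tensor_power_carrier: "carrier (tensor_power Mat i) = fib ` Theta ` carrier (MA i)"
 by (auto simp: tensor_power_def quot_module_simps coset_eq_fib)

lemma tensor_power_one: "\<one>\<^bsub>tensor_power Mat i\<^esub> = fib \<one>"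
proof -
 have "Theta \<one>\<^bsub>MA i\<^esub> = \<one>"
  by (simp add: monoid_algebra_simps Theta_single tuple_monoid_simps fold_sandwich_one[simplified] S.scalar_one)
 then show ?thesis by (simp add: tensor_power_def quot_module_simps coset_eq_fib)
qed

lemma tensor_power_add:
 assumes "f \<in> carrier (MA i)" "g \<in> carrier (MA i)"
 shows "fib (Theta f) \<oplus>\<^bsub>tensor_power Mat i\<^esub> fib (Theta g) = fib (Theta f \<oplus> Theta g)"
proof -
 have "fib (Theta f) <+>\<^bsub>MA i\<^esub> fib (Theta g) = fib (Theta (f \<oplus>\<^bsub>MA i\<^esub> g))"
  using I.a_rcos_sum[OF assms] unfolding coset_eq_fib[OF assms(1)] coset_eq_fib[OF assms(2)]
   coset_eq_fib[OF MA.a_closed[OF assms]] .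
 then show ?thesis
  unfolding tensor_power_def quot_module_simps by (simp only: monoid_algebra_simps(4) Theta_add)
qed

lemma tensor_power_mult:
 assumes "f \<in> carrier (MA i)" "g \<in> carrier (MA i)"
 shows "fib (Theta f) \<otimes>\<^bsub>tensor_power Mat i\<^esub> fib (Theta g) = fib (Theta f \<otimes> Theta g)"
proof -
 have "rcoset_mult (MA i) (tensor_ideal Mat i) (fib (Theta f)) (fib (Theta g)) = fib (Theta (f \<otimes>\<^bsub>MA i\<^esub> g))"
  using I.rcoset_mult_add[OF assms] unfolding coset_eq_fib[OF assms(1)] coset_eq_fib[OF assms(2)]
   coset_eq_fib[OF MA.m_closed[OF assms]] .
 then show ?thesis
  unfolding tensor_power_def quot_module_simps by (simp only: Theta_mult[OF assms])
qed

lemma scale_MA: "f \<in> carrier (MA i) ==> Poly_Mapping.map ((*) c) f \<in> carrier (MA i)"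
 using keys_scale[of c f] by (auto simp: monoid_algebra_simps)

text \<open>Scaling a coset elementwise gives a full coset only for nonzero \<open>c\<close>. Adding
  the ideal, as \<open>quot_module\<close> does, also covers c = 0, where the scaled set is just
  {0}.\<close>

lemma tensor_power_scale:
 assumes f: "f \<in> carrier (MA i)"
 shows "c \<odot>\<^bsub>tensor_power Mat i\<^esub> fib (Theta f) = fib (c \<odot>\<^bsub>L\<^esub> Theta f)"
proof -
 have "g \<in> tensor_ideal Mat i <+>\<^bsub>MA i\<^esub> ((\<odot>\<^bsub>MA i\<^esub>) c ` fib (Theta f)) \<longleftrightarrow> g \<in> fib (c \<odot>\<^bsub>L\<^esub> Theta f)" for g
 proof
  assume "g \<in> tensor_ideal Mat i <+>\<^bsub>MA i\<^esub> ((\<odot>\<^bsub>MA i\<^esub>) c ` fib (Theta f))"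
  then obtain a h where ah: "a \<in> tensor_ideal Mat i" "h \<in> fib (Theta f)"
   "g = a \<oplus>\<^bsub>MA i\<^esub> (c \<odot>\<^bsub>MA i\<^esub> h)"
   unfolding set_add_def' by blast
  then have a: "a \<in> carrier (MA i)" "Theta a = \<zero>" and h: "h \<in> carrier (MA i)" "Theta h = Theta f"
   unfolding tensor_ideal_eq fib_def by auto
  have "Theta g = c \<odot>\<^bsub>L\<^esub> Theta f"
   unfolding ah(3) monoid_algebra_simps(4,5) Theta_add Theta_scale a(2) h(2)
   by (simp add: S.scalar_closed Theta_carrier)
  moreover have "g \<in> carrier (MA i)"
   unfolding ah(3) monoid_algebra_simps(5) by (intro MA.a_closed a scale_MA h)
  ultimately show "g \<in> fib (c \<odot>\<^bsub>L\<^esub> Theta f)" unfolding fib_def by blast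
 next
  assume "g \<in> fib (c \<odot>\<^bsub>L\<^esub> Theta f)"
  then have g: "g \<in> carrier (MA i)" "Theta g = c \<odot>\<^bsub>L\<^esub> Theta f" unfolding fib_def by auto
  have "Theta (g - Poly_Mapping.map ((*) c) f) = \<zero>"
   unfolding Theta_diff Theta_scale g(2)
   by (simp add: diff_zero_iff S.scalar_closed Theta_carrier)
  then have "g - Poly_Mapping.map ((*) c) f \<in> tensor_ideal Mat i"
   unfolding tensor_ideal_eq using MA_diff_closed[OF g(1) scale_MA[OF f]] by blast
  moreover have "g = (g - Poly_Mapping.map ((*) c) f) \<oplus>\<^bsub>MA i\<^esub> (c \<odot>\<^bsub>MA i\<^esub> f)"
   unfolding monoid_algebra_simps(4,5) by simp
  ultimately show "g \<in> tensor_ideal Mat i <+>\<^bsub>MA i\<^esub> ((\<odot>\<^bsub>MA i\<^esub>) c ` fib (Theta f))"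
   unfolding set_add_def' using fib_mem[OF f] by blast
 qed
 then show ?thesis unfolding tensor_power_def quot_module_simps by blast
qed

end

end

subsection \<open>The direct limit\<close>

context leavitt_nontrivial
begin

text \<open>The image of the i-th tensor power in \<open>L\<close>. The transition maps become
  inclusions of these subalgebras (\<open>img_mono\<close>), and by the normal forms in degree zero
  their union is the whole component (\<open>img_exhaust\<close>).\<close>

definition img :: "nat => 'a set" where
 "img i = Theta ` carrier (MA i)"

lemma img_comp: "z \<in> img i ==> z \<in> component L 0"
 by (auto simp: img_def Theta_comp)

lemma img_carrier: "z \<in> img i ==> z \<in> carrier L"
 using img_comp A.comp_carrier by blast

lemma img_add: "[|z \<in> img i; z' \<in> img i|] ==> z \<oplus> z' \<in> img i"
proof -
 interpret MA: ring "MA i" by (rule ring_monoid_algebra[OF monoid_tuple_monoid])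
 assume "z \<in> img i" "z' \<in> img i"
 then obtain f g where fg: "f \<in> carrier (MA i)" "z = Theta f" "g \<in> carrier (MA i)" "z' = Theta g"
  unfolding img_def by blast
 have "z \<oplus> z' = Theta (f \<oplus>\<^bsub>MA i\<^esub> g)" unfolding fg monoid_algebra_simps(4) Theta_add ..
 then show "z \<oplus> z' \<in> img i" unfolding img_def using MA.a_closed[OF fg(1,3)] by blast
qed

lemma img_mult: "[|z \<in> img i; z' \<in> img i|] ==> z \<otimes> z' \<in> img i"
proof -
 interpret MA: ring "MA i" by (rule ring_monoid_algebra[OF monoid_tuple_monoid])
 assume "z \<in> img i" "z' \<in> img i"
 then obtain f g where fg: "f \<in> carrier (MA i)" "z = Theta f" "g \<in> carrier (MA i)" "z' = Theta g"
  unfolding img_def by blast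
 have "z \<otimes> z' = Theta (f \<otimes>\<^bsub>MA i\<^esub> g)" unfolding fg Theta_mult[OF fg(1,3)] ..
 then show "z \<otimes> z' \<in> img i" unfolding img_def using MA.m_closed[OF fg(1,3)] by blast
qed

lemma img_scalar: "z \<in> img i ==> c \<odot>\<^bsub>L\<^esub> z \<in> img i"
proof -
 assume "z \<in> img i"
 then obtain f where f: "f \<in> carrier (MA i)" "z = Theta f" unfolding img_def by blast
 then show "c \<odot>\<^bsub>L\<^esub> z \<in> img i"
  unfolding img_def f(2) Theta_scale[symmetric] using scale_MA[OF f(1)] by blast
qed

lemma img_zero: "\<zero> \<in> img i"
proof -
 have "0 \<in> carrier (MA i)" by (simp add: monoid_algebra_simps(1))
 then show ?thesis unfolding img_def using Theta_zero by (metis imageI)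
qed

lemma normal_forms_img: "z \<in> normal_forms r (\<lambda>s. s = r) ==> z \<in> img r"
proof (induction rule: normal_forms.induct)
 case (add v w s z c)
 have "Y v \<otimes> X w = Theta (single (units v w) 1)"
  using add fold_sandwich_units[of v r w \<one>]
  by (simp add: Theta_single Y_words_closed X_words_closed S.scalar_one)
 moreover have "single (units v w) (1::'k) \<in> carrier (MA r)"
  using add by (intro single_MA units_carrier) auto
 ultimately have "Y v \<otimes> X w \<in> img r" unfolding img_def by blast
 then show ?case using add by (intro img_add img_scalar)
qed (rule img_zero)

definition one_left :: "('k mat list \<Rightarrow>\<^sub>0 'k) => ('k mat list \<Rightarrow>\<^sub>0 'k)" where
 "one_left f = (\<Sum>as \<in> keys f. single (1\<^sub>m (Suc n) # as) (lookup f as))"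

lemma Theta_one_left: "Theta (one_left f) = Theta f"
proof -
 have "Theta (\<Sum>as \<in> J. single (1\<^sub>m (Suc n) # as) (lookup f as))
   = (\<Oplus>as \<in> J. lookup f as \<odot>\<^bsub>L\<^esub> fold sandwich as \<one>)" if "finite J" for J
  using that
  by (induction J rule: finite_induct)
   (simp_all add: Theta_zero Theta_add Theta_single sandwich_one S.scalar_closed fold_sandwich_closed)
 then show ?thesis by (simp add: one_left_def Theta_def lin_ext_def)
qed

lemma one_left_closed: "f \<in> carrier (MA i) ==> one_left f \<in> carrier (MA (Suc i))"
proof -
 assume f: "f \<in> carrier (MA i)"
 have "keys (\<Sum>as \<in> J. single (1\<^sub>m (Suc n) # as) (lookup f as))
   \<subseteq> carrier (W (Suc i))" if "finite J" "J \<subseteq> carrier (W i)" for J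
  using that
 proof (induction J rule: finite_induct)
  case (insert as J)
  then have "1\<^sub>m (Suc n) # as \<in> carrier (W (Suc i))" by (simp add: tuple_monoid_simps)
  with insert show ?case by (simp add: keys_add_subset)
 qed simp
 from this[OF finite_keys] f show "one_left f \<in> carrier (MA (Suc i))"
  by (simp add: one_left_def monoid_algebra_simps(1))
qed

lemma img_mono: "i \<le> j ==> img i \<subseteq> img j"
proof (induction j rule: dec_induct)
 case (step j)
 have "img j \<subseteq> img (Suc j)"
 proof
  fix z assume "z \<in> img j"
  then obtain f where "f \<in> carrier (MA j)" "z = Theta (one_left f)"
   unfolding img_def Theta_one_left by blast
  then show "z \<in> img (Suc j)" unfolding img_def using one_left_closed by blast
 qed
 with step show ?case by blast
qed simp

lemma img_exhaust: "component L 0 = (\<Union>i. img i)"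
proof (intro equalityI subsetI)
 fix z assume "z \<in> component L 0"
 from normal_form_zero[OF this] show "z \<in> (\<Union>i. img i)" using normal_forms_img by blast
qed (use img_comp in blast)

text \<open>Adding the ideal of the next level enlarges the image of a fibre under
  \<open>one_left\<close> to the full fibre over the same element of \<open>L\<close>.\<close>

lemma tensor_one_left_fib:
 assumes "z \<in> img i" shows "tensor_one_left Mat i (fib i z) = fib (Suc i) z"
proof -
 obtain f where f: "f \<in> carrier (MA i)" "z = Theta f" using assms unfolding img_def by blast
 have eq: "tensor_one_left Mat i (fib i z)
   = tensor_ideal Mat (Suc i) <+>\<^bsub>MA (Suc i)\<^esub> (one_left ` fib i z)"
  unfolding tensor_one_left_def one_left_def[abs_def] module_mat_simps(3) ..
 have "g \<in> tensor_ideal Mat (Suc i) <+>\<^bsub>MA (Suc i)\<^esub> (one_left ` fib i z) \<longleftrightarrow> g \<in> fib (Suc i) z" for g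
 proof
  interpret MA: ring "MA (Suc i)" by (rule ring_monoid_algebra[OF monoid_tuple_monoid])
  assume "g \<in> tensor_ideal Mat (Suc i) <+>\<^bsub>MA (Suc i)\<^esub> (one_left ` fib i z)"
  then obtain a h where ah: "a \<in> tensor_ideal Mat (Suc i)" "h \<in> fib i z" "g = a \<oplus>\<^bsub>MA (Suc i)\<^esub> one_left h"
   unfolding set_add_def' by blast
  then have a: "a \<in> carrier (MA (Suc i))" "Theta a = \<zero>" and h: "h \<in> carrier (MA i)" "Theta h = z"
   unfolding tensor_ideal_eq fib_def by auto
  have "g \<in> carrier (MA (Suc i))"
   unfolding ah(3) by (intro MA.a_closed a one_left_closed h)
  moreover have "Theta g = z"
   unfolding ah(3) monoid_algebra_simps(4) Theta_add a(2) Theta_one_left h(2)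
   using assms by (simp add: img_carrier)
  ultimately show "g \<in> fib (Suc i) z" unfolding fib_def by blast
 next
  assume "g \<in> fib (Suc i) z"
  then have g: "g \<in> carrier (MA (Suc i))" "Theta g = z" unfolding fib_def by auto
  have "Theta (g - one_left f) = \<zero>"
   unfolding Theta_diff Theta_one_left g(2) f(2)[symmetric]
   using assms by (simp add: diff_zero_iff img_carrier)
  then have "g - one_left f \<in> tensor_ideal Mat (Suc i)"
   unfolding tensor_ideal_eq using MA_diff_closed[OF g(1) one_left_closed[OF f(1)]] by blast
  moreover have "g = (g - one_left f) \<oplus>\<^bsub>MA (Suc i)\<^esub> one_left f"
   unfolding monoid_algebra_simps(4) by simp
  moreover have "f \<in> fib i z" unfolding f(2) using f(1) by (rule fib_mem)
  ultimately show "g \<in> tensor_ideal Mat (Suc i) <+>\<^bsub>MA (Suc i)\<^esub> (one_left ` fib i z)"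
   unfolding set_add_def' by blast
 qed
 then show ?thesis unfolding eq by blast
qed

lemma fold_tensor_one_left:
 assumes "z \<in> img i" "i \<le> m"
 shows "fold (tensor_one_left Mat) [i..<m] (fib i z) = fib m z"
 using assms(2)
proof (induction m rule: dec_induct)
 case (step m)
 then show ?case using img_mono[OF step(1)] assms(1) tensor_one_left_fib[of z m] by auto
qed simp

lemma fib_img_inj: "[|fib i z = fib i z'; z \<in> img i|] ==> z = z'"
 using fib_inj by (auto simp: img_def)

text \<open>All representatives of \<open>z\<close>: one fibre for each level at which
  \<open>z\<close> occurs. These sets are the classes of \<open>dirlim_rel\<close>; nothing else is
  identified, since fibres of different elements at one level differ.\<close>

definition cls :: "'a => (nat \<times> ('k mat list \<Rightarrow>\<^sub>0 'k) set) set" where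
 "cls z = {(i, fib i z) | i. z \<in> img i}"

abbreviation "tensor_rel \<equiv> dirlim_rel (tensor_power Mat) (tensor_one_left Mat)"

lemma tensor_power_carrier_img: "carrier (tensor_power Mat i) = fib i ` img i"
 unfolding tensor_power_carrier img_def by blast

lemma dirlim_rel_image: "z \<in> img i ==> tensor_rel `` {(i, fib i z)} = cls z"
proof -
 assume z: "z \<in> img i"
 have "((i, fib i z), p) \<in> tensor_rel \<longleftrightarrow> p \<in> cls z" for p
 proof (cases p)
  case (Pair j b)
  show ?thesis
  proof
   assume "((i, fib i z), p) \<in> tensor_rel"
   then obtain m where m: "b \<in> carrier (tensor_power Mat j)" "i \<le> m" "j \<le> m"
    "fold (tensor_one_left Mat) [i..<m] (fib i z) = fold (tensor_one_left Mat) [j..<m] b"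
    unfolding Pair dirlim_rel_def by blast
   then obtain z' where z': "z' \<in> img j" "b = fib j z'" unfolding tensor_power_carrier_img by blast
   have "fib m z = fib m z'"
    using m(4) unfolding z'(2) fold_tensor_one_left[OF z m(2)] fold_tensor_one_left[OF z'(1) m(3)] .
   then have "z = z'" using img_mono[OF m(2)] z by (intro fib_img_inj[of m]) auto
   then show "p \<in> cls z" using z' unfolding Pair cls_def by blast
  next
   assume "p \<in> cls z"
   then have j: "z \<in> img j" "b = fib j z" unfolding Pair cls_def by auto
   have "fold (tensor_one_left Mat) [i..<max i j] (fib i z) = fold (tensor_one_left Mat) [j..<max i j] b"
    unfolding j(2) using z j(1) by (simp add: fold_tensor_one_left)
   then show "((i, fib i z), p) \<in> tensor_rel"
    unfolding Pair dirlim_rel_def tensor_power_carrier_img using z j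
    by (auto intro!: exI[of _ "max i j"])
  qed
 qed
 then show ?thesis by blast
qed

lemma cls_nonempty: "z \<in> component L 0 ==> cls z ~= {}"
 unfolding img_exhaust cls_def by blast

lemma UN_eq_const: "S ~= {} ==> (!!p. p \<in> S ==> F p = C) ==> (\<Union>p \<in> S. F p) = C"
 by blast

text \<open>The union in \<open>dirlim_op\<close> runs over representatives at arbitrary levels, but
  all of them contribute the same class, because both arguments can be moved to level
  \<open>max i j\<close> without changing the elements of \<open>L\<close> that they stand
  for.\<close>

lemma dirlim_op_cls:
 assumes z: "z \<in> component L 0" "z' \<in> component L 0"
  and oper: "!!i. [|z \<in> img i; z' \<in> img i|] ==> oper i (fib i z) (fib i z') = fib i u \<and> u \<in> img i"
 shows "dirlim_op (tensor_power Mat) (tensor_one_left Mat) oper (cls z) (cls z') = cls u"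
proof -
 have "tensor_rel `` {(max i j, oper (max i j) (fold (tensor_one_left Mat) [i..<max i j] a)
   (fold (tensor_one_left Mat) [j..<max i j] b))} = cls u"
  if "(i, a) \<in> cls z" "(j, b) \<in> cls z'" for i j a b
 proof -
  have ij: "z \<in> img i" "a = fib i z" "z' \<in> img j" "b = fib j z'" using that unfolding cls_def by auto
  then have "z \<in> img (max i j)" "z' \<in> img (max i j)"
   using img_mono[of i "max i j"] img_mono[of j "max i j"] by auto
  then show ?thesis using oper[of "max i j"] ij by (simp add: fold_tensor_one_left dirlim_rel_image)
 qed
 note op = this
 have *: "(case p of (i, a) => \<Union>(j, b) \<in> cls z'. tensor_rel `` {(max i j,
   oper (max i j) (fold (tensor_one_left Mat) [i..<max i j] a)
   (fold (tensor_one_left Mat) [j..<max i j] b))}) = cls u" if "p \<in> cls z" for p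
 proof (cases p)
  case (Pair i a)
  have "(case q of (j, b) => tensor_rel `` {(max i j,
   oper (max i j) (fold (tensor_one_left Mat) [i..<max i j] a)
   (fold (tensor_one_left Mat) [j..<max i j] b))}) = cls u" if "q \<in> cls z'" for q
   using that \<open>p \<in> cls z\<close> unfolding Pair by (cases q) (simp add: op)
  then show ?thesis
   unfolding Pair prod.case using cls_nonempty[OF z(2)] by (intro UN_eq_const) auto
 qed
 show ?thesis
  unfolding dirlim_op_def using cls_nonempty[OF z(1)] * by (rule UN_eq_const)
qed

lemma degree_zero_iso: "isomorphic_algebras (degree_zero L) (matrix_tensor_limit n)"
proof -
 let ?S = "dirlim (tensor_power Mat) (tensor_one_left Mat)"
 have S: "matrix_tensor_limit n = ?S" by (simp add: matrix_tensor_limit_def)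
 have carrier: "carrier ?S = cls ` component L 0"
 proof -
  have "carrier ?S = (\<Union>i. (\<lambda>a. tensor_rel `` {(i, a)}) ` carrier (tensor_power Mat i))"
   unfolding dirlim_def quotient_def by auto
  also have "\<dots> = (\<Union>i. cls ` img i)"
   unfolding tensor_power_carrier_img image_image
   by (intro SUP_cong refl image_cong) (simp add: dirlim_rel_image)
  also have "\<dots> = cls ` component L 0" unfolding img_exhaust by blast
  finally show ?thesis .
 qed
 have inj: "inj_on cls (component L 0)"
 proof (rule inj_onI)
  fix z z' assume z: "z \<in> component L 0" and "cls z = cls z'"
  then obtain i where "z \<in> img i" "(i, fib i z) \<in> cls z'" unfolding img_exhaust cls_def by blast
  then show "z = z'" using fib_img_inj unfolding cls_def by auto
 qed
 have hom: "cls \<in> Ring.ring_hom (degree_zero L) ?S"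
 proof (rule ring_hom_memI)
  fix z z' assume "z \<in> carrier (degree_zero L)" "z' \<in> carrier (degree_zero L)"
  then have z: "z \<in> component L 0" "z' \<in> component L 0" by (auto simp: degree_zero_def)
  show "cls z \<in> carrier ?S" using z carrier by blast
  have "cls z \<otimes>\<^bsub>?S\<^esub> cls z' = cls (z \<otimes> z')"
   unfolding dirlim_def using z by (simp, intro dirlim_op_cls conjI) (auto simp: img_mult, auto simp: img_def tensor_power_mult)
  then show "cls (z \<otimes>\<^bsub>degree_zero L\<^esub> z') = cls z \<otimes>\<^bsub>?S\<^esub> cls z'" by (simp add: degree_zero_def)
  have "cls z \<oplus>\<^bsub>?S\<^esub> cls z' = cls (z \<oplus> z')"
   unfolding dirlim_def using z by (simp, intro dirlim_op_cls conjI) (auto simp: img_add, auto simp: img_def tensor_power_add)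
  then show "cls (z \<oplus>\<^bsub>degree_zero L\<^esub> z') = cls z \<oplus>\<^bsub>?S\<^esub> cls z'" by (simp add: degree_zero_def)
 next
  have "\<one> \<in> img 0"
  proof -
   have "\<one> = Theta (single [] 1)" by (simp add: Theta_single S.scalar_one)
   moreover have "single [] (1::'k) \<in> carrier (MA 0)"
    by (rule single_MA) (simp add: tuple_monoid_simps)
   ultimately show ?thesis unfolding img_def by blast
  qed
  then show "cls \<one>\<^bsub>degree_zero L\<^esub> = \<one>\<^bsub>?S\<^esub>"
   by (simp add: dirlim_def degree_zero_def tensor_power_one dirlim_rel_image)
 qed
 have "bij_betw cls (carrier (degree_zero L)) (carrier ?S)"
  using inj carrier by (simp add: bij_betw_def degree_zero_def)
 with hom have "cls \<in> ring_iso (degree_zero L) ?S" by (simp add: ring_iso_def)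
 moreover have "cls (c \<odot>\<^bsub>degree_zero L\<^esub> z) = c \<odot>\<^bsub>?S\<^esub> cls z" if "z \<in> carrier (degree_zero L)" for c z
 proof -
  have z: "z \<in> component L 0" using that by (simp add: degree_zero_def)
  have "tensor_rel `` {(i, c \<odot>\<^bsub>tensor_power Mat i\<^esub> a)} = cls (c \<odot>\<^bsub>L\<^esub> z)" if "(i, a) \<in> cls z" for i a
  proof -
   have ia: "z \<in> img i" "a = fib i z" using that unfolding cls_def by auto
   then have "c \<odot>\<^bsub>tensor_power Mat i\<^esub> a = fib i (c \<odot>\<^bsub>L\<^esub> z)"
    by (auto simp: img_def tensor_power_scale)
   then show ?thesis using ia by (simp add: dirlim_rel_image img_scalar)
  qed
  then have "(\<Union>(i, a) \<in> cls z. tensor_rel `` {(i, c \<odot>\<^bsub>tensor_power Mat i\<^esub> a)}) = cls (c \<odot>\<^bsub>L\<^esub> z)"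
   using cls_nonempty[OF z] by (intro UN_eq_const) auto
  then have "c \<odot>\<^bsub>?S\<^esub> cls z = cls (c \<odot>\<^bsub>L\<^esub> z)"
   unfolding dirlim_def by simp
  then show ?thesis by (simp add: degree_zero_def)
 qed
 ultimately show ?thesis unfolding S isomorphic_algebras_def by blast
qed

end

section \<open>Graded modules over strongly graded algebras\<close>

text \<open>Cardinal arithmetic: an infinite set is equipotent with the set of its finite lists and
  absorbs a countable factor. Both the coinduced modules and the germs are relabelled through this
  fact.\<close>

lemma inj_into_infinite:
 assumes C: "infinite C" and g: "inj_on g X" "g ` X \<subseteq> (UNIV :: nat set) \<times> lists C"
 shows "\<exists>h. inj_on h X \<and> h ` X \<subseteq> C"
proof -
 have "(card_of (UNIV :: nat set), card_of C) \<in> ordLeq"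
  using C by (simp add: infinite_iff_card_of_nat[symmetric])
 moreover have "(card_of (lists C), card_of C) \<in> ordLeq"
  using card_of_lists_infinite[OF C] by (rule ordIso_imp_ordLeq)
 ultimately have "(card_of ((UNIV :: nat set) \<times> lists C), card_of C) \<in> ordLeq"
  by (rule card_of_Times_ordLeq_infinite[OF C])
 then obtain k where k: "inj_on k ((UNIV :: nat set) \<times> lists C)" "k ` ((UNIV :: nat set) \<times> lists C) \<subseteq> C"
  unfolding card_of_ordLeq[symmetric] by blast
 have "inj_on (k \<circ> g) X" using g k(1) by (intro comp_inj_on) (auto intro: inj_on_subset)
 moreover have "(k \<circ> g) ` X \<subseteq> C" using order_trans[OF image_mono[OF g(2)] k(2)] by (simp add: image_comp)
 ultimately show ?thesis by blast
qed

definition zero_part :: "('a, 'u) graded => ('a, 'u) module" where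
 "zero_part M = \<lparr>carrier = component M 0, mult = mult M, one = \<one>\<^bsub>M\<^esub>, zero = \<zero>\<^bsub>M\<^esub>, add = add M, smult = smult M\<rparr>"

lemma zero_part_simps [simp]:
 "carrier (zero_part M) = component M 0" "zero (zero_part M) = zero M" "add (zero_part M) = add M"
 "smult (zero_part M) = smult M"
 by (simp_all add: zero_part_def)

lemma degree_zero_simps [simp]:
 "carrier (degree_zero A) = component A 0" "zero (degree_zero A) = zero A" "add (degree_zero A) = add A"
 "mult (degree_zero A) = mult A" "one (degree_zero A) = one A"
 by (simp_all add: degree_zero_def)

lemma LMod_iso:
 assumes M: "left_module A M" and N: "left_module A N"
  and f: "f \<in> carrier M \<rightarrow> carrier N" "f \<in> extensional (carrier M)"
   "!!x y. [|x \<in> carrier M; y \<in> carrier M|] ==> f (x \<oplus>\<^bsub>M\<^esub> y) = f x \<oplus>\<^bsub>N\<^esub> f y"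
   "!!a x. [|a \<in> carrier A; x \<in> carrier M|] ==> f (a \<odot>\<^bsub>M\<^esub> x) = a \<odot>\<^bsub>N\<^esub> f x"
  and bij: "bij_betw f (carrier M) (carrier N)"
 shows "f \<in> cat_iso (LMod A) M N"
proof -
 interpret M: left_module A M by fact
 interpret N: left_module A N by fact
 define g where "g = (\<lambda>y \<in> carrier N. inv_into (carrier M) f y)"
 have g: "g y \<in> carrier M" "f (g y) = y" if "y \<in> carrier N" for y
  using bij that by (auto simp: g_def bij_betw_def intro: inv_into_into f_inv_into_f)
 have gI: "g y = x" if "x \<in> carrier M" "f x = y" for x y
  using bij that f(1) by (auto simp: g_def bij_betw_def)
 have "g \<in> homs (LMod A) N M"
  by (auto simp: LMod_def LinearCombinations.module_hom_def g M.smult_closed f(3,4) intro!: gI)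
   (auto simp: g_def)
 moreover have "compose (carrier M) g f = (\<lambda>x \<in> carrier M. x)"
  "compose (carrier N) f g = (\<lambda>x \<in> carrier N. x)"
  by (auto simp: fun_eq_iff compose_def g gI)
 ultimately show ?thesis using f
  by (auto simp: cat_iso_def) (auto simp: LMod_def LinearCombinations.module_hom_def)
qed

section \<open>Restriction to degree zero over a strongly graded algebra\<close>

locale strongly_graded_alg = graded_alg A for A :: "('k::field, 'a) graded" (structure) +
 assumes strong: "component A j \<cdot> component A (- j) = component A 0"
begin

lemma ring_degree_zero: "ring (degree_zero A)"
proof (rule ringI)
 show "abelian_group (degree_zero A)"
 proof (rule abelian_groupI, goal_cases)
  case (6 a)
  then show ?case
   by (intro bexI[of _ "\<ominus> a"]) (auto simp: l_neg A.comp_carrier A.comp_minus)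
 qed (auto simp: A.comp_carrier a_ac A.comp_add A.comp_zero)
 have "a \<otimes> b \<in> component A 0" if "a \<in> component A 0" "b \<in> component A 0" for a b
  using comp_mult[OF that] by simp
 then show "monoid (degree_zero A)"
  by (intro monoidI) (auto simp: A.comp_carrier m_assoc comp_one)
qed (auto simp: A.comp_carrier l_distr r_distr)

lemma zero_part_left_module:
 assumes "graded_mod A M" shows "left_module (degree_zero A) (zero_part M)"
proof -
 interpret M: graded_mod A M by fact
 have "abelian_group (zero_part M)"
 proof (rule abelian_groupI, goal_cases)
  case (6 x)
  then show ?case
   by (intro bexI[of _ "\<ominus>\<^bsub>M\<^esub> x"]) (auto simp: M.M.l_neg M.M.comp_carrier M.M.comp_minus)
 qed (auto simp: M.M.comp_carrier M.M.a_ac M.M.comp_add M.M.comp_zero)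
 then show ?thesis
  using M.comp_smult[of _ 0 _ 0]
  by (intro left_moduleI ring_degree_zero)
   (auto simp: A.comp_carrier M.M.comp_carrier M.smult_l_distr M.smult_r_distr M.smult_assoc1 M.smult_one)
qed

lemma one_in_prod: "\<one> \<in> component A j \<cdot> component A (- j)"
 using strong comp_one by simp

lemma prod_closed: "z \<in> component A i \<cdot> component A j ==> z \<in> component A (i + j)"
 by (induction rule: ideal_prod.induct) (auto intro: comp_mult A.comp_add)

context
 fixes M :: "('a, 'u) graded" assumes M: "graded_mod A M"
begin

interpretation M: graded_mod A M by (rule M)

lemma hpart_smult_comp:
 assumes b: "b \<in> carrier A" and x: "x \<in> component M j"
 shows "hpart M (b \<odot>\<^bsub>M\<^esub> x) 0 = hpart A b (- j) \<odot>\<^bsub>M\<^esub> x"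
 using b
proof (induction b rule: A.homogeneous_induct)
 case zero
 then show ?case using x by (simp add: A.hpart_zero M.zero_smult M.M.comp_carrier M.M.hpart_zero)
next
 case (homogeneous i b)
 then show ?case using x M.comp_smult[OF homogeneous x]
  by (auto simp: A.hpart_comp M.M.hpart_comp M.zero_smult M.M.comp_carrier)
next
 case (add a b)
 then show ?case using x
  by (simp add: M.smult_l_distr M.M.hpart_add M.smult_closed M.M.comp_carrier A.hpart_add A.hpart_closed)
qed

text \<open>Writing 1 as a sum of products a b, with a of degree j and b of degree -j, exhibits x as
  a sum of elements a (b x).\<close>

lemma zero_if_annihilated:
 assumes x: "x \<in> component M j" and "!!b. b \<in> component A (- j) ==> b \<odot>\<^bsub>M\<^esub> x = \<zero>\<^bsub>M\<^esub>"
 shows "x = \<zero>\<^bsub>M\<^esub>"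
proof -
 have xc: "x \<in> carrier M" using x by (rule M.M.comp_carrier)
 have "z \<odot>\<^bsub>M\<^esub> x = \<zero>\<^bsub>M\<^esub> \<and> z \<in> carrier A" if "z \<in> component A j \<cdot> component A (- j)" for z
  using that
  by (induction rule: ideal_prod.induct)
   (auto simp: assms(2) xc M.smult_assoc1 M.smult_l_distr A.comp_carrier M.smult_zero)
 from this[OF one_in_prod] show ?thesis using xc by (simp add: M.smult_one)
qed

text \<open>A multiplier of degree -j isolates the degree j part of the difference, to which
  \<open>zero_if_annihilated\<close> applies.\<close>

lemma eqI_hpart_smult:
 assumes x: "x \<in> carrier M" "y \<in> carrier M"
  and eq: "!!b. b \<in> carrier A ==> hpart M (b \<odot>\<^bsub>M\<^esub> x) 0 = hpart M (b \<odot>\<^bsub>M\<^esub> y) 0"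
 shows "x = y"
proof -
 let ?d = "x \<ominus>\<^bsub>M\<^esub> y"
 have d: "?d \<in> carrier M" using x by simp
 have "hpart M ?d j = \<zero>\<^bsub>M\<^esub>" for j
 proof (rule zero_if_annihilated[of _ j])
  fix b assume b: "b \<in> component A (- j)"
  have "b \<odot>\<^bsub>M\<^esub> hpart M ?d j = hpart M (b \<odot>\<^bsub>M\<^esub> ?d) 0"
   using M.hpart_smult[OF b d, of j] by simp
  also have "\<dots> = \<zero>\<^bsub>M\<^esub>"
   using x eq[of b] b by (simp add: M.smult_diff A.comp_carrier M.M.hpart_diff M.smult_closed
     M.M.diff_zero_iff M.M.hpart_closed)
  finally show "b \<odot>\<^bsub>M\<^esub> hpart M ?d j = \<zero>\<^bsub>M\<^esub>" .
 qed (rule M.M.hpart(1)[OF d])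
 then have "?d = \<zero>\<^bsub>M\<^esub>" by (intro M.M.hpart_eqI[OF d M.M.zero_closed]) (simp add: M.M.hpart_zero)
 then show ?thesis using x by (simp add: M.M.diff_zero_iff)
qed

end

text \<open>The homogeneous parts of \<open>b x\<close> in degree zero determine \<open>x\<close>; a homomorphism of the degree zero
 parts is extended by prescribing these.\<close>

lemma extend_hom:
 assumes M: "graded_mod A M" and N: "graded_mod A N"
  and f: "f \<in> LinearCombinations.module_hom (degree_zero A) (zero_part M) (zero_part N)"
 shows "\<exists>F \<in> graded_hom A M N. \<forall>x \<in> component M 0. F x = f x"
proof -
 interpret M: graded_mod A M by fact
 interpret N: graded_mod A N by fact
 have fc: "f x \<in> component N 0" if "x \<in> component M 0" for x
  using f that by (auto simp: LinearCombinations.module_hom_def)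
 have fa: "f (x \<oplus>\<^bsub>M\<^esub> y) = f x \<oplus>\<^bsub>N\<^esub> f y" if "x \<in> component M 0" "y \<in> component M 0" for x y
  using f that by (auto simp: LinearCombinations.module_hom_def)
 have fs: "f (a \<odot>\<^bsub>M\<^esub> x) = a \<odot>\<^bsub>N\<^esub> f x" if "a \<in> component A 0" "x \<in> component M 0" for a x
  using f that by (auto simp: LinearCombinations.module_hom_def)
 define rel where "rel x y \<longleftrightarrow> y \<in> carrier N \<and>
   (\<forall>b \<in> carrier A. hpart N (b \<odot>\<^bsub>N\<^esub> y) 0 = f (hpart M (b \<odot>\<^bsub>M\<^esub> x) 0))" for x y
 have unique: "y = y'" if "rel x y" "rel x y'" for x y y'
  using that by - (rule eqI_hpart_smult[OF N], auto simp: rel_def)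
 have rel_add: "rel (x \<oplus>\<^bsub>M\<^esub> x') (y \<oplus>\<^bsub>N\<^esub> y')" if "rel x y" "rel x' y'" "x \<in> carrier M" "x' \<in> carrier M" for x x' y y'
  using that unfolding rel_def
  by (simp add: N.smult_r_distr M.smult_r_distr N.M.hpart_add M.M.hpart_add N.smult_closed M.smult_closed
    fa M.M.hpart(1))
 have rel_comp: "\<exists>y \<in> component N j. rel x y" if x: "x \<in> component M j" for j x
 proof -
  have xc: "x \<in> carrier M" using x by (rule M.M.comp_carrier)
  have bx: "b \<odot>\<^bsub>M\<^esub> x \<in> component M 0" if "b \<in> component A (- j)" for b
   using M.comp_smult[OF that x] by simp
  \<comment> \<open>The value at x is built by induction over z in the product of the components of
    degrees j and -j, with z inserted before x: for z = a c take a f(c x), for a sum add the values.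
    Setting z = 1 yields y. Existence is all that is needed here, because uniqueness is provided by
    \<open>eqI_hpart_smult\<close>.\<close>
  have "\<exists>y \<in> component N j. \<forall>b \<in> component A (- j). b \<odot>\<^bsub>N\<^esub> y = f ((b \<otimes> z) \<odot>\<^bsub>M\<^esub> x)"
   if "z \<in> component A j \<cdot> component A (- j)" for z
   using that
  proof (induction rule: ideal_prod.induct)
   case (prod a c)
   have ac: "a \<in> carrier A" "c \<in> carrier A" using prod by (auto simp: A.comp_carrier)
   have y: "a \<odot>\<^bsub>N\<^esub> f (c \<odot>\<^bsub>M\<^esub> x) \<in> component N j"
    using N.comp_smult[OF prod(1) fc[OF bx[OF prod(2)]]] by simp
   moreover have "b \<odot>\<^bsub>N\<^esub> (a \<odot>\<^bsub>N\<^esub> f (c \<odot>\<^bsub>M\<^esub> x)) = f ((b \<otimes> (a \<otimes> c)) \<odot>\<^bsub>M\<^esub> x)"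
    if b: "b \<in> component A (- j)" for b
   proof -
    have bc: "b \<in> carrier A" using b by (rule A.comp_carrier)
    have ba: "b \<otimes> a \<in> component A 0" using comp_mult[OF b prod(1)] by simp
    have "b \<odot>\<^bsub>N\<^esub> (a \<odot>\<^bsub>N\<^esub> f (c \<odot>\<^bsub>M\<^esub> x)) = (b \<otimes> a) \<odot>\<^bsub>N\<^esub> f (c \<odot>\<^bsub>M\<^esub> x)"
     using ac bc N.M.comp_carrier[OF fc[OF bx[OF prod(2)]]] by (simp add: N.smult_assoc1)
    also have "\<dots> = f ((b \<otimes> a) \<odot>\<^bsub>M\<^esub> (c \<odot>\<^bsub>M\<^esub> x))" using fs[OF ba bx[OF prod(2)]] by simp
    also have "(b \<otimes> a) \<odot>\<^bsub>M\<^esub> (c \<odot>\<^bsub>M\<^esub> x) = (b \<otimes> (a \<otimes> c)) \<odot>\<^bsub>M\<^esub> x"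
     using ac bc xc by (simp add: M.smult_assoc1 M.smult_closed)
    finally show ?thesis .
   qed
   ultimately show ?case by blast
  next
   case (sum s t)
   then obtain y y' where y: "y \<in> component N j" "!!b. b \<in> component A (- j) ==> b \<odot>\<^bsub>N\<^esub> y = f ((b \<otimes> s) \<odot>\<^bsub>M\<^esub> x)"
    "y' \<in> component N j" "!!b. b \<in> component A (- j) ==> b \<odot>\<^bsub>N\<^esub> y' = f ((b \<otimes> t) \<odot>\<^bsub>M\<^esub> x)"
    by blast
   have st: "s \<in> component A 0" "t \<in> component A 0" using sum(1,2) strong by auto
   have "b \<odot>\<^bsub>N\<^esub> (y \<oplus>\<^bsub>N\<^esub> y') = f ((b \<otimes> (s \<oplus> t)) \<odot>\<^bsub>M\<^esub> x)" if b: "b \<in> component A (- j)" for b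
   proof -
    have bst: "b \<otimes> s \<in> component A (- j)" "b \<otimes> t \<in> component A (- j)"
     using comp_mult[OF b] st by fastforce+
    show ?thesis
     using b y st xc fa[OF bx[OF bst(1)] bx[OF bst(2)]]
     by (simp add: N.smult_r_distr A.comp_carrier N.M.comp_carrier r_distr M.smult_l_distr)
   qed
   then show ?case using y(1,3) N.M.comp_add by blast
  qed
  from this[OF one_in_prod] obtain y where y: "y \<in> component N j"
   "!!b. b \<in> component A (- j) ==> b \<odot>\<^bsub>N\<^esub> y = f (b \<odot>\<^bsub>M\<^esub> x)"
   by (auto simp: A.comp_carrier)
  have "rel x y"
   unfolding rel_def using y x
   by (auto simp: hpart_smult_comp[OF M] hpart_smult_comp[OF N] A.hpart(1) N.M.comp_carrier)
  then show ?thesis using y(1) by blast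
 qed
 have f0: "f \<zero>\<^bsub>M\<^esub> = \<zero>\<^bsub>N\<^esub>"
  using fs[OF A.comp_zero M.M.comp_zero] fc[OF M.M.comp_zero]
  by (simp add: M.zero_smult N.zero_smult N.M.comp_carrier)
 have ex: "\<exists>y. rel x y" if "x \<in> carrier M" for x
  using that
 proof (induction x rule: M.M.homogeneous_induct)
  case zero
  have "rel \<zero>\<^bsub>M\<^esub> \<zero>\<^bsub>N\<^esub>"
   by (simp add: rel_def M.smult_zero N.smult_zero M.M.hpart_zero N.M.hpart_zero f0)
  then show ?case by blast
 qed (use rel_comp rel_add in blast)+
 define F where "F = (\<lambda>x \<in> carrier M. THE y. rel x y)"
 have F: "rel x (F x)" if "x \<in> carrier M" for x
  unfolding F_def using that ex[OF that] unique by (auto intro: theI)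
 have FI: "F x = y" if "x \<in> carrier M" "rel x y" for x y
  using unique[OF F] that by blast
 have Fc: "F x \<in> carrier N" if "x \<in> carrier M" for x using F[OF that] by (simp add: rel_def)
 have "F \<in> graded_hom A M N"
 proof (rule graded_homI)
  show "F (x \<oplus>\<^bsub>M\<^esub> y) = F x \<oplus>\<^bsub>N\<^esub> F y" if "x \<in> carrier M" "y \<in> carrier M" for x y
   using that by (intro FI rel_add F) auto
  show "F (a \<odot>\<^bsub>M\<^esub> x) = a \<odot>\<^bsub>N\<^esub> F x" if a: "a \<in> carrier A" and x: "x \<in> carrier M" for a x
  proof (rule FI)
   show "rel (a \<odot>\<^bsub>M\<^esub> x) (a \<odot>\<^bsub>N\<^esub> F x)"
    using F[OF x] a x unfolding rel_def
    by (auto simp: N.smult_closed simp flip: N.smult_assoc1 M.smult_assoc1)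
  qed (use a x in \<open>simp add: M.smult_closed\<close>)
  show "F x \<in> component N i" if x: "x \<in> component M i" for i x
  proof -
   obtain y where "y \<in> component N i" "rel x y" using rel_comp[OF x] by blast
   then show ?thesis using FI[OF M.M.comp_carrier[OF x]] by simp
  qed
  show "F \<in> extensional (carrier M)" by (simp add: F_def)
 qed (rule Fc)
 moreover have "F x = f x" if x: "x \<in> component M 0" for x
 proof -
  obtain y where y: "y \<in> component N 0" "rel x y" using rel_comp[OF x] by blast
  then have "hpart N (\<one> \<odot>\<^bsub>N\<^esub> y) 0 = f (hpart M (\<one> \<odot>\<^bsub>M\<^esub> x) 0)" by (simp add: rel_def)
  then have "y = f x" using y x
   by (simp add: N.smult_one M.smult_one N.M.comp_carrier M.M.comp_carrier N.M.hpart_comp M.M.hpart_comp)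
  then show ?thesis using FI[OF M.M.comp_carrier[OF x] y(2)] by simp
 qed
 ultimately show ?thesis by blast
qed

lemma hom_eqI:
 assumes M: "graded_mod A M" and N: "graded_mod A N"
  and f: "f \<in> graded_hom A M N" and g: "g \<in> graded_hom A M N"
  and eq: "!!x. x \<in> component M 0 ==> f x = g x"
 shows "f = g"
proof
 fix x
 interpret M: graded_mod A M by fact
 interpret N: graded_mod A N by fact
 have h: "hpart N (b \<odot>\<^bsub>N\<^esub> h x) 0 = h (hpart M (b \<odot>\<^bsub>M\<^esub> x) 0)"
  if "h \<in> graded_hom A M N" "b \<in> carrier A" "x \<in> carrier M" for h b
  using that hpart_add_map[OF M.M.graded_group_axioms N.M.graded_group_axioms graded_homD(6)[OF that(1)],
    of 0 "b \<odot>\<^bsub>M\<^esub> x" 0]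
  by (simp add: graded_homD[OF that(1)] M.smult_closed)
 show "f x = g x"
 proof (cases "x \<in> carrier M")
  case True
  show ?thesis
  proof (rule eqI_hpart_smult[OF N])
   fix b assume b: "b \<in> carrier A"
   show "hpart N (b \<odot>\<^bsub>N\<^esub> f x) 0 = hpart N (b \<odot>\<^bsub>N\<^esub> g x) 0"
    using True b by (simp add: h f g eq M.M.hpart(1) M.smult_closed)
  qed (use True f g in \<open>auto simp: graded_homD\<close>)
 next
  case False
  then show ?thesis using graded_homD(5)[OF f] graded_homD(5)[OF g] by (simp add: extensional_def)
 qed
qed


subsection \<open>Coinduced modules\<close>

text \<open>The graded module of maps from \<open>A\<close> to \<open>V\<close> that are linear over
  degree zero, with \<open>A\<close> acting by right translation of the argument. Vanishing outside
  finitely many degrees keeps only finite sums of homogeneous maps. A map of degree j lives on the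
  component of degree -j, so that maps of degree zero are determined by their value at 1.\<close>

definition coind :: "('a, 'v, 'z) module_scheme => ('a, 'a => 'v) graded" where
 "coind V = (let C = {ph \<in> carrier A \<rightarrow>\<^sub>E carrier V.
    (\<forall>b \<in> carrier A. \<forall>c \<in> carrier A. ph (b \<oplus> c) = ph b \<oplus>\<^bsub>V\<^esub> ph c) \<and>
    (\<forall>a \<in> component A 0. \<forall>b \<in> carrier A. ph (a \<otimes> b) = a \<odot>\<^bsub>V\<^esub> ph b) \<and>
    (\<exists>J. finite J \<and> (\<forall>i. i \<notin> J --> (\<forall>b \<in> component A i. ph b = \<zero>\<^bsub>V\<^esub>)))}
   in \<lparr>carrier = C, mult = (\<lambda>ph ps. ph), one = (\<lambda>b \<in> carrier A. \<zero>\<^bsub>V\<^esub>), zero = (\<lambda>b \<in> carrier A. \<zero>\<^bsub>V\<^esub>),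
     add = (\<lambda>ph ps. \<lambda>b \<in> carrier A. ph b \<oplus>\<^bsub>V\<^esub> ps b), smult = (\<lambda>a ph. \<lambda>b \<in> carrier A. ph (b \<otimes> a)),
     component = (\<lambda>j. {ph \<in> C. \<forall>i. i ~= - j --> (\<forall>b \<in> component A i. ph b = \<zero>\<^bsub>V\<^esub>)})\<rparr>)"

context
 fixes V :: "('a, 'v, 'z) module_scheme" assumes V: "left_module (degree_zero A) V"
begin

interpretation V: left_module "degree_zero A" V by (rule V)

lemma coind_simps:
 "zero (coind V) = (\<lambda>b \<in> carrier A. \<zero>\<^bsub>V\<^esub>)" "ph \<oplus>\<^bsub>coind V\<^esub> ps = (\<lambda>b \<in> carrier A. ph b \<oplus>\<^bsub>V\<^esub> ps b)"
 "a \<odot>\<^bsub>coind V\<^esub> ph = (\<lambda>b \<in> carrier A. ph (b \<otimes> a))"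
 "component (coind V) j = {ph \<in> carrier (coind V). \<forall>i. i ~= - j --> (\<forall>b \<in> component A i. ph b = \<zero>\<^bsub>V\<^esub>)}"
 by (simp_all add: coind_def Let_def)

lemma coind_compD:
 "[|ph \<in> component (coind V) j; i ~= - j; b \<in> component A i|] ==> ph b = \<zero>\<^bsub>V\<^esub>"
 by (auto simp: coind_simps)

lemma coindI:
 assumes "!!b. b \<in> carrier A ==> ph b \<in> carrier V" "ph \<in> extensional (carrier A)"
  "!!b c. [|b \<in> carrier A; c \<in> carrier A|] ==> ph (b \<oplus> c) = ph b \<oplus>\<^bsub>V\<^esub> ph c"
  "!!a b. [|a \<in> component A 0; b \<in> carrier A|] ==> ph (a \<otimes> b) = a \<odot>\<^bsub>V\<^esub> ph b"
  "finite J" "!!i b. [|i \<notin> J; b \<in> component A i|] ==> ph b = \<zero>\<^bsub>V\<^esub>"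
 shows "ph \<in> carrier (coind V)"
 using assms by (auto simp: coind_def Let_def PiE_iff)

lemma coindD:
 assumes "ph \<in> carrier (coind V)"
 shows "b \<in> carrier A ==> ph b \<in> carrier V" "ph \<in> extensional (carrier A)"
  "[|b \<in> carrier A; c \<in> carrier A|] ==> ph (b \<oplus> c) = ph b \<oplus>\<^bsub>V\<^esub> ph c"
  "[|a \<in> component A 0; b \<in> carrier A|] ==> ph (a \<otimes> b) = a \<odot>\<^bsub>V\<^esub> ph b"
 using assms by (auto simp: coind_def Let_def PiE_iff)

lemma coind_support:
 assumes "ph \<in> carrier (coind V)"
 obtains J where "finite J" "!!i b. [|i \<notin> J; b \<in> component A i|] ==> ph b = \<zero>\<^bsub>V\<^esub>"
 using assms by (auto simp: coind_def Let_def)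

lemma coind_additive: "ph \<in> carrier (coind V) ==> additive_map A V ph"
 by unfold_locales (auto intro!: add_mapI simp: coindD)

lemma coind_eqI:
 assumes ph: "ph \<in> carrier (coind V)" and ps: "ps \<in> carrier (coind V)"
  and eq: "!!i b. b \<in> component A i ==> ph b = ps b"
 shows "ph = ps"
proof (rule extensionalityI)
 interpret ph: additive_map A V ph by (rule coind_additive[OF ph])
 interpret ps: additive_map A V ps by (rule coind_additive[OF ps])
 show "ph b = ps b" if "b \<in> carrier A" for b
  using that by (induction b rule: A.homogeneous_induct) (auto simp: eq ph.add ps.add ph.zero ps.zero)
qed (use ph ps in \<open>auto simp: coindD\<close>)

lemma coind_zero: "(\<lambda>b \<in> carrier A. \<zero>\<^bsub>V\<^esub>) \<in> carrier (coind V)"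
 by (rule coindI[where J = "{}"]) (auto simp: V.smult_zero A.comp_carrier)

lemma coind_add:
 assumes ph: "ph \<in> carrier (coind V)" and ps: "ps \<in> carrier (coind V)"
 shows "(\<lambda>b \<in> carrier A. ph b \<oplus>\<^bsub>V\<^esub> ps b) \<in> carrier (coind V)"
proof -
 obtain J J' where J: "finite J" "!!i b. [|i \<notin> J; b \<in> component A i|] ==> ph b = \<zero>\<^bsub>V\<^esub>"
  "finite J'" "!!i b. [|i \<notin> J'; b \<in> component A i|] ==> ps b = \<zero>\<^bsub>V\<^esub>"
  using coind_support[OF ph] coind_support[OF ps] by metis
 show ?thesis
  by (rule coindI[where J = "J \<union> J'"])
   (auto simp: coindD[OF ph] coindD[OF ps] V.M.a_ac J A.comp_carrier V.smult_r_distr)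
qed

lemma coind_minus:
 assumes ph: "ph \<in> carrier (coind V)"
 shows "(\<lambda>b \<in> carrier A. \<ominus>\<^bsub>V\<^esub> ph b) \<in> carrier (coind V)"
proof -
 obtain J where J: "finite J" "!!i b. [|i \<notin> J; b \<in> component A i|] ==> ph b = \<zero>\<^bsub>V\<^esub>"
  using coind_support[OF ph] by metis
 show ?thesis
  by (rule coindI[where J = J])
   (auto simp: coindD[OF ph] V.M.minus_add J A.comp_carrier V.smult_minus)
qed

lemma coind_smult:
 assumes ph: "ph \<in> carrier (coind V)" and a: "a \<in> carrier A"
 shows "(\<lambda>b \<in> carrier A. ph (b \<otimes> a)) \<in> carrier (coind V)"
proof -
 obtain J where J: "finite J" "!!i b. [|i \<notin> J; b \<in> component A i|] ==> ph b = \<zero>\<^bsub>V\<^esub>"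
  using coind_support[OF ph] by metis
 interpret ph: additive_map A V ph by (rule coind_additive[OF ph])
 have "\<exists>J'. finite J' \<and> (\<forall>i. i \<notin> J' --> (\<forall>b \<in> component A i. ph (b \<otimes> a) = \<zero>\<^bsub>V\<^esub>))"
  using a
 proof (induction a rule: A.homogeneous_induct)
  case zero
  show ?case by (rule exI[of _ "{}"]) (auto simp: A.comp_carrier ph.zero)
 next
  case (homogeneous k a)
  have "ph (b \<otimes> a) = \<zero>\<^bsub>V\<^esub>" if "i \<notin> (\<lambda>j. j - k) ` J" "b \<in> component A i" for i b
  proof (rule J(2)[OF _ comp_mult[OF that(2) homogeneous]])
   show "i + k \<notin> J" using that(1) by (auto simp: image_iff)
  qed
  then show ?case using J(1) by (intro exI[of _ "(\<lambda>j. j - k) ` J"]) auto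
 next
  case (add a c)
  then obtain J1 J2 where "finite J1" "\<forall>i. i \<notin> J1 --> (\<forall>b \<in> component A i. ph (b \<otimes> a) = \<zero>\<^bsub>V\<^esub>)"
   "finite J2" "\<forall>i. i \<notin> J2 --> (\<forall>b \<in> component A i. ph (b \<otimes> c) = \<zero>\<^bsub>V\<^esub>)" by blast
  then show ?case using add(1,2)
   by (intro exI[of _ "J1 \<union> J2"]) (auto simp: r_distr A.comp_carrier ph.add)
 qed
 then obtain J' where J': "finite J'" "!!i b. [|i \<notin> J'; b \<in> component A i|] ==> ph (b \<otimes> a) = \<zero>\<^bsub>V\<^esub>"
  by blast
 show ?thesis
  using a by (intro coindI[where J = J'])
   (auto simp: coindD[OF ph] J' A.comp_carrier l_distr m_assoc)
qed

lemma coind_abelian_group: "abelian_group (coind V)"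
proof (rule abelian_groupI, goal_cases)
 case (3 ph ps \<theta>)
 then show ?case by (auto simp: coind_simps coindD V.M.a_assoc intro!: restrict_ext)
next
 case (4 ph ps)
 then show ?case by (auto simp: coind_simps coindD V.M.a_comm intro!: restrict_ext)
next
 case (5 ph)
 then show ?case by (intro extensionalityI[of _ "carrier A"]) (auto simp: coind_simps coindD)
next
 case (6 ph)
 then show ?case
  by (intro bexI[OF _ coind_minus]) (auto simp: coind_simps coindD V.M.l_neg intro!: restrict_ext)
qed (auto simp: coind_simps coind_zero coind_add)

lemma coind_eval: "b \<in> carrier A ==> additive_map (coind V) V (\<lambda>ph. ph b)"
 by (intro additive_map.intro additive_map_axioms.intro add_mapI coind_abelian_group V.M.abelian_group_axioms)
  (auto simp: coind_simps coindD)

lemma coind_part: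
 assumes ph: "ph \<in> carrier (coind V)"
 shows "(\<lambda>b \<in> carrier A. ph (hpart A b (- j))) \<in> component (coind V) j"
proof -
 interpret ph: additive_map A V ph by (rule coind_additive[OF ph])
 have mult: "hpart A (a \<otimes> b) i = a \<otimes> hpart A b i" if "a \<in> component A 0" "b \<in> carrier A" for a b i
  using hpart_mult_left[OF that, of i] by simp
 have "(\<lambda>b \<in> carrier A. ph (hpart A b (- j))) \<in> carrier (coind V)"
  by (rule coindI[where J = "{- j}"])
   (auto simp: coindD[OF ph] A.hpart_closed A.hpart_add A.hpart_comp A.comp_carrier ph.zero mult)
 then show ?thesis
  by (auto simp: coind_simps A.comp_carrier A.hpart_comp ph.zero)
qed

lemma coind_graded_mod: "graded_mod A (coind V)"
proof (rule graded_modI[OF graded_algebra])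
 interpret C: abelian_group "coind V" by (rule coind_abelian_group)
 have minus: "\<ominus>\<^bsub>coind V\<^esub> ph = (\<lambda>b \<in> carrier A. \<ominus>\<^bsub>V\<^esub> ph b)" if "ph \<in> carrier (coind V)" for ph
  using that by (intro C.minus_equality coind_minus)
   (auto simp: coind_simps coindD V.M.l_neg intro!: restrict_ext)
 show "left_module A (coind V)"
 proof (rule left_moduleI[OF ring_axioms coind_abelian_group])
  fix ph assume ph: "ph \<in> carrier (coind V)"
  show "\<one> \<odot>\<^bsub>coind V\<^esub> ph = ph"
   using ph by (intro extensionalityI[of _ "carrier A"]) (auto simp: coind_simps coindD)
  show "(a \<oplus> b) \<odot>\<^bsub>coind V\<^esub> ph = a \<odot>\<^bsub>coind V\<^esub> ph \<oplus>\<^bsub>coind V\<^esub> b \<odot>\<^bsub>coind V\<^esub> ph"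
   if "a \<in> carrier A" "b \<in> carrier A" for a b
   using ph that by (auto simp: coind_simps coindD r_distr intro!: restrict_ext)
 qed (auto simp: coind_simps coind_smult coindD m_assoc[symmetric] intro!: restrict_ext)
 show "direct_sum_grading (coind V)"
 proof (rule direct_sum_gradingI[OF coind_abelian_group,
    where p = "\<lambda>j ph. \<lambda>b \<in> carrier A. ph (hpart A b (- j))"])
  show "additive_subgroup (component (coind V) j) (coind V)" for j
   unfolding C.additive_subgroup_iff
   by (auto simp: coind_simps coind_zero coind_add minus coind_minus A.comp_carrier)
  fix ph assume ph: "ph \<in> carrier (coind V)"
  interpret ph: additive_map A V ph by (rule coind_additive[OF ph])
  obtain J where J: "finite J" "!!i b. [|i \<notin> J; b \<in> component A i|] ==> ph b = \<zero>\<^bsub>V\<^esub>"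
   using coind_support[OF ph] by metis
  let ?p = "\<lambda>j. \<lambda>b \<in> carrier A. ph (hpart A b (- j))"
  have pc: "?p j \<in> carrier (coind V)" for j
   using coind_part[OF ph, of j] by (auto simp: coind_simps)
  have "finsum (coind V) ?p (uminus ` J) = ph"
  proof (rule coind_eqI)
   fix i b assume b: "b \<in> component A i"
   then have bc: "b \<in> carrier A" by (rule A.comp_carrier)
   interpret ev: additive_map "coind V" V "\<lambda>ph. ph b" by (rule coind_eval[OF bc])
   have "finsum (coind V) ?p (uminus ` J) b = finsum V (\<lambda>j. if j = - i then ph b else \<zero>\<^bsub>V\<^esub>) (uminus ` J)"
    using bc b pc by (subst ev.finsum) (auto simp: A.hpart_comp ph.zero ph.closed intro!: V.M.finsum_cong')
   also have "\<dots> = ph b"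
   proof (cases "i \<in> J")
    case True
    then have "finsum V (\<lambda>j. if j = - i then ph b else \<zero>\<^bsub>V\<^esub>) (uminus ` J)
      = finsum V (\<lambda>j. if j = - i then ph b else \<zero>\<^bsub>V\<^esub>) {- i}"
     using J(1) bc by (intro V.M.finsum_eq_superset) (auto simp: ph.closed)
    then show ?thesis using bc by (simp add: ph.closed)
   next
    case False
    then have "finsum V (\<lambda>j. if j = - i then ph b else \<zero>\<^bsub>V\<^esub>) (uminus ` J) = finsum V (\<lambda>j. \<zero>\<^bsub>V\<^esub>) (uminus ` J)"
     using bc by (intro V.M.finsum_cong') (auto simp: ph.closed)
    then show ?thesis using J(2)[OF False b] by simp
   qed
   finally show "finsum (coind V) ?p (uminus ` J) b = ph b" .
  qed (use pc ph in \<open>simp_all add: C.finsum_closed\<close>)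
  moreover have "?p j = \<zero>\<^bsub>coind V\<^esub>" if "j \<notin> uminus ` J" for j
  proof -
   have "- j \<notin> J"
   proof
    assume "- j \<in> J"
    then have "- (- j) \<in> uminus ` J" by (rule imageI)
    then show False using that by simp
   qed
   then have "ph (hpart A b (- j)) = \<zero>\<^bsub>V\<^esub>" if "b \<in> carrier A" for b
    by (rule J(2)) (rule A.hpart(1)[OF that])
   then show ?thesis unfolding coind_simps(1) by (rule restrict_ext)
  qed
  ultimately show "\<exists>K. finite K \<and> (\<forall>j. j \<notin> K --> ?p j = \<zero>\<^bsub>coind V\<^esub>) \<and> finsum (coind V) ?p K = ph"
   using J(1) by (intro exI[of _ "uminus ` J"]) auto
  show "?p j \<in> component (coind V) j" for j by (rule coind_part[OF ph])
  show "(\<lambda>b \<in> carrier A. (ph \<oplus>\<^bsub>coind V\<^esub> ps) (hpart A b (- j)))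
    = ?p j \<oplus>\<^bsub>coind V\<^esub> (\<lambda>b \<in> carrier A. ps (hpart A b (- j)))"
   if "ps \<in> carrier (coind V)" for j ps
   by (auto simp: coind_simps A.hpart_closed intro!: restrict_ext)
 next
  show "(\<lambda>b \<in> carrier A. ph (hpart A b (- i))) = \<zero>\<^bsub>coind V\<^esub>" if "ph \<in> component (coind V) j" "i ~= j" for i j ph
   unfolding coind_simps(1)
   using coind_compD[OF that(1) _ A.hpart(1)[where i = "- i"]] that(2) by (intro restrict_ext) simp
 qed
 show "a \<odot>\<^bsub>coind V\<^esub> ph \<in> component (coind V) (i + j)"
  if a: "a \<in> component A i" and ph: "ph \<in> component (coind V) j" for i j a ph
 proof -
  have "ph (b \<otimes> a) = \<zero>\<^bsub>V\<^esub>" if "k ~= - i - j" "b \<in> component A k" for k b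
   using coind_compD[OF ph _ comp_mult[OF that(2) a]] that(1) by simp
  then show ?thesis using a ph by (auto simp: coind_simps coind_smult A.comp_carrier)
 qed
qed

text \<open>Write 1 as a finite sum of products a b, with a of degree -i and b of degree i. Then c
  is the sum of the (c a) b with c a of degree zero, so linearity expresses \<open>ph c\<close>
  through the finitely many \<open>ph b\<close>. The predicate \<open>det\<close> is this claim with
  1 replaced by z, which permits induction over the product.\<close>

lemma coind_finite_determination:
 "\<exists>bs. set bs \<subseteq> component A i \<and> (\<forall>ph \<in> carrier (coind V). \<forall>ps \<in> carrier (coind V).
   (\<forall>b \<in> set bs. ph b = ps b) --> (\<forall>c \<in> component A i. ph c = ps c))"
proof -
 define det where "det z bs \<longleftrightarrow> (\<forall>ph ps c. ph \<in> carrier (coind V) --> ps \<in> carrier (coind V) -->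
   (\<forall>b \<in> set bs. ph b = ps b) --> c \<in> component A i --> ph (c \<otimes> z) = ps (c \<otimes> z))" for z bs
 have "\<exists>bs. set bs \<subseteq> component A i \<and> det z bs"
  if "z \<in> component A (- i) \<cdot> component A (- (- i))" for z
  using that
 proof (induction rule: ideal_prod.induct)
  case (prod a b)
  have "ph (c \<otimes> (a \<otimes> b)) = ps (c \<otimes> (a \<otimes> b))"
   if "ph \<in> carrier (coind V)" "ps \<in> carrier (coind V)" "ph b = ps b" "c \<in> component A i" for ph ps c
  proof -
   have "c \<otimes> a \<in> component A 0" using comp_mult[OF that(4) prod(1)] by simp
   moreover have "c \<otimes> (a \<otimes> b) = (c \<otimes> a) \<otimes> b"
    using prod that by (simp add: m_assoc A.comp_carrier)
   ultimately show ?thesis using prod(2) that by (simp add: coindD A.comp_carrier)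
  qed
  then have "det (a \<otimes> b) [b]" by (simp add: det_def)
  then show ?case using prod(2) by (intro exI[of _ "[b]"]) simp
 next
  case (sum s t)
  then obtain bs cs where bs: "set bs \<subseteq> component A i" "det s bs"
   and cs: "set cs \<subseteq> component A i" "det t cs"
   by blast
  have st: "s \<in> carrier A" "t \<in> carrier A"
   using prod_closed[OF sum(1)] prod_closed[OF sum(2)] A.comp_carrier by auto
  have "det (s \<oplus> t) (bs @ cs)"
   unfolding det_def
  proof (intro allI impI)
   fix ph ps c assume *: "ph \<in> carrier (coind V)" "ps \<in> carrier (coind V)"
    "\<forall>b \<in> set (bs @ cs). ph b = ps b" "c \<in> component A i"
   have "ph (c \<otimes> s) = ps (c \<otimes> s)"
    using bs(2)[unfolded det_def, rule_format, of ph ps c] * by simp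
   moreover have "ph (c \<otimes> t) = ps (c \<otimes> t)"
    using cs(2)[unfolded det_def, rule_format, of ph ps c] * by simp
   ultimately show "ph (c \<otimes> (s \<oplus> t)) = ps (c \<otimes> (s \<oplus> t))"
    using * st by (simp add: r_distr A.comp_carrier coindD)
  qed
  then show ?case using bs(1) cs(1) by (intro exI[of _ "bs @ cs"]) simp
 qed
 from this[OF one_in_prod] obtain bs where "set bs \<subseteq> component A i" "det \<one> bs" by blast
 then show ?thesis by (intro exI[of _ bs]) (simp add: det_def A.comp_carrier)
qed

text \<open>A map is encoded by a bound m on its support and by its values on the finite determining
  sets in the degrees from -m to m, that is, by a number and a list over \<open>V\<close>. If
  \<open>V\<close> is zero, the coinduced module has one element.\<close>

lemma coind_inj:
 assumes "infinite (carrier V) \<or> carrier V = {\<zero>\<^bsub>V\<^esub>}"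
 shows "\<exists>h. inj_on h (carrier (coind V)) \<and> h ` carrier (coind V) \<subseteq> carrier V"
 using assms
proof
 assume inf: "infinite (carrier V)"
 obtain bs where bs: "!!i. set (bs i) \<subseteq> component A i" "!!i ph ps c. [|ph \<in> carrier (coind V); ps \<in> carrier (coind V);
   \<forall>b \<in> set (bs i). ph b = ps b; c \<in> component A i|] ==> ph c = ps c"
  using coind_finite_determination by metis
 have "\<exists>m::nat. \<forall>i. \<bar>i\<bar> > int m --> (\<forall>b \<in> component A i. ph b = \<zero>\<^bsub>V\<^esub>)" if ph: "ph \<in> carrier (coind V)" for ph
 proof -
  obtain J where J: "finite J" "!!i b. [|i \<notin> J; b \<in> component A i|] ==> ph b = \<zero>\<^bsub>V\<^esub>"
   using coind_support[OF ph] by metis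
  have "finite ((\<lambda>i. nat \<bar>i\<bar>) ` J)" using J(1) by simp
  then obtain m where m: "!!i. i \<in> J ==> nat \<bar>i\<bar> \<le> m"
   by (meson finite_nat_set_iff_bounded_le imageI)
  show ?thesis using J(2) m by (intro exI[of _ m]) force
 qed
 then obtain m where m: "!!ph i b. [|ph \<in> carrier (coind V); \<bar>i\<bar> > int (m ph); b \<in> component A i|] ==> ph b = \<zero>\<^bsub>V\<^esub>"
  by metis
 define g where "g ph = (m ph, map ph (concat (map bs [- int (m ph)..int (m ph)])))" for ph
 have "inj_on g (carrier (coind V))"
 proof (rule inj_onI)
  fix ph ps assume *: "ph \<in> carrier (coind V)" "ps \<in> carrier (coind V)" "g ph = g ps"
  then have mm: "m ps = m ph" and eq: "\<forall>b \<in> set (concat (map bs [- int (m ph)..int (m ph)])). ph b = ps b"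
   by (auto simp: g_def)
  show "ph = ps"
  proof (rule coind_eqI[OF *(1,2)])
   fix i b assume b: "b \<in> component A i"
   show "ph b = ps b"
   proof (cases "\<bar>i\<bar> > int (m ph)")
    case True
    then show ?thesis using m[OF *(1) True b] m[OF *(2) _ b] mm by simp
   next
    case False
    then have "i \<in> set [- int (m ph)..int (m ph)]" by auto
    then have "\<forall>b \<in> set (bs i). ph b = ps b" using eq by auto
    then show ?thesis by (rule bs(2)[OF *(1,2) _ b])
   qed
  qed
 qed
 moreover have "g ` carrier (coind V) \<subseteq> UNIV \<times> lists (carrier V)"
  using bs(1) A.comp_carrier by (fastforce simp: g_def coindD)
 ultimately show ?thesis by (rule inj_into_infinite[OF inf])
next
 assume triv: "carrier V = {\<zero>\<^bsub>V\<^esub>}"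
 have "ph = ps" if "ph \<in> carrier (coind V)" "ps \<in> carrier (coind V)" for ph ps
  using coindD(1)[OF that(1)] coindD(1)[OF that(2)] triv A.comp_carrier
  by - (rule coind_eqI[OF that], auto)
 then show ?thesis using triv by (intro exI[of _ "\<lambda>_. \<zero>\<^bsub>V\<^esub>"]) (auto intro!: inj_onI)
qed

lemma coind_zero_part:
 "bij_betw (\<lambda>ph. ph \<one>) (component (coind V) 0) (carrier V)"
proof (rule bij_betwI')
 fix ph ps assume ph: "ph \<in> component (coind V) 0" and ps: "ps \<in> component (coind V) 0"
 show "ph \<one> = ps \<one> \<longleftrightarrow> ph = ps"
 proof
  assume eq: "ph \<one> = ps \<one>"
  have phc: "ph \<in> carrier (coind V)" and psc: "ps \<in> carrier (coind V)"
   using ph ps by (auto simp: coind_simps)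
  show "ph = ps"
  proof (rule coind_eqI[OF phc psc])
   fix i b assume b: "b \<in> component A i"
   show "ph b = ps b"
   proof (cases "i = 0")
    case True
    then show ?thesis
     using coindD(4)[OF phc, of b "\<one>"] coindD(4)[OF psc, of b "\<one>"] b eq by (simp add: A.comp_carrier)
   next
    case False
    then show ?thesis using ph ps b by (auto simp: coind_simps)
   qed
  qed
 qed simp
next
 show "ph \<one> \<in> carrier V" if "ph \<in> component (coind V) 0" for ph
  using that by (auto simp: coind_simps coindD)
next
 fix v assume v: "v \<in> carrier V"
 \<comment> \<open>The preimage of \<open>v\<close> under evaluation at 1: the argument acts on
   \<open>v\<close> through its degree zero part.\<close>
 let ?ph = "\<lambda>b \<in> carrier A. hpart A b 0 \<odot>\<^bsub>V\<^esub> v"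
 have mult: "hpart A (a \<otimes> b) 0 = a \<otimes> hpart A b 0" if "a \<in> component A 0" "b \<in> carrier A" for a b
  using hpart_mult_left[OF that, of 0] by simp
 have zs: "\<zero> \<odot>\<^bsub>V\<^esub> v = \<zero>\<^bsub>V\<^esub>" using V.zero_smult[OF v] by simp
 have "?ph \<in> carrier (coind V)"
  using v V.smult_closed[of _ v] V.smult_l_distr[of _ _ v] V.smult_assoc1[of _ _ v]
  by (intro coindI[where J = "{0}"])
   (auto simp: A.hpart(1) A.hpart_add A.comp_carrier mult A.hpart_comp zs)
 then have "?ph \<in> component (coind V) 0"
  by (auto simp: coind_simps A.comp_carrier A.hpart_comp zs)
 moreover have "v = ?ph \<one>"
  using V.smult_one[OF v] comp_one by (simp add: A.hpart_comp)
 ultimately show "\<exists>ph \<in> component (coind V) 0. v = ph \<one>" by blast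
qed

end

text \<open>Full faithfulness is the unique extension of homomorphisms from degree zero. The
  cardinality hypothesis serves essential surjectivity: it lets the coinduced module of
  \<open>V\<close> be relabelled by elements of \<open>V\<close>, hence of
  \<open>'u\<close>.\<close>

theorem Gr_equiv_LMod:
 assumes inf: "!!V :: ('a, 'u) module. left_module (degree_zero A) V
   ==> infinite (carrier V) \<or> carrier V = {\<zero>\<^bsub>V\<^esub>}"
 shows "equivalent_categories (Gr A :: (('a, 'u) graded, 'u => 'u) cat)
  (LMod (degree_zero A) :: (('a, 'u) module, 'u => 'u) cat)"
proof -
 let ?G = "Gr A :: (('a, 'u) graded, 'u => 'u) cat"
 let ?M = "LMod (degree_zero A) :: (('a, 'u) module, 'u => 'u) cat"
 interpret G: category ?G by (rule category_Gr[OF graded_algebra])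
 interpret M: category ?M by (rule category_LMod)
 have obj: "graded_mod A M" if "M \<in> obj ?G" for M
  using that graded_algebra by (simp add: Gr_def graded_mod_def)
 interpret weak_equivalence ?G ?M zero_part "\<lambda>M N f. restrict f (component M 0)"
 proof unfold_locales
  fix M N :: "('a, 'u) graded" assume MN: "M \<in> obj ?G" "N \<in> obj ?G"
  interpret M: graded_mod A M by (rule obj[OF MN(1)])
  interpret N: graded_mod A N by (rule obj[OF MN(2)])
  show "zero_part M \<in> obj ?M" by (simp add: LMod_def zero_part_left_module[OF M.graded_mod_axioms])
  show "bij_betw (\<lambda>f. restrict f (component M 0)) (homs ?G M N) (homs ?M (zero_part M) (zero_part N))"
  proof (rule bij_betwI')
   fix f g assume fg: "f \<in> homs ?G M N" "g \<in> homs ?G M N"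
   then have h: "f \<in> graded_hom A M N" "g \<in> graded_hom A M N" by (simp_all add: Gr_def)
   show "restrict f (component M 0) = restrict g (component M 0) \<longleftrightarrow> f = g"
    using hom_eqI[OF M.graded_mod_axioms N.graded_mod_axioms h] by (metis restrict_apply')
   show "restrict f (component M 0) \<in> homs ?M (zero_part M) (zero_part N)"
    using h(1) M.comp_smult[of _ 0 _ 0]
    by (auto simp: LMod_def LinearCombinations.module_hom_def graded_homD M.M.comp_add M.M.comp_carrier
      A.comp_carrier)
  next
   fix f assume f: "f \<in> homs ?M (zero_part M) (zero_part N)"
   then have "f \<in> LinearCombinations.module_hom (degree_zero A) (zero_part M) (zero_part N)"
    "f \<in> extensional (component M 0)" by (simp_all add: LMod_def)
   with extend_hom[OF M.graded_mod_axioms N.graded_mod_axioms this(1)]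
   obtain F where F: "F \<in> graded_hom A M N" "!!x. x \<in> component M 0 ==> F x = f x" by blast
   have "restrict F (component M 0) = f"
    using F \<open>f \<in> extensional (component M 0)\<close> by (intro extensionalityI[of _ "component M 0"]) auto
   then show "\<exists>F \<in> homs ?G M N. f = restrict F (component M 0)" using F(1) by (auto simp: Gr_def)
  qed
 next
  fix M assume "M \<in> obj ?G"
  then interpret M: graded_mod A M by (rule obj)
  show "restrict (idm ?G M) (component M 0) = idm ?M (zero_part M)"
   by (auto simp: Gr_def LMod_def M.M.comp_carrier intro!: restrict_ext)
 next
  fix M N P f g
  assume M: "M \<in> obj ?G" and fg: "f \<in> homs ?G M N" "g \<in> homs ?G N P"
  interpret M: graded_mod A M by (rule obj[OF M])
  have f: "f \<in> graded_hom A M N" using fg(1) by (simp add: Gr_def)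
  show "restrict (cmp ?G M N P g f) (component M 0)
    = cmp ?M (zero_part M) (zero_part N) (zero_part P) (restrict g (component N 0)) (restrict f (component M 0))"
   by (auto simp: Gr_def LMod_def M.M.comp_carrier graded_homD(4)[OF f] compose_def restrict_def fun_eq_iff)
 next
  fix V :: "('a, 'u) module" assume "V \<in> obj ?M"
  then have V: "left_module (degree_zero A) V" by (simp add: LMod_def)
  interpret V: left_module "degree_zero A" V by (rule V)
  obtain h :: "('a => 'u) => 'u" where h: "inj_on h (carrier (coind V))" using coind_inj[OF V inf[OF V]] by blast
  interpret C: graded_mod A "coind V" by (rule coind_graded_mod[OF V])
  interpret transported A "coind V" h by unfold_locales (rule h)
  let ?N = "transport h (coind V)"
  have comp: "component ?N 0 = h ` component (coind V) 0" by (simp add: transport_simps)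
  have cc: "ph \<in> carrier (coind V)" if "ph \<in> component (coind V) 0" for ph
   using that by (rule C.M.comp_carrier)
  \<comment> \<open>The isomorphism undoes the relabelling and evaluates at 1.\<close>
  define e where "e = (\<lambda>x \<in> component ?N 0. inv_into (carrier (coind V)) h x \<one>)"
  have e: "e (h ph) = ph \<one>" if "ph \<in> component (coind V) 0" for ph
   using that h cc by (auto simp: comp e_def)
  have "e \<in> cat_iso ?M (zero_part ?N) V"
  proof (rule LMod_iso[OF zero_part_left_module[OF transport_graded_mod] V])
   show "e \<in> carrier (zero_part ?N) \<rightarrow> carrier V"
   proof
    fix x assume "x \<in> carrier (zero_part ?N)"
    then obtain ph where ph: "ph \<in> component (coind V) 0" "x = h ph" by (auto simp: comp)
    show "e x \<in> carrier V"
     unfolding ph(2) e[OF ph(1)] by (rule coindD(1)[OF V cc[OF ph(1)] one_closed])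
   qed
   show "e \<in> extensional (carrier (zero_part ?N))" by (simp add: e_def)
   fix x y assume "x \<in> carrier (zero_part ?N)" "y \<in> carrier (zero_part ?N)"
   then obtain ph ps where ph: "ph \<in> component (coind V) 0" "x = h ph" "ps \<in> component (coind V) 0" "y = h ps"
    by (auto simp: comp)
   have "e (x \<oplus>\<^bsub>?N\<^esub> y) = e (h (ph \<oplus>\<^bsub>coind V\<^esub> ps))"
    unfolding ph(2,4) by (simp only: transport_simps(4)[OF cc[OF ph(1)] cc[OF ph(3)]])
   also have "\<dots> = (ph \<oplus>\<^bsub>coind V\<^esub> ps) \<one>" by (rule e[OF C.M.comp_add[OF ph(1,3)]])
   also have "\<dots> = e x \<oplus>\<^bsub>V\<^esub> e y" by (simp add: ph(2,4) e[OF ph(1)] e[OF ph(3)] coind_simps[OF V])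
   finally show "e (x \<oplus>\<^bsub>zero_part ?N\<^esub> y) = e x \<oplus>\<^bsub>V\<^esub> e y" by simp
  next
   fix a x assume "a \<in> carrier (degree_zero A)" and "x \<in> carrier (zero_part ?N)"
   then obtain ph where a: "a \<in> component A 0" and ph: "ph \<in> component (coind V) 0" "x = h ph"
    by (auto simp: comp)
   have ac: "a \<in> carrier A" using a by (rule A.comp_carrier)
   have aph: "a \<odot>\<^bsub>coind V\<^esub> ph \<in> component (coind V) 0" using C.comp_smult[OF a ph(1)] by simp
   have "e (a \<odot>\<^bsub>?N\<^esub> x) = e (h (a \<odot>\<^bsub>coind V\<^esub> ph))"
    unfolding ph(2) by (simp only: transport_simps(5)[OF cc[OF ph(1)]])
   also have "\<dots> = ph a" unfolding e[OF aph] using ac by (simp add: coind_simps[OF V])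
   also have "\<dots> = a \<odot>\<^bsub>V\<^esub> e x"
    using coindD(4)[OF V cc[OF ph(1)] a one_closed] ac by (simp add: ph(2) e[OF ph(1)])
   finally show "e (a \<odot>\<^bsub>zero_part ?N\<^esub> x) = a \<odot>\<^bsub>V\<^esub> e x" by simp
  next
   have "bij_betw h (component (coind V) 0) (component ?N 0)"
    unfolding comp using inj_on_subset[OF h] cc by (intro bij_betw_imageI) auto
   moreover have "bij_betw (e \<circ> h) (component (coind V) 0) (carrier V)"
    using coind_zero_part[OF V] e bij_betw_cong[of "component (coind V) 0" "e \<circ> h" "\<lambda>ph. ph \<one>"]
    by simp
   ultimately show "bij_betw e (carrier (zero_part ?N)) (carrier V)"
    by (simp add: bij_betw_comp_iff)
  qed
  moreover have "?N \<in> obj ?G" using transport_graded_mod by (simp add: Gr_def graded_mod_def)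
  ultimately show "\<exists>N \<in> obj ?G. cat_iso ?M (zero_part N) V ~= {}" by blast
 qed (auto intro: G.idm_closed G.cmp_closed)
 show ?thesis by (rule equivalent)
qed

end

text \<open>For v nonzero some idempotent \<open>Y w \<otimes> X w\<close> with w of length r does
  not kill v, since these idempotents sum to 1. Then the vectors obtained from v by
  \<open>Y p \<otimes> X w\<close>, for the words p of length r, are distinct:
  \<open>Y w \<otimes> X p\<close> sends the one for p to a nonzero vector and kills the others. So
  the carrier has at least (n+1)^r elements for every r.\<close>

lemma (in leavitt_alg) zero_module_infinite:
 assumes n: "n \<ge> 1" and V: "left_module (degree_zero L) V"
 shows "infinite (carrier V) \<or> carrier V = {\<zero>\<^bsub>V\<^esub>}"
proof (rule ccontr)
 assume "\<not> (infinite (carrier V) \<or> carrier V = {\<zero>\<^bsub>V\<^esub>})"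
 then have fin: "finite (carrier V)" and "carrier V ~= {\<zero>\<^bsub>V\<^esub>}" by auto
 interpret V: left_module "degree_zero L" V by (rule V)
 obtain v where v: "v \<in> carrier V" "v ~= \<zero>\<^bsub>V\<^esub>" using \<open>carrier V ~= {\<zero>\<^bsub>V\<^esub>}\<close> V.M.zero_closed by blast
 \<comment> \<open>At this length a finite carrier is refuted by (n+1)^r \<ge> 2^r > r.\<close>
 define r where "r = card (carrier V)"
 have YX: "Y p \<otimes> X w \<in> component L 0" if "p \<in> words n r" "w \<in> words n r" for p w
  using comp_mult[OF Y_words[OF that(1)] X_words[OF that(2)]] by simp
 have "\<exists>w \<in> words n r. (Y w \<otimes> X w) \<odot>\<^bsub>V\<^esub> v ~= \<zero>\<^bsub>V\<^esub>"
 proof (rule ccontr)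
  assume no: "\<not> ?thesis"
  have "word_sum L n r (\<lambda>w. Y w \<otimes> X w) \<in> {z \<in> component L 0. z \<odot>\<^bsub>V\<^esub> v = \<zero>\<^bsub>V\<^esub>}"
   using no v V.zero_smult[OF v(1)] V.smult_l_distr[OF _ _ v(1)]
   by (intro word_sum_mem) (auto simp: A.comp_carrier A.comp_zero A.comp_add YX)
  then show False using v V.smult_one[OF v(1)] by (simp add: sum_Y_X)
 qed
 then obtain w where w: "w \<in> words n r" "(Y w \<otimes> X w) \<odot>\<^bsub>V\<^esub> v ~= \<zero>\<^bsub>V\<^esub>" by blast
 have "inj_on (\<lambda>p. (Y p \<otimes> X w) \<odot>\<^bsub>V\<^esub> v) (words n r)"
 proof (rule inj_onI)
  fix p q assume pq: "p \<in> words n r" "q \<in> words n r" "(Y p \<otimes> X w) \<odot>\<^bsub>V\<^esub> v = (Y q \<otimes> X w) \<odot>\<^bsub>V\<^esub> v"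
  have mult: "(Y w \<otimes> X p) \<odot>\<^bsub>V\<^esub> ((Y q \<otimes> X w) \<odot>\<^bsub>V\<^esub> v) = (if p = q then (Y w \<otimes> X w) \<odot>\<^bsub>V\<^esub> v else \<zero>\<^bsub>V\<^esub>)"
   if "q \<in> words n r" for q
  proof -
   note c = X_words_closed[OF pq(1)] Y_words_closed[OF that] X_words_closed[OF w(1)] Y_words_closed[OF w(1)]
   have "(Y w \<otimes> X p) \<otimes> (Y q \<otimes> X w) = Y w \<otimes> (X p \<otimes> Y q) \<otimes> X w" using c by (simp add: m_assoc)
   also have "\<dots> = (if p = q then Y w \<otimes> X w else \<zero>)" using c by (simp add: X_Y[OF pq(1) that])
   finally show ?thesis
    using V.smult_assoc1[of "Y w \<otimes> X p" "Y q \<otimes> X w" v] YX[OF w(1) pq(1)] YX[OF that w(1)] v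
     V.zero_smult[OF v(1)] by (auto split: if_splits)
  qed
  show "p = q"
   using mult[OF pq(1)] mult[OF pq(2)] w(2) unfolding pq(3) by (auto split: if_splits)
 qed
 moreover have "(\<lambda>p. (Y p \<otimes> X w) \<odot>\<^bsub>V\<^esub> v) ` words n r \<subseteq> carrier V"
  using V.smult_closed YX w(1) v(1) by auto
 ultimately have "card (words n r) \<le> card (carrier V)" using fin by (intro card_inj_on_le)
 moreover have "words n r = {xs. set xs \<subseteq> {0..n} \<and> length xs = r}" by (auto simp: words_def)
 then have "card (words n r) = (n + 1) ^ r" by (simp add: card_lists_length_eq)
 ultimately have "(n + 1) ^ r \<le> r" by (simp add: r_def)
 moreover have "(2::nat) ^ r \<le> (n + 1) ^ r" using n by (intro power_mono) auto
 moreover have "r < 2 ^ r" by (rule less_exp)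
 ultimately show False by linarith
qed

section \<open>Modules over the free algebra\<close>

definition wds :: "nat => nat list set" where
 "wds n = lists {0..n}"

lemma wds_simps [simp]:
 "[] \<in> wds n" "i # w \<in> wds n \<longleftrightarrow> i \<le> n \<and> w \<in> wds n" "v @ w \<in> wds n \<longleftrightarrow> v \<in> wds n \<and> w \<in> wds n"
 by (auto simp: wds_def)

lemma words_iff: "w \<in> words n r \<longleftrightarrow> w \<in> wds n \<and> length w = r"
 by (simp add: words_def wds_def)

lemma replicate_wds: "replicate r 0 \<in> wds n"
 by (induction r) auto

lemma wds_split:
 assumes "w \<in> wds n" "r \<le> length w"
 obtains v u where "w = v @ u" "v \<in> wds n" "u \<in> words n r"
proof
 let ?k = "length w - r"
 show "w = take ?k w @ drop ?k w" by simp
 then have *: "take ?k w \<in> wds n \<and> drop ?k w \<in> wds n" using assms(1) by (metis wds_simps(3))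
 show "take ?k w \<in> wds n" using * by blast
 show "drop ?k w \<in> words n r" using * assms(2) by (simp add: words_iff)
qed

text \<open>Treating "all sufficiently long words" as a filter lets the many threshold arguments be
  carried out by \<open>eventually_elim\<close>. The filter is proper, as
  \<open>eventually_long_const\<close> shows.\<close>

definition long :: "nat => nat list filter" where
 "long n = inf (filtercomap length at_top) (principal (wds n))"

lemma eventually_long: "eventually P (long n) \<longleftrightarrow> (\<exists>r. \<forall>w \<in> wds n. r \<le> length w --> P w)"
 unfolding long_def eventually_inf_principal eventually_filtercomap_at_top_linorder by blast

lemma eventually_long_wds: "\<forall>\<^sub>F w in long n. w \<in> wds n"
 by (auto simp: eventually_long)

lemma eventually_long_const: "(\<forall>\<^sub>F w in long n. Q) \<longleftrightarrow> Q"
proof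
 assume "\<forall>\<^sub>F w in long n. Q"
 then obtain r where "\<forall>w \<in> wds n. r \<le> length w --> Q" by (auto simp: eventually_long)
 then show Q using replicate_wds[of r n] by force
qed simp

text \<open>The threshold for the prefix depends on the suffix, but a long word may be cut so that
  the suffix has a fixed length r, and there are only finitely many such suffixes. A common
  threshold s for them gives the bound r + s.\<close>

lemma eventually_long_append:
 assumes "\<forall>\<^sub>F w in long n. \<forall>\<^sub>F v in long n. P (v @ w)"
 shows "\<forall>\<^sub>F w in long n. P w"
proof -
 from eventually_long[THEN iffD1, OF assms]
 obtain r where r: "\<forall>w \<in> wds n. r \<le> length w --> (\<forall>\<^sub>F v in long n. P (v @ w))" by blast
 have "\<forall>\<^sub>F v in long n. \<forall>u \<in> words n r. P (v @ u)"
  using r finite_words by (intro eventually_ball_finite) (auto simp: words_iff)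
 from eventually_long[THEN iffD1, OF this]
 obtain s where s: "\<forall>v \<in> wds n. s \<le> length v --> (\<forall>u \<in> words n r. P (v @ u))" by blast
 show ?thesis unfolding eventually_long
 proof (intro exI[of _ "r + s"] ballI impI)
  fix w assume w: "w \<in> wds n" "r + s \<le> length w"
  have "r \<le> length w" using w(2) by simp
  from wds_split[OF w(1) this] obtain v u where v: "w = v @ u" "v \<in> wds n" "u \<in> words n r" .
  then have "s \<le> length v" using w(2) by (simp add: words_iff)
  then show "P w" using s v by blast
 qed
qed

lemma eventually_long_snoc:
 assumes "eventually P (long n)" "i \<le> n" shows "\<forall>\<^sub>F w in long n. P (w @ [i])"
proof -
 obtain r where r: "\<forall>w \<in> wds n. r \<le> length w --> P w" using assms by (auto simp: eventually_long)
 show ?thesis unfolding eventually_long using r assms(2) by (intro exI[of _ r]) auto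
qed

lemma eventually_long_upward:
 assumes "eventually P (long n)" shows "\<forall>\<^sub>F w in long n. \<forall>v \<in> wds n. P (v @ w)"
proof -
 obtain r where r: "\<forall>w \<in> wds n. r \<le> length w --> P w" using assms by (auto simp: eventually_long)
 show ?thesis unfolding eventually_long using r by (intro exI[of _ r]) auto
qed

lemma eventually_long_butlast:
 assumes "eventually P (long n)"
 shows "\<forall>\<^sub>F w in long n. w ~= [] \<and> last w \<le> n \<and> butlast w \<in> wds n \<and> P (butlast w)"
proof -
 obtain r where r: "\<forall>w \<in> wds n. r \<le> length w --> P w" using assms by (auto simp: eventually_long)
 show ?thesis unfolding eventually_long
 proof (intro exI[of _ "Suc r"] ballI impI)
  fix w assume w: "w \<in> wds n" "Suc r \<le> length w"
  then obtain v i where "w = v @ [i]" by (cases w rule: rev_cases) auto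
  then show "w ~= [] \<and> last w \<le> n \<and> butlast w \<in> wds n \<and> P (butlast w)" using w r by auto
 qed
qed

lemmas free_algebra_simps = graded_free_algebra_simps[of "{0..n::nat}" "\<lambda>i. 1" for n, folded free_algebra_def]

lemma graded_algebra_free_algebra: "graded_algebra (free_algebra n)"
 unfolding free_algebra_def by (rule graded_algebra_free)

lemma single_free_carrier: "w \<in> wds n ==> single w c \<in> carrier (free_algebra n)"
 by (simp add: free_algebra_simps wds_def)

lemma single_free_comp:
 "w \<in> wds n ==> single w c \<in> component (free_algebra n) (int (length w))"
 by (simp add: free_algebra_simps wds_def sum_list_triv)

section \<open>The action of words and scalars on a graded module\<close>

definition wact :: "(nat list \<Rightarrow>\<^sub>0 'k::field, 'u, 'z) module_scheme => nat list => 'u => 'u" where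
 "wact M w x = single w 1 \<odot>\<^bsub>M\<^esub> x"

definition sc :: "(nat list \<Rightarrow>\<^sub>0 'k::field, 'u, 'z) module_scheme => 'k => 'u => 'u" where
 "sc M c x = single [] c \<odot>\<^bsub>M\<^esub> x"

lemma scalar_one_free: "c \<odot>\<^bsub>free_algebra n\<^esub> \<one>\<^bsub>free_algebra n\<^esub> = single [] c"
 by (simp add: free_algebra_simps map_scale_single)

lemma single_free_mult: "single v a \<otimes>\<^bsub>free_algebra n\<^esub> single w b
  = single (v @ w) (a * b)"
 unfolding free_algebra_def by (rule free_algebra_mult_single)

locale free_mod = graded_mod "free_algebra n" M for n :: nat and M :: "(nat list \<Rightarrow>\<^sub>0 'k::field, 'u) graded" (structure)
begin

lemma wact_closed: "[|w \<in> wds n; x \<in> carrier M|] ==> wact M w x \<in> carrier M"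
 by (simp add: wact_def smult_closed single_free_carrier)

lemma additive_wact: "w \<in> wds n ==> additive_map M M (wact M w)"
 unfolding wact_def by (rule additive_smult) (rule single_free_carrier)

lemmas wact_add = additive_map.add[OF additive_wact]
 and wact_zero = additive_map.zero[OF additive_wact]
 and wact_minus = additive_map.minus[OF additive_wact]
 and wact_diff = additive_map.diff[OF additive_wact]

lemma wact_Nil: "x \<in> carrier M ==> wact M [] x = x"
 using smult_one[of x] by (simp add: wact_def free_algebra_simps)

lemma wact_append:
 assumes "v \<in> wds n" "w \<in> wds n" "x \<in> carrier M"
 shows "wact M (v @ w) x = wact M v (wact M w x)"
 using smult_assoc1[OF single_free_carrier[OF assms(1)] single_free_carrier[OF assms(2)] assms(3), of 1 1]
 by (simp add: wact_def single_free_mult)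

lemma wact_comp:
 "[|w \<in> wds n; x \<in> component M j|] ==> wact M w x \<in> component M (int (length w) + j)"
 unfolding wact_def by (rule comp_smult) (rule single_free_comp)

lemma hpart_wact:
 assumes "w \<in> wds n" "x \<in> carrier M"
 shows "hpart M (wact M w x) i = wact M w (hpart M x (i - int (length w)))"
 using hpart_smult[OF single_free_comp[OF assms(1), of 1] assms(2), of "i - int (length w)"]
 by (simp add: wact_def)

lemma sc_eq: "(c \<odot>\<^bsub>free_algebra n\<^esub> \<one>\<^bsub>free_algebra n\<^esub>) \<odot> x = sc M c x"
 by (simp add: sc_def scalar_one_free)

lemma sc_closed: "x \<in> carrier M ==> sc M c x \<in> carrier M"
 and sc_add_left: "x \<in> carrier M ==> sc M (c + d) x = sc M c x \<oplus> sc M d x"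
 and sc_add: "[|x \<in> carrier M; y \<in> carrier M|] ==> sc M c (x \<oplus> y) = sc M c x \<oplus> sc M c y"
 and sc_mult: "x \<in> carrier M ==> sc M (c * d) x = sc M c (sc M d x)"
 and sc_one: "x \<in> carrier M ==> sc M 1 x = x"
 and sc_zero: "sc M c \<zero> = \<zero>"
 using K.scalar_closed[of x c] K.scalar_add[of x c d] K.scalar_distrib[of x y c] K.scalar_mult[of x c d]
  K.scalar_one[of x] K.scalar_zero[of c]
 unfolding sc_eq by blast+

lemma wact_sc:
 assumes "w \<in> wds n" "x \<in> carrier M"
 shows "wact M w (sc M c x) = sc M c (wact M w x)"
proof -
 have "single w 1 \<otimes>\<^bsub>free_algebra n\<^esub> single [] c
   = single [] c \<otimes>\<^bsub>free_algebra n\<^esub> single w 1"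
  by (simp add: single_free_mult)
 then show ?thesis
  unfolding wact_def sc_def
   smult_assoc1[OF single_free_carrier[OF assms(1)] single_free_carrier[OF wds_simps(1)] assms(2), symmetric]
   smult_assoc1[OF single_free_carrier[OF wds_simps(1)] single_free_carrier[OF assms(1)] assms(2), symmetric]
  by (rule arg_cong)
qed

lemma sc_comp: "x \<in> component M j ==> sc M c x \<in> component M j"
 using comp_smult[OF single_free_comp[OF wds_simps(1)], of x j c] by (simp add: sc_def)

lemma hpart_sc: "x \<in> carrier M ==> hpart M (sc M c x) i = sc M c (hpart M x i)"
 using hpart_smult[OF single_free_comp[OF wds_simps(1)], of x c i] by (simp add: sc_def)

lemma free_submodule_smult:
 assumes "N \<subseteq> carrier M" "!!x y. [|x \<in> N; y \<in> N|] ==> x \<oplus> y \<in> N"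
  "!!c x. x \<in> N ==> sc M c x \<in> N" "!!i x. [|i \<le> n; x \<in> N|] ==> wact M [i] x \<in> N"
  and "a \<in> carrier (free_algebra n)" "x \<in> N"
 shows "a \<odot> x \<in> N"
 by (rule submodule_generated[OF alg_generated_free[of "{0..n::nat}" "\<lambda>i. 1", folded free_algebra_def] assms(1)])
  (use assms in \<open>auto simp: sc_eq wact_def\<close>)

end


subsection \<open>Germs of eventually linear functions\<close>

text \<open>Modulo eventual equality this is the direct limit over r of the homomorphisms to
  \<open>M\<close> from the left ideal spanned by the words of length at least r. That ideal is free
  on the words of length r, since each of its words is uniquely v w with w of length r.\<close>

definition evlin :: "nat => (nat list \<Rightarrow>\<^sub>0 'k::field, 'u) graded => (nat list => 'u) set" where
 "evlin n M = {u. \<forall>\<^sub>F w in long n. u w \<in> carrier M \<and> (\<forall>v \<in> wds n. u (v @ w) = wact M v (u w))}"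

lemma evlinI:
 "(\<forall>\<^sub>F w in long n. u w \<in> carrier M \<and> (\<forall>v \<in> wds n. u (v @ w) = wact M v (u w))) ==> u \<in> evlin n M"
 by (simp add: evlin_def)

lemma evlinD:
 assumes "u \<in> evlin n M"
 shows "\<forall>\<^sub>F w in long n. w \<in> wds n \<and> u w \<in> carrier M \<and> (\<forall>v \<in> wds n. u (v @ w) = wact M v (u w))"
 using assms eventually_long_wds[of n] by (auto simp: evlin_def elim: eventually_elim2)

lemma evlin_carrier: "u \<in> evlin n M ==> \<forall>\<^sub>F w in long n. u w \<in> carrier M"
 by (drule evlinD) (auto elim: eventually_mono)

lemma evlin_cong:
 assumes "u \<in> evlin n M" "\<forall>\<^sub>F w in long n. u w = u' w" shows "u' \<in> evlin n M"
proof (rule evlinI)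
 show "\<forall>\<^sub>F w in long n. u' w \<in> carrier M \<and> (\<forall>v \<in> wds n. u' (v @ w) = wact M v (u' w))"
  using evlinD[OF assms(1)] assms(2) eventually_long_upward[OF assms(2)]
  by eventually_elim simp
qed

context free_mod
begin

lemma evlin_zero: "(\<lambda>w. \<zero>) \<in> evlin n M"
 by (rule evlinI) (simp add: wact_zero)

lemma evlin_add: "[|u \<in> evlin n M; v \<in> evlin n M|] ==> (\<lambda>w. u w \<oplus> v w) \<in> evlin n M"
 by (rule evlinI, drule (1) evlinD[THEN eventually_conj, OF _ evlinD], erule eventually_mono)
  (auto simp: wact_add)

lemma evlin_minus: "u \<in> evlin n M ==> (\<lambda>w. \<ominus> u w) \<in> evlin n M"
 by (rule evlinI, drule evlinD, erule eventually_mono) (auto simp: wact_minus)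

lemma evlin_sc: "u \<in> evlin n M ==> (\<lambda>w. sc M c (u w)) \<in> evlin n M"
 by (rule evlinI, drule evlinD, erule eventually_mono) (auto simp: wact_sc sc_closed)

lemma evlin_snoc: "[|u \<in> evlin n M; i \<le> n|] ==> (\<lambda>w. u (w @ [i])) \<in> evlin n M"
 by (rule evlinI, drule evlinD, drule (1) eventually_long_snoc, erule eventually_mono) simp

lemma evlin_star:
 "u \<in> evlin n M ==> (\<lambda>w. if w ~= [] \<and> last w = i then u (butlast w) else \<zero>) \<in> evlin n M"
 by (rule evlinI, drule evlinD, drule eventually_long_butlast, erule eventually_mono)
  (auto simp: wact_zero butlast_append)

lemma evlin_part: "u \<in> evlin n M ==> (\<lambda>w. hpart M (u w) (d + int (length w))) \<in> evlin n M"
 by (rule evlinI, drule evlinD, erule eventually_mono) (auto simp: hpart_wact M.hpart_closed)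

lemma evlin_orbit: "x \<in> carrier M ==> (\<lambda>w. wact M w x) \<in> evlin n M"
 by (rule evlinI, rule eventually_mono[OF eventually_long_wds]) (auto simp: wact_closed wact_append)

text \<open>Along long words the values of \<open>u\<close> are translates of earlier values, so a
  property that all long translates of each element acquire is acquired by the germ.\<close>

lemma evlin_eventually:
 assumes u: "u \<in> evlin n M" and P: "!!x. [|x \<in> carrier M; Q x|] ==> \<forall>\<^sub>F v in long n. P (wact M v x)"
  and Q: "\<forall>\<^sub>F w in long n. Q (u w)"
 shows "\<forall>\<^sub>F w in long n. P (u w)"
proof (rule eventually_long_append)
 show "\<forall>\<^sub>F w in long n. \<forall>\<^sub>F v in long n. P (u (v @ w))"
  using evlinD[OF u] Q
 proof eventually_elim
  case (elim w)
  have "\<forall>\<^sub>F v in long n. P (wact M v (u w))" using elim by (intro P) auto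
  with eventually_long_wds show ?case
  proof eventually_elim
   case (elim v)
   then show ?case using \<open>w \<in> wds n \<and> u w \<in> carrier M \<and> (\<forall>v \<in> wds n. u (v @ w) = wact M v (u w))\<close>
    by simp
  qed
 qed
qed

text \<open>Freeness of the left ideal of long words: the values on the words of length r may be
  prescribed arbitrarily.\<close>

lemma evlin_extend:
 assumes g: "!!w. w \<in> words n r ==> g w \<in> carrier M"
 shows "\<exists>u \<in> evlin n M. \<forall>w \<in> words n r. \<forall>v \<in> wds n. u (v @ w) = wact M v (g w)"
proof -
 define u where "u w = wact M (take (length w - r) w) (g (drop (length w - r) w))" for w
 have u: "u (v @ w) = wact M v (g w)" if "w \<in> words n r" for v w
  using that by (simp add: u_def words_iff)
 have "u \<in> evlin n M"
 proof (rule evlinI, unfold eventually_long, intro exI[of _ r] ballI impI)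
  fix w assume w: "w \<in> wds n" "r \<le> length w"
  from wds_split[OF w] obtain w1 w0 where w0: "w = w1 @ w0" "w1 \<in> wds n" "w0 \<in> words n r" .
  have *: "u (v @ w) = wact M v (u w) \<and> u w \<in> carrier M" if "v \<in> wds n" for v
   using u[OF w0(3), of w1] u[OF w0(3), of "v @ w1"] that w0 g[OF w0(3)]
   by (simp add: wact_append wact_closed)
  from *[of "[]"] show "u w \<in> carrier M \<and> (\<forall>v \<in> wds n. u (v @ w) = wact M v (u w))" using * by simp
 qed
 then show ?thesis using u by blast
qed

end

text \<open>The germ of \<open>u\<close> at infinity is \<open>germ u\<close>; the type of germs is left open since the module of germs
 is needed inside the universe of modules.\<close>

locale localization = free_mod n M for n and M :: "(nat list \<Rightarrow>\<^sub>0 'k::field, 'u) graded" (structure) +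
 fixes germ :: "(nat list => 'u) => 'p"
 assumes germ_eq_iff: "[|u \<in> evlin n M; v \<in> evlin n M|] ==> germ u = germ v \<longleftrightarrow> (\<forall>\<^sub>F w in long n. u w = v w)"
begin

definition rep :: "'p => nat list => 'u" where
 "rep p = inv_into (evlin n M) germ p"

text \<open>Operations go through the chosen representatives \<open>rep\<close>. A germ of degree d
  sends a long word w to degree d + \<open>length w\<close>, since prefixing a letter raises the
  degree of the value by one.\<close>

definition germs :: "('k, 'p) graded" where
 "germs = \<lparr>carrier = germ ` evlin n M, mult = (\<lambda>p q. p), one = germ (\<lambda>w. \<zero>), zero = germ (\<lambda>w. \<zero>),
   add = (\<lambda>p q. germ (\<lambda>w. rep p w \<oplus> rep q w)), smult = (\<lambda>c p. germ (\<lambda>w. sc M c (rep p w))),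
   component = (\<lambda>d. germ ` {u \<in> evlin n M. \<forall>\<^sub>F w in long n. u w \<in> component M (d + int (length w))})\<rparr>"

primrec germ_op :: "leavitt_gen => 'p => 'p" where
 "germ_op (Gen i) = (\<lambda>p. germ (\<lambda>w. rep p (w @ [i])))"
| "germ_op (Gen_star i) = (\<lambda>p. germ (\<lambda>w. if w ~= [] \<and> last w = i then rep p (butlast w) else \<zero>))"

lemma germ_eqI:
 "[|u \<in> evlin n M; v \<in> evlin n M; \<forall>\<^sub>F w in long n. u w = v w|] ==> germ u = germ v"
 by (simp add: germ_eq_iff)

lemma rep_evlin: "u \<in> evlin n M ==> rep (germ u) \<in> evlin n M"
 unfolding rep_def by (rule inv_into_into) simp

lemma rep_germ: "u \<in> evlin n M ==> \<forall>\<^sub>F w in long n. rep (germ u) w = u w"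
 using germ_eq_iff[OF rep_evlin, of u u] f_inv_into_f[of "germ u" germ "evlin n M"] by (simp add: rep_def)

lemma germs_carrier: "carrier germs = germ ` evlin n M" "\<zero>\<^bsub>germs\<^esub> = germ (\<lambda>w. \<zero>)"
 "component germs d = germ ` {u \<in> evlin n M. \<forall>\<^sub>F w in long n. u w \<in> component M (d + int (length w))}"
 by (simp_all add: germs_def)

lemma germs_add:
 assumes "u \<in> evlin n M" "v \<in> evlin n M"
 shows "germ u \<oplus>\<^bsub>germs\<^esub> germ v = germ (\<lambda>w. u w \<oplus> v w)"
proof -
 have "\<forall>\<^sub>F w in long n. rep (germ u) w \<oplus> rep (germ v) w = u w \<oplus> v w"
  using rep_germ[OF assms(1)] rep_germ[OF assms(2)] by eventually_elim simp
 then have "germ (\<lambda>w. rep (germ u) w \<oplus> rep (germ v) w) = germ (\<lambda>w. u w \<oplus> v w)"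
  by (rule germ_eqI[OF evlin_add[OF rep_evlin[OF assms(1)] rep_evlin[OF assms(2)]] evlin_add[OF assms]])
 then show ?thesis by (simp add: germs_def)
qed

lemma germs_scalar:
 assumes "u \<in> evlin n M" shows "c \<odot>\<^bsub>germs\<^esub> germ u = germ (\<lambda>w. sc M c (u w))"
proof -
 have "\<forall>\<^sub>F w in long n. sc M c (rep (germ u) w) = sc M c (u w)"
  using rep_germ[OF assms(1)] by eventually_elim simp
 then have "germ (\<lambda>w. sc M c (rep (germ u) w)) = germ (\<lambda>w. sc M c (u w))"
  by (rule germ_eqI[OF evlin_sc[OF rep_evlin[OF assms]] evlin_sc[OF assms]])
 then show ?thesis by (simp add: germs_def)
qed

lemma germ_op_x:
 assumes "u \<in> evlin n M" "i \<le> n" shows "germ_op (Gen i) (germ u) = germ (\<lambda>w. u (w @ [i]))"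
 using eventually_long_snoc[OF rep_germ[OF assms(1)] assms(2)]
 by (simp add: germ_eqI evlin_snoc rep_evlin assms)

lemma germ_op_y:
 assumes "u \<in> evlin n M"
 shows "germ_op (Gen_star i) (germ u) = germ (\<lambda>w. if w ~= [] \<and> last w = i then u (butlast w) else \<zero>)"
proof -
 have "\<forall>\<^sub>F w in long n. (if w ~= [] \<and> last w = i then rep (germ u) (butlast w) else \<zero>)
   = (if w ~= [] \<and> last w = i then u (butlast w) else \<zero>)"
  using eventually_long_butlast[OF rep_germ[OF assms]] by eventually_elim simp
 then show ?thesis unfolding germ_op.simps by (rule germ_eqI[OF evlin_star[OF rep_evlin[OF assms]] evlin_star[OF assms]])
qed

lemma germs_abelian_group: "abelian_group germs"
proof (rule abelian_groupI)
 show "\<zero>\<^bsub>germs\<^esub> \<in> carrier germs" by (simp add: germs_carrier evlin_zero)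
 fix p assume "p \<in> carrier germs"
 then obtain u where u: "u \<in> evlin n M" "p = germ u" by (auto simp: germs_carrier)
 show "\<zero>\<^bsub>germs\<^esub> \<oplus>\<^bsub>germs\<^esub> p = p"
  unfolding u(2) germs_carrier(2) germs_add[OF evlin_zero u(1)]
  by (rule germ_eqI[OF evlin_add[OF evlin_zero u(1)] u(1)], rule eventually_mono[OF evlin_carrier[OF u(1)]]) simp
 have "germ (\<lambda>w. \<ominus> u w) \<oplus>\<^bsub>germs\<^esub> p = \<zero>\<^bsub>germs\<^esub>"
  unfolding u(2) germs_carrier(2) germs_add[OF evlin_minus[OF u(1)] u(1)]
  by (rule germ_eqI[OF evlin_add[OF evlin_minus[OF u(1)] u(1)] evlin_zero],
    rule eventually_mono[OF evlin_carrier[OF u(1)]]) (simp add: M.l_neg)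
 then show "\<exists>q \<in> carrier germs. q \<oplus>\<^bsub>germs\<^esub> p = \<zero>\<^bsub>germs\<^esub>"
  using evlin_minus[OF u(1)] by (auto simp: germs_carrier(1))
 fix q assume "q \<in> carrier germs"
 then obtain v where v: "v \<in> evlin n M" "q = germ v" by (auto simp: germs_carrier)
 show "p \<oplus>\<^bsub>germs\<^esub> q \<in> carrier germs"
  unfolding u(2) v(2) germs_add[OF u(1) v(1)] germs_carrier(1) by (rule imageI[OF evlin_add[OF u(1) v(1)]])
 show "p \<oplus>\<^bsub>germs\<^esub> q = q \<oplus>\<^bsub>germs\<^esub> p"
  unfolding u(2) v(2) germs_add[OF u(1) v(1)] germs_add[OF v(1) u(1)]
  by (rule germ_eqI[OF evlin_add[OF u(1) v(1)] evlin_add[OF v(1) u(1)]],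
    rule eventually_elim2[OF evlin_carrier[OF u(1)] evlin_carrier[OF v(1)]]) (rule M.a_comm)
 fix r assume "r \<in> carrier germs"
 then obtain t where t: "t \<in> evlin n M" "r = germ t" by (auto simp: germs_carrier)
 have "\<forall>\<^sub>F w in long n. (u w \<oplus> v w) \<oplus> t w = u w \<oplus> (v w \<oplus> t w)"
  using evlin_carrier[OF u(1)] evlin_carrier[OF v(1)] evlin_carrier[OF t(1)]
  by eventually_elim (rule M.a_assoc)
 then show "(p \<oplus>\<^bsub>germs\<^esub> q) \<oplus>\<^bsub>germs\<^esub> r = p \<oplus>\<^bsub>germs\<^esub> (q \<oplus>\<^bsub>germs\<^esub> r)"
  unfolding u(2) v(2) t(2) germs_add[OF u(1) v(1)] germs_add[OF v(1) t(1)]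
   germs_add[OF evlin_add[OF u(1) v(1)] t(1)] germs_add[OF u(1) evlin_add[OF v(1) t(1)]]
  by (rule germ_eqI[OF evlin_add[OF evlin_add[OF u(1) v(1)] t(1)] evlin_add[OF u(1) evlin_add[OF v(1) t(1)]]])
qed

interpretation G: abelian_group germs by (rule germs_abelian_group)

lemma germs_minus:
 assumes "u \<in> evlin n M" shows "\<ominus>\<^bsub>germs\<^esub> germ u = germ (\<lambda>w. \<ominus> u w)"
proof (rule G.minus_equality)
 show "germ (\<lambda>w. \<ominus> u w) \<oplus>\<^bsub>germs\<^esub> germ u = \<zero>\<^bsub>germs\<^esub>"
  unfolding germs_carrier(2) germs_add[OF evlin_minus[OF assms] assms]
  by (rule germ_eqI[OF evlin_add[OF evlin_minus[OF assms] assms] evlin_zero],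
    rule eventually_mono[OF evlin_carrier[OF assms]]) (simp add: M.l_neg)
qed (use assms evlin_minus[OF assms] in \<open>simp_all add: germs_carrier(1)\<close>)

lemma germs_kspace: "kspace germs"
proof (rule kspaceI[OF germs_abelian_group])
 fix p :: 'p and c d assume "p \<in> carrier germs"
 then obtain u where u: "u \<in> evlin n M" "p = germ u" by (auto simp: germs_carrier)
 show "c \<odot>\<^bsub>germs\<^esub> p \<in> carrier germs" using u by (auto simp: germs_carrier germs_scalar evlin_sc)
 have "\<forall>\<^sub>F w in long n. sc M (c + d) (u w) = sc M c (u w) \<oplus> sc M d (u w)"
  "\<forall>\<^sub>F w in long n. sc M (c * d) (u w) = sc M c (sc M d (u w))" "\<forall>\<^sub>F w in long n. sc M 1 (u w) = u w"
  using evlin_carrier[OF u(1)] by (auto simp: sc_add_left sc_mult sc_one elim: eventually_mono)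
 note ev = this
 show "(c + d) \<odot>\<^bsub>germs\<^esub> p = c \<odot>\<^bsub>germs\<^esub> p \<oplus>\<^bsub>germs\<^esub> d \<odot>\<^bsub>germs\<^esub> p"
  unfolding u(2) germs_scalar[OF u(1)] germs_add[OF evlin_sc[OF u(1)] evlin_sc[OF u(1)]]
  by (rule germ_eqI[OF evlin_sc[OF u(1)] evlin_add[OF evlin_sc[OF u(1)] evlin_sc[OF u(1)]] ev(1)])
 show "(c * d) \<odot>\<^bsub>germs\<^esub> p = c \<odot>\<^bsub>germs\<^esub> (d \<odot>\<^bsub>germs\<^esub> p)"
  unfolding u(2) germs_scalar[OF u(1)] germs_scalar[OF evlin_sc[OF u(1)]]
  by (rule germ_eqI[OF evlin_sc[OF u(1)] evlin_sc[OF evlin_sc[OF u(1)]] ev(2)])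
 show "1 \<odot>\<^bsub>germs\<^esub> p = p"
  unfolding u(2) germs_scalar[OF u(1)] by (rule germ_eqI[OF evlin_sc[OF u(1)] u(1) ev(3)])
next
 fix p q c assume "p \<in> carrier germs" "q \<in> carrier germs"
 then obtain u v where *: "u \<in> evlin n M" "v \<in> evlin n M" "p = germ u" "q = germ v" by (auto simp: germs_carrier)
 have "\<forall>\<^sub>F w in long n. sc M c (u w \<oplus> v w) = sc M c (u w) \<oplus> sc M c (v w)"
  using evlin_carrier[OF *(1)] evlin_carrier[OF *(2)] by eventually_elim (simp add: sc_add)
 then show "c \<odot>\<^bsub>germs\<^esub> (p \<oplus>\<^bsub>germs\<^esub> q) = c \<odot>\<^bsub>germs\<^esub> p \<oplus>\<^bsub>germs\<^esub> c \<odot>\<^bsub>germs\<^esub> q"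
  unfolding *(3,4) germs_add[OF *(1,2)] germs_scalar[OF *(1)] germs_scalar[OF *(2)]
   germs_scalar[OF evlin_add[OF *(1,2)]] germs_add[OF evlin_sc[OF *(1)] evlin_sc[OF *(2)]]
  by (rule germ_eqI[OF evlin_sc[OF evlin_add[OF *(1,2)]] evlin_add[OF evlin_sc[OF *(1)] evlin_sc[OF *(2)]]])
qed

lemma germs_finsum:
 assumes "finite J" "!!j. j \<in> J ==> u j \<in> evlin n M"
 shows "(\<Oplus>\<^bsub>germs\<^esub>j \<in> J. germ (u j)) = germ (\<lambda>w. \<Oplus>j \<in> J. u j w) \<and> (\<lambda>w. \<Oplus>j \<in> J. u j w) \<in> evlin n M"
 using assms
proof (induction J rule: finite_induct)
 case empty
 then show ?case by (simp add: germs_carrier evlin_zero)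
next
 case (insert j J)
 have e: "u j \<in> evlin n M" "(\<lambda>w. \<Oplus>j \<in> J. u j w) \<in> evlin n M"
  "!!i. i \<in> J ==> u i \<in> evlin n M" using insert by auto
 have "\<forall>\<^sub>F w in long n. \<forall>i \<in> J. u i w \<in> carrier M"
  using insert(1) evlin_carrier[OF e(3)] by (intro eventually_ball_finite) auto
 then have eq: "\<forall>\<^sub>F w in long n. u j w \<oplus> (\<Oplus>j \<in> J. u j w) = (\<Oplus>j \<in> insert j J. u j w)"
  using evlin_carrier[OF e(1)] by eventually_elim (use insert(1,2) in auto)
 have ev: "(\<lambda>w. \<Oplus>j \<in> insert j J. u j w) \<in> evlin n M"
  by (rule evlin_cong[OF evlin_add[OF e(1,2)] eq])
 have "(\<Oplus>\<^bsub>germs\<^esub>j \<in> insert j J. germ (u j)) = germ (u j) \<oplus>\<^bsub>germs\<^esub> germ (\<lambda>w. \<Oplus>j \<in> J. u j w)"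
  using insert e(1,3) by (simp add: germs_carrier(1))
 also have "\<dots> = germ (\<lambda>w. \<Oplus>j \<in> insert j J. u j w)"
  unfolding germs_add[OF e(1,2)] by (rule germ_eqI[OF evlin_add[OF e(1,2)] ev eq])
 finally show ?case using ev by blast
qed

lemma germs_comp:
 "[|u \<in> evlin n M; \<forall>\<^sub>F w in long n. u w \<in> component M (d + int (length w))|] ==> germ u \<in> component germs d"
 by (auto simp: germs_carrier)

lemma germs_part:
 assumes u: "u \<in> evlin n M"
 shows "germ (\<lambda>w. hpart M (u w) (d + int (length w))) \<in> component germs d"
 by (rule germs_comp[OF evlin_part[OF u]], rule eventually_mono[OF evlin_carrier[OF u]]) (rule M.hpart(1))

text \<open>The values on the finitely many words of length r involve finitely many degrees, and
  further letters shift the degree of the value and the length of the word together.\<close>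

lemma evlin_parts_finite:
 assumes u: "u \<in> evlin n M"
 shows "\<exists>J. finite J \<and> (\<forall>\<^sub>F w in long n. \<forall>d. d \<notin> J --> hpart M (u w) (d + int (length w)) = \<zero>)"
proof -
 from eventually_long[THEN iffD1, OF evlinD[OF u]] obtain r where r: "\<forall>w \<in> wds n. r \<le> length w -->
   w \<in> wds n \<and> u w \<in> carrier M \<and> (\<forall>v \<in> wds n. u (v @ w) = wact M v (u w))" by blast
 then have c: "u w \<in> carrier M" "!!v. v \<in> wds n ==> u (v @ w) = wact M v (u w)" if "w \<in> words n r" for w
  using that by (auto simp: words_iff)
 define J where "J = (\<Union>w \<in> words n r. (\<lambda>i. i - int r) ` {i. hpart M (u w) i ~= \<zero>})"
 have "finite J" unfolding J_def using finite_words M.hpart(2) c(1) by (intro finite_UN_I finite_imageI) auto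
 moreover have "hpart M (u w) (d + int (length w)) = \<zero>" if w: "w \<in> wds n" "r \<le> length w" and d: "d \<notin> J" for w d
 proof -
  from wds_split[OF w] obtain v w0 where w0: "w = v @ w0" "v \<in> wds n" "w0 \<in> words n r" .
  have z: "hpart M (u w0) (d + int r) = \<zero>"
  proof (rule ccontr)
   assume "hpart M (u w0) (d + int r) ~= \<zero>"
   then have "(d + int r) - int r \<in> J" unfolding J_def using w0(3) by blast
   then show False using d by simp
  qed
  have "length w = length v + r" using w0 by (simp add: words_iff)
  then show ?thesis
   unfolding w0(1) c(2)[OF w0(3,2)] using z by (simp add: hpart_wact[OF w0(2) c(1)[OF w0(3)]] w0 wact_zero)
 qed
 ultimately show ?thesis unfolding eventually_long by blast
qed

lemma germs_direct_sum: "direct_sum_grading germs"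
proof (rule direct_sum_gradingI[OF germs_abelian_group,
   where p = "\<lambda>d p. germ (\<lambda>w. hpart M (rep p w) (d + int (length w)))"])
 have part_rep: "germ (\<lambda>w. hpart M (rep (germ u) w) (d + int (length w))) = germ (\<lambda>w. hpart M (u w) (d + int (length w)))"
  if "u \<in> evlin n M" for u d
  by (rule germ_eqI[OF evlin_part[OF rep_evlin[OF that]] evlin_part[OF that]],
    rule eventually_mono[OF rep_germ[OF that]]) simp
 show "additive_subgroup (component germs d) germs" for d
  unfolding G.additive_subgroup_iff
 proof (intro conjI ballI)
  show "component germs d \<subseteq> carrier germs" by (auto simp: germs_carrier)
  show "\<zero>\<^bsub>germs\<^esub> \<in> component germs d"
   unfolding germs_carrier(2) by (rule germs_comp) (simp_all add: evlin_zero M.comp_zero)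
  fix p assume "p \<in> component germs d"
  then obtain u where u: "u \<in> evlin n M" "\<forall>\<^sub>F w in long n. u w \<in> component M (d + int (length w))" "p = germ u"
   by (auto simp: germs_carrier)
  show "\<ominus>\<^bsub>germs\<^esub> p \<in> component germs d"
   unfolding u(3) germs_minus[OF u(1)]
   by (rule germs_comp[OF evlin_minus[OF u(1)]], rule eventually_mono[OF u(2)]) (rule M.comp_minus)
  fix q assume "q \<in> component germs d"
  then obtain v where v: "v \<in> evlin n M" "\<forall>\<^sub>F w in long n. v w \<in> component M (d + int (length w))" "q = germ v"
   by (auto simp: germs_carrier)
  show "p \<oplus>\<^bsub>germs\<^esub> q \<in> component germs d"
   unfolding u(3) v(3) germs_add[OF u(1) v(1)]
   by (rule germs_comp[OF evlin_add[OF u(1) v(1)]], rule eventually_elim2[OF u(2) v(2)]) (rule M.comp_add)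
 qed
 fix d p assume "p \<in> carrier germs"
 then obtain u where u: "u \<in> evlin n M" "p = germ u" by (auto simp: germs_carrier)
 show "germ (\<lambda>w. hpart M (rep p w) (d + int (length w))) \<in> component germs d"
  unfolding u(2) part_rep[OF u(1)] by (rule germs_part[OF u(1)])
 obtain J where J: "finite J" "\<forall>\<^sub>F w in long n. \<forall>d. d \<notin> J --> hpart M (u w) (d + int (length w)) = \<zero>"
  using evlin_parts_finite[OF u(1)] by blast
 have sum: "\<forall>\<^sub>F w in long n. (\<Oplus>d \<in> J. hpart M (u w) (d + int (length w))) = u w"
  using J(2) evlin_carrier[OF u(1)]
 proof eventually_elim
  case (elim w)
  let ?s = "\<lambda>d. d + int (length w)"
  have zero: "hpart M (u w) i = \<zero>" if "i \<notin> ?s ` J" for i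
  proof -
   have "i - int (length w) \<notin> J" using that by force
   then show ?thesis using elim(1)[rule_format, of "i - int (length w)"] by simp
  qed
  have "(\<Oplus>d \<in> J. hpart M (u w) (?s d)) = finsum M (hpart M (u w)) (?s ` J)"
   using elim(2) by (subst M.finsum_reindex) (auto simp: M.hpart_closed inj_on_def)
  also have "\<dots> = u w" using M.hpart_sum[OF elim(2) finite_imageI[OF J(1)] zero] .
  finally show ?case .
 qed
 have "(\<Oplus>\<^bsub>germs\<^esub>d \<in> J. germ (\<lambda>w. hpart M (u w) (d + int (length w)))) = germ u"
  using germs_finsum[OF J(1), of "\<lambda>d w. hpart M (u w) (d + int (length w))"] evlin_part[OF u(1)] sum u(1)
  by (auto intro!: germ_eqI)
 moreover have "germ (\<lambda>w. hpart M (u w) (d + int (length w))) = \<zero>\<^bsub>germs\<^esub>" if "d \<notin> J" for d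
  unfolding germs_carrier(2)
  by (rule germ_eqI[OF evlin_part[OF u(1)] evlin_zero], rule eventually_mono[OF J(2)]) (use that in blast)
 ultimately show "\<exists>J. finite J \<and> (\<forall>d. d \<notin> J --> germ (\<lambda>w. hpart M (rep p w) (d + int (length w))) = \<zero>\<^bsub>germs\<^esub>) \<and>
   (\<Oplus>\<^bsub>germs\<^esub>d \<in> J. germ (\<lambda>w. hpart M (rep p w) (d + int (length w)))) = p"
  unfolding u(2) part_rep[OF u(1)] using J(1) by blast
 fix q assume "q \<in> carrier germs"
 then obtain v where v: "v \<in> evlin n M" "q = germ v" by (auto simp: germs_carrier)
 show "germ (\<lambda>w. hpart M (rep (p \<oplus>\<^bsub>germs\<^esub> q) w) (d + int (length w)))
   = germ (\<lambda>w. hpart M (rep p w) (d + int (length w))) \<oplus>\<^bsub>germs\<^esub> germ (\<lambda>w. hpart M (rep q w) (d + int (length w)))"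
  unfolding u(2) v(2) germs_add[OF u(1) v(1)] part_rep[OF u(1)] part_rep[OF v(1)]
   part_rep[OF evlin_add[OF u(1) v(1)]] germs_add[OF evlin_part[OF u(1)] evlin_part[OF v(1)]]
  by (rule germ_eqI[OF evlin_part[OF evlin_add[OF u(1) v(1)]] evlin_add[OF evlin_part[OF u(1)] evlin_part[OF v(1)]]],
    rule eventually_elim2[OF evlin_carrier[OF u(1)] evlin_carrier[OF v(1)]]) (rule M.hpart_add)
next
 fix d e p assume "p \<in> component germs e" "d ~= e"
 then obtain u where u: "u \<in> evlin n M" "\<forall>\<^sub>F w in long n. u w \<in> component M (e + int (length w))" "p = germ u"
  by (auto simp: germs_carrier)
 have "\<forall>\<^sub>F w in long n. hpart M (rep p w) (d + int (length w)) = \<zero>"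
  using u(2) rep_germ[OF u(1)] unfolding u(3)
  by eventually_elim (use \<open>d ~= e\<close> in \<open>simp add: M.hpart_comp\<close>)
 then show "germ (\<lambda>w. hpart M (rep p w) (d + int (length w))) = \<zero>\<^bsub>germs\<^esub>"
  unfolding germs_carrier(2) by (rule germ_eqI[OF evlin_part[OF rep_evlin[OF u(1)]] evlin_zero, folded u(3)])
qed

lemma germs_operators: "graded_operators germs (Gen ` {0..n} \<union> Gen_star ` {0..n}) leavitt_deg germ_op"
proof -
 have gk: "graded_kspace germs"
 proof (rule graded_kspaceI[OF germs_kspace germs_direct_sum])
  fix c d p assume "p \<in> component germs d"
  then obtain u where u: "u \<in> evlin n M" "\<forall>\<^sub>F w in long n. u w \<in> component M (d + int (length w))" "p = germ u"
   by (auto simp: germs_carrier)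
  show "c \<odot>\<^bsub>germs\<^esub> p \<in> component germs d"
   unfolding u(3) germs_scalar[OF u(1)]
   by (rule germs_comp[OF evlin_sc[OF u(1)]], rule eventually_mono[OF u(2)]) (rule sc_comp)
 qed
 have closed: "germ_op g p \<in> carrier germs" and scalar: "germ_op g (c \<odot>\<^bsub>germs\<^esub> p) = c \<odot>\<^bsub>germs\<^esub> germ_op g p"
  if g: "g \<in> Gen ` {0..n} \<union> Gen_star ` {0..n}" and p: "p \<in> carrier germs" for g p c
 proof -
  obtain u where u: "u \<in> evlin n M" "p = germ u" using p by (auto simp: germs_carrier)
  have star: "germ (\<lambda>w. if w ~= [] \<and> last w = i then sc M c (u (butlast w)) else \<zero>)
    = germ (\<lambda>w. sc M c (if w ~= [] \<and> last w = i then u (butlast w) else \<zero>))" for i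
   by (rule arg_cong[of _ _ germ]) (auto simp: sc_zero)
  show "germ_op g p \<in> carrier germs"
   using g u(1) by (auto simp: u(2) germ_op_x germ_op_y germs_carrier evlin_snoc evlin_star simp del: germ_op.simps)
  show "germ_op g (c \<odot>\<^bsub>germs\<^esub> p) = c \<odot>\<^bsub>germs\<^esub> germ_op g p"
   using g u(1) star by (auto simp: u(2) germ_op_x germ_op_y germs_scalar evlin_sc evlin_snoc evlin_star simp del: germ_op.simps)
 qed
 have add: "germ_op g (p \<oplus>\<^bsub>germs\<^esub> q) = germ_op g p \<oplus>\<^bsub>germs\<^esub> germ_op g q"
  if g: "g \<in> Gen ` {0..n} \<union> Gen_star ` {0..n}" and pq: "p \<in> carrier germs" "q \<in> carrier germs" for g p q
 proof -
  obtain u v where u: "u \<in> evlin n M" "p = germ u" and v: "v \<in> evlin n M" "q = germ v"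
   using pq by (auto simp: germs_carrier)
  have star: "germ (\<lambda>w. if w ~= [] \<and> last w = i then u (butlast w) \<oplus> v (butlast w) else \<zero>)
    = germ (\<lambda>w. (if w ~= [] \<and> last w = i then u (butlast w) else \<zero>) \<oplus>
      (if w ~= [] \<and> last w = i then v (butlast w) else \<zero>))" for i
   by (rule arg_cong[of _ _ germ]) auto
  show ?thesis
   using g u(1) v(1) star
   by (auto simp: u(2) v(2) germ_op_x germ_op_y germs_add evlin_add evlin_snoc evlin_star simp del: germ_op.simps)
 qed
 have comp: "germ_op g p \<in> component germs (leavitt_deg g + d)"
  if g: "g \<in> Gen ` {0..n} \<union> Gen_star ` {0..n}" and p: "p \<in> component germs d" for g p d
 proof -
  obtain u where u: "u \<in> evlin n M" "\<forall>\<^sub>F w in long n. u w \<in> component M (d + int (length w))" "p = germ u"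
   using p by (auto simp: germs_carrier)
  from g consider i where "g = Gen i" "i \<le> n" | i where "g = Gen_star i" "i \<le> n" by auto
  then show ?thesis
  proof cases
   case 1
   have "\<forall>\<^sub>F w in long n. u (w @ [i]) \<in> component M (1 + d + int (length w))"
    using eventually_long_snoc[OF u(2) 1(2)] by eventually_elim (simp add: ac_simps)
   then show ?thesis unfolding 1(1) u(3) germ_op_x[OF u(1) 1(2)] leavitt_deg.simps
    by (rule germs_comp[OF evlin_snoc[OF u(1) 1(2)]])
  next
   case 2
   have "\<forall>\<^sub>F w in long n. (if w ~= [] \<and> last w = i then u (butlast w) else \<zero>)
     \<in> component M (- 1 + d + int (length w))"
    using eventually_long_butlast[OF u(2)]
   proof eventually_elim
    case (elim w)
    then have "d + int (length (butlast w)) = - 1 + d + int (length w)" by (cases w) auto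
    with elim have "u (butlast w) \<in> component M (- 1 + d + int (length w))" by metis
    then show ?case using M.comp_zero[of "- 1 + d + int (length w)"] by (simp split: if_split)
   qed
   then show ?thesis unfolding 2(1) u(3) germ_op_y[OF u(1)] leavitt_deg.simps
    by (rule germs_comp[OF evlin_star[OF u(1)]])
  qed
 qed
 show ?thesis
  by (rule graded_operators.intro[OF gk], rule graded_operators_axioms.intro)
   (rule closed add scalar comp, assumption+)+
qed

definition loc_mod :: "((leavitt_gen list \<Rightarrow>\<^sub>0 'k) set, 'p) graded" where
 "loc_mod = descend_module (operator_module germs germ_op)"

lemma germ_op_x_y:
 assumes "i \<le> n" "j \<le> n" "p \<in> carrier germs"
 shows "germ_op (Gen i) (germ_op (Gen_star j) p) = (if i = j then p else \<zero>\<^bsub>germs\<^esub>)"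
proof -
 obtain u where u: "u \<in> evlin n M" "p = germ u" using assms(3) by (auto simp: germs_carrier)
 show ?thesis
  unfolding u(2) germ_op_y[OF u(1)] germ_op_x[OF evlin_star[OF u(1)] assms(1)] by (simp add: germs_carrier)
qed

text \<open>At a nonempty word only the summand indexed by the last letter survives, and it returns
  the value there. At the empty word the sum is zero, so the relation holds for germs rather than
  for functions.\<close>

lemma germ_op_sum_y_x:
 assumes "p \<in> carrier germs"
 shows "(\<Oplus>\<^bsub>germs\<^esub>i \<in> {0..n}. germ_op (Gen_star i) (germ_op (Gen i) p)) = p"
proof -
 obtain u where u: "u \<in> evlin n M" "p = germ u" using assms by (auto simp: germs_carrier)
 let ?v = "\<lambda>i w. if w ~= [] \<and> last w = i then u (butlast w @ [i]) else \<zero>"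
 have v: "?v i \<in> evlin n M" "germ_op (Gen_star i) (germ_op (Gen i) p) = germ (?v i)" if "i \<le> n" for i
  using evlin_star[OF evlin_snoc[OF u(1) that], of i] germ_op_y[OF evlin_snoc[OF u(1) that], of i]
  by (simp_all only: u(2) germ_op_x[OF u(1) that])
 have "(\<Oplus>\<^bsub>germs\<^esub>i \<in> {0..n}. germ_op (Gen_star i) (germ_op (Gen i) p)) = (\<Oplus>\<^bsub>germs\<^esub>i \<in> {0..n}. germ (?v i))"
  using v by (intro G.finsum_cong') (auto simp: germs_carrier(1))
 also have "\<dots> = germ (\<lambda>w. \<Oplus>i \<in> {0..n}. ?v i w)" using germs_finsum[of "{0..n}" ?v] v(1) by auto
 also have "\<dots> = germ u"
 proof (rule germ_eqI)
  show "(\<lambda>w. \<Oplus>i \<in> {0..n}. ?v i w) \<in> evlin n M" using germs_finsum[of "{0..n}" ?v] v(1) by auto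
  show "\<forall>\<^sub>F w in long n. (\<Oplus>i \<in> {0..n}. ?v i w) = u w"
   using eventually_long_butlast[OF eventually_long_wds] evlin_carrier[OF u(1)]
  proof eventually_elim
   case (elim w)
   have "(\<Oplus>i \<in> {0..n}. ?v i w) = (\<Oplus>i \<in> {last w}. ?v i w)"
    using elim by (intro M.finsum_eq_superset) auto
   then show ?case using elim by simp
  qed
 qed (rule u(1))
 finally show ?thesis by (simp add: u(2))
qed

lemma loc_mod_facts:
 "graded_mod (leavitt n) loc_mod" "carrier loc_mod = carrier germs" "add loc_mod = add germs"
 "zero loc_mod = zero germs" "component loc_mod = component germs"
 "[|i \<le> n; p \<in> carrier germs|] ==> leavitt_x n i \<odot>\<^bsub>loc_mod\<^esub> p = germ_op (Gen i) p"
 "[|i \<le> n; p \<in> carrier germs|] ==> leavitt_y n i \<odot>\<^bsub>loc_mod\<^esub> p = germ_op (Gen_star i) p"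
 "p \<in> carrier germs ==> (c \<odot>\<^bsub>leavitt n\<^esub> \<one>\<^bsub>leavitt n\<^esub>) \<odot>\<^bsub>loc_mod\<^esub> p = c \<odot>\<^bsub>germs\<^esub> p"
 unfolding loc_mod_def
 by (rule leavitt_module[OF germs_operators], (rule germ_op_x_y germ_op_sum_y_x; assumption)+, assumption?,
   assumption?)+

lemma loc_mod_graded: "graded_mod (leavitt n) loc_mod"
 by (rule loc_mod_facts(1))

lemma loc_mod_simps:
 "carrier loc_mod = germ ` evlin n M" "\<zero>\<^bsub>loc_mod\<^esub> = germ (\<lambda>w. \<zero>)"
 "component loc_mod d = germ ` {u \<in> evlin n M. \<forall>\<^sub>F w in long n. u w \<in> component M (d + int (length w))}"
 "[|u \<in> evlin n M; v \<in> evlin n M|] ==> germ u \<oplus>\<^bsub>loc_mod\<^esub> germ v = germ (\<lambda>w. u w \<oplus> v w)"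
 "u \<in> evlin n M ==> (c \<odot>\<^bsub>leavitt n\<^esub> \<one>\<^bsub>leavitt n\<^esub>) \<odot>\<^bsub>loc_mod\<^esub> germ u = germ (\<lambda>w. sc M c (u w))"
 "[|u \<in> evlin n M; i \<le> n|] ==> leavitt_x n i \<odot>\<^bsub>loc_mod\<^esub> germ u = germ (\<lambda>w. u (w @ [i]))"
 "[|u \<in> evlin n M; i \<le> n|] ==> leavitt_y n i \<odot>\<^bsub>loc_mod\<^esub> germ u
   = germ (\<lambda>w. if w ~= [] \<and> last w = i then u (butlast w) else \<zero>)"
proof -
 have c: "germ u \<in> carrier germs" if "u \<in> evlin n M" for u using that by (simp add: germs_carrier)
 show "carrier loc_mod = germ ` evlin n M" "\<zero>\<^bsub>loc_mod\<^esub> = germ (\<lambda>w. \<zero>)"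
  "component loc_mod d = germ ` {u \<in> evlin n M. \<forall>\<^sub>F w in long n. u w \<in> component M (d + int (length w))}"
  by (simp_all add: loc_mod_facts germs_carrier)
 show "germ u \<oplus>\<^bsub>loc_mod\<^esub> germ v = germ (\<lambda>w. u w \<oplus> v w)" if "u \<in> evlin n M" "v \<in> evlin n M"
  using germs_add[OF that] by (simp add: loc_mod_facts(3))
 show "(c \<odot>\<^bsub>leavitt n\<^esub> \<one>\<^bsub>leavitt n\<^esub>) \<odot>\<^bsub>loc_mod\<^esub> germ u = germ (\<lambda>w. sc M c (u w))" if "u \<in> evlin n M"
  using loc_mod_facts(8)[OF c[OF that]] germs_scalar[OF that] by simp
 show "leavitt_x n i \<odot>\<^bsub>loc_mod\<^esub> germ u = germ (\<lambda>w. u (w @ [i]))" if "u \<in> evlin n M" "i \<le> n"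
  unfolding loc_mod_facts(6)[OF that(2) c[OF that(1)]] by (rule germ_op_x[OF that])
 show "leavitt_y n i \<odot>\<^bsub>loc_mod\<^esub> germ u = germ (\<lambda>w. if w ~= [] \<and> last w = i then u (butlast w) else \<zero>)"
  if "u \<in> evlin n M" "i \<le> n"
  unfolding loc_mod_facts(7)[OF that(2) c[OF that(1)]] by (rule germ_op_y[OF that(1)])
qed

end

section \<open>Torsion modules and fractions\<close>

context graded_mod
begin

section \<open>Finite dimension in terms of linear subspaces\<close>

definition ksub :: "'u set => bool" where
 "ksub H \<longleftrightarrow> H \<subseteq> carrier M \<and> \<zero>\<^bsub>M\<^esub> \<in> H \<and> (\<forall>x \<in> H. \<forall>y \<in> H. x \<oplus>\<^bsub>M\<^esub> y \<in> H) \<and>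
   (\<forall>c. \<forall>x \<in> H. (c \<odot>\<^bsub>A\<^esub> \<one>\<^bsub>A\<^esub>) \<odot>\<^bsub>M\<^esub> x \<in> H)"

lemma restrict_scalars_module: "Module.module class_ring (restrict_scalars A M)"
 using restrict_scalars_kspace by (simp only: kspace_iff_module)

lemma restrict_scalars_simps:
 "carrier (restrict_scalars A M) = carrier M" "zero (restrict_scalars A M) = zero M"
 "add (restrict_scalars A M) = add M" "smult (restrict_scalars A M) = (\<lambda>c x. (c \<odot>\<^bsub>A\<^esub> \<one>\<^bsub>A\<^esub>) \<odot>\<^bsub>M\<^esub> x)"
 by (simp_all add: restrict_scalars_def)

lemma ksub_iff_submodule: "ksub H \<longleftrightarrow> LinearCombinations.submodule class_ring H (restrict_scalars A M)"
 using restrict_scalars_module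
 by (auto simp: ksub_def LinearCombinations.submodule_def restrict_scalars_simps class_ring_simps)

text \<open>Spanning is expressed by the absence of proper subspaces containing \<open>B\<close>.
  This turns statements about all elements into the task of exhibiting one suitable
  subspace.\<close>

lemma finite_dimensional_iff:
 "finite_dimensional A M \<longleftrightarrow>
   (\<exists>B. finite B \<and> B \<subseteq> carrier M \<and> (\<forall>H. ksub H --> B \<subseteq> H --> H = carrier M))"
proof -
 let ?V = "restrict_scalars A M"
 have V: "vectorspace class_ring ?V"
  using restrict_scalars_module class_field by (simp add: vectorspace_def)
 interpret V: vectorspace class_ring ?V by (rule V)
 have "V.span B = carrier M \<longleftrightarrow> (\<forall>H. ksub H --> B \<subseteq> H --> H = carrier M)" if B: "B \<subseteq> carrier M" for B
 proof
  assume span: "V.span B = carrier M"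
  show "\<forall>H. ksub H --> B \<subseteq> H --> H = carrier M"
  proof (intro allI impI)
   fix H assume H: "ksub H" "B \<subseteq> H"
   have "V.span B \<subseteq> H" using H by (intro V.span_is_subset) (simp_all add: ksub_iff_submodule)
   then show "H = carrier M" using H(1) span by (auto simp: ksub_def)
  qed
 next
  assume "\<forall>H. ksub H --> B \<subseteq> H --> H = carrier M"
  moreover have "ksub (V.span B)" "B \<subseteq> V.span B"
   using B V.span_is_submodule[of B] V.in_own_span[of B] by (simp_all add: ksub_iff_submodule restrict_scalars_simps)
  ultimately show "V.span B = carrier M" by blast
 qed
 then show ?thesis
  unfolding finite_dimensional_def V.fin_dim_def restrict_scalars_simps(1) using V by blast
qed

definition kspan :: "'u set => 'u set" where
 "kspan F = \<Inter>{H. ksub H \<and> F \<subseteq> H}"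

lemma ksub_carrier: "ksub (carrier M)"
 by (auto simp: ksub_def K.scalar_closed)

lemma ksub_kspan: "F \<subseteq> carrier M ==> ksub (kspan F)"
 unfolding kspan_def using ksub_carrier
 by (subst ksub_def) (intro conjI ballI allI InterI; (force simp: ksub_def)?)

lemma kspan_superset: "F \<subseteq> kspan F"
 by (auto simp: kspan_def)

lemma kspan_least: "[|ksub H; F \<subseteq> H|] ==> kspan F \<subseteq> H"
 by (auto simp: kspan_def)

end

context free_mod
begin

text \<open>A word raises degrees by its length, so when only degrees between -m and m occur, every
  word of length at least 2 m + 1 acts as zero.\<close>

lemma bounded_degrees_torsion:
 assumes J: "finite J" "!!x i. [|x \<in> carrier M; i \<notin> J|] ==> hpart M x i = \<zero>" and x: "x \<in> carrier M"
 shows "\<forall>\<^sub>F w in long n. wact M w x = \<zero>"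
proof -
 define m where "m = Max (insert 0 (abs ` J))"
 have m: "\<bar>j\<bar> \<le> m" if "j \<in> J" for j using J(1) that by (auto simp: m_def intro!: Max_ge)
 show ?thesis unfolding eventually_long
 proof (intro exI[of _ "nat (2 * m + 1)"] ballI impI)
  fix w assume w: "w \<in> wds n" "nat (2 * m + 1) \<le> length w"
  show "wact M w x = \<zero>"
  proof (rule M.hpart_eqI[OF wact_closed[OF w(1) x] M.zero_closed])
   fix i
   show "hpart M (wact M w x) i = hpart M \<zero> i"
   proof (cases "i \<in> J")
    case True
    then have "\<bar>i\<bar> \<le> m" by (rule m)
    then have "i - int (length w) \<notin> J" using w(2) m[of "i - int (length w)"] by linarith
    from J(2)[OF x this] show ?thesis by (simp add: hpart_wact[OF w(1) x] wact_zero[OF w(1)] M.hpart_zero)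
   next
    case False
    then show ?thesis using J(2)[OF wact_closed[OF w(1) x]] by (simp add: M.hpart_zero)
   qed
  qed
 qed
qed

text \<open>The elements whose parts lie in the degrees occurring in a finite spanning set form a
  subspace, hence everything, so the degrees are bounded.\<close>

lemma finite_dimensional_torsion:
 assumes fd: "finite_dimensional (free_algebra n) M" and x: "x \<in> carrier M"
 shows "\<forall>\<^sub>F w in long n. wact M w x = \<zero>"
proof -
 obtain B where B: "finite B" "B \<subseteq> carrier M" "!!H. [|ksub H; B \<subseteq> H|] ==> H = carrier M"
  using fd by (auto simp: finite_dimensional_iff)
 define J where "J = (\<Union>b \<in> B. {i. hpart M b i ~= \<zero>})"
 have J: "finite J" unfolding J_def using B(1,2) M.hpart(2) by (intro finite_UN_I) auto
 define H where "H = {x \<in> carrier M. \<forall>i. i \<notin> J --> hpart M x i = \<zero>}"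
 have "ksub H"
  by (auto simp: H_def ksub_def M.hpart_zero M.hpart_add sc_eq sc_closed hpart_sc sc_zero)
 moreover have "B \<subseteq> H" using B(2) by (auto simp: H_def J_def)
 ultimately have "H = carrier M" by (rule B(3))
 then show ?thesis by (intro bounded_degrees_torsion[OF J _ x]) (auto simp: H_def)
qed

text \<open>A finite set of homogeneous elements which is closed under the action of the variables up to
 zero spans a finite-dimensional graded submodule.\<close>

definition closed_set :: "'u set => bool" where
 "closed_set F \<longleftrightarrow> finite F \<and> F \<subseteq> (\<Union>i. component M i) \<and> (\<forall>i \<le> n. \<forall>f \<in> F. wact M [i] f \<in> insert \<zero> F)"

lemma closed_set_carrier: "closed_set F ==> F \<subseteq> carrier M"
 using M.comp_carrier by (auto simp: closed_set_def)

lemma kspan_closed_set: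
 assumes F: "closed_set F"
 shows "graded_submodule (free_algebra n) (kspan F) M"
  "finite_dimensional (free_algebra n) (sub_graded M (kspan F))"
proof -
 note Fc = closed_set_carrier[OF F]
 have k: "kspan F \<subseteq> carrier M" "\<zero> \<in> kspan F" "!!x y. [|x \<in> kspan F; y \<in> kspan F|] ==> x \<oplus> y \<in> kspan F"
  "!!c x. x \<in> kspan F ==> sc M c x \<in> kspan F"
  using ksub_kspan[OF Fc] unfolding ksub_def sc_eq by blast+
 have wact: "wact M [i] x \<in> kspan F" if "i \<le> n" "x \<in> kspan F" for i x
 proof -
  have i: "[i] \<in> wds n" using that(1) by simp
  have "ksub {x \<in> carrier M. wact M [i] x \<in> kspan F}"
   unfolding ksub_def sc_eq
   by (intro conjI ballI allI subsetI)
    (simp_all add: k(2-4) wact_zero[OF i] wact_add[OF i] wact_sc[OF i] sc_closed)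
  moreover have "F \<subseteq> {x \<in> carrier M. wact M [i] x \<in> kspan F}"
  proof
   fix f assume f: "f \<in> F"
   then have "wact M [i] f \<in> insert \<zero> F" using F that(1) unfolding closed_set_def by blast
   then have "wact M [i] f \<in> kspan F"
   proof (rule insertE)
    assume "wact M [i] f = \<zero>"
    then show ?thesis using k(2) by simp
   qed (rule subsetD[OF kspan_superset])
   then show "f \<in> {x \<in> carrier M. wact M [i] x \<in> kspan F}" using subsetD[OF Fc f] by simp
  qed
  ultimately have "kspan F \<subseteq> {x \<in> carrier M. wact M [i] x \<in> kspan F}" by (rule kspan_least)
  then show ?thesis using that(2) by auto
 qed
 have part: "hpart M x i \<in> kspan F" if "x \<in> kspan F" for i x
 proof -
  have "ksub {x \<in> carrier M. hpart M x i \<in> kspan F}"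
   unfolding ksub_def sc_eq
   by (intro conjI ballI allI subsetI) (simp_all add: k(2-4) M.hpart_zero M.hpart_add hpart_sc sc_closed)
  moreover have "F \<subseteq> {x \<in> carrier M. hpart M x i \<in> kspan F}"
  proof
   fix f assume f: "f \<in> F"
   then obtain j where "f \<in> component M j" using F by (auto simp: closed_set_def)
   then show "f \<in> {x \<in> carrier M. hpart M x i \<in> kspan F}"
    using f Fc k(2) kspan_superset[of F] by (auto simp: M.hpart_comp)
  qed
  ultimately have "kspan F \<subseteq> {x \<in> carrier M. hpart M x i \<in> kspan F}" by (rule kspan_least)
  then show ?thesis using that by auto
 qed
 show sub: "graded_submodule (free_algebra n) (kspan F) M"
  by (rule graded_submoduleI[OF k(1-3)]) (use free_submodule_smult[OF k(1,3,4) wact] part in auto)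
 interpret N: graded_mod "free_algebra n" "sub_graded M (kspan F)" by (rule sub_graded_mod[OF sub])
 have "H = kspan F" if H: "N.ksub H" "F \<subseteq> H" for H
 proof
  show "H \<subseteq> kspan F" using H(1) by (simp add: N.ksub_def)
  have "ksub H" using H(1) k(1) by (auto simp: N.ksub_def ksub_def)
  then show "kspan F \<subseteq> H" using H(2) by (rule kspan_least)
 qed
 then show "finite_dimensional (free_algebra n) (sub_graded M (kspan F))"
  unfolding N.finite_dimensional_iff using F kspan_superset[of F]
  by (intro exI[of _ F]) (auto simp: closed_set_def)
qed

text \<open>The finite set consists of the translates of the homogeneous parts of x by words of
  length at most r. Longer translates are zero, because words of length at least r kill x and hence
  its parts.\<close>

lemma torsion_closed_set:
 assumes x: "x \<in> carrier M" and tor: "\<forall>\<^sub>F w in long n. wact M w x = \<zero>"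
 shows "\<exists>F. closed_set F \<and> x \<in> kspan F"
proof -
 obtain r where r: "!!w. [|w \<in> wds n; r \<le> length w|] ==> wact M w x = \<zero>"
  using tor by (auto simp: eventually_long)
 define S where "S = {j. hpart M x j ~= \<zero>}"
 define F where "F = (\<lambda>(j, w). wact M w (hpart M x j)) ` (S \<times> (\<Union>s \<in> {..r}. words n s))"
 have mem: "wact M w (hpart M x j) \<in> insert \<zero> F" if w: "w \<in> wds n" for w j
 proof (cases "j \<in> S \<and> length w \<le> r")
  case True
  then show ?thesis using w by (force simp: F_def words_iff)
 next
  case False
  moreover have "wact M w (hpart M x j) = hpart M (wact M w x) (j + int (length w))"
   by (simp add: hpart_wact[OF w x])
  ultimately show ?thesis using r[OF w] by (auto simp: S_def wact_zero[OF w] M.hpart_zero)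
 qed
 have "closed_set F"
  unfolding closed_set_def
 proof (intro conjI allI impI ballI)
  show "finite F" unfolding F_def S_def
   using M.hpart(2)[OF x] by (intro finite_imageI finite_SigmaI finite_UN_I finite_words) auto
  show "F \<subseteq> (\<Union>i. component M i)"
   using wact_comp[OF _ M.hpart(1)[OF x]] by (fastforce simp: F_def words_iff)
  fix i f assume i: "i \<le> n" and "f \<in> F"
  then obtain j w where w: "f = wact M w (hpart M x j)" "w \<in> wds n" by (auto simp: F_def words_iff)
  have "wact M [i] f = wact M (i # w) (hpart M x j)"
   using wact_append[of "[i]" w "hpart M x j"] i w M.hpart_closed[OF x] by simp
  then show "wact M [i] f \<in> insert \<zero> F" using mem[of "i # w" j] i w(2) by simp
 qed
 moreover have "x \<in> kspan F"
 proof -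
  have k: "ksub (kspan F)" by (rule ksub_kspan[OF closed_set_carrier[OF calculation]])
  have "hpart M x j \<in> kspan F" for j
   using mem[of "[]" j] kspan_superset[of F] k by (auto simp: wact_Nil M.hpart_closed[OF x] ksub_def)
  then show ?thesis using k by (intro M.subgroup_mem[OF x]) (auto simp: ksub_def)
 qed
 ultimately show ?thesis by blast
qed

end

lemma Fdim_iff:
 "M \<in> Fdim (free_algebra n) \<longleftrightarrow>
   free_mod n M \<and> (\<forall>x \<in> carrier M. \<forall>\<^sub>F w in long n. wact M w x = \<zero>\<^bsub>M\<^esub>)"
proof (cases "free_mod n M")
 case True
 then interpret free_mod n M .
 show ?thesis
 proof (intro iffI conjI ballI)
  fix x assume M: "M \<in> Fdim (free_algebra n)" and "x \<in> carrier M"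
  then obtain N where N: "graded_submodule (free_algebra n) N M"
   "finite_dimensional (free_algebra n) (sub_graded M N)" "x \<in> N" unfolding Fdim_def by blast
  interpret N: free_mod n "sub_graded M N" using sub_graded_mod[OF N(1)] by (simp add: free_mod_def)
  show "\<forall>\<^sub>F w in long n. wact M w x = \<zero>\<^bsub>M\<^esub>"
   using N.finite_dimensional_torsion[OF N(2)] N(3) by (simp add: wact_def)
 next
  assume *: "free_mod n M \<and> (\<forall>x \<in> carrier M. \<forall>\<^sub>F w in long n. wact M w x = \<zero>\<^bsub>M\<^esub>)"
  \<comment> \<open>The spans of closed sets are directed because the union of two closed sets is
    closed.\<close>
  let ?\<F> = "kspan ` {F. closed_set F}"
  have "kspan {} \<in> ?\<F>" by (auto simp: closed_set_def)
  moreover have "\<exists>Q \<in> ?\<F>. N \<union> P \<subseteq> Q" if NP: "N \<in> ?\<F>" "P \<in> ?\<F>" for N P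
  proof -
   obtain F where F: "closed_set F" "N = kspan F" using NP(1) by auto
   obtain G where G: "closed_set G" "P = kspan G" using NP(2) by auto
   note FG = F(1) G(1) F(2) G(2)
   have FG': "closed_set (F \<union> G)" using FG(1,2) by (auto simp: closed_set_def)
   have "ksub (kspan (F \<union> G))" by (rule ksub_kspan[OF closed_set_carrier[OF FG']])
   then have "N \<union> P \<subseteq> kspan (F \<union> G)"
    unfolding FG(3,4) using kspan_superset[of "F \<union> G"] by (intro Un_least kspan_least) auto
   then show ?thesis using FG' by blast
  qed
  moreover have "carrier M = \<Union>?\<F>"
  proof
   show "carrier M \<subseteq> \<Union>?\<F>" using * torsion_closed_set by blast
   show "\<Union>?\<F> \<subseteq> carrier M" using ksub_kspan[OF closed_set_carrier] unfolding ksub_def by blast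
  qed
  moreover have "graded_submodule (free_algebra n) N M \<and> finite_dimensional (free_algebra n) (sub_graded M N)"
   if "N \<in> ?\<F>" for N using that kspan_closed_set by blast
  ultimately show "M \<in> Fdim (free_algebra n)"
   unfolding Fdim_def using graded_module by (intro CollectI conjI exI[of _ ?\<F>]) blast+
 qed (rule True)
next
 case False
 then show ?thesis by (simp add: Fdim_def free_mod_def graded_mod_def graded_algebra_free_algebra)
qed

context free_mod
begin

lemma free_mod_sub: "graded_submodule (free_algebra n) N M ==> free_mod n (sub_graded M N)"
 by (simp add: free_mod_def sub_graded_mod)

lemma sub_Fdim_iff:
 assumes N: "graded_submodule (free_algebra n) N M"
 shows "sub_graded M N \<in> Fdim (free_algebra n) \<longleftrightarrow> (\<forall>x \<in> N. \<forall>\<^sub>F w in long n. wact M w x = \<zero>)"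
 by (simp add: Fdim_iff free_mod_sub[OF N] wact_def)

lemma quot_Fdim_iff:
 assumes N: "graded_submodule (free_algebra n) N M"
 shows "quot_graded M N \<in> Fdim (free_algebra n) \<longleftrightarrow> (\<forall>x \<in> carrier M. \<forall>\<^sub>F w in long n. wact M w x \<in> N)"
proof -
 interpret N: abelian_subgroup N M by (rule abelian_subgroup[OF N])
 have "free_mod n (quot_graded M N)" using quot_graded_mod[OF N] by (simp add: free_mod_def)
 moreover have "wact (quot_graded M N) w (N +> x) = \<zero>\<^bsub>quot_graded M N\<^esub> \<longleftrightarrow> wact M w x \<in> N"
  if "w \<in> wds n" "x \<in> carrier M" for w x
  using N.coset_eq_self_iff[OF wact_closed[OF that]]
  unfolding wact_def quot_smult[OF N single_free_carrier[OF that(1)] that(2)] quot_graded_simps(3) .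
 then have "(\<forall>\<^sub>F w in long n. wact (quot_graded M N) w (N +> x) = \<zero>\<^bsub>quot_graded M N\<^esub>)
   \<longleftrightarrow> (\<forall>\<^sub>F w in long n. wact M w x \<in> N)" if "x \<in> carrier M" for x
  using that by (intro eventually_cong[OF eventually_long_wds]) auto
 ultimately show ?thesis by (simp add: Fdim_iff quot_graded_simps(1))
qed

lemma torsion_submodule:
 "graded_submodule (free_algebra n) {x \<in> carrier M. \<forall>\<^sub>F w in long n. wact M w x = \<zero>} M"
  (is "graded_submodule _ ?T M")
proof -
 have T: "?T \<subseteq> carrier M" by blast
 have add: "x \<oplus> y \<in> ?T" if "x \<in> ?T" "y \<in> ?T" for x y
 proof -
  have "\<forall>\<^sub>F w in long n. wact M w x = \<zero>" "\<forall>\<^sub>F w in long n. wact M w y = \<zero>" using that by auto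
  with eventually_long_wds[of n] have "\<forall>\<^sub>F w in long n. wact M w (x \<oplus> y) = \<zero>"
   by eventually_elim (use that in \<open>simp add: wact_add\<close>)
  then show ?thesis using that by simp
 qed
 have sc: "sc M c x \<in> ?T" if "x \<in> ?T" for c x
 proof -
  have "\<forall>\<^sub>F w in long n. wact M w x = \<zero>" using that by auto
  with eventually_long_wds[of n] have "\<forall>\<^sub>F w in long n. wact M w (sc M c x) = \<zero>"
   by eventually_elim (use that in \<open>simp add: wact_sc sc_zero\<close>)
  then show ?thesis using that by (simp add: sc_closed)
 qed
 have wact: "wact M [i] x \<in> ?T" if "i \<le> n" "x \<in> ?T" for i x
 proof -
  have "\<forall>\<^sub>F w in long n. wact M (w @ [i]) x = \<zero>" using that by (intro eventually_long_snoc) auto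
  with eventually_long_wds[of n] have "\<forall>\<^sub>F w in long n. wact M w (wact M [i] x) = \<zero>"
   by eventually_elim (use that in \<open>simp add: wact_append\<close>)
  then show ?thesis using that by (simp add: wact_closed)
 qed
 have part: "hpart M x i \<in> ?T" if "x \<in> ?T" for i x
 proof -
  have "\<forall>\<^sub>F w in long n. wact M w x = \<zero>" using that by auto
  with eventually_long_wds[of n] have "\<forall>\<^sub>F w in long n. wact M w (hpart M x i) = \<zero>"
  proof eventually_elim
   case (elim w)
   then show ?case using hpart_wact[OF elim(1), of x "i + int (length w)"] that by (simp add: M.hpart_zero)
  qed
  then show ?thesis using that by (simp add: M.hpart_closed)
 qed
 have "\<forall>\<^sub>F w in long n. wact M w \<zero> = \<zero>"
  by (rule eventually_mono[OF eventually_long_wds]) (rule wact_zero)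
 then show ?thesis
  by (intro graded_submoduleI[OF T _ add free_submodule_smult[OF T add sc wact] part]) auto
qed

end


subsection \<open>Fractions as linear relations\<close>

text \<open>A fraction \<open>(M', N', f)\<close> is determined by the relation \<open>{(x, y). x \<in> M' \<and> y \<in> f x}\<close>, and the
 composition of fractions is the composition of relations.\<close>

definition graph_of :: "'u set \<times> 'v set \<times> ('u => 'v set) => ('u \<times> 'v) set" where
 "graph_of p = (case p of (M', N', f) => {(x, y). x \<in> M' \<and> y \<in> f x})"

definition frac_of :: "('a, 'u) graded => ('u \<times> 'v) set => 'u set \<times> 'v set \<times> ('u => 'v set)" where
 "frac_of M E = (Domain E, E `` {\<zero>\<^bsub>M\<^esub>}, \<lambda>x \<in> Domain E. E `` {x})"

text \<open>The conditions say that E is a graded submodule of the direct sum of M and N whose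
  projection to M has a torsion cokernel and whose intersection with the summand N is
  torsion.\<close>

locale frac_graph = M: free_mod n M + N: free_mod n N
 for n and M :: "(nat list \<Rightarrow>\<^sub>0 'k::field, 'u) graded" and N :: "(nat list \<Rightarrow>\<^sub>0 'k::field, 'v) graded" +
 fixes E :: "('u \<times> 'v) set"
 assumes carr: "(x, y) \<in> E ==> x \<in> carrier M \<and> y \<in> carrier N"
  and rel_zero: "(\<zero>\<^bsub>M\<^esub>, \<zero>\<^bsub>N\<^esub>) \<in> E"
  and rel_add: "[|(x, y) \<in> E; (x', y') \<in> E|] ==> (x \<oplus>\<^bsub>M\<^esub> x', y \<oplus>\<^bsub>N\<^esub> y') \<in> E"
  and rel_sc: "(x, y) \<in> E ==> (sc M c x, sc N c y) \<in> E"
  and rel_letter: "[|i \<le> n; (x, y) \<in> E|] ==> (wact M [i] x, wact N [i] y) \<in> E"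
  and rel_hpart: "(x, y) \<in> E ==> (hpart M x d, hpart N y d) \<in> E"
  and cotorsion: "x \<in> carrier M ==> \<forall>\<^sub>F w in long n. wact M w x \<in> Domain E"
  and torsion: "(\<zero>\<^bsub>M\<^esub>, y) \<in> E ==> \<forall>\<^sub>F w in long n. wact N w y = \<zero>\<^bsub>N\<^esub>"
begin

lemma carrM: "(x, y) \<in> E ==> x \<in> carrier M" and carrN: "(x, y) \<in> E ==> y \<in> carrier N"
 using carr by blast+

lemma rel_smult:
 assumes "a \<in> carrier (free_algebra n)" "(x, y) \<in> E"
 shows "(a \<odot>\<^bsub>M\<^esub> x, a \<odot>\<^bsub>N\<^esub> y) \<in> E"
proof -
 have "\<forall>x y. (x, y) \<in> E --> (a \<odot>\<^bsub>M\<^esub> x, a \<odot>\<^bsub>N\<^esub> y) \<in> E"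
  using alg_generated_free[of "{0..n::nat}" "\<lambda>i. 1", folded free_algebra_def] assms(1)
 proof (induction a rule: M.alg.generated_induct)
  case (scalar c)
  then show ?case by (simp add: M.sc_eq N.sc_eq rel_sc)
 next
  case (gen g)
  then show ?case using rel_letter by (auto simp: wact_def)
 next
  case (add a b)
  then show ?case by (simp add: M.smult_l_distr N.smult_l_distr carrM carrN rel_add)
 next
  case (mult a b)
  then show ?case by (simp add: M.smult_assoc1 N.smult_assoc1 carrM carrN)
 qed
 then show ?thesis using assms(2) by blast
qed

lemma rel_wact: "[|w \<in> wds n; (x, y) \<in> E|] ==> (wact M w x, wact N w y) \<in> E"
 unfolding wact_def by (rule rel_smult[OF single_free_carrier])

lemma rel_minus:
 assumes "(x, y) \<in> E" shows "(\<ominus>\<^bsub>M\<^esub> x, \<ominus>\<^bsub>N\<^esub> y) \<in> E"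
 using rel_smult[OF _ assms, of "\<ominus>\<^bsub>free_algebra n\<^esub> \<one>\<^bsub>free_algebra n\<^esub>"] carr[OF assms]
 by (simp add: M.minus_smult N.minus_smult M.smult_one N.smult_one)

lemma rel_diff: "[|(x, y) \<in> E; (x', y') \<in> E|] ==> (x \<ominus>\<^bsub>M\<^esub> x', y \<ominus>\<^bsub>N\<^esub> y') \<in> E"
 unfolding a_minus_def by (rule rel_add[OF _ rel_minus])

lemma rel_diff_same:
 assumes "(x, y) \<in> E" "(x, y') \<in> E" shows "(\<zero>\<^bsub>M\<^esub>, y \<ominus>\<^bsub>N\<^esub> y') \<in> E"
proof -
 have "x \<ominus>\<^bsub>M\<^esub> x = \<zero>\<^bsub>M\<^esub>" using carrM[OF assms(1)] by (simp add: M.M.diff_zero_iff)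
 then show ?thesis using rel_diff[OF assms] by simp
qed

lemma Domain_submodule: "graded_submodule (free_algebra n) (Domain E) M"
proof (rule M.graded_submoduleI)
 show "Domain E \<subseteq> carrier M" using carrM by blast
 show "\<zero>\<^bsub>M\<^esub> \<in> Domain E" using rel_zero by blast
 fix x assume "x \<in> Domain E"
 then obtain y where xy: "(x, y) \<in> E" by blast
 show "a \<odot>\<^bsub>M\<^esub> x \<in> Domain E" if "a \<in> carrier (free_algebra n)" for a using rel_smult[OF that xy] by blast
 show "hpart M x i \<in> Domain E" for i using rel_hpart[OF xy] by blast
 fix x' assume "x' \<in> Domain E"
 then obtain y' where "(x', y') \<in> E" by blast
 from rel_add[OF xy this] show "x \<oplus>\<^bsub>M\<^esub> x' \<in> Domain E" by blast
qed

lemma kernel_submodule: "graded_submodule (free_algebra n) (E `` {\<zero>\<^bsub>M\<^esub>}) N"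
proof (rule N.graded_submoduleI)
 show "E `` {\<zero>\<^bsub>M\<^esub>} \<subseteq> carrier N" using carrN by blast
 show "\<zero>\<^bsub>N\<^esub> \<in> E `` {\<zero>\<^bsub>M\<^esub>}" using rel_zero by blast
 fix y assume y: "y \<in> E `` {\<zero>\<^bsub>M\<^esub>}"
 show "y \<oplus>\<^bsub>N\<^esub> y' \<in> E `` {\<zero>\<^bsub>M\<^esub>}" if "y' \<in> E `` {\<zero>\<^bsub>M\<^esub>}" for y'
  using rel_add[of "\<zero>\<^bsub>M\<^esub>" y "\<zero>\<^bsub>M\<^esub>" y'] y that by simp
 show "a \<odot>\<^bsub>N\<^esub> y \<in> E `` {\<zero>\<^bsub>M\<^esub>}" if "a \<in> carrier (free_algebra n)" for a
  using rel_smult[OF that, of "\<zero>\<^bsub>M\<^esub>" y] y that by (simp add: M.smult_zero)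
 show "hpart N y i \<in> E `` {\<zero>\<^bsub>M\<^esub>}" for i
  using rel_hpart[of "\<zero>\<^bsub>M\<^esub>" y i] y by (simp add: M.M.hpart_zero)
qed

lemma coset_section:
 assumes N0: "graded_submodule (free_algebra n) N0 N" "E `` {\<zero>\<^bsub>M\<^esub>} \<subseteq> N0" and xy: "(x, y) \<in> E"
 shows "N0 <+>\<^bsub>N\<^esub> E `` {x} = N0 +>\<^bsub>N\<^esub> y"
proof -
 interpret N0: abelian_subgroup N0 N by (rule N.abelian_subgroup[OF N0(1)])
 note y = carrN[OF xy]
 have "h \<oplus>\<^bsub>N\<^esub> s \<in> N0 +>\<^bsub>N\<^esub> y" if h: "h \<in> N0" and s: "(x, s) \<in> E" for h s
 proof -
  have c: "h \<in> carrier N" "s \<in> carrier N" using N.submodule_carrier[OF N0(1) h] carrN[OF s] by auto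
  have "s \<ominus>\<^bsub>N\<^esub> y \<in> N0" using rel_diff_same[OF s xy] N0(2) by blast
  then have "h \<oplus>\<^bsub>N\<^esub> (s \<ominus>\<^bsub>N\<^esub> y) \<in> N0" by (rule N.submodule_add[OF N0(1) h])
  moreover have "h \<oplus>\<^bsub>N\<^esub> (s \<ominus>\<^bsub>N\<^esub> y) = (h \<oplus>\<^bsub>N\<^esub> s) \<ominus>\<^bsub>N\<^esub> y"
   using c y by (simp add: a_minus_def N.M.a_assoc)
  ultimately show ?thesis using c y by (simp add: N0.coset_mem)
 qed
 moreover have "\<exists>h \<in> N0. z = h \<oplus>\<^bsub>N\<^esub> y" if "z \<in> N0 +>\<^bsub>N\<^esub> y" for z
 proof -
  have z: "z \<in> carrier N" "z \<ominus>\<^bsub>N\<^esub> y \<in> N0" using that y by (auto simp: N0.coset_mem)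
  have "(z \<ominus>\<^bsub>N\<^esub> y) \<oplus>\<^bsub>N\<^esub> y = z" using z(1) y by (simp add: a_minus_def N.M.a_assoc N.M.l_neg)
  then show ?thesis using z(2) by (intro bexI[of _ "z \<ominus>\<^bsub>N\<^esub> y"]) simp_all
 qed
 ultimately show ?thesis using xy unfolding set_add_def' by blast
qed

text \<open>Two partners of x differ by a partner of zero, so the partners of x form a coset of the
  kernel; this is how a linear relation becomes a map to a quotient module.\<close>

lemma section_eq:
 assumes xy: "(x, y) \<in> E" shows "E `` {x} = E `` {\<zero>\<^bsub>M\<^esub>} +>\<^bsub>N\<^esub> y"
proof -
 interpret N0: abelian_subgroup "E `` {\<zero>\<^bsub>M\<^esub>}" N by (rule N.abelian_subgroup[OF kernel_submodule])
 note y = carrN[OF xy]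
 show ?thesis
 proof (rule Set.set_eqI, rule iffI)
  fix z assume "z \<in> E `` {x}"
  then show "z \<in> E `` {\<zero>\<^bsub>M\<^esub>} +>\<^bsub>N\<^esub> y" using rel_diff_same[OF _ xy, of z] carrN y by (auto simp: N0.coset_mem)
 next
  fix z assume "z \<in> E `` {\<zero>\<^bsub>M\<^esub>} +>\<^bsub>N\<^esub> y"
  then have z: "z \<in> carrier N" "(\<zero>\<^bsub>M\<^esub>, z \<ominus>\<^bsub>N\<^esub> y) \<in> E" using y by (auto simp: N0.coset_mem)
  have "(z \<ominus>\<^bsub>N\<^esub> y) \<oplus>\<^bsub>N\<^esub> y = z" using z(1) y by (simp add: a_minus_def N.M.a_assoc N.M.l_neg)
  then show "z \<in> E `` {x}" using rel_add[OF z(2) xy] carrM[OF xy] by simp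
 qed
qed

end

lemma frac_of_frac:
 fixes M N :: "(nat list \<Rightarrow>\<^sub>0 'k::field, 'u) graded"
 assumes "frac_graph n M N E"
 shows "frac_of M E \<in> qgr_frac (free_algebra n) M N"
proof -
 interpret frac_graph n M N E by fact
 let ?K = "E `` {\<zero>\<^bsub>M\<^esub>}" and ?f = "\<lambda>x \<in> Domain E. E `` {x}"
 have f: "?f x = ?K +>\<^bsub>N\<^esub> y" if "(x, y) \<in> E" for x y using section_eq[OF that] that by auto
 have "?f \<in> graded_hom (free_algebra n) (sub_graded M (Domain E)) (quot_graded N ?K)"
 proof (rule graded_homI)
  show "?f x \<in> carrier (quot_graded N ?K)" if x: "x \<in> carrier (sub_graded M (Domain E))" for x
  proof -
   obtain y where xy: "(x, y) \<in> E" using x by auto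
   show ?thesis unfolding f[OF xy] by (rule N.coset_closed[OF kernel_submodule carrN[OF xy]])
  qed
  show "?f (x \<oplus>\<^bsub>sub_graded M (Domain E)\<^esub> x') = ?f x \<oplus>\<^bsub>quot_graded N ?K\<^esub> ?f x'"
   if x: "x \<in> carrier (sub_graded M (Domain E))" "x' \<in> carrier (sub_graded M (Domain E))" for x x'
  proof -
   obtain y y' where xy: "(x, y) \<in> E" "(x', y') \<in> E" using x by auto
   show ?thesis unfolding sub_graded_simps f[OF xy(1)] f[OF xy(2)] f[OF rel_add[OF xy]]
    by (rule N.quot_add[OF kernel_submodule carrN[OF xy(1)] carrN[OF xy(2)], symmetric])
  qed
  show "?f (a \<odot>\<^bsub>sub_graded M (Domain E)\<^esub> x) = a \<odot>\<^bsub>quot_graded N ?K\<^esub> ?f x"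
   if a: "a \<in> carrier (free_algebra n)" and x: "x \<in> carrier (sub_graded M (Domain E))" for a x
  proof -
   obtain y where xy: "(x, y) \<in> E" using x by auto
   show ?thesis unfolding sub_graded_simps f[OF xy] f[OF rel_smult[OF a xy]]
    by (rule N.quot_smult[OF kernel_submodule a carrN[OF xy], symmetric])
  qed
  show "?f x \<in> component (quot_graded N ?K) i" if x: "x \<in> component (sub_graded M (Domain E)) i" for x i
  proof -
   have xi: "x \<in> component M i" using x by simp
   obtain y where xy: "(x, y) \<in> E" using x by auto
   have "(x, hpart N y i) \<in> E" using rel_hpart[OF xy, of i] by (simp add: M.M.hpart_comp[OF xi])
   from f[OF this] show ?thesis
    using N.coset_comp[OF kernel_submodule N.M.hpart(1)[OF carrN[OF xy]]] by simp
  qed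
 qed simp
 moreover have "quot_graded M (Domain E) \<in> Fdim (free_algebra n)"
  unfolding M.quot_Fdim_iff[OF Domain_submodule] using cotorsion by blast
 moreover have "sub_graded N ?K \<in> Fdim (free_algebra n)"
  unfolding N.sub_Fdim_iff[OF kernel_submodule] using torsion by blast
 ultimately show ?thesis
  by (simp add: frac_of_def qgr_frac_def Domain_submodule kernel_submodule)
qed

text \<open>Together with \<open>frac_of_frac\<close> and \<open>graph_of_frac_of\<close> this makes
  fractions and such relations equivalent data, so that later arguments can be carried out with
  relations alone.\<close>

lemma frac_graph_of:
 fixes M N :: "(nat list \<Rightarrow>\<^sub>0 'k::field, 'u) graded"
 assumes M: "free_mod n M" and N: "free_mod n N" and p: "p \<in> qgr_frac (free_algebra n) M N"
 shows "frac_graph n M N (graph_of p)" "frac_of M (graph_of p) = p"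
proof -
 interpret M: free_mod n M by fact
 interpret N: free_mod n N by fact
 obtain M' N' f where p_eq: "p = (M', N', f)" by (cases p)
 have M': "graded_submodule (free_algebra n) M' M" "quot_graded M M' \<in> Fdim (free_algebra n)"
  and N': "graded_submodule (free_algebra n) N' N" "sub_graded N N' \<in> Fdim (free_algebra n)"
  and f: "f \<in> graded_hom (free_algebra n) (sub_graded M M') (quot_graded N N')"
  using p by (auto simp: p_eq qgr_frac_def)
 interpret N': abelian_subgroup N' N by (rule N.abelian_subgroup[OF N'(1)])
 interpret SM: graded_mod "free_algebra n" "sub_graded M M'" by (rule M.sub_graded_mod[OF M'(1)])
 interpret QN: graded_mod "free_algebra n" "quot_graded N N'" by (rule N.quot_graded_mod[OF N'(1)])
 interpret F: additive_map "sub_graded M M'" "quot_graded N N'" f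
  by unfold_locales (rule graded_homD(6)[OF f])
 note M'c = M.submodule_carrier[OF M'(1)]
 have cos: "\<exists>y \<in> carrier N. f x = N' +>\<^bsub>N\<^esub> y" if "x \<in> M'" for x
  using F.closed[of x] that by (simp add: N.quot_carrier_iff[OF N'(1)])
 have E: "(x, y) \<in> graph_of p \<longleftrightarrow> x \<in> M' \<and> y \<in> carrier N \<and> f x = N' +>\<^bsub>N\<^esub> y" for x y
 proof (cases "x \<in> M'")
  case True
  obtain z where z: "z \<in> carrier N" "f x = N' +>\<^bsub>N\<^esub> z" using cos[OF True] by blast
  have "y \<in> f x \<longleftrightarrow> y \<in> carrier N \<and> N' +>\<^bsub>N\<^esub> z = N' +>\<^bsub>N\<^esub> y"
   using z(1) N'.coset_eq_iff[of y z] by (auto simp: z(2) N'.coset_mem)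
  then show ?thesis using True z(2) by (simp add: p_eq graph_of_def)
 qed (simp add: p_eq graph_of_def)
 have zero: "f \<zero>\<^bsub>M\<^esub> = N' +>\<^bsub>N\<^esub> \<zero>\<^bsub>N\<^esub>"
  using F.zero by (simp add: N.quot_zero[OF N'(1)])
 have zero_iff: "(\<zero>\<^bsub>M\<^esub>, y) \<in> graph_of p \<longleftrightarrow> y \<in> N'" for y
  using N'.coset_eq_self_iff[of y] N.submodule_carrier[OF N'(1), of y] M.submodule_zero[OF M'(1)]
  by (auto simp: E zero N'.zero_coset)
 have "x \<in> Domain (graph_of p) \<longleftrightarrow> x \<in> M'" for x
  unfolding Domain_iff E using cos[of x] by blast
 then have dom: "Domain (graph_of p) = M'" by blast
 show "frac_graph n M N (graph_of p)"
 proof (rule frac_graph.intro[OF M N], rule frac_graph_axioms.intro)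
  fix x y x' y' assume xy: "(x, y) \<in> graph_of p"
  then have *: "x \<in> M'" "y \<in> carrier N" "f x = N' +>\<^bsub>N\<^esub> y" by (simp_all add: E)
  show "x \<in> carrier M \<and> y \<in> carrier N" using * M'c by blast
  have smult: "(a \<odot>\<^bsub>M\<^esub> x, a \<odot>\<^bsub>N\<^esub> y) \<in> graph_of p" if a: "a \<in> carrier (free_algebra n)" for a
   unfolding E using graded_homD(3)[OF f a, of x] * a
   by (simp add: M.submodule_smult[OF M'(1)] N.smult_closed N.quot_smult[OF N'(1)])
  show "(sc M c x, sc N c y) \<in> graph_of p" for c
   unfolding sc_def by (rule smult[OF single_free_carrier]) simp
  show "(wact M [i] x, wact N [i] y) \<in> graph_of p" if "i \<le> n" for i
   unfolding wact_def by (rule smult[OF single_free_carrier]) (simp add: that)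
  show "(hpart M x i, hpart N y i) \<in> graph_of p" for i
  proof -
   have "hpart (quot_graded N N') (f x) (i + 0) = f (hpart (sub_graded M M') x i)"
    by (rule hpart_add_map[OF SM.M.graded_group_axioms QN.M.graded_group_axioms graded_homD(6)[OF f]])
     (use graded_homD(4)[OF f] * in auto)
   then show ?thesis unfolding E
    using * by (simp add: M.hpart_sub_graded[OF M'(1)] M.submodule_hpart[OF M'(1)] N.M.hpart_closed
      N.hpart_coset[OF N'(1)])
  qed
  assume "(x', y') \<in> graph_of p"
  then have **: "x' \<in> M'" "y' \<in> carrier N" "f x' = N' +>\<^bsub>N\<^esub> y'" by (simp_all add: E)
  show "(x \<oplus>\<^bsub>M\<^esub> x', y \<oplus>\<^bsub>N\<^esub> y') \<in> graph_of p"
   unfolding E using F.add[of x x'] * ** by (simp add: M.submodule_add[OF M'(1)] N.quot_add[OF N'(1)])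
 next
  show "(\<zero>\<^bsub>M\<^esub>, \<zero>\<^bsub>N\<^esub>) \<in> graph_of p" by (simp add: zero_iff N.submodule_zero[OF N'(1)])
  show "\<forall>\<^sub>F w in long n. wact M w x \<in> Domain (graph_of p)" if "x \<in> carrier M" for x
   using M'(2) that by (simp add: M.quot_Fdim_iff[OF M'(1)] dom)
  show "\<forall>\<^sub>F w in long n. wact N w y = \<zero>\<^bsub>N\<^esub>" if "(\<zero>\<^bsub>M\<^esub>, y) \<in> graph_of p" for y
   using N'(2) that by (simp add: N.sub_Fdim_iff[OF N'(1)] zero_iff)
 qed
 have "(\<lambda>x \<in> M'. graph_of p `` {x}) = f"
 proof (rule extensionalityI[of _ M'])
  show "f \<in> extensional M'" using graded_homD(5)[OF f] by simp
  show "(\<lambda>x \<in> M'. graph_of p `` {x}) x = f x" if "x \<in> M'" for x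
   using that by (auto simp: p_eq graph_of_def)
 qed simp
 moreover have "graph_of p `` {\<zero>\<^bsub>M\<^esub>} = N'" using zero_iff by auto
 ultimately show "frac_of M (graph_of p) = p"
  by (simp add: frac_of_def dom) (simp add: p_eq)
qed

lemma graph_of_frac_of: "graph_of (frac_of M E) = E"
 by (auto simp: graph_of_def frac_of_def split: if_splits)

lemma frac_graph_comp:
 assumes "frac_graph n M N E" "frac_graph n N P E'"
 shows "frac_graph n M P (E O E')"
proof -
 interpret G: frac_graph n M N E by fact
 interpret D: frac_graph n N P E' by fact
 show ?thesis
 proof (unfold_locales)
  fix x z assume "(x, z) \<in> E O E'"
  then obtain y where y: "(x, y) \<in> E" "(y, z) \<in> E'" by blast
  show "x \<in> carrier M \<and> z \<in> carrier P" using G.carrM[OF y(1)] D.carrN[OF y(2)] by blast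
  show "(sc M c x, sc P c z) \<in> E O E'" for c using G.rel_sc[OF y(1)] D.rel_sc[OF y(2)] by blast
  show "(wact M [i] x, wact P [i] z) \<in> E O E'" if "i \<le> n" for i
   using G.rel_letter[OF that y(1)] D.rel_letter[OF that y(2)] by blast
  show "(hpart M x i, hpart P z i) \<in> E O E'" for i using G.rel_hpart[OF y(1)] D.rel_hpart[OF y(2)] by blast
  fix x' z' assume "(x', z') \<in> E O E'"
  then obtain y' where y': "(x', y') \<in> E" "(y', z') \<in> E'" by blast
  show "(x \<oplus>\<^bsub>M\<^esub> x', z \<oplus>\<^bsub>P\<^esub> z') \<in> E O E'"
   using G.rel_add[OF y(1) y'(1)] D.rel_add[OF y(2) y'(2)] by blast
 next
  show "(\<zero>\<^bsub>M\<^esub>, \<zero>\<^bsub>P\<^esub>) \<in> E O E'" using G.rel_zero D.rel_zero by blast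
 next
  \<comment> \<open>A long word w first moves x into the domain of E; a further word v, with a
    threshold depending on w, moves the partner into the domain of \<open>E'\<close>.\<close>
  fix x assume x: "x \<in> carrier M"
  show "\<forall>\<^sub>F w in long n. wact M w x \<in> Domain (E O E')"
  proof (rule eventually_long_append)
   show "\<forall>\<^sub>F w in long n. \<forall>\<^sub>F v in long n. wact M (v @ w) x \<in> Domain (E O E')"
    using G.cotorsion[OF x] eventually_long_wds[of n]
   proof eventually_elim
    case (elim w)
    then obtain y where y: "(wact M w x, y) \<in> E" by blast
    show ?case using D.cotorsion[OF G.carrN[OF y]] eventually_long_wds[of n]
    proof eventually_elim
     case (elim v)
     then show ?case using G.rel_wact[OF elim(2) y] \<open>w \<in> wds n\<close>
      by (auto simp: G.M.wact_append x)
    qed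
   qed
  qed
 next
  fix z assume "(\<zero>\<^bsub>M\<^esub>, z) \<in> E O E'"
  then obtain y where y: "(\<zero>\<^bsub>M\<^esub>, y) \<in> E" "(y, z) \<in> E'" by blast
  have z: "z \<in> carrier P" using D.carrN[OF y(2)] .
  show "\<forall>\<^sub>F w in long n. wact P w z = \<zero>\<^bsub>P\<^esub>"
  proof (rule eventually_long_append)
   show "\<forall>\<^sub>F w in long n. \<forall>\<^sub>F v in long n. wact P (v @ w) z = \<zero>\<^bsub>P\<^esub>"
    using G.torsion[OF y(1)] eventually_long_wds[of n]
   proof eventually_elim
    case (elim w)
    then have "(\<zero>\<^bsub>N\<^esub>, wact P w z) \<in> E'" using D.rel_wact[OF elim(2) y(2)] by simp
    from D.torsion[OF this] eventually_long_wds[of n] show ?case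
    proof eventually_elim
     case (elim v)
     then show ?case using \<open>w \<in> wds n\<close> z by (simp add: D.N.wact_append)
    qed
   qed
  qed
 qed
qed

text \<open>Holds for arbitrary relations: the unions in \<open>qgr_frac_comp\<close> collect the
  values over all representatives, which is what composing relations does.\<close>

lemma frac_comp_relcomp: "qgr_frac_comp (frac_of N E') (frac_of M E) = frac_of M (E O E')"
proof -
 have "{x \<in> Domain E. (\<lambda>x \<in> Domain E. E `` {x}) x \<inter> Domain E' ~= {}} = Domain (E O E')" by auto
 moreover have "\<Union>((\<lambda>y \<in> Domain E'. E' `` {y}) ` (Domain E' \<inter> E `` {\<zero>\<^bsub>M\<^esub>})) = (E O E') `` {\<zero>\<^bsub>M\<^esub>}" by auto
 moreover have "(\<lambda>x \<in> Domain (E O E'). \<Union>((\<lambda>y \<in> Domain E'. E' `` {y}) ` ((\<lambda>x \<in> Domain E. E `` {x}) x \<inter> Domain E')))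
   = (\<lambda>x \<in> Domain (E O E'). (E O E') `` {x})"
  by (rule restrict_ext) auto
 ultimately show ?thesis by (simp only: frac_of_def qgr_frac_comp.simps Let_def)
qed

lemma frac_graph_Id:
 assumes "free_mod n M"
 shows "frac_graph n M M (Id_on (carrier M))"
  "frac_of M (Id_on (carrier M)) = (carrier M, {\<zero>\<^bsub>M\<^esub>}, \<lambda>x \<in> carrier M. {\<zero>\<^bsub>M\<^esub>} +>\<^bsub>M\<^esub> x)"
proof -
 interpret free_mod n M by fact
 have "\<forall>\<^sub>F w in long n. wact M w x \<in> carrier M" if "x \<in> carrier M" for x
  using that by (intro eventually_mono[OF eventually_long_wds]) (rule wact_closed)
 moreover have "\<forall>\<^sub>F w in long n. wact M w \<zero>\<^bsub>M\<^esub> = \<zero>\<^bsub>M\<^esub>"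
  by (rule eventually_mono[OF eventually_long_wds]) (rule wact_zero)
 ultimately show "frac_graph n M M (Id_on (carrier M))"
  by unfold_locales (auto simp: sc_closed wact_closed M.hpart_closed)
 show "frac_of M (Id_on (carrier M)) = (carrier M, {\<zero>\<^bsub>M\<^esub>}, \<lambda>x \<in> carrier M. {\<zero>\<^bsub>M\<^esub>} +>\<^bsub>M\<^esub> x)"
  by (auto simp: frac_of_def a_r_coset_def' intro!: restrict_ext)
qed

subsection \<open>Fractions act on germs\<close>

context localization
begin

text \<open>The canonical map from \<open>M\<close> to its localization; two elements have the same
  image if and only if their difference is torsion.\<close>

definition orb :: "'u => 'p" where
 "orb x = germ (\<lambda>w. wact M w x)"

lemma loc_closed: "u \<in> evlin n M ==> germ u \<in> carrier loc_mod"
 by (simp add: loc_mod_simps(1))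

lemma loc_cases:
 assumes "p \<in> carrier loc_mod" obtains u where "u \<in> evlin n M" "p = germ u"
 using assms by (auto simp: loc_mod_simps(1))

lemma orb_closed: "x \<in> carrier M ==> orb x \<in> carrier loc_mod"
 unfolding orb_def by (rule loc_closed[OF evlin_orbit])

lemma orb_eq_iff:
 assumes "u \<in> evlin n M" "x \<in> carrier M"
 shows "germ u = orb x \<longleftrightarrow> (\<forall>\<^sub>F w in long n. u w = wact M w x)"
 unfolding orb_def by (rule germ_eq_iff[OF assms(1) evlin_orbit[OF assms(2)]])

lemma orb_zero: "orb \<zero> = \<zero>\<^bsub>loc_mod\<^esub>"
 unfolding loc_mod_simps(2) orb_eq_iff[OF evlin_zero M.zero_closed, THEN iffD2, symmetric]
 by (rule sym, subst orb_eq_iff[OF evlin_zero M.zero_closed], rule eventually_mono[OF eventually_long_wds])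
  (simp add: wact_zero)

lemma orb_add:
 assumes "x \<in> carrier M" "y \<in> carrier M" shows "orb (x \<oplus> y) = orb x \<oplus>\<^bsub>loc_mod\<^esub> orb y"
 unfolding orb_def loc_mod_simps(4)[OF evlin_orbit[OF assms(1)] evlin_orbit[OF assms(2)]]
 by (rule germ_eqI[OF evlin_orbit[OF M.a_closed[OF assms]] evlin_add[OF evlin_orbit[OF assms(1)] evlin_orbit[OF assms(2)]]],
   rule eventually_mono[OF eventually_long_wds]) (rule wact_add[OF _ assms])

lemma orb_sc:
 assumes "x \<in> carrier M" shows "orb (sc M c x) = (c \<odot>\<^bsub>leavitt n\<^esub> \<one>\<^bsub>leavitt n\<^esub>) \<odot>\<^bsub>loc_mod\<^esub> orb x"
 unfolding orb_def loc_mod_simps(5)[OF evlin_orbit[OF assms]]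
 by (rule germ_eqI[OF evlin_orbit[OF sc_closed[OF assms]] evlin_sc[OF evlin_orbit[OF assms]]],
   rule eventually_mono[OF eventually_long_wds]) (rule wact_sc[OF _ assms])

lemma orb_letter:
 assumes i: "i \<le> n" and x: "x \<in> carrier M"
 shows "orb (wact M [i] x) = leavitt_x n i \<odot>\<^bsub>loc_mod\<^esub> orb x"
proof -
 have w: "[i] \<in> wds n" using i by simp
 show ?thesis
  unfolding orb_def loc_mod_simps(6)[OF evlin_orbit[OF x] i]
  by (rule germ_eqI[OF evlin_orbit[OF wact_closed[OF w x]] evlin_snoc[OF evlin_orbit[OF x] i]],
    rule eventually_mono[OF eventually_long_wds]) (rule wact_append[OF _ w x, symmetric])
qed

lemma orb_comp: "x \<in> component M d ==> orb x \<in> component loc_mod d"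
proof -
 assume x: "x \<in> component M d"
 have "\<forall>\<^sub>F w in long n. wact M w x \<in> component M (d + int (length w))"
  by (rule eventually_mono[OF eventually_long_wds]) (use wact_comp[OF _ x] in \<open>simp add: add.commute\<close>)
 then show ?thesis unfolding orb_def loc_mod_simps(3) using evlin_orbit[OF M.comp_carrier[OF x]] by blast
qed

lemma orb_hpart: "x \<in> carrier M ==> hpart loc_mod (orb x) d = orb (hpart M x d)"
 using hpart_add_map[OF M.graded_group_axioms, of loc_mod orb 0 x d] loc_mod_graded
 by (simp add: graded_mod_def graded_left_module_def graded_group_def graded_group_axioms_def left_module_def
   add_mapI orb_closed orb_add orb_comp)

lemma evlin_append:
 assumes u: "u \<in> evlin n M" shows "w \<in> wds n ==> (\<lambda>v. u (v @ w)) \<in> evlin n M"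
proof (induction w)
 case (Cons i w)
 then show ?case using evlin_snoc[of "\<lambda>v. u (v @ w)" i] by simp
qed (simp add: u)

text \<open>Shifting the argument of \<open>u\<close> by a long word w, which is the action of a
  product of the x_i, gives the orbit of the value at w. So long words move every germ into the
  image of \<open>orb\<close>, whose cokernel is therefore torsion.\<close>

lemma orb_germ:
 assumes u: "u \<in> evlin n M"
 shows "\<forall>\<^sub>F w in long n. w \<in> wds n \<and> u w \<in> carrier M \<and> germ (\<lambda>v. u (v @ w)) = orb (u w)"
 using evlinD[OF u]
proof eventually_elim
 case (elim w)
 have "germ (\<lambda>v. u (v @ w)) = orb (u w)"
  unfolding orb_def
  by (rule germ_eqI[OF evlin_append[OF u] evlin_orbit], use elim in blast, use elim in blast,
    rule eventually_mono[OF eventually_long_wds]) (use elim in blast)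
 then show ?case using elim by blast
qed

end

lemma leavitt_homI:
 fixes M :: "((leavitt_gen list \<Rightarrow>\<^sub>0 'k::field) set, 'u) graded" and N :: "((leavitt_gen list \<Rightarrow>\<^sub>0 'k) set, 'v) graded"
 assumes M: "graded_mod (leavitt n) M" and N: "graded_mod (leavitt n) N" and f: "add_map M N f"
  and sc: "!!c x. x \<in> carrier M ==> f ((c \<odot>\<^bsub>leavitt n\<^esub> \<one>\<^bsub>leavitt n\<^esub>) \<odot>\<^bsub>M\<^esub> x)
   = (c \<odot>\<^bsub>leavitt n\<^esub> \<one>\<^bsub>leavitt n\<^esub>) \<odot>\<^bsub>N\<^esub> f x"
  and x: "!!i x. [|i \<le> n; x \<in> carrier M|] ==> f (leavitt_x n i \<odot>\<^bsub>M\<^esub> x) = leavitt_x n i \<odot>\<^bsub>N\<^esub> f x"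
  and y: "!!i x. [|i \<le> n; x \<in> carrier M|] ==> f (leavitt_y n i \<odot>\<^bsub>M\<^esub> x) = leavitt_y n i \<odot>\<^bsub>N\<^esub> f x"
  and comp: "!!d x. x \<in> component M d ==> f x \<in> component N d" and ext: "f \<in> extensional (carrier M)"
 shows "f \<in> graded_hom (leavitt n) M N"
proof (rule graded_homI)
 show "f (a \<odot>\<^bsub>M\<^esub> z) = a \<odot>\<^bsub>N\<^esub> f z" if "a \<in> carrier (leavitt n)" "z \<in> carrier M" for a z
 proof (rule hom_generated[OF M N leavitt_alg.generated[OF leavitt_alg_leavitt] f sc _ that])
  fix g :: "(leavitt_gen list \<Rightarrow>\<^sub>0 'k) set" and z
  assume "g \<in> leavitt_x n ` {0..n} \<union> leavitt_y n ` {0..n}" "z \<in> carrier M"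
  then show "f (g \<odot>\<^bsub>M\<^esub> z) = g \<odot>\<^bsub>N\<^esub> f z" using x y by auto
 qed
qed (use f comp ext in \<open>auto simp: add_map_def\<close>)

context frac_graph
begin

text \<open>Partners are chosen for the values at the words of one large length r and extended by
  \<open>evlin_extend\<close>; linearity of E carries the relation over to longer words.\<close>

lemma rel_total:
 assumes u: "u \<in> evlin n M"
 shows "\<exists>v \<in> evlin n N. \<forall>\<^sub>F w in long n. (u w, v w) \<in> E"
proof -
 have "\<forall>\<^sub>F w in long n. u w \<in> Domain E"
  by (rule M.evlin_eventually[OF u, where Q = "\<lambda>_. True"]) (use cotorsion in auto)
 then have "\<forall>\<^sub>F w in long n. u w \<in> Domain E \<and> (\<forall>v \<in> wds n. u (v @ w) = wact M v (u w))"
  using evlinD[OF u] by eventually_elim blast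
 then obtain r where r: "!!w. [|w \<in> wds n; r \<le> length w|] ==> u w \<in> Domain E"
  "!!w v. [|w \<in> wds n; r \<le> length w; v \<in> wds n|] ==> u (v @ w) = wact M v (u w)"
  unfolding eventually_long by blast
 define g where "g w = (SOME y. (u w, y) \<in> E)" for w
 have g: "(u w, g w) \<in> E" if "w \<in> words n r" for w
 proof -
  have "\<exists>y. (u w, y) \<in> E" using r(1)[of w] that by (auto simp: words_iff)
  then show ?thesis unfolding g_def by (rule someI_ex)
 qed
 obtain v where v: "v \<in> evlin n N" "!!w t. [|w \<in> words n r; t \<in> wds n|] ==> v (t @ w) = wact N t (g w)"
  using N.evlin_extend[of r g] carrN[OF g] by blast
 have "\<forall>\<^sub>F w in long n. (u w, v w) \<in> E"
  unfolding eventually_long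
 proof (intro exI[of _ r] ballI impI)
  fix w assume w: "w \<in> wds n" "r \<le> length w"
  from wds_split[OF w] obtain t w0 where w0: "w = t @ w0" "t \<in> wds n" "w0 \<in> words n r" .
  have "u w = wact M t (u w0)" unfolding w0(1) using w0(2,3) by (intro r(2)) (auto simp: words_iff)
  moreover have "v w = wact N t (g w0)" unfolding w0(1) by (rule v(2)[OF w0(3,2)])
  ultimately show "(u w, v w) \<in> E" using rel_wact[OF w0(2) g[OF w0(3)]] by simp
 qed
 then show ?thesis using v(1) by blast
qed

lemma evlin_diff_torsion:
 assumes v: "v \<in> evlin n N" "v' \<in> evlin n N"
  and Q: "\<forall>\<^sub>F w in long n. Q (v w \<ominus>\<^bsub>N\<^esub> v' w)"
   "!!y. [|y \<in> carrier N; Q y|] ==> \<forall>\<^sub>F w in long n. wact N w y = \<zero>\<^bsub>N\<^esub>"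
 shows "\<forall>\<^sub>F w in long n. v w = v' w"
proof -
 have "(\<lambda>w. v w \<ominus>\<^bsub>N\<^esub> v' w) \<in> evlin n N"
  unfolding a_minus_def by (rule N.evlin_add[OF v(1) N.evlin_minus[OF v(2)]])
 then have "\<forall>\<^sub>F w in long n. v w \<ominus>\<^bsub>N\<^esub> v' w = \<zero>\<^bsub>N\<^esub>"
  by (rule N.evlin_eventually[where Q = Q]) (use Q in auto)
 then show ?thesis using evlin_carrier[OF v(1)] evlin_carrier[OF v(2)]
  by eventually_elim (simp add: N.M.diff_zero_iff)
qed

text \<open>Two lifts differ by values in the torsion kernel of E, and a germ with torsion values
  vanishes.\<close>

lemma rel_unique:
 assumes v: "v \<in> evlin n N" "v' \<in> evlin n N"
  and "\<forall>\<^sub>F w in long n. (u w, v w) \<in> E" "\<forall>\<^sub>F w in long n. (u w, v' w) \<in> E"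
 shows "\<forall>\<^sub>F w in long n. v w = v' w"
proof (rule evlin_diff_torsion[OF v, where Q = "\<lambda>y. (\<zero>\<^bsub>M\<^esub>, y) \<in> E"])
 show "\<forall>\<^sub>F w in long n. (\<zero>\<^bsub>M\<^esub>, v w \<ominus>\<^bsub>N\<^esub> v' w) \<in> E"
  using assms(3,4) by eventually_elim (rule rel_diff_same)
qed (rule torsion)

end

text \<open>The relation is applied at each long word. The germ described by \<open>THE\<close>
  exists by \<open>rel_total\<close> and is unique by \<open>rel_unique\<close>.\<close>

definition germ_map :: "nat => (nat list \<Rightarrow>\<^sub>0 'k::field, 'u) graded => (nat list \<Rightarrow>\<^sub>0 'k, 'v) graded
  => ((nat list => 'u) => 'p) => ((nat list => 'v) => 'q) => ('u \<times> 'v) set => 'p => 'q" where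
 "germ_map n M N germ \<mu> E = (\<lambda>p \<in> germ ` evlin n M. THE q. \<exists>u \<in> evlin n M. \<exists>v \<in> evlin n N.
   p = germ u \<and> q = \<mu> v \<and> (\<forall>\<^sub>F w in long n. (u w, v w) \<in> E))"

locale frac_germs = frac_graph n M N E + LM: localization n M germ + LN: localization n N \<mu>
 for n and M :: "(nat list \<Rightarrow>\<^sub>0 'k::field, 'u) graded" and N :: "(nat list \<Rightarrow>\<^sub>0 'k::field, 'v) graded"
  and E :: "('u \<times> 'v) set" and germ :: "(nat list => 'u) => 'p" and \<mu> :: "(nat list => 'v) => 'q"
begin

abbreviation gmap :: "'p => 'q" where
 "gmap \<equiv> germ_map n M N germ \<mu> E"

lemma gmap_eq:
 assumes u: "u \<in> evlin n M" and v: "v \<in> evlin n N" and uv: "\<forall>\<^sub>F w in long n. (u w, v w) \<in> E"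
 shows "gmap (germ u) = \<mu> v"
proof -
 have "(THE q. \<exists>u' \<in> evlin n M. \<exists>v \<in> evlin n N. germ u = germ u' \<and> q = \<mu> v \<and> (\<forall>\<^sub>F w in long n. (u' w, v w) \<in> E)) = \<mu> v"
 proof (rule the_equality)
  show "\<exists>u' \<in> evlin n M. \<exists>v' \<in> evlin n N. germ u = germ u' \<and> \<mu> v = \<mu> v' \<and> (\<forall>\<^sub>F w in long n. (u' w, v' w) \<in> E)"
   using u v uv by blast
  fix q assume "\<exists>u' \<in> evlin n M. \<exists>v' \<in> evlin n N. germ u = germ u' \<and> q = \<mu> v' \<and> (\<forall>\<^sub>F w in long n. (u' w, v' w) \<in> E)"
  then obtain u' v' where *: "u' \<in> evlin n M" "v' \<in> evlin n N" "germ u = germ u'" "q = \<mu> v'"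
   "\<forall>\<^sub>F w in long n. (u' w, v' w) \<in> E" by blast
  have "\<forall>\<^sub>F w in long n. u w = u' w" using *(3) LM.germ_eq_iff[OF u *(1)] by blast
  then have "\<forall>\<^sub>F w in long n. (u' w, v w) \<in> E" using uv by eventually_elim simp
  from rel_unique[OF v *(2) this *(5)] show "q = \<mu> v" unfolding *(4)
   using LN.germ_eqI[OF v *(2)] by simp
 qed
 then show ?thesis using u unfolding germ_map_def by simp
qed

lemma gmap_cases:
 assumes "p \<in> carrier LM.loc_mod"
 obtains u v where "u \<in> evlin n M" "v \<in> evlin n N" "\<forall>\<^sub>F w in long n. (u w, v w) \<in> E" "p = germ u" "gmap p = \<mu> v"
proof -
 obtain u where u: "u \<in> evlin n M" "p = germ u" using LM.loc_cases[OF assms] .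
 obtain v where v: "v \<in> evlin n N" "\<forall>\<^sub>F w in long n. (u w, v w) \<in> E" using rel_total[OF u(1)] by blast
 show ?thesis using that[OF u(1) v u(2)] gmap_eq[OF u(1) v] u(2) by simp
qed

lemma gmap_hom: "gmap \<in> graded_hom (leavitt n) LM.loc_mod LN.loc_mod"
proof (rule leavitt_homI[OF LM.loc_mod_graded LN.loc_mod_graded])
 show "add_map LM.loc_mod LN.loc_mod gmap"
 proof (rule add_mapI)
  fix p assume "p \<in> carrier LM.loc_mod"
  then obtain u v where uv: "u \<in> evlin n M" "v \<in> evlin n N" "\<forall>\<^sub>F w in long n. (u w, v w) \<in> E" "p = germ u" "gmap p = \<mu> v"
   by (rule gmap_cases)
  show "gmap p \<in> carrier LN.loc_mod" unfolding uv(5) by (rule LN.loc_closed[OF uv(2)])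
  fix q assume "q \<in> carrier LM.loc_mod"
  then obtain s t where st: "s \<in> evlin n M" "t \<in> evlin n N" "\<forall>\<^sub>F w in long n. (s w, t w) \<in> E" "q = germ s" "gmap q = \<mu> t"
   by (rule gmap_cases)
  have "\<forall>\<^sub>F w in long n. (u w \<oplus>\<^bsub>M\<^esub> s w, v w \<oplus>\<^bsub>N\<^esub> t w) \<in> E" using uv(3) st(3) by eventually_elim (rule rel_add)
  from gmap_eq[OF M.evlin_add[OF uv(1) st(1)] N.evlin_add[OF uv(2) st(2)] this]
  show "gmap (p \<oplus>\<^bsub>LM.loc_mod\<^esub> q) = gmap p \<oplus>\<^bsub>LN.loc_mod\<^esub> gmap q"
   unfolding uv(5) st(5) unfolding uv(4) st(4) LM.loc_mod_simps(4)[OF uv(1) st(1)] LN.loc_mod_simps(4)[OF uv(2) st(2)] .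
 qed
next
 fix p assume "p \<in> carrier LM.loc_mod"
 then obtain u v where uv: "u \<in> evlin n M" "v \<in> evlin n N" "\<forall>\<^sub>F w in long n. (u w, v w) \<in> E" "p = germ u" "gmap p = \<mu> v"
  by (rule gmap_cases)
 show "gmap ((c \<odot>\<^bsub>leavitt n\<^esub> \<one>\<^bsub>leavitt n\<^esub>) \<odot>\<^bsub>LM.loc_mod\<^esub> p) = (c \<odot>\<^bsub>leavitt n\<^esub> \<one>\<^bsub>leavitt n\<^esub>) \<odot>\<^bsub>LN.loc_mod\<^esub> gmap p" for c
  unfolding uv(5) unfolding uv(4) LM.loc_mod_simps(5)[OF uv(1)] LN.loc_mod_simps(5)[OF uv(2)]
  by (rule gmap_eq[OF M.evlin_sc[OF uv(1)] N.evlin_sc[OF uv(2)]], rule eventually_mono[OF uv(3)]) (rule rel_sc)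
 show "gmap (leavitt_x n i \<odot>\<^bsub>LM.loc_mod\<^esub> p) = leavitt_x n i \<odot>\<^bsub>LN.loc_mod\<^esub> gmap p" if i: "i \<le> n" for i
  unfolding uv(5) unfolding uv(4) LM.loc_mod_simps(6)[OF uv(1) i] LN.loc_mod_simps(6)[OF uv(2) i]
  by (rule gmap_eq[OF M.evlin_snoc[OF uv(1) i] N.evlin_snoc[OF uv(2) i] eventually_long_snoc[OF uv(3) i]])
 show "gmap (leavitt_y n i \<odot>\<^bsub>LM.loc_mod\<^esub> p) = leavitt_y n i \<odot>\<^bsub>LN.loc_mod\<^esub> gmap p" if i: "i \<le> n" for i
  unfolding uv(5) unfolding uv(4) LM.loc_mod_simps(7)[OF uv(1) i] LN.loc_mod_simps(7)[OF uv(2) i]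
  by (rule gmap_eq[OF M.evlin_star[OF uv(1)] N.evlin_star[OF uv(2)]],
    rule eventually_mono[OF eventually_long_butlast[OF uv(3)]]) (simp add: rel_zero)
next
 fix d p assume p: "p \<in> component LM.loc_mod d"
 then obtain u where u: "u \<in> evlin n M" "\<forall>\<^sub>F w in long n. u w \<in> component M (d + int (length w))" "p = germ u"
  by (auto simp: LM.loc_mod_simps(3))
 obtain v where v: "v \<in> evlin n N" "\<forall>\<^sub>F w in long n. (u w, v w) \<in> E" using rel_total[OF u(1)] by blast
 \<comment> \<open>The lift \<open>v\<close> need not be homogeneous, but its part in the expected
   degree is again a lift, because E is closed under taking homogeneous parts.\<close>
 let ?v = "\<lambda>w. hpart N (v w) (d + int (length w))"
 have "\<forall>\<^sub>F w in long n. (u w, ?v w) \<in> E"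
  using u(2) v(2)
 proof eventually_elim
  case (elim w)
  show ?case using rel_hpart[OF elim(2), of "d + int (length w)"] by (simp add: M.M.hpart_comp[OF elim(1)])
 qed
 from gmap_eq[OF u(1) N.evlin_part[OF v(1)] this] have "gmap p = \<mu> ?v" by (simp only: u(3))
 moreover have "\<forall>\<^sub>F w in long n. ?v w \<in> component N (d + int (length w))"
  by (rule eventually_mono[OF evlin_carrier[OF v(1)]]) (rule N.M.hpart(1))
 ultimately show "gmap p \<in> component LN.loc_mod d"
  unfolding LN.loc_mod_simps(3) using N.evlin_part[OF v(1)] by blast
next
 show "gmap \<in> extensional (carrier LM.loc_mod)" by (simp add: germ_map_def LM.loc_mod_simps(1))
qed

end

lemma germ_map_comp:
 assumes "frac_germs n M N E germ \<mu>" "frac_germs n N P E' \<mu> \<nu>"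
 shows "germ_map n M P germ \<nu> (E O E')
  = compose (carrier (localization.loc_mod n M germ)) (germ_map n N P \<mu> \<nu> E') (germ_map n M N germ \<mu> E)"
proof -
 interpret G: frac_germs n M N E germ \<mu> by fact
 interpret D: frac_germs n N P E' \<mu> \<nu> by fact
 interpret GD: frac_germs n M P "E O E'" germ \<nu>
  using frac_graph_comp[OF G.frac_graph_axioms D.frac_graph_axioms] G.LM.localization_axioms D.LN.localization_axioms
  by (simp add: frac_germs_def)
 show ?thesis
 proof (rule extensionalityI)
  show "germ_map n M P germ \<nu> (E O E') \<in> extensional (carrier G.LM.loc_mod)"
   using graded_homD(5)[OF GD.gmap_hom] .
  fix p assume p: "p \<in> carrier G.LM.loc_mod"
  obtain u v where uv: "u \<in> evlin n M" "v \<in> evlin n N" "\<forall>\<^sub>F w in long n. (u w, v w) \<in> E" "p = germ u"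
   "G.gmap p = \<mu> v" using G.gmap_cases[OF p] .
  obtain t where t: "t \<in> evlin n P" "\<forall>\<^sub>F w in long n. (v w, t w) \<in> E'" using D.rel_total[OF uv(2)] by blast
  have "\<forall>\<^sub>F w in long n. (u w, t w) \<in> E O E'" using uv(3) t(2) by eventually_elim blast
  from GD.gmap_eq[OF uv(1) t(1) this] D.gmap_eq[OF uv(2) t]
  show "GD.gmap p = compose (carrier G.LM.loc_mod) D.gmap G.gmap p"
   using p uv(4,5) by (simp add: compose_def)
 qed (simp add: compose_def)
qed

lemma germ_map_Id:
 assumes "localization n M germ"
 shows "germ_map n M M germ germ (Id_on (carrier M)) = (\<lambda>p \<in> carrier (localization.loc_mod n M germ). p)"
proof -
 interpret localization n M germ by fact
 interpret I: frac_germs n M M "Id_on (carrier M)" germ germ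
  using frac_graph_Id(1)[OF free_mod_axioms] localization_axioms by (simp add: frac_germs_def)
 show ?thesis
 proof (rule extensionalityI)
  show "I.gmap \<in> extensional (carrier loc_mod)" using graded_homD(5)[OF I.gmap_hom] .
  fix p assume p: "p \<in> carrier loc_mod"
  then obtain u where u: "u \<in> evlin n M" "p = germ u" by (rule loc_cases)
  have "\<forall>\<^sub>F w in long n. (u w, u w) \<in> Id_on (carrier M)"
   by (rule eventually_mono[OF evlin_carrier[OF u(1)]]) blast
  from I.gmap_eq[OF u(1) u(1) this] show "I.gmap p = (\<lambda>p \<in> carrier loc_mod. p) p" using p u(2) by simp
 qed simp
qed

lemma qgr_relI:
 assumes "(M1, N1, f1) \<in> qgr_frac A M N" "(M2, N2, f2) \<in> qgr_frac A M N"
  "graded_submodule A M0 M" "quot_graded M M0 \<in> Fdim A" "M0 \<subseteq> M1 \<inter> M2"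
  "graded_submodule A N0 N" "sub_graded N N0 \<in> Fdim A" "N1 \<union> N2 \<subseteq> N0"
  "!!x. x \<in> M0 ==> N0 <+>\<^bsub>N\<^esub> f1 x = N0 <+>\<^bsub>N\<^esub> f2 x"
 shows "((M1, N1, f1), (M2, N2, f2)) \<in> qgr_rel A M N"
 using assms unfolding qgr_rel_def by blast

text \<open>Shows at once that the map on germs depends only on the class of a fraction and that it
  separates classes, i.e. that the functor is well defined and faithful.\<close>

lemma germ_map_eq_iff:
 fixes M N :: "(nat list \<Rightarrow>\<^sub>0 'k::field, 'u) graded"
 assumes "frac_germs n M N E germ \<mu>" "frac_germs n M N E' germ \<mu>"
 shows "germ_map n M N germ \<mu> E = germ_map n M N germ \<mu> E'
  \<longleftrightarrow> (frac_of M E, frac_of M E') \<in> qgr_rel (free_algebra n) M N"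
proof -
 interpret G: frac_germs n M N E germ \<mu> by fact
 interpret D: frac_germs n M N E' germ \<mu> by fact
 show ?thesis
 proof
  assume eq: "G.gmap = D.gmap"
  \<comment> \<open>The later stage at which the fractions are to agree: the common domain, and the
    full torsion submodule of N, which contains both kernels and absorbs the difference of two
    partners of the same element.\<close>
  let ?M0 = "Domain E \<inter> Domain E'"
  let ?N0 = "{y \<in> carrier N. \<forall>\<^sub>F w in long n. wact N w y = \<zero>\<^bsub>N\<^esub>}"
  have M0: "graded_submodule (free_algebra n) ?M0 M"
   by (rule G.M.graded_submodule_Int[OF G.Domain_submodule D.Domain_submodule])
  have N0: "graded_submodule (free_algebra n) ?N0 N" by (rule G.N.torsion_submodule)
  have M0': "quot_graded M ?M0 \<in> Fdim (free_algebra n)"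
   unfolding G.M.quot_Fdim_iff[OF M0]
  proof
   fix x assume "x \<in> carrier M"
   from G.cotorsion[OF this] D.cotorsion[OF this] show "\<forall>\<^sub>F w in long n. wact M w x \<in> ?M0"
    by eventually_elim blast
  qed
  have N0': "sub_graded N ?N0 \<in> Fdim (free_algebra n)" by (simp add: G.N.sub_Fdim_iff[OF N0])
  have sub: "E `` {\<zero>\<^bsub>M\<^esub>} \<subseteq> ?N0" "E' `` {\<zero>\<^bsub>M\<^esub>} \<subseteq> ?N0"
   by (auto intro: G.torsion D.torsion G.carrN D.carrN)
  have cosets: "?N0 <+>\<^bsub>N\<^esub> E `` {x} = ?N0 <+>\<^bsub>N\<^esub> E' `` {x}" if x: "x \<in> ?M0" for x
  proof -
   obtain y z where y: "(x, y) \<in> E" and z: "(x, z) \<in> E'" using x by blast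
   note c = G.carrM[OF y] G.carrN[OF y] D.carrN[OF z]
   interpret N0: abelian_subgroup ?N0 N by (rule G.N.abelian_subgroup[OF N0])
   have "\<forall>\<^sub>F w in long n. (wact M w x, wact N w y) \<in> E"
    by (rule eventually_mono[OF eventually_long_wds]) (rule G.rel_wact[OF _ y])
   from G.gmap_eq[OF G.M.evlin_orbit[OF c(1)] G.N.evlin_orbit[OF c(2)] this]
   have 1: "G.gmap (G.LM.orb x) = G.LN.orb y" unfolding G.LM.orb_def G.LN.orb_def .
   have "\<forall>\<^sub>F w in long n. (wact M w x, wact N w z) \<in> E'"
    by (rule eventually_mono[OF eventually_long_wds]) (rule D.rel_wact[OF _ z])
   from D.gmap_eq[OF G.M.evlin_orbit[OF c(1)] G.N.evlin_orbit[OF c(3)] this]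
   have 2: "D.gmap (G.LM.orb x) = G.LN.orb z" unfolding G.LM.orb_def G.LN.orb_def .
   have "\<forall>\<^sub>F w in long n. wact N w y = wact N w z"
    using 1 2 eq G.LN.orb_eq_iff[OF G.N.evlin_orbit[OF c(2)] c(3)] unfolding G.LN.orb_def by metis
   then have "\<forall>\<^sub>F w in long n. wact N w (y \<ominus>\<^bsub>N\<^esub> z) = \<zero>\<^bsub>N\<^esub>"
    using eventually_long_wds[of n]
   proof eventually_elim
    case (elim w)
    show ?case
     unfolding G.N.wact_diff[OF elim(2) c(2,3)]
     by (rule G.N.M.diff_zero_iff[OF G.N.wact_closed[OF elim(2) c(2)] G.N.wact_closed[OF elim(2) c(3)], THEN iffD2,
        OF elim(1)])
   qed
   then have "y \<ominus>\<^bsub>N\<^esub> z \<in> ?N0" using G.N.M.minus_closed[OF c(2,3)] by blast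
   then show ?thesis
    unfolding G.coset_section[OF N0 sub(1) y] D.coset_section[OF N0 sub(2) z] N0.coset_eq_iff[OF c(2,3)] .
  qed
  show "(frac_of M E, frac_of M E') \<in> qgr_rel (free_algebra n) M N"
   unfolding frac_of_def
  proof (rule qgr_relI[OF frac_of_frac[OF G.frac_graph_axioms, unfolded frac_of_def]
     frac_of_frac[OF D.frac_graph_axioms, unfolded frac_of_def] M0 M0' order_refl N0 N0' Un_least[OF sub]])
   fix x assume x: "x \<in> ?M0"
   then have "x \<in> Domain E" "x \<in> Domain E'" by blast+
   then show "?N0 <+>\<^bsub>N\<^esub> (\<lambda>x \<in> Domain E. E `` {x}) x = ?N0 <+>\<^bsub>N\<^esub> (\<lambda>x \<in> Domain E'. E' `` {x}) x"
    unfolding restrict_apply' by (simp only: restrict_apply if_True cosets[OF x])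
  qed
 next
  assume "(frac_of M E, frac_of M E') \<in> qgr_rel (free_algebra n) M N"
  then obtain M0 N0 where M0: "graded_submodule (free_algebra n) M0 M" "quot_graded M M0 \<in> Fdim (free_algebra n)"
    "M0 \<subseteq> Domain E \<inter> Domain E'"
   and N0: "graded_submodule (free_algebra n) N0 N" "sub_graded N N0 \<in> Fdim (free_algebra n)"
    "E `` {\<zero>\<^bsub>M\<^esub>} \<union> E' `` {\<zero>\<^bsub>M\<^esub>} \<subseteq> N0"
   and eq: "\<forall>x \<in> M0. N0 <+>\<^bsub>N\<^esub> (\<lambda>x \<in> Domain E. E `` {x}) x = N0 <+>\<^bsub>N\<^esub> (\<lambda>x \<in> Domain E'. E' `` {x}) x"
   unfolding qgr_rel_def frac_of_def by blast
  interpret N0: abelian_subgroup N0 N by (rule G.N.abelian_subgroup[OF N0(1)])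
  \<comment> \<open>Partners of one element under the two relations differ by an element of the
    torsion submodule \<open>N0\<close>, so the lifts of a germ through E and \<open>E'\<close>
    agree on long words.\<close>
  have diff: "y \<ominus>\<^bsub>N\<^esub> z \<in> N0" if "x \<in> M0" "(x, y) \<in> E" "(x, z) \<in> E'" for x y z
  proof -
   have "N0 <+>\<^bsub>N\<^esub> E `` {x} = N0 <+>\<^bsub>N\<^esub> E' `` {x}"
    using eq[rule_format, OF that(1)] that(2,3) by (simp add: Domain.DomainI)
   then show ?thesis
    using N0(3) G.coset_section[OF N0(1) _ that(2)] D.coset_section[OF N0(1) _ that(3)]
     N0.coset_eq_iff[OF G.carrN[OF that(2)] D.carrN[OF that(3)]] by simp
  qed
  show "G.gmap = D.gmap"
  proof (rule extensionalityI)
   show "G.gmap \<in> extensional (carrier G.LM.loc_mod)" "D.gmap \<in> extensional (carrier G.LM.loc_mod)"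
    using graded_homD(5)[OF G.gmap_hom] graded_homD(5)[OF D.gmap_hom] .
   fix p assume "p \<in> carrier G.LM.loc_mod"
   then obtain u where u: "u \<in> evlin n M" "p = germ u" by (rule G.LM.loc_cases)
   obtain v where v: "v \<in> evlin n N" "\<forall>\<^sub>F w in long n. (u w, v w) \<in> E" using G.rel_total[OF u(1)] by blast
   obtain t where t: "t \<in> evlin n N" "\<forall>\<^sub>F w in long n. (u w, t w) \<in> E'" using D.rel_total[OF u(1)] by blast
   have "\<forall>\<^sub>F w in long n. u w \<in> M0"
    by (rule G.M.evlin_eventually[OF u(1), where Q = "\<lambda>_. True"])
     (use M0(2) G.M.quot_Fdim_iff[OF M0(1)] in auto)
   then have "\<forall>\<^sub>F w in long n. v w \<ominus>\<^bsub>N\<^esub> t w \<in> N0"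
    using v(2) t(2) by eventually_elim (rule diff)
   from G.evlin_diff_torsion[OF v(1) t(1) this] have "\<forall>\<^sub>F w in long n. v w = t w"
    using N0(2) G.N.sub_Fdim_iff[OF N0(1)] by blast
   from G.LN.germ_eqI[OF v(1) t(1) this] show "G.gmap p = D.gmap p"
    unfolding u(2) G.gmap_eq[OF u(1) v] D.gmap_eq[OF u(1) t] .
  qed
 qed
qed

text \<open>The relation consists of the pairs whose orbits correspond under F. Its domain is large
  because long words move both a germ and its image under F to orbits; its kernel is torsion because
  \<open>orb\<close> has a torsion kernel.\<close>

lemma germ_map_surj:
 assumes "localization n M germ" "localization n N \<mu>"
  and F: "F \<in> graded_hom (leavitt n) (localization.loc_mod n M germ) (localization.loc_mod n N \<mu>)"
 shows "\<exists>E. frac_germs n M N E germ \<mu> \<and> germ_map n M N germ \<mu> E = F"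
proof -
 interpret LM: localization n M germ by fact
 interpret LN: localization n N \<mu> by fact
 note FD = graded_homD[OF F]
 have xL: "leavitt_x n i \<in> carrier (leavitt n)" if "i \<le> n" for i
  by (rule leavitt_alg.x_closed[OF leavitt_alg_leavitt that])
 interpret QM: graded_mod "leavitt n" LM.loc_mod by (rule LM.loc_mod_graded)
 interpret QN: graded_mod "leavitt n" LN.loc_mod by (rule LN.loc_mod_graded)
 interpret F: additive_map LM.loc_mod LN.loc_mod F by unfold_locales (rule FD(6))
 define E where "E = {(x, y). x \<in> carrier M \<and> y \<in> carrier N \<and> F (LM.orb x) = LN.orb y}"
 have E: "(x, y) \<in> E \<longleftrightarrow> x \<in> carrier M \<and> y \<in> carrier N \<and> F (LM.orb x) = LN.orb y" for x y by (simp add: E_def)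
 \<comment> \<open>Shifting a germ by a word is the action of a product of the x_i, hence commutes
   with F.\<close>
 have append: "F (germ (\<lambda>v. u (v @ w))) = \<mu> (\<lambda>v. t (v @ w))"
  if u: "u \<in> evlin n M" "t \<in> evlin n N" "F (germ u) = \<mu> t" and w: "w \<in> wds n" for u t w
  using w
 proof (induction w)
  case Nil
  then show ?case using u(3) by simp
 next
  case (Cons i w)
  then have i: "i \<le> n" and w: "w \<in> wds n" by auto
  note e = LM.evlin_append[OF u(1) w] LN.evlin_append[OF u(2) w]
  have "F (leavitt_x n i \<odot>\<^bsub>LM.loc_mod\<^esub> germ (\<lambda>v. u (v @ w))) = leavitt_x n i \<odot>\<^bsub>LN.loc_mod\<^esub> \<mu> (\<lambda>v. t (v @ w))"
   using FD(3)[OF xL[OF i] LM.loc_closed[OF e(1)]] Cons.IH[OF w] by simp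
  then show ?case unfolding LM.loc_mod_simps(6)[OF e(1) i] LN.loc_mod_simps(6)[OF e(2) i] by simp
 qed
 have ev: "\<forall>\<^sub>F w in long n. (u w, t w) \<in> E"
  if u: "u \<in> evlin n M" "t \<in> evlin n N" "F (germ u) = \<mu> t" for u t
  using LM.orb_germ[OF u(1)] LN.orb_germ[OF u(2)]
 proof eventually_elim
  case (elim w)
  then show ?case using append[OF u, of w] by (simp add: E)
 qed
 have graph: "frac_graph n M N E"
 proof (rule frac_graph.intro[OF LM.free_mod_axioms LN.free_mod_axioms], rule frac_graph_axioms.intro)
  fix x y assume "(x, y) \<in> E"
  then have xy: "x \<in> carrier M" "y \<in> carrier N" "F (LM.orb x) = LN.orb y" by (simp_all add: E)
  show "x \<in> carrier M \<and> y \<in> carrier N" using xy by blast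
  show "(sc M c x, sc N c y) \<in> E" for c
  proof -
   have "c \<odot>\<^bsub>leavitt n\<^esub> \<one>\<^bsub>leavitt n\<^esub> \<in> carrier (leavitt n)"
    by (rule QM.alg.S.scalar_closed) simp
   then show ?thesis unfolding E using xy FD(3)[OF _ LM.orb_closed[OF xy(1)]]
    by (simp add: LM.sc_closed LN.sc_closed LM.orb_sc LN.orb_sc)
  qed
  show "(wact M [i] x, wact N [i] y) \<in> E" if i: "i \<le> n" for i
   unfolding E using xy FD(3)[OF xL[OF i] LM.orb_closed[OF xy(1)]] i
   by (simp add: LM.wact_closed LN.wact_closed LM.orb_letter LN.orb_letter)
  show "(hpart M x d, hpart N y d) \<in> E" for d
  proof -
   have "hpart LN.loc_mod (F (LM.orb x)) (d + 0) = F (hpart LM.loc_mod (LM.orb x) d)"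
    by (rule hpart_add_map[OF QM.M.graded_group_axioms QN.M.graded_group_axioms FD(6)])
     (use FD(4) LM.orb_closed[OF xy(1)] in auto)
   then show ?thesis unfolding E using xy
    by (simp add: LM.M.hpart_closed LN.M.hpart_closed LM.orb_hpart LN.orb_hpart)
  qed
  fix x' y' assume "(x', y') \<in> E"
  then have xy': "x' \<in> carrier M" "y' \<in> carrier N" "F (LM.orb x') = LN.orb y'" by (simp_all add: E)
  show "(x \<oplus>\<^bsub>M\<^esub> x', y \<oplus>\<^bsub>N\<^esub> y') \<in> E"
   unfolding E using xy xy' FD(2)[OF LM.orb_closed[OF xy(1)] LM.orb_closed[OF xy'(1)]]
   by (simp add: LM.orb_add LN.orb_add)
 next
  show "(\<zero>\<^bsub>M\<^esub>, \<zero>\<^bsub>N\<^esub>) \<in> E" by (simp add: E LM.orb_zero LN.orb_zero F.zero)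
 next
  fix x assume x: "x \<in> carrier M"
  obtain t where t: "t \<in> evlin n N" "F (LM.orb x) = \<mu> t"
   using LN.loc_cases[OF FD(1)[OF LM.orb_closed[OF x]]] .
  from ev[OF LM.evlin_orbit[OF x] t(1) t(2)[unfolded LM.orb_def]]
  show "\<forall>\<^sub>F w in long n. wact M w x \<in> Domain E" by eventually_elim blast
 next
  fix y assume "(\<zero>\<^bsub>M\<^esub>, y) \<in> E"
  then have y: "y \<in> carrier N" "LN.orb y = \<zero>\<^bsub>LN.loc_mod\<^esub>" by (simp_all add: E LM.orb_zero F.zero)
  then have "\<mu> (\<lambda>w. \<zero>\<^bsub>N\<^esub>) = LN.orb y" by (simp add: LN.loc_mod_simps(2))
  then have "\<forall>\<^sub>F w in long n. \<zero>\<^bsub>N\<^esub> = wact N w y" using LN.orb_eq_iff[OF LN.evlin_zero y(1)] by simp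
  then show "\<forall>\<^sub>F w in long n. wact N w y = \<zero>\<^bsub>N\<^esub>" by eventually_elim simp
 qed
 then interpret G: frac_germs n M N E germ \<mu>
  using assms(1,2) by (simp add: frac_germs_def)
 have "G.gmap = F"
 proof (rule extensionalityI)
  show "G.gmap \<in> extensional (carrier LM.loc_mod)" "F \<in> extensional (carrier LM.loc_mod)"
   using graded_homD(5)[OF G.gmap_hom] FD(5) .
  fix p assume p: "p \<in> carrier LM.loc_mod"
  then obtain u where u: "u \<in> evlin n M" "p = germ u" by (rule LM.loc_cases)
  obtain t where t: "t \<in> evlin n N" "F p = \<mu> t" using LN.loc_cases[OF FD(1)[OF p]] .
  show "G.gmap p = F p"
   using G.gmap_eq[OF u(1) t(1) ev[OF u(1) t(1)]] t(2) u(2) by simp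
 qed
 then show ?thesis using G.frac_germs_axioms by blast
qed

section \<open>The equivalence between \<open>QGr\<close> of the free algebra and \<open>Gr\<close> of the Leavitt algebra\<close>

lemma (in free_mod) localization_germ_sets:
 "localization n M (\<lambda>u. {v \<in> evlin n M. \<forall>\<^sub>F w in long n. u w = v w})" (is "localization n M ?\<gamma>")
proof (rule localization.intro[OF free_mod_axioms], rule localization_axioms.intro)
 fix u v assume uv: "u \<in> evlin n M" "v \<in> evlin n M"
 show "?\<gamma> u = ?\<gamma> v \<longleftrightarrow> (\<forall>\<^sub>F w in long n. u w = v w)"
 proof
  assume "?\<gamma> u = ?\<gamma> v"
  moreover have "v \<in> ?\<gamma> v" using uv(2) by simp
  ultimately have "v \<in> ?\<gamma> u" by simp
  then show "\<forall>\<^sub>F w in long n. u w = v w" by simp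
 next
  assume eq: "\<forall>\<^sub>F w in long n. u w = v w"
  have "(\<forall>\<^sub>F w in long n. u w = t w) \<longleftrightarrow> (\<forall>\<^sub>F w in long n. v w = t w)" for t
   by (rule eventually_cong[OF eq]) simp
  then show "?\<gamma> u = ?\<gamma> v" by simp
 qed
qed

text \<open>Germs can be represented inside the universe: an eventually linear function is determined by
 finitely many values.\<close>

lemma (in free_mod) localization_exists: "\<exists>germ :: (nat list => 'u) => 'u. localization n M germ"
proof (cases "finite (carrier M)")
 case True
 \<comment> \<open>A finite module involves finitely many degrees, so it is torsion and all its
   germs are zero; a constant map serves.\<close>
 define J where "J = (\<Union>x \<in> carrier M. {i. hpart M x i ~= \<zero>\<^bsub>M\<^esub>})"
 have J: "finite J" unfolding J_def using True M.hpart(2) by (intro finite_UN_I) auto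
 have tor: "\<forall>\<^sub>F w in long n. wact M w x = \<zero>\<^bsub>M\<^esub>" if "x \<in> carrier M" for x
  by (rule bounded_degrees_torsion[OF J _ that]) (auto simp: J_def)
 have zero: "\<forall>\<^sub>F w in long n. u w = \<zero>\<^bsub>M\<^esub>" if "u \<in> evlin n M" for u
  by (rule evlin_eventually[OF that, where Q = "\<lambda>_. True"]) (use tor in auto)
 have "localization n M (\<lambda>u. \<zero>\<^bsub>M\<^esub>)"
 proof (rule localization.intro[OF free_mod_axioms], rule localization_axioms.intro)
  fix u v assume uv: "u \<in> evlin n M" "v \<in> evlin n M"
  have "\<forall>\<^sub>F w in long n. u w = v w" using zero[OF uv(1)] zero[OF uv(2)] by eventually_elim simp
  then show "\<zero>\<^bsub>M\<^esub> = \<zero>\<^bsub>M\<^esub> \<longleftrightarrow> (\<forall>\<^sub>F w in long n. u w = v w)" by simp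
 qed
 then show ?thesis by blast
next
 case False
 define \<gamma> where "\<gamma> u = {v \<in> evlin n M. \<forall>\<^sub>F w in long n. u w = v w}" for u
 interpret \<gamma>: localization n M \<gamma> using localization_germ_sets by (simp add: \<gamma>_def[abs_def])
 have "\<exists>r. \<forall>w \<in> words n r. u w \<in> carrier M \<and> (\<forall>v \<in> wds n. u (v @ w) = wact M v (u w))" if u: "u \<in> evlin n M" for u
 proof -
  obtain r where "\<forall>w \<in> wds n. r \<le> length w -->
    w \<in> wds n \<and> u w \<in> carrier M \<and> (\<forall>v \<in> wds n. u (v @ w) = wact M v (u w))"
   using evlinD[OF u] unfolding eventually_long by blast
  then show ?thesis by (intro exI[of _ r]) (simp add: words_iff)
 qed
 then obtain r where r: "!!u w. [|u \<in> evlin n M; w \<in> words n (r u)|] ==>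
   u w \<in> carrier M \<and> (\<forall>v \<in> wds n. u (v @ w) = wact M v (u w))" by metis
 obtain ws where ws: "!!s. set (ws s) = words n s" using finite_list[OF finite_words] by metis
 \<comment> \<open>The code of a germ: a length from which its representative is linear, and the
   values of that representative at the words of this length.\<close>
 define g where "g U = (r (\<gamma>.rep U), map (\<gamma>.rep U) (ws (r (\<gamma>.rep U))))" for U
 have inj: "inj_on g (\<gamma> ` evlin n M)"
 proof (rule inj_onI)
  fix U V assume "U \<in> \<gamma> ` evlin n M" "V \<in> \<gamma> ` evlin n M" and g: "g U = g V"
  then obtain u v where uv: "u \<in> evlin n M" "U = \<gamma> u" "v \<in> evlin n M" "V = \<gamma> v" by blast
  let ?u = "\<gamma>.rep U" and ?v = "\<gamma>.rep V"
  have e: "?u \<in> evlin n M" "?v \<in> evlin n M" unfolding uv by (rule \<gamma>.rep_evlin, rule uv)+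
  have rr: "r ?v = r ?u" using g by (simp add: g_def)
  have "map ?u (ws (r ?u)) = map ?v (ws (r ?u))" using g rr by (simp add: g_def)
  then have eq: "?u w = ?v w" if "w \<in> words n (r ?u)" for w using that by (simp add: ws)
  have "\<forall>\<^sub>F w in long n. ?u w = ?v w" unfolding eventually_long
  proof (intro exI[of _ "r ?u"] ballI impI)
   fix w assume w: "w \<in> wds n" "r ?u \<le> length w"
   from wds_split[OF w] obtain t w0 where w0: "w = t @ w0" "t \<in> wds n" "w0 \<in> words n (r ?u)" .
   have "w0 \<in> words n (r ?v)" using w0(3) rr by simp
   then have "?v (t @ w0) = wact M t (?v w0)" using r[OF e(2)] w0(2) by blast
   moreover have "?u (t @ w0) = wact M t (?u w0)" using r[OF e(1) w0(3)] w0(2) by blast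
   ultimately show "?u w = ?v w" by (simp only: w0(1) eq[OF w0(3)])
  qed
  with \<gamma>.rep_germ[OF uv(1)] \<gamma>.rep_germ[OF uv(3)] have "\<forall>\<^sub>F w in long n. u w = v w"
   unfolding uv(2,4) by eventually_elim simp
  then show "U = V" unfolding uv(2,4) by (rule \<gamma>.germ_eqI[OF uv(1,3)])
 qed
 have img: "g ` \<gamma> ` evlin n M \<subseteq> UNIV \<times> lists (carrier M)"
 proof
  fix z assume "z \<in> g ` \<gamma> ` evlin n M"
  then obtain u where u: "u \<in> evlin n M" "z = g (\<gamma> u)" by blast
  have "\<forall>w \<in> words n (r (\<gamma>.rep (\<gamma> u))). \<gamma>.rep (\<gamma> u) w \<in> carrier M"
   using r[OF \<gamma>.rep_evlin[OF u(1)]] by blast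
  then show "z \<in> UNIV \<times> lists (carrier M)" unfolding u(2) g_def by (auto simp: ws)
 qed
 from inj_into_infinite[OF False inj img]
 obtain h where h: "inj_on h (\<gamma> ` evlin n M) \<and> h ` \<gamma> ` evlin n M \<subseteq> carrier M" ..
 have "localization n M (\<lambda>u. h (\<gamma> u))"
 proof (rule localization.intro[OF free_mod_axioms], rule localization_axioms.intro)
  fix u v assume uv: "u \<in> evlin n M" "v \<in> evlin n M"
  have "h (\<gamma> u) = h (\<gamma> v) \<longleftrightarrow> \<gamma> u = \<gamma> v" using uv by (intro inj_on_eq_iff[OF conjunct1[OF h]]) auto
  then show "h (\<gamma> u) = h (\<gamma> v) \<longleftrightarrow> (\<forall>\<^sub>F w in long n. u w = v w)" using \<gamma>.germ_eq_iff[OF uv] by simp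
 qed
 then show ?thesis by blast
qed

section \<open>The localization functor on classes of fractions\<close>

definition germ_rep :: "nat => (nat list \<Rightarrow>\<^sub>0 'k::field, 'u) graded => (nat list => 'u) => 'u" where
 "germ_rep n M = (SOME germ. localization n M germ)"

lemma localization_germ_rep: "free_mod n M ==> localization n M (germ_rep n M)"
 unfolding germ_rep_def by (rule someI_ex[OF free_mod.localization_exists])

definition loc_obj where
 "loc_obj n M = localization.loc_mod n M (germ_rep n M)"

definition loc_map where
 "loc_map n M N p = germ_map n M N (germ_rep n M) (germ_rep n N) (graph_of p)"

lemma frac_germs_rep:
 "frac_graph n M N E ==> frac_germs n M N E (germ_rep n M) (germ_rep n N)"
 by (simp add: frac_germs_def frac_graph_def localization_germ_rep)

context
 fixes n :: nat
begin

abbreviation (input) "FA \<equiv> free_algebra n"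

lemma loc_map_hom:
 assumes "free_mod n M" "free_mod n N" "p \<in> qgr_frac FA M N"
 shows "loc_map n M N p \<in> graded_hom (leavitt n) (loc_obj n M) (loc_obj n N)"
 unfolding loc_map_def loc_obj_def
 by (rule frac_germs.gmap_hom[OF frac_germs_rep[OF frac_graph_of(1)[OF assms]]])

text \<open>Identifies \<open>qgr_rel\<close> as equality of induced maps, so that it is an
  equivalence relation and its classes are the fibres of \<open>loc_map\<close>.\<close>

lemma qgr_rel_iff:
 assumes M: "free_mod n M" and N: "free_mod n N"
 shows "(p, q) \<in> qgr_rel FA M N \<longleftrightarrow>
  p \<in> qgr_frac FA M N \<and> q \<in> qgr_frac FA M N \<and> loc_map n M N p = loc_map n M N q"
proof (cases "p \<in> qgr_frac FA M N \<and> q \<in> qgr_frac FA M N")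
 case True
 then have p: "p \<in> qgr_frac FA M N" and q: "q \<in> qgr_frac FA M N" by auto
 show ?thesis
  using True germ_map_eq_iff[OF frac_germs_rep[OF frac_graph_of(1)[OF M N p]]
    frac_germs_rep[OF frac_graph_of(1)[OF M N q]]]
  unfolding loc_map_def frac_graph_of(2)[OF M N p] frac_graph_of(2)[OF M N q] by blast
next
 case False
 then show ?thesis by (cases p; cases q) (auto simp: qgr_rel_def)
qed

lemma loc_map_surj:
 assumes M: "free_mod n M" and N: "free_mod n N"
  and F: "F \<in> graded_hom (leavitt n) (loc_obj n M) (loc_obj n N)"
 shows "\<exists>p \<in> qgr_frac FA M N. loc_map n M N p = F"
proof -
 obtain E where E: "frac_germs n M N E (germ_rep n M) (germ_rep n N)"
  "germ_map n M N (germ_rep n M) (germ_rep n N) E = F"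
  using germ_map_surj[OF localization_germ_rep[OF M] localization_germ_rep[OF N] F[unfolded loc_obj_def]] by blast
 have "frac_graph n M N E" using E(1) by (simp add: frac_germs_def)
 from frac_of_frac[OF this] E(2) show ?thesis
  by (intro bexI[of _ "frac_of M E"]) (simp_all add: loc_map_def graph_of_frac_of)
qed

lemma loc_map_comp:
 assumes M: "free_mod n M" and N: "free_mod n N" and P: "free_mod n P"
  and p: "p \<in> qgr_frac FA M N" and q: "q \<in> qgr_frac FA N P"
 shows "qgr_frac_comp q p \<in> qgr_frac FA M P"
  "loc_map n M P (qgr_frac_comp q p) = compose (carrier (loc_obj n M)) (loc_map n N P q) (loc_map n M N p)"
proof -
 note gp = frac_graph_of[OF M N p] and gq = frac_graph_of[OF N P q]
 have eq: "qgr_frac_comp q p = frac_of M (graph_of p O graph_of q)"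
  using frac_comp_relcomp[of N "graph_of q" M "graph_of p"] gp(2) gq(2) by simp
 show "qgr_frac_comp q p \<in> qgr_frac FA M P"
  unfolding eq by (rule frac_of_frac[OF frac_graph_comp[OF gp(1) gq(1)]])
 show "loc_map n M P (qgr_frac_comp q p) = compose (carrier (loc_obj n M)) (loc_map n N P q) (loc_map n M N p)"
  unfolding loc_map_def loc_obj_def eq graph_of_frac_of
  by (rule germ_map_comp[OF frac_germs_rep[OF gp(1)] frac_germs_rep[OF gq(1)]])
qed

lemma loc_map_id:
 assumes M: "free_mod n M"
 defines "i \<equiv> (carrier M, {\<zero>\<^bsub>M\<^esub>}, \<lambda>x \<in> carrier M. {\<zero>\<^bsub>M\<^esub>} +>\<^bsub>M\<^esub> x)"
 shows "i \<in> qgr_frac FA M M" "loc_map n M M i = (\<lambda>x \<in> carrier (loc_obj n M). x)"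
proof -
 have eq: "i = frac_of M (Id_on (carrier M))" unfolding i_def by (rule frac_graph_Id(2)[OF M, symmetric])
 show "i \<in> qgr_frac FA M M" unfolding eq by (rule frac_of_frac[OF frac_graph_Id(1)[OF M]])
 show "loc_map n M M i = (\<lambda>x \<in> carrier (loc_obj n M). x)"
  unfolding eq loc_map_def loc_obj_def graph_of_frac_of by (rule germ_map_Id[OF localization_germ_rep[OF M]])
qed

lemma qgr_class:
 assumes M: "free_mod n M" and N: "free_mod n N" and p: "p \<in> qgr_frac FA M N"
 shows "q \<in> qgr_rel FA M N `` {p} \<longleftrightarrow> q \<in> qgr_frac FA M N \<and> loc_map n M N q = loc_map n M N p"
  "loc_map n M N (SOME q. q \<in> qgr_rel FA M N `` {p}) = loc_map n M N p"
proof -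
 show iff: "q \<in> qgr_rel FA M N `` {p} \<longleftrightarrow> q \<in> qgr_frac FA M N \<and> loc_map n M N q = loc_map n M N p" for q
  using p by (auto simp: qgr_rel_iff[OF M N])
 have "p \<in> qgr_rel FA M N `` {p}" using p iff by blast
 then have "(SOME q. q \<in> qgr_rel FA M N `` {p}) \<in> qgr_rel FA M N `` {p}" by (rule someI)
 then show "loc_map n M N (SOME q. q \<in> qgr_rel FA M N `` {p}) = loc_map n M N p" using iff by blast
qed

lemma qgr_class_eqI:
 assumes M: "free_mod n M" and N: "free_mod n N" and p: "p \<in> qgr_frac FA M N" and q: "q \<in> qgr_frac FA M N"
  and eq: "loc_map n M N p = loc_map n M N q"
 shows "qgr_rel FA M N `` {p} = qgr_rel FA M N `` {q}"
 by (rule Set.set_eqI) (simp only: qgr_class(1)[OF M N p] qgr_class(1)[OF M N q] eq)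

text \<open>The composite of two classes is a union over all representatives. Each pair contributes
  the same class, because \<open>loc_map\<close> turns composites of fractions into composites of
  maps.\<close>

lemma qgr_cmp:
 assumes M: "free_mod n M" and N: "free_mod n N" and P: "free_mod n P"
  and p: "p \<in> qgr_frac FA M N" and q: "q \<in> qgr_frac FA N P"
 shows "(\<Union>q' \<in> qgr_rel FA N P `` {q}. \<Union>p' \<in> qgr_rel FA M N `` {p}. qgr_rel FA M P `` {qgr_frac_comp q' p'})
  = qgr_rel FA M P `` {qgr_frac_comp q p}"
proof -
 have "qgr_rel FA M P `` {qgr_frac_comp q' p'} = qgr_rel FA M P `` {qgr_frac_comp q p}"
  if q': "q' \<in> qgr_rel FA N P `` {q}" and p': "p' \<in> qgr_rel FA M N `` {p}" for q' p'
 proof -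
  have "p' \<in> qgr_frac FA M N" "q' \<in> qgr_frac FA N P" "loc_map n M N p' = loc_map n M N p"
   "loc_map n N P q' = loc_map n N P q"
   using p' q' qgr_class(1)[OF M N p] qgr_class(1)[OF N P q] by blast+
  then show ?thesis
   by (intro qgr_class_eqI[OF M P]) (simp_all add: loc_map_comp[OF M N P] p q)
 qed
 moreover have "q \<in> qgr_rel FA N P `` {q}" "p \<in> qgr_rel FA M N `` {p}"
  using p q qgr_class(1)[OF M N p] qgr_class(1)[OF N P q] by blast+
 ultimately show ?thesis by blast
qed

end

lemma cat_iso_sym: "f \<in> cat_iso C a b ==> cat_iso C b a ~= {}"
 unfolding cat_iso_def by blast


subsection \<open>Essential surjectivity\<close>

text \<open>The underlying graded vector space; the x_i are then taken as operators on it to obtain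
  a module over the free algebra.\<close>

definition scalar_part :: "('k::field, 'a) graded => ('a, 'u) graded => ('k, 'u) graded" where
 "scalar_part A M = \<lparr>carrier = carrier M, mult = mult M, one = \<one>\<^bsub>M\<^esub>, zero = \<zero>\<^bsub>M\<^esub>, add = add M,
   smult = (\<lambda>c x. (c \<odot>\<^bsub>A\<^esub> \<one>\<^bsub>A\<^esub>) \<odot>\<^bsub>M\<^esub> x), component = component M\<rparr>"

lemma (in graded_mod) scalar_part_kspace: "graded_kspace (scalar_part A M)"
proof (rule graded_kspaceI)
 have ab: "abelian_group (scalar_part A M)"
  by (rule abelian_group_cong[OF M.abelian_group_axioms]) (simp_all add: scalar_part_def)
 show "kspace (scalar_part A M)"
  by (rule kspaceI[OF ab])
   (simp_all add: scalar_part_def K.scalar_closed K.scalar_add K.scalar_distrib K.scalar_mult K.scalar_one)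
 show "direct_sum_grading (scalar_part A M)"
  by (rule direct_sum_grading_cong[OF M.abelian_group_axioms M.direct_sum]) (simp_all add: scalar_part_def)
 show "c \<odot>\<^bsub>scalar_part A M\<^esub> x \<in> component (scalar_part A M) i" if "x \<in> component (scalar_part A M) i" for c i x
  using that comp_smult[OF alg.comp_scalar[OF alg.comp_one], of x i c] by (simp add: scalar_part_def)
qed

text \<open>The preimage of \<open>N\<close> is \<open>N\<close> itself, regarded as a module over
  the free algebra through the x_i. The map \<open>orb\<close> is then an isomorphism onto the
  germs, because over the Leavitt algebra every eventually linear function agrees on long words with
  a single orbit.\<close>

lemma loc_obj_surj:
 fixes N :: "((leavitt_gen list \<Rightarrow>\<^sub>0 'k::field) set, 'u) graded"
 assumes N: "graded_mod (leavitt n) N"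
 shows "\<exists>M :: (nat list \<Rightarrow>\<^sub>0 'k, 'u) graded. free_mod n M \<and> cat_iso (Gr (leavitt n)) (loc_obj n M) N ~= {}"
proof -
 interpret N: graded_mod "leavitt n" N by fact
 interpret L: leavitt_alg "leavitt n :: ('k, (leavitt_gen list \<Rightarrow>\<^sub>0 'k) set) graded" n "leavitt_x n" "leavitt_y n"
  by (rule leavitt_alg_leavitt)
 let ?P = "scalar_part (leavitt n) N" and ?T = "\<lambda>i x. leavitt_x n i \<odot>\<^bsub>N\<^esub> x"
 have P: "carrier ?P = carrier N" "add ?P = add N" "zero ?P = zero N" "component ?P = component N"
  "smult ?P = (\<lambda>c x. (c \<odot>\<^bsub>leavitt n\<^esub> \<one>\<^bsub>leavitt n\<^esub>) \<odot>\<^bsub>N\<^esub> x)"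
  by (simp_all add: scalar_part_def)
 have one_c: "c \<odot>\<^bsub>leavitt n\<^esub> \<one>\<^bsub>leavitt n\<^esub> \<in> carrier (leavitt n)" for c :: 'k
  by (rule N.alg.S.scalar_closed) simp
 have central: "a \<otimes>\<^bsub>leavitt n\<^esub> (c \<odot>\<^bsub>leavitt n\<^esub> \<one>\<^bsub>leavitt n\<^esub>) = (c \<odot>\<^bsub>leavitt n\<^esub> \<one>\<^bsub>leavitt n\<^esub>) \<otimes>\<^bsub>leavitt n\<^esub> a"
  if "a \<in> carrier (leavitt n)" for a and c :: 'k
  using N.alg.scalar_mult_right[of a "\<one>\<^bsub>leavitt n\<^esub>" c] N.alg.scalar_mult_assoc[of "\<one>\<^bsub>leavitt n\<^esub>" a c] that
  by simp
 interpret O: graded_operators ?P "{0..n}" "\<lambda>i. 1" ?T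
 proof (rule graded_operators.intro[OF N.scalar_part_kspace], rule graded_operators_axioms.intro)
  fix i x assume i: "i \<in> {0..n}" and x: "x \<in> carrier ?P"
  have xi: "(leavitt_x n i :: (leavitt_gen list \<Rightarrow>\<^sub>0 'k) set) \<in> carrier (leavitt n)" using i by (simp add: L.x_closed)
  show "?T i x \<in> carrier ?P" using x xi by (simp add: P N.smult_closed)
  show "?T i (c \<odot>\<^bsub>?P\<^esub> x) = c \<odot>\<^bsub>?P\<^esub> ?T i x" for c
   using x xi one_c[of c] central[OF xi, of c] by (simp add: P flip: N.smult_assoc1)
  show "?T i (x \<oplus>\<^bsub>?P\<^esub> y) = ?T i x \<oplus>\<^bsub>?P\<^esub> ?T i y" if "y \<in> carrier ?P" for y
   using x xi that by (simp add: P N.smult_r_distr)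
 next
  fix i x j assume "i \<in> {0..n}" "x \<in> component ?P j"
  then show "?T i x \<in> component ?P (1 + j)" by (auto simp: P intro!: N.comp_smult L.x_comp)
 qed
 define M where "M = operator_module ?P ?T"
 have M: "carrier M = carrier N" "add M = add N" "zero M = zero N" "component M = component N"
  unfolding M_def O.operator_module_simps P by simp_all
 interpret M: free_mod n M
  using O.operator_module_graded by (simp add: M_def free_mod_def free_algebra_def)
 interpret loc: localization n M "germ_rep n M" by (rule localization_germ_rep[OF M.free_mod_axioms])
 interpret Q: graded_mod "leavitt n" loc.loc_mod by (rule loc.loc_mod_graded)
 have wact: "wact M w x = L.X w \<odot>\<^bsub>N\<^esub> x" if w: "w \<in> wds n" and x: "x \<in> carrier N" for w x
 proof -
  have "foldr ?T w x = L.X w \<odot>\<^bsub>N\<^esub> x" using w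
  proof (induction w)
   case Nil
   then show ?case using x by (simp add: N.smult_one)
  next
   case (Cons i w)
   then show ?case using x by (simp add: N.smult_assoc1 L.x_closed L.X_closed wds_def)
  qed
  moreover have "wact M w x = 1 \<odot>\<^bsub>?P\<^esub> foldr ?T w x"
   unfolding wact_def M_def O.operator_module_simps(5) using w x
   by (intro O.act_ext_single) (simp_all add: wds_def P)
  moreover have "L.X w \<odot>\<^bsub>N\<^esub> x \<in> carrier ?P" using w x by (simp add: P N.smult_closed L.X_closed wds_def)
  ultimately show ?thesis using O.scalar_one by simp
 qed
 have Xc: "L.X w \<in> carrier (leavitt n)" if "w \<in> wds n" for w using that by (simp add: L.X_closed wds_def)
 have sc: "sc M c x = (c \<odot>\<^bsub>leavitt n\<^esub> \<one>\<^bsub>leavitt n\<^esub>) \<odot>\<^bsub>N\<^esub> x" if "x \<in> carrier N" for c x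
  using O.operator_module_scalar[of x c] that by (simp add: sc_def M_def P)
 let ?e = "\<lambda>x \<in> carrier N. loc.orb x"
 have e: "?e \<in> graded_hom (leavitt n) N loc.loc_mod"
 proof (rule leavitt_homI[OF N loc.loc_mod_graded])
  show "add_map N loc.loc_mod ?e"
   by (rule add_mapI) (use loc.orb_closed loc.orb_add in \<open>simp_all add: M\<close>)
  show "?e ((c \<odot>\<^bsub>leavitt n\<^esub> \<one>\<^bsub>leavitt n\<^esub>) \<odot>\<^bsub>N\<^esub> x) = (c \<odot>\<^bsub>leavitt n\<^esub> \<one>\<^bsub>leavitt n\<^esub>) \<odot>\<^bsub>loc.loc_mod\<^esub> ?e x"
   if x: "x \<in> carrier N" for c x
   using loc.orb_sc[of x c] x N.smult_closed[OF one_c x] by (simp add: M sc)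
  show "?e (leavitt_x n i \<odot>\<^bsub>N\<^esub> x) = leavitt_x n i \<odot>\<^bsub>loc.loc_mod\<^esub> ?e x" if i: "i \<le> n" and x: "x \<in> carrier N" for i x
   using loc.orb_letter[of i x] wact[of "[i]" x] i x by (simp add: M N.smult_closed L.x_closed)
  show "?e (leavitt_y n i \<odot>\<^bsub>N\<^esub> x) = leavitt_y n i \<odot>\<^bsub>loc.loc_mod\<^esub> ?e x" if i: "i \<le> n" and x: "x \<in> carrier N" for i x
  proof -
   have yx: "leavitt_y n i \<odot>\<^bsub>N\<^esub> x \<in> carrier N" using i x by (simp add: N.smult_closed L.y_closed)
   have orb: "(\<lambda>w. wact M w x) \<in> evlin n M" using x by (intro M.evlin_orbit) (simp add: M)
   have "\<forall>\<^sub>F w in long n. (if w ~= [] \<and> last w = i then wact M (butlast w) x else \<zero>\<^bsub>M\<^esub>)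
     = wact M w (leavitt_y n i \<odot>\<^bsub>N\<^esub> x)"
    using eventually_long_butlast[OF eventually_long_wds]
   proof eventually_elim
    case (elim w)
    then obtain v j where w: "w = v @ [j]" "v \<in> wds n" "j \<le> n" by (cases w rule: rev_cases) auto
    \<comment> \<open>Compatibility with y_i is tested at words ending in a letter j: the factor x_j
      y_i reproduces the case distinction in the action of y_i on germs.\<close>
    have "L.X w = L.X v \<otimes>\<^bsub>leavitt n\<^esub> leavitt_x n j"
     using L.X_append[of v "[j]"] w by (simp add: wds_def L.x_closed)
    then have "wact M w (leavitt_y n i \<odot>\<^bsub>N\<^esub> x)
      = L.X v \<odot>\<^bsub>N\<^esub> ((leavitt_x n j \<otimes>\<^bsub>leavitt n\<^esub> leavitt_y n i) \<odot>\<^bsub>N\<^esub> x)"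
     using w i x yx Xc[OF w(2)] wact[of w, OF _ yx]
     by (simp add: N.smult_assoc1 L.x_closed L.y_closed)
    then show ?case using w i x
     by (simp add: L.x_y wact N.smult_one N.zero_smult N.smult_zero Xc M)
   qed
   from loc.orb_eq_iff[OF M.evlin_star[OF orb] _, THEN iffD2, OF _ this]
   show ?thesis using loc.loc_mod_simps(7)[OF orb i] x yx by (simp add: M loc.orb_def)
  qed
  show "?e x \<in> component loc.loc_mod d" if "x \<in> component N d" for d x
   using loc.orb_comp[of x d] N.M.comp_carrier[OF that] that by (simp add: M)
 qed simp
 have "bij_betw ?e (carrier N) (carrier loc.loc_mod)"
 proof (rule bij_betwI')
  show "?e x \<in> carrier loc.loc_mod" if "x \<in> carrier N" for x using loc.orb_closed[of x] that by (simp add: M)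
  fix x y assume xy: "x \<in> carrier N" "y \<in> carrier N"
  show "?e x = ?e y \<longleftrightarrow> x = y"
  proof
   assume "?e x = ?e y"
   then have "germ_rep n M (\<lambda>w. wact M w x) = loc.orb y" using xy by (simp add: loc.orb_def)
   moreover have "(\<lambda>w. wact M w x) \<in> evlin n M" "y \<in> carrier M" using xy by (auto simp: M intro: M.evlin_orbit)
   ultimately have "\<forall>\<^sub>F w in long n. wact M w x = wact M w y" using loc.orb_eq_iff by blast
   then obtain r where "\<forall>w \<in> wds n. r \<le> length w --> wact M w x = wact M w y"
    unfolding eventually_long by blast
   then have r: "wact M w x = wact M w y" if "w \<in> words n r" for w using that by (simp add: words_iff)
   have eq: "L.X w \<odot>\<^bsub>N\<^esub> x = L.X w \<odot>\<^bsub>N\<^esub> y" if "w \<in> words n r" for w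
    using r[OF that] that xy by (simp add: wact words_iff)
   \<comment> \<open>Applying \<open>L.Y w\<close> and summing over all words of length r recovers
     both elements, since the products of \<open>L.Y w\<close> and \<open>L.X w\<close> sum to
     1.\<close>
   have "word_sum N n r (\<lambda>w. L.Y w \<odot>\<^bsub>N\<^esub> (L.X w \<odot>\<^bsub>N\<^esub> x)) = word_sum N n r (\<lambda>w. L.Y w \<odot>\<^bsub>N\<^esub> (L.X w \<odot>\<^bsub>N\<^esub> y))"
    using xy by (intro N.M.word_sum_cong) (simp add: eq N.smult_closed L.X_words_closed L.Y_words_closed)
   then show "x = y" by (simp add: L.sum_Y_X_smult[OF N] xy)
  qed simp
 next
  fix p assume "p \<in> carrier loc.loc_mod"
  then obtain u where u: "u \<in> evlin n M" "p = germ_rep n M u" by (rule loc.loc_cases)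
  from evlinD[OF u(1)] obtain r where r: "!!w. [|w \<in> wds n; r \<le> length w|] ==>
    u w \<in> carrier M \<and> (\<forall>v \<in> wds n. u (v @ w) = wact M v (u w))"
   unfolding eventually_long by blast
  have uc: "u w \<in> carrier N" if "w \<in> words n r" for w using r[of w] that by (simp add: words_iff M)
  \<comment> \<open>The element whose orbit is the given germ: the values at the words of length r
    are reassembled by the adjoint words, so that \<open>L.X v\<close> returns the value at v by
    \<open>L.X_Y\<close>.\<close>
  define x where "x = word_sum N n r (\<lambda>w. L.Y w \<odot>\<^bsub>N\<^esub> u w)"
  have x: "x \<in> carrier N"
   unfolding x_def by (intro N.M.word_sum_closed) (simp add: N.smult_closed L.Y_words_closed uc)
  have Xx: "L.X v \<odot>\<^bsub>N\<^esub> x = u v" if v: "v \<in> words n r" for v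
  proof -
   note vc = L.X_words_closed[OF v]
   have "L.X v \<odot>\<^bsub>N\<^esub> x = word_sum N n r (\<lambda>w. L.X v \<odot>\<^bsub>N\<^esub> (L.Y w \<odot>\<^bsub>N\<^esub> u w))"
    unfolding x_def by (rule additive_map.word_sum[OF N.additive_smult[OF vc]])
     (simp add: N.smult_closed L.Y_words_closed uc)
   also have "\<dots> = word_sum N n r (\<lambda>w. if w = v then u v else \<zero>\<^bsub>N\<^esub>)"
   proof (rule N.M.word_sum_cong, rule conjI)
    fix w assume w: "w \<in> words n r"
    show "L.X v \<odot>\<^bsub>N\<^esub> (L.Y w \<odot>\<^bsub>N\<^esub> u w) = (if w = v then u v else \<zero>\<^bsub>N\<^esub>)"
     using N.smult_assoc1[OF vc L.Y_words_closed[OF w] uc[OF w]] uc[OF w]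
     by (auto simp: L.X_Y[OF v w] N.smult_one N.zero_smult)
    show "(if w = v then u v else \<zero>\<^bsub>N\<^esub>) \<in> carrier N" using uc[OF v] by simp
   qed
   also have "\<dots> = u v" by (rule N.M.word_sum_delta[OF v uc[OF v]])
   finally show ?thesis .
  qed
  have "\<forall>\<^sub>F w in long n. u w = wact M w x" unfolding eventually_long
  proof (intro exI[of _ r] ballI impI)
   fix w assume w: "w \<in> wds n" "r \<le> length w"
   from wds_split[OF w] obtain v w0 where w0: "w = v @ w0" "v \<in> wds n" "w0 \<in> words n r" .
   have w0': "w0 \<in> wds n" "length w0 = r" using w0(3) by (simp_all add: words_iff)
   have "u w = wact M v (wact M w0 x)"
    using r[of w0] w0' w0(1,2) wact[OF w0'(1) x] Xx[OF w0(3)] by simp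
   then show "u w = wact M w x" using M.wact_append[OF w0(2) w0'(1), of x] x by (simp add: M w0(1))
  qed
  then have "germ_rep n M u = loc.orb x" using loc.orb_eq_iff[OF u(1), of x] x by (simp add: M)
  then show "\<exists>x \<in> carrier N. p = ?e x" using x u(2) by (intro bexI[of _ x]) simp_all
 qed
 from graded_iso[OF N loc.loc_mod_graded e this] have "cat_iso (Gr (leavitt n)) (loc_obj n M) N ~= {}"
  unfolding loc_obj_def by (rule cat_iso_sym)
 then show ?thesis using M.free_mod_axioms by blast
qed

text \<open>A morphism of QGr is a class of fractions, so the functor evaluates
  \<open>loc_map\<close> at an arbitrary member of it; by \<open>qgr_class\<close> the result does
  not depend on the member.\<close>

theorem QGr_free_equiv_Gr_leavitt:
 "equivalent_categories
   (QGr (free_algebra n) :: ((nat list \<Rightarrow>\<^sub>0 'k::field, 'u) graded, ('u set \<times> 'u set \<times> ('u => 'u set)) set) cat)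
   (Gr (leavitt n) :: (((leavitt_gen list \<Rightarrow>\<^sub>0 'k) set, 'u) graded, 'u => 'u) cat)"
proof -
 let ?FA = "free_algebra n :: ('k, nat list \<Rightarrow>\<^sub>0 'k) graded"
 let ?C = "QGr ?FA :: ((nat list \<Rightarrow>\<^sub>0 'k, 'u) graded, ('u set \<times> 'u set \<times> ('u => 'u set)) set) cat"
 let ?D = "Gr (leavitt n) :: (((leavitt_gen list \<Rightarrow>\<^sub>0 'k) set, 'u) graded, 'u => 'u) cat"
 interpret L: leavitt_alg "leavitt n :: ('k, (leavitt_gen list \<Rightarrow>\<^sub>0 'k) set) graded" n "leavitt_x n" "leavitt_y n"
  by (rule leavitt_alg_leavitt)
 have obj: "free_mod n M" if "M \<in> obj ?C" for M
  using that by (simp add: QGr_def free_mod_def graded_mod_def graded_algebra_free_algebra)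
 have homs: "\<exists>p \<in> qgr_frac ?FA M N. F = qgr_rel ?FA M N `` {p}" if "F \<in> homs ?C M N" for F M N
  using that by (auto simp: QGr_def elim: quotientE)
 have class_hom: "qgr_rel ?FA M N `` {p} \<in> homs ?C M N" if "p \<in> qgr_frac ?FA M N" for M N p
  using that by (auto simp: QGr_def intro: quotientI)
 interpret D: category ?D by (rule category_Gr[OF L.graded_algebra])
 interpret weak_equivalence ?C ?D "loc_obj n" "\<lambda>M N F. loc_map n M N (SOME p. p \<in> F)"
 proof (rule weak_equivalence.intro[OF D.category_axioms], rule weak_equivalence_axioms.intro)
  fix M assume "M \<in> obj ?C"
  note M = obj[OF this]
  show "idm ?C M \<in> homs ?C M M"
   using class_hom[OF loc_map_id(1)[OF M]] by (simp add: QGr_def)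
  show "loc_obj n M \<in> obj ?D"
   using localization.loc_mod_graded[OF localization_germ_rep[OF M]]
   by (simp add: Gr_def loc_obj_def graded_mod_def)
  show "loc_map n M M (SOME p. p \<in> idm ?C M) = idm ?D (loc_obj n M)"
   using qgr_class(2)[OF M M loc_map_id(1)[OF M]] loc_map_id(2)[OF M] by (simp add: QGr_def Gr_def)
 next
  fix M N P F G assume "M \<in> obj ?C" "N \<in> obj ?C" "P \<in> obj ?C" and F: "F \<in> homs ?C M N" and G: "G \<in> homs ?C N P"
  then have M: "free_mod n M" and N: "free_mod n N" and P: "free_mod n P" using obj by blast+
  obtain p where p: "p \<in> qgr_frac ?FA M N" "F = qgr_rel ?FA M N `` {p}" using homs[OF F] by blast
  obtain q where q: "q \<in> qgr_frac ?FA N P" "G = qgr_rel ?FA N P `` {q}" using homs[OF G] by blast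
  have cmp: "cmp ?C M N P G F = qgr_rel ?FA M P `` {qgr_frac_comp q p}"
   unfolding p(2) q(2) using qgr_cmp[OF M N P p(1) q(1)] by (simp add: QGr_def)
  note c = loc_map_comp[OF M N P p(1) q(1)]
  show "cmp ?C M N P G F \<in> homs ?C M P" unfolding cmp by (rule class_hom[OF c(1)])
  show "loc_map n M P (SOME p. p \<in> cmp ?C M N P G F) = cmp ?D (loc_obj n M) (loc_obj n N) (loc_obj n P)
    (loc_map n N P (SOME p. p \<in> G)) (loc_map n M N (SOME p. p \<in> F))"
   unfolding cmp qgr_class(2)[OF M P c(1)] c(2)
   unfolding p(2) q(2) qgr_class(2)[OF M N p(1)] qgr_class(2)[OF N P q(1)] by (simp add: Gr_def)
 next
  fix M N assume "M \<in> obj ?C" "N \<in> obj ?C"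
  then have M: "free_mod n M" and N: "free_mod n N" using obj by blast+
  show "bij_betw (\<lambda>F. loc_map n M N (SOME p. p \<in> F)) (homs ?C M N) (homs ?D (loc_obj n M) (loc_obj n N))"
  proof (rule bij_betwI')
   fix F G assume F: "F \<in> homs ?C M N" and G: "G \<in> homs ?C M N"
   obtain p where p: "p \<in> qgr_frac ?FA M N" "F = qgr_rel ?FA M N `` {p}" using homs[OF F] by blast
   obtain q where q: "q \<in> qgr_frac ?FA M N" "G = qgr_rel ?FA M N `` {q}" using homs[OF G] by blast
   show "loc_map n M N (SOME p. p \<in> F) = loc_map n M N (SOME p. p \<in> G) \<longleftrightarrow> F = G"
    unfolding p(2) q(2) qgr_class(2)[OF M N p(1)] qgr_class(2)[OF M N q(1)]
    using qgr_class_eqI[OF M N p(1) q(1)] qgr_class(2)[OF M N p(1)] qgr_class(2)[OF M N q(1)] by metis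
   show "loc_map n M N (SOME p. p \<in> F) \<in> homs ?D (loc_obj n M) (loc_obj n N)"
    unfolding p(2) qgr_class(2)[OF M N p(1)] using loc_map_hom[OF M N p(1)] by (simp add: Gr_def)
  next
   fix f assume "f \<in> homs ?D (loc_obj n M) (loc_obj n N)"
   then obtain p where p: "p \<in> qgr_frac ?FA M N" "loc_map n M N p = f"
    using loc_map_surj[OF M N, of f] by (auto simp: Gr_def)
   show "\<exists>F \<in> homs ?C M N. f = loc_map n M N (SOME p. p \<in> F)"
    by (rule bexI[OF _ class_hom[OF p(1)]]) (simp only: qgr_class(2)[OF M N p(1)] p(2))
  qed
 next
  fix N assume "N \<in> obj ?D"
  then have "graded_mod (leavitt n) N" using L.graded_algebra by (simp add: Gr_def graded_mod_def)
  from loc_obj_surj[OF this] obtain M :: "(nat list \<Rightarrow>\<^sub>0 'k, 'u) graded"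
   where M: "free_mod n M" "cat_iso ?D (loc_obj n M) N ~= {}" by blast
  then show "\<exists>M \<in> obj ?C. cat_iso ?D (loc_obj n M) N ~= {}"
   by (intro bexI[of _ M]) (simp_all add: QGr_def free_mod_def graded_mod_def)
 qed
 show ?thesis by (rule equivalent)
qed


subsection \<open>The Leavitt algebra is nonzero\<close>

definition regular_mod :: "('k, 'a) graded => ('a, 'a) graded" where
 "regular_mod A = \<lparr>carrier = carrier A, mult = mult A, one = \<one>\<^bsub>A\<^esub>, zero = \<zero>\<^bsub>A\<^esub>, add = add A,
   smult = mult A, component = component A\<rparr>"

lemma (in graded_alg) regular_mod_graded: "graded_mod A (regular_mod A)"
proof (rule graded_modI[OF graded_algebra])
 have ab: "abelian_group (regular_mod A)"
  by (rule abelian_group_cong[OF abelian_group_axioms]) (simp_all add: regular_mod_def)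
 show "left_module A (regular_mod A)"
  by (rule left_moduleI[OF ring_axioms ab]) (simp_all add: regular_mod_def l_distr r_distr m_assoc)
 show "direct_sum_grading (regular_mod A)"
  by (rule direct_sum_grading_cong[OF abelian_group_axioms A.direct_sum]) (simp_all add: regular_mod_def)
qed (simp add: regular_mod_def comp_mult)

text \<open>The free algebra is not a torsion module, so its module of germs is a nonzero module over the
 Leavitt algebra.\<close>

lemma leavitt_nontrivial_leavitt:
 "leavitt_nontrivial (leavitt n :: ('k::field, (leavitt_gen list \<Rightarrow>\<^sub>0 'k) set) graded) n (leavitt_x n) (leavitt_y n)"
proof (rule leavitt_nontrivial.intro[OF leavitt_alg_leavitt], rule leavitt_nontrivial_axioms.intro, rule notI)
 let ?FA = "free_algebra n :: ('k, nat list \<Rightarrow>\<^sub>0 'k) graded"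
 let ?L = "leavitt n :: ('k, (leavitt_gen list \<Rightarrow>\<^sub>0 'k) set) graded"
 let ?M = "regular_mod ?FA"
 assume L: "\<one>\<^bsub>?L\<^esub> = \<zero>\<^bsub>?L\<^esub>"
 interpret FA: graded_alg ?FA by (rule graded_alg.intro[OF graded_algebra_free_algebra])
 interpret M: free_mod n ?M using FA.regular_mod_graded by (simp add: free_mod_def)
 interpret loc: localization n ?M "germ_rep n ?M" by (rule localization_germ_rep[OF M.free_mod_axioms])
 interpret Q: graded_mod ?L loc.loc_mod by (rule loc.loc_mod_graded)
 have one: "\<one>\<^bsub>?FA\<^esub> \<in> carrier ?M" by (simp add: regular_mod_def)
 \<comment> \<open>If 1 = 0 in the Leavitt algebra, all its modules vanish and so does the germ of
   the orbit of 1. But a word w sends 1 to the basis element w of the free algebra, which is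
   nonzero.\<close>
 have "loc.orb \<one>\<^bsub>?FA\<^esub> = \<zero>\<^bsub>loc.loc_mod\<^esub>"
  using Q.smult_one[OF loc.orb_closed[OF one]] Q.zero_smult[OF loc.orb_closed[OF one]] L by simp
 then have "germ_rep n ?M (\<lambda>w. \<zero>\<^bsub>?M\<^esub>) = loc.orb \<one>\<^bsub>?FA\<^esub>" by (simp add: loc.loc_mod_simps(2))
 then have "\<forall>\<^sub>F w in long n. \<zero>\<^bsub>?M\<^esub> = wact ?M w \<one>\<^bsub>?FA\<^esub>"
  using loc.orb_eq_iff[OF M.evlin_zero one] by simp
 with eventually_long_wds have "\<forall>\<^sub>F w in long n. False"
 proof eventually_elim
  case (elim w)
  have "wact ?M w \<one>\<^bsub>?FA\<^esub> = single w 1"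
   using single_free_carrier[OF elim(1), of "1 :: 'k"] by (simp add: wact_def regular_mod_def)
  moreover have "\<zero>\<^bsub>?M\<^esub> = 0" by (simp add: regular_mod_def free_algebra_simps)
  ultimately have "single w (1 :: 'k) = 0" using elim(2) by metis
  then have "lookup (single w (1 :: 'k)) w = 0" by simp
  then show ?case by simp
 qed
 then show False by (simp only: eventually_long_const)
qed

theorem theorem1p4:
  fixes n :: nat
    and R :: "('k::field, nat list \<Rightarrow>\<^sub>0 'k) graded"
    and L :: "('k, (leavitt_gen list \<Rightarrow>\<^sub>0 'k) set) graded"
    and S :: "('k, (nat \<times> ('k mat list \<Rightarrow>\<^sub>0 'k) set) set) module"
  assumes "n \<ge> 1"
    and "R = free_algebra n"
    and "L = leavitt n"
    and "S = matrix_tensor_limit n"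
  shows "strongly_graded L \<and>
    isomorphic_algebras (degree_zero L) S \<and>
    equivalent_categories
      (QGr R :: ((nat list \<Rightarrow>\<^sub>0 'k, 'u) graded, ('u set \<times> 'u set \<times> ('u \<Rightarrow> 'u set)) set) cat)
      (Gr L :: (((leavitt_gen list \<Rightarrow>\<^sub>0 'k) set, 'u) graded, 'u \<Rightarrow> 'u) cat) \<and>
    equivalent_categories
      (Gr L :: (((leavitt_gen list \<Rightarrow>\<^sub>0 'k) set, 'u) graded, 'u \<Rightarrow> 'u) cat)
      (LMod (degree_zero L) :: (((leavitt_gen list \<Rightarrow>\<^sub>0 'k) set, 'u) module, 'u \<Rightarrow> 'u) cat)"
proof -
 interpret L: leavitt_nontrivial "leavitt n :: ('k, (leavitt_gen list \<Rightarrow>\<^sub>0 'k) set) graded" n "leavitt_x n" "leavitt_y n"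
  by (rule leavitt_nontrivial_leavitt)
 interpret SG: strongly_graded_alg "leavitt n :: ('k, (leavitt_gen list \<Rightarrow>\<^sub>0 'k) set) graded"
  by unfold_locales (use L.strongly_graded in \<open>auto simp: strongly_graded_def\<close>)
 \<comment> \<open>The bound on \<open>n\<close> enters through \<open>zero_module_infinite\<close>,
   which discharges the cardinality hypothesis of \<open>Gr_equiv_LMod\<close>.\<close>
 show ?thesis
  unfolding assms(2-4)
  using L.strongly_graded L.degree_zero_iso QGr_free_equiv_Gr_leavitt
   SG.Gr_equiv_LMod[OF L.zero_module_infinite[OF assms(1)]] by blast
qed

end
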